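(* For each $i\in\{1,2,3,4\}$ the following pairs of categories are equivalent: (1) the category of Boolean restriction semigroups with local units (and morphisms of type $i$) and the category of ample categories (and cofunctors of type $i$); (2) the category of Boolean range semigroups (and morphisms of type $i$) and the category of strongly ample categories (and cofunctors of type $i$); (3) the category of étale Boolean range semigroups (and morphisms of type $i$) and the category of biample categories (and cofunctors of type $i$); (4) the category of Boolean birestriction semigroups (and morphisms of type $i$) and the category of biample categories (and cofunctors of type $i$ whose action is injective).
   Context: **Algebra.** A restriction semigroup is an algebra $(S;\cdot,{}^* )$ where $(S;\cdot)$ is a semigroup and ${}^*$ is unary with $xx^*=x$, $x^*y^*=y^*x^*=(x^*y^* )^*$, $(xy)^*=(x^*y)^*$, $x^*y=y(xy)^*$. Projections: $P(S)=\{s^*:s\in S\}$, a semilattice. Natural partial order: $s\le t$ iff $s=ts^*$; $s\vee t$ is the least upper bound with respect to $\le$, if it exists. Elements $s,t$ are compatible, $s\smile t$, if $st^*=ts^*$. A generalized Boolean algebra is a relatively complemented distributive lattice with bottom $0$. A restriction semigroup with a left zero $0$ that is a projection is Boolean if: (BR1) $s\vee t$ exists whenever $s\smile t$; (BR2) $(P(S),\le)$ is a generalized Boolean algebra; (BR3) $(s\vee t)u=su\vee tu$ whenever $s\vee t$ exists. It is preBoolean if (BR1) is relaxed to: $s\vee t$ exists whenever $s,t$ have a common upper bound. $S$ has local units if for every $s\in S$ there is $e\in P(S)$ with $es=s$. A range semigroup is an algebra $(S;\cdot,{}^*,{}^+)$ with $(S;\cdot,{}^* )$ a restriction semigroup and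 $x^+x=x$, $x^+y^+=y^+x^+=(x^+y^+)^+$, $(xy)^+=(xy^+)^+$, $(x^+)^*=x^+$, $(x^* )^+=x^*$; it is a Boolean range semigroup if $(S;\cdot,{}^* )$ is Boolean. An element $s$ is bideterministic if $es=s(es)^*$ and $se=(se)^+s$ for all $e\in P(S)$. A Boolean range semigroup is étale if every element is a finite join of bideterministic elements. A birestriction semigroup is a range semigroup satisfying also $xy^+=(xy)^+x$. A birestriction semigroup with a left zero that is a projection is Boolean if $P(S)$ is a generalized Boolean algebra and $s\vee t$ exists whenever $st^*=ts^*$ and $t^+s=s^+t$. (Every Boolean birestriction semigroup is, with the operations $\cdot,{}^*$, a preBoolean restriction semigroup with local units.) **Morphisms of semigroups.** A morphism $f\colon S\to T$ of preBoolean restriction semigroups is a map preserving $\cdot$ and ${}^*$ whose restriction $P(S)\to P(T)$ is a morphism of generalized Boolean algebras that is proper (for every $q\in P(T)$ there is $p\in P(S)$ with $f(p)\ge q$). The morphism $f$ is proper if for every $t\in T$ there are $n\ge1$, $t_1,\dots,t_n\in T$, $s_1,\dots,s_n\in S$ with $t\le t_1\vee\dots\vee t_n$ and $f(s_j)\ge t_j$ for all $j$. It is weakly meet-preserving if for all $s,t\in S$, $u\in T$ with $u\le f(s),f(t)$ there is $v\le s,t$ with $u\le f(v)$. Types: 1 = morphisms; 2 = weakly meet-preserving morphisms; 3 = proper morphisms; 4 = proper and weakly meet-preserving morphisms. These morphisms are used for all classes of semigroups above. **Topological categories.** A topological category $C=(C_1,C_0,u,d,r,m)$ is a small category internal to topological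 spaces: arrows $C_1$, objects $C_0$, continuous unit $u$, domain $d$, range $r$ and multiplication $m\colon C_2\to C_1$, $C_2=\{(x,y)\in C_1\times C_1: r(y)=d(x)\}$ (subspace topology), $d(xy)=d(y)$, $r(xy)=r(x)$; $1_x=u(x)$. $C$ is étale if $C_0$ is locally compact Hausdorff and $d$ is a local homeomorphism; bi-étale if moreover $r$ is a local homeomorphism. A slice is an open $A\subseteq C_1$ with $d|_A$ injective; a bislice is a slice with $r|_A$ injective too. $C$ is ample if étale and compact slices form a basis of $C_1$; strongly ample if ample and $r$ is open; biample if bi-étale and compact bislices form a basis of $C_1$. **Cofunctors.** An action of $C$ on a space $X$ is a pair $(\mu,f)$ of continuous maps $f\colon X\to C_0$ and $\mu\colon C_1\times_{d,f}X=\{(s,x):d(s)=f(x)\}\to X$, $(s,x)\mapsto s\cdot x$, with $f(s\cdot x)=r(s)$, $s\cdot(t\cdot x)=st\cdot x$ when both sides are defined, and $1_{f(x)}\cdot x=x$. It is injective if $d(s)=f(x)=f(y)$ and $s\cdot x=s\cdot y$ imply $x=y$. The transformation category $C\rtimes X$ has objects $X$, arrows $C_1\times_{d,f}X$, $u(x)=(1_{f(x)},x)$, $d(s,x)=x$, $r(s,x)=s\cdot x$, $(s,t\cdot x)(t,x)=(st,x)$. A cofunctor $F=(\mu,f,\rho)\colon C\rightsquigarrow D$ of ample categories consists of an action $(\mu,f)$ of $C$ on $D_0$ with $f$ proper (preimages of compact sets are compact) and a continuous functor $\rho=(\rho_1,\rho_0)\colon C\rtimes D_0\to D$ that is the identity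 on objects, such that for each compact slice $A\subseteq C_1$ the set $F_*(A)=\{\rho_1(s,x):s\in A,(s,x)\in C\rtimes D_0\}$ is compact-open. The composition of $F=(\bar\mu,\bar f,\bar\rho)\colon C\rightsquigarrow D$ and $G=(\tilde\mu,\tilde f,\tilde\rho)\colon D\rightsquigarrow E$ is $G\circ F=(\mu,f,\rho)$ with $f=\bar f\tilde f$, $\mu(s,x)=\tilde\mu(\bar\rho_1(s,\tilde f(x)),x)$, $\rho_0(x)=x$, $\rho_1(s,x)=\tilde\rho_1(\bar\rho_1(s,\tilde f(x)),x)$. $F$ is injective on arrows if $\rho_1(s,x)=\rho_1(t,x)$ implies $s=t$; surjective on arrows if for all $t\in D_1$ with $d(t)=x$ there is $(s,x)\in C_1\times_{d,f}D_0$ with $\rho_1(s,x)=t$; bijective on arrows if both. Types of cofunctors: 1 = all; 2 = injective on arrows; 3 = surjective on arrows; 4 = bijective on arrows. *)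

theory Defs
  imports "HOL-Analysis.Analysis"
begin

section \<open>Categories and their equivalence\<close>

text \<open>Composition, and the action of a functor on arrows, take the objects involved as arguments,
  since hom-sets of different pairs of objects may overlap. \<open>cmp A X Y Z g f\<close> is
  the composite of \<open>f : X \<rightarrow> Y\<close> and \<open>g : Y \<rightarrow> Z\<close>.\<close>

record ('o, 'm) cat =
  objs :: "'o set"
  hom :: "'o \<Rightarrow> 'o \<Rightarrow> 'm set"
  ident :: "'o \<Rightarrow> 'm"
  cmp :: "'o \<Rightarrow> 'o \<Rightarrow> 'o \<Rightarrow> 'm \<Rightarrow> 'm \<Rightarrow> 'm"

definition is_category :: "('o, 'm) cat \<Rightarrow> bool" where
  "is_category A \<longleftrightarrow>
    (\<forall>X\<in>objs A. ident A X \<in> hom A X X) \<and>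
    (\<forall>X\<in>objs A. \<forall>Y\<in>objs A. \<forall>Z\<in>objs A. \<forall>f\<in>hom A X Y. \<forall>g\<in>hom A Y Z.
        cmp A X Y Z g f \<in> hom A X Z) \<and>
    (\<forall>X\<in>objs A. \<forall>Y\<in>objs A. \<forall>f\<in>hom A X Y.
        cmp A X X Y f (ident A X) = f \<and> cmp A X Y Y (ident A Y) f = f) \<and>
    (\<forall>W\<in>objs A. \<forall>X\<in>objs A. \<forall>Y\<in>objs A. \<forall>Z\<in>objs A.
      \<forall>f\<in>hom A W X. \<forall>g\<in>hom A X Y. \<forall>h\<in>hom A Y Z.
        cmp A W X Z (cmp A X Y Z h g) f = cmp A W Y Z h (cmp A W X Y g f))"

definition is_functor ::
  "('o, 'm) cat \<Rightarrow> ('p, 'n) cat \<Rightarrow> ('o \<Rightarrow> 'p) \<Rightarrow> ('o \<Rightarrow> 'o \<Rightarrow> 'm \<Rightarrow> 'n) \<Rightarrow> bool" where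
  "is_functor A B F0 F1 \<longleftrightarrow>
    (\<forall>X\<in>objs A. F0 X \<in> objs B) \<and>
    (\<forall>X\<in>objs A. \<forall>Y\<in>objs A. \<forall>f\<in>hom A X Y. F1 X Y f \<in> hom B (F0 X) (F0 Y)) \<and>
    (\<forall>X\<in>objs A. F1 X X (ident A X) = ident B (F0 X)) \<and>
    (\<forall>X\<in>objs A. \<forall>Y\<in>objs A. \<forall>Z\<in>objs A. \<forall>f\<in>hom A X Y. \<forall>g\<in>hom A Y Z.
        F1 X Z (cmp A X Y Z g f) = cmp B (F0 X) (F0 Y) (F0 Z) (F1 Y Z g) (F1 X Y f))"

definition is_iso :: "('o, 'm) cat \<Rightarrow> 'o \<Rightarrow> 'o \<Rightarrow> 'm \<Rightarrow> bool" where
  "is_iso A X Y f \<longleftrightarrow> f \<in> hom A X Y \<and>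
    (\<exists>g\<in>hom A Y X. cmp A X Y X g f = ident A X \<and> cmp A Y X Y f g = ident A Y)"

definition natural_iso ::
  "('o, 'm) cat \<Rightarrow> ('p, 'n) cat \<Rightarrow> ('o \<Rightarrow> 'p) \<Rightarrow> ('o \<Rightarrow> 'o \<Rightarrow> 'm \<Rightarrow> 'n) \<Rightarrow>
    ('o \<Rightarrow> 'p) \<Rightarrow> ('o \<Rightarrow> 'o \<Rightarrow> 'm \<Rightarrow> 'n) \<Rightarrow> ('o \<Rightarrow> 'n) \<Rightarrow> bool" where
  "natural_iso A B F0 F1 G0 G1 \<eta> \<longleftrightarrow>
    (\<forall>X\<in>objs A. is_iso B (F0 X) (G0 X) (\<eta> X)) \<and>
    (\<forall>X\<in>objs A. \<forall>Y\<in>objs A. \<forall>f\<in>hom A X Y.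
        cmp B (F0 X) (F0 Y) (G0 Y) (\<eta> Y) (F1 X Y f) =
        cmp B (F0 X) (G0 X) (G0 Y) (G1 X Y f) (\<eta> X))"

definition equivalent_categories :: "('o, 'm) cat \<Rightarrow> ('p, 'n) cat \<Rightarrow> bool" where
  "equivalent_categories A B \<longleftrightarrow> is_category A \<and> is_category B \<and>
    (\<exists>F0 F1 G0 G1 \<eta> \<epsilon>.
      is_functor A B F0 F1 \<and> is_functor B A G0 G1 \<and>
      natural_iso A A (\<lambda>X. X) (\<lambda>X Y f. f)
        (\<lambda>X. G0 (F0 X)) (\<lambda>X Y f. G1 (F0 X) (F0 Y) (F1 X Y f)) \<eta> \<and>
      natural_iso B B (\<lambda>X. F0 (G0 X)) (\<lambda>X Y f. F1 (G0 X) (G0 Y) (G1 X Y f))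
        (\<lambda>X. X) (\<lambda>X Y f. f) \<epsilon>)"


section \<open>Generalized Boolean algebras\<close>

definition is_lub_on :: "'a set \<Rightarrow> ('a \<Rightarrow> 'a \<Rightarrow> bool) \<Rightarrow> 'a set \<Rightarrow> 'a \<Rightarrow> bool" where
  "is_lub_on P le A u \<longleftrightarrow> u \<in> P \<and> (\<forall>a\<in>A. le a u) \<and> (\<forall>v\<in>P. (\<forall>a\<in>A. le a v) \<longrightarrow> le u v)"

definition is_glb_on :: "'a set \<Rightarrow> ('a \<Rightarrow> 'a \<Rightarrow> bool) \<Rightarrow> 'a set \<Rightarrow> 'a \<Rightarrow> bool" where
  "is_glb_on P le A u \<longleftrightarrow> u \<in> P \<and> (\<forall>a\<in>A. le u a) \<and> (\<forall>v\<in>P. (\<forall>a\<in>A. le v a) \<longrightarrow> le v u)"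

definition join_on :: "'a set \<Rightarrow> ('a \<Rightarrow> 'a \<Rightarrow> bool) \<Rightarrow> 'a \<Rightarrow> 'a \<Rightarrow> 'a" where
  "join_on P le x y = (THE u. is_lub_on P le {x, y} u)"

definition meet_on :: "'a set \<Rightarrow> ('a \<Rightarrow> 'a \<Rightarrow> bool) \<Rightarrow> 'a \<Rightarrow> 'a \<Rightarrow> 'a" where
  "meet_on P le x y = (THE u. is_glb_on P le {x, y} u)"

definition lattice_on :: "'a set \<Rightarrow> ('a \<Rightarrow> 'a \<Rightarrow> bool) \<Rightarrow> bool" where
  "lattice_on P le \<longleftrightarrow>
    (\<forall>x\<in>P. le x x) \<and>
    (\<forall>x\<in>P. \<forall>y\<in>P. le x y \<longrightarrow> le y x \<longrightarrow> x = y) \<and>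
    (\<forall>x\<in>P. \<forall>y\<in>P. \<forall>z\<in>P. le x y \<longrightarrow> le y z \<longrightarrow> le x z) \<and>
    (\<forall>x\<in>P. \<forall>y\<in>P. (\<exists>u. is_lub_on P le {x, y} u) \<and> (\<exists>u. is_glb_on P le {x, y} u))"

definition generalized_boolean_algebra :: "'a set \<Rightarrow> ('a \<Rightarrow> 'a \<Rightarrow> bool) \<Rightarrow> 'a \<Rightarrow> bool" where
  "generalized_boolean_algebra P le z \<longleftrightarrow>
    lattice_on P le \<and>
    z \<in> P \<and> (\<forall>x\<in>P. le z x) \<and>
    (\<forall>x\<in>P. \<forall>y\<in>P. \<forall>w\<in>P.
      meet_on P le x (join_on P le y w) = join_on P le (meet_on P le x y) (meet_on P le x w)) \<and>
    (\<forall>a\<in>P. \<forall>b\<in>P. \<forall>x\<in>P. le a x \<longrightarrow> le x b \<longrightarrow>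
      (\<exists>y\<in>P. le a y \<and> le y b \<and> meet_on P le x y = a \<and> join_on P le x y = b))"

definition gba_morphism ::
  "'a set \<Rightarrow> ('a \<Rightarrow> 'a \<Rightarrow> bool) \<Rightarrow> 'a \<Rightarrow> 'b set \<Rightarrow> ('b \<Rightarrow> 'b \<Rightarrow> bool) \<Rightarrow> 'b \<Rightarrow> ('a \<Rightarrow> 'b) \<Rightarrow> bool" where
  "gba_morphism P le z Q le' z' f \<longleftrightarrow>
    f \<in> P \<rightarrow> Q \<and> f z = z' \<and>
    (\<forall>x\<in>P. \<forall>y\<in>P. f (join_on P le x y) = join_on Q le' (f x) (f y)) \<and>
    (\<forall>x\<in>P. \<forall>y\<in>P. f (meet_on P le x y) = meet_on Q le' (f x) (f y))"


section \<open>Restriction, range and birestriction semigroups\<close>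

record 'a restr_sgp =
  carrier :: "'a set"
  mult :: "'a \<Rightarrow> 'a \<Rightarrow> 'a"
  star :: "'a \<Rightarrow> 'a"

record 'a range_sgp = "'a restr_sgp" +
  plus :: "'a \<Rightarrow> 'a"

definition restriction_semigroup :: "('a, 'z) restr_sgp_scheme \<Rightarrow> bool" where
  "restriction_semigroup S \<longleftrightarrow>
    (\<forall>x\<in>carrier S. \<forall>y\<in>carrier S. mult S x y \<in> carrier S) \<and>
    (\<forall>x\<in>carrier S. \<forall>y\<in>carrier S. \<forall>z\<in>carrier S.
      mult S (mult S x y) z = mult S x (mult S y z)) \<and>
    (\<forall>x\<in>carrier S. star S x \<in> carrier S) \<and>
    (\<forall>x\<in>carrier S. mult S x (star S x) = x) \<and>
    (\<forall>x\<in>carrier S. \<forall>y\<in>carrier S.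
      mult S (star S x) (star S y) = mult S (star S y) (star S x) \<and>
      mult S (star S y) (star S x) = star S (mult S (star S x) (star S y)) \<and>
      star S (mult S x y) = star S (mult S (star S x) y) \<and>
      mult S (star S x) y = mult S y (star S (mult S x y)))"

definition projections :: "('a, 'z) restr_sgp_scheme \<Rightarrow> 'a set" where
  "projections S = star S ` carrier S"

definition le :: "('a, 'z) restr_sgp_scheme \<Rightarrow> 'a \<Rightarrow> 'a \<Rightarrow> bool" where
  "le S s t \<longleftrightarrow> s = mult S t (star S s)"

definition is_join :: "('a, 'z) restr_sgp_scheme \<Rightarrow> 'a set \<Rightarrow> 'a \<Rightarrow> bool" where
  "is_join S = is_lub_on (carrier S) (le S)"

definition compatible :: "('a, 'z) restr_sgp_scheme \<Rightarrow> 'a \<Rightarrow> 'a \<Rightarrow> bool" where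
  "compatible S s t \<longleftrightarrow> mult S s (star S t) = mult S t (star S s)"

text \<open>A left zero that is a projection is unique, because projections commute.\<close>

definition is_zero :: "('a, 'z) restr_sgp_scheme \<Rightarrow> 'a \<Rightarrow> bool" where
  "is_zero S z \<longleftrightarrow> z \<in> projections S \<and> (\<forall>x\<in>carrier S. mult S z x = z)"

definition zero_of :: "('a, 'z) restr_sgp_scheme \<Rightarrow> 'a" where
  "zero_of S = (THE z. is_zero S z)"

definition boolean_restriction_semigroup :: "('a, 'z) restr_sgp_scheme \<Rightarrow> bool" where
  "boolean_restriction_semigroup S \<longleftrightarrow>
    restriction_semigroup S \<and>
    (\<exists>z. is_zero S z) \<and>
    (\<forall>s\<in>carrier S. \<forall>t\<in>carrier S. compatible S s t \<longrightarrow> (\<exists>v. is_join S {s, t} v)) \<and>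
    generalized_boolean_algebra (projections S) (le S) (zero_of S) \<and>
    (\<forall>s\<in>carrier S. \<forall>t\<in>carrier S. \<forall>u\<in>carrier S. \<forall>v.
      is_join S {s, t} v \<longrightarrow> is_join S {mult S s u, mult S t u} (mult S v u))"

definition local_units :: "('a, 'z) restr_sgp_scheme \<Rightarrow> bool" where
  "local_units S \<longleftrightarrow> (\<forall>s\<in>carrier S. \<exists>e\<in>projections S. mult S e s = s)"

definition range_semigroup :: "('a, 'z) range_sgp_scheme \<Rightarrow> bool" where
  "range_semigroup S \<longleftrightarrow>
    restriction_semigroup S \<and>
    (\<forall>x\<in>carrier S. plus S x \<in> carrier S) \<and>
    (\<forall>x\<in>carrier S. mult S (plus S x) x = x) \<and>
    (\<forall>x\<in>carrier S. \<forall>y\<in>carrier S.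
      mult S (plus S x) (plus S y) = mult S (plus S y) (plus S x) \<and>
      mult S (plus S y) (plus S x) = plus S (mult S (plus S x) (plus S y)) \<and>
      plus S (mult S x y) = plus S (mult S x (plus S y))) \<and>
    (\<forall>x\<in>carrier S. star S (plus S x) = plus S x \<and> plus S (star S x) = star S x)"

definition boolean_range_semigroup :: "('a, 'z) range_sgp_scheme \<Rightarrow> bool" where
  "boolean_range_semigroup S \<longleftrightarrow> range_semigroup S \<and> boolean_restriction_semigroup S"

definition bideterministic :: "('a, 'z) range_sgp_scheme \<Rightarrow> 'a \<Rightarrow> bool" where
  "bideterministic S s \<longleftrightarrow> (\<forall>e\<in>projections S.
      mult S e s = mult S s (star S (mult S e s)) \<and>
      mult S s e = mult S (plus S (mult S s e)) s)"

definition etale_boolean_range_semigroup :: "('a, 'z) range_sgp_scheme \<Rightarrow> bool" where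
  "etale_boolean_range_semigroup S \<longleftrightarrow> boolean_range_semigroup S \<and>
    (\<forall>s\<in>carrier S. \<exists>B. finite B \<and> B \<subseteq> {b \<in> carrier S. bideterministic S b} \<and> is_join S B s)"

definition birestriction_semigroup :: "('a, 'z) range_sgp_scheme \<Rightarrow> bool" where
  "birestriction_semigroup S \<longleftrightarrow> range_semigroup S \<and>
    (\<forall>x\<in>carrier S. \<forall>y\<in>carrier S. mult S x (plus S y) = mult S (plus S (mult S x y)) x)"

definition boolean_birestriction_semigroup :: "('a, 'z) range_sgp_scheme \<Rightarrow> bool" where
  "boolean_birestriction_semigroup S \<longleftrightarrow>
    birestriction_semigroup S \<and>
    (\<exists>z. is_zero S z) \<and>
    generalized_boolean_algebra (projections S) (le S) (zero_of S) \<and>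
    (\<forall>s\<in>carrier S. \<forall>t\<in>carrier S.
      mult S s (star S t) = mult S t (star S s) \<longrightarrow> mult S (plus S t) s = mult S (plus S s) t \<longrightarrow>
      (\<exists>v. is_join S {s, t} v))"


section \<open>Morphisms of semigroups\<close>

text \<open>Only the product and the star are required to be preserved, also between range semigroups.
  Morphisms are extensional functions, so that equality of morphisms is equality on the carrier.\<close>

definition sgp_morphism ::
  "('a, 'z) restr_sgp_scheme \<Rightarrow> ('b, 'y) restr_sgp_scheme \<Rightarrow> ('a \<Rightarrow> 'b) \<Rightarrow> bool" where
  "sgp_morphism S T f \<longleftrightarrow>
    f \<in> carrier S \<rightarrow>\<^sub>E carrier T \<and>
    (\<forall>x\<in>carrier S. \<forall>y\<in>carrier S. f (mult S x y) = mult T (f x) (f y)) \<and>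
    (\<forall>x\<in>carrier S. f (star S x) = star T (f x)) \<and>
    gba_morphism (projections S) (le S) (zero_of S) (projections T) (le T) (zero_of T) f \<and>
    (\<forall>q\<in>projections T. \<exists>p\<in>projections S. le T q (f p))"

definition proper_morphism ::
  "('a, 'z) restr_sgp_scheme \<Rightarrow> ('b, 'y) restr_sgp_scheme \<Rightarrow> ('a \<Rightarrow> 'b) \<Rightarrow> bool" where
  "proper_morphism S T f \<longleftrightarrow>
    (\<forall>t\<in>carrier T. \<exists>n\<ge>1. \<exists>(\<tau> :: nat \<Rightarrow> 'b) (\<sigma> :: nat \<Rightarrow> 'a).
      (\<forall>j\<in>{1..n}. \<tau> j \<in> carrier T \<and> \<sigma> j \<in> carrier S \<and> le T (\<tau> j) (f (\<sigma> j))) \<and>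
      (\<exists>v. is_join T (\<tau> ` {1..n}) v \<and> le T t v))"

definition weakly_meet_preserving ::
  "('a, 'z) restr_sgp_scheme \<Rightarrow> ('b, 'y) restr_sgp_scheme \<Rightarrow> ('a \<Rightarrow> 'b) \<Rightarrow> bool" where
  "weakly_meet_preserving S T f \<longleftrightarrow>
    (\<forall>s\<in>carrier S. \<forall>t\<in>carrier S. \<forall>u\<in>carrier T. le T u (f s) \<longrightarrow> le T u (f t) \<longrightarrow>
      (\<exists>v\<in>carrier S. le S v s \<and> le S v t \<and> le T u (f v)))"

definition morphism_of_type ::
  "nat \<Rightarrow> ('a, 'z) restr_sgp_scheme \<Rightarrow> ('b, 'y) restr_sgp_scheme \<Rightarrow> ('a \<Rightarrow> 'b) \<Rightarrow> bool" where
  "morphism_of_type i S T f \<longleftrightarrow> sgp_morphism S T f \<and>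
    (i \<in> {2, 4} \<longrightarrow> weakly_meet_preserving S T f) \<and>
    (i \<in> {3, 4} \<longrightarrow> proper_morphism S T f)"

definition sgp_cat ::
  "nat \<Rightarrow> ('a, 'z) restr_sgp_scheme set \<Rightarrow> (('a, 'z) restr_sgp_scheme, 'a \<Rightarrow> 'a) cat" where
  "sgp_cat i Ob =
    \<lparr>objs = Ob,
     hom = (\<lambda>S T. {f. morphism_of_type i S T f}),
     ident = (\<lambda>S. restrict (\<lambda>x. x) (carrier S)),
     cmp = (\<lambda>S T U g f. compose (carrier S) g f)\<rparr>"


section \<open>Topological categories\<close>

record ('c, 'o) top_cat =
  C1 :: "'c topology"
  C0 :: "'o topology"
  un :: "'o \<Rightarrow> 'c"
  dm :: "'c \<Rightarrow> 'o"
  rg :: "'c \<Rightarrow> 'o"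
  mu :: "'c \<Rightarrow> 'c \<Rightarrow> 'c"

definition composable :: "('c, 'o) top_cat \<Rightarrow> ('c \<times> 'c) set" where
  "composable C = {(x, y). x \<in> topspace (C1 C) \<and> y \<in> topspace (C1 C) \<and> rg C y = dm C x}"

definition topological_category :: "('c, 'o) top_cat \<Rightarrow> bool" where
  "topological_category C \<longleftrightarrow>
    continuous_map (C0 C) (C1 C) (un C) \<and>
    continuous_map (C1 C) (C0 C) (dm C) \<and>
    continuous_map (C1 C) (C0 C) (rg C) \<and>
    continuous_map (subtopology (prod_topology (C1 C) (C1 C)) (composable C)) (C1 C)
      (\<lambda>(x, y). mu C x y) \<and>
    (\<forall>x\<in>topspace (C0 C). dm C (un C x) = x \<and> rg C (un C x) = x) \<and>
    (\<forall>(x, y)\<in>composable C. dm C (mu C x y) = dm C y \<and> rg C (mu C x y) = rg C x) \<and>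
    (\<forall>x\<in>topspace (C1 C). mu C x (un C (dm C x)) = x \<and> mu C (un C (rg C x)) x = x) \<and>
    (\<forall>x y z. (x, y) \<in> composable C \<longrightarrow> (y, z) \<in> composable C \<longrightarrow>
      mu C (mu C x y) z = mu C x (mu C y z))"

definition local_homeomorphism :: "'x topology \<Rightarrow> 'y topology \<Rightarrow> ('x \<Rightarrow> 'y) \<Rightarrow> bool" where
  "local_homeomorphism X Y f \<longleftrightarrow>
    f \<in> topspace X \<rightarrow> topspace Y \<and>
    (\<forall>x\<in>topspace X. \<exists>U. openin X U \<and> x \<in> U \<and> openin Y (f ` U) \<and>
      homeomorphic_map (subtopology X U) (subtopology Y (f ` U)) f)"

definition etale_category :: "('c, 'o) top_cat \<Rightarrow> bool" where
  "etale_category C \<longleftrightarrow> topological_category C \<and>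
    locally_compact_space (C0 C) \<and> Hausdorff_space (C0 C) \<and>
    local_homeomorphism (C1 C) (C0 C) (dm C)"

definition bietale_category :: "('c, 'o) top_cat \<Rightarrow> bool" where
  "bietale_category C \<longleftrightarrow> etale_category C \<and> local_homeomorphism (C1 C) (C0 C) (rg C)"

definition is_slice :: "('c, 'o) top_cat \<Rightarrow> 'c set \<Rightarrow> bool" where
  "is_slice C A \<longleftrightarrow> openin (C1 C) A \<and> inj_on (dm C) A"

definition is_bislice :: "('c, 'o) top_cat \<Rightarrow> 'c set \<Rightarrow> bool" where
  "is_bislice C A \<longleftrightarrow> is_slice C A \<and> inj_on (rg C) A"

definition compact_slice :: "('c, 'o) top_cat \<Rightarrow> 'c set \<Rightarrow> bool" where
  "compact_slice C A \<longleftrightarrow> is_slice C A \<and> compactin (C1 C) A"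

definition compact_bislice :: "('c, 'o) top_cat \<Rightarrow> 'c set \<Rightarrow> bool" where
  "compact_bislice C A \<longleftrightarrow> is_bislice C A \<and> compactin (C1 C) A"

definition ample :: "('c, 'o) top_cat \<Rightarrow> bool" where
  "ample C \<longleftrightarrow> etale_category C \<and> openin (C1 C) = arbitrary union_of (compact_slice C)"

definition strongly_ample :: "('c, 'o) top_cat \<Rightarrow> bool" where
  "strongly_ample C \<longleftrightarrow> ample C \<and> open_map (C1 C) (C0 C) (rg C)"

definition biample :: "('c, 'o) top_cat \<Rightarrow> bool" where
  "biample C \<longleftrightarrow> bietale_category C \<and> openin (C1 C) = arbitrary union_of (compact_bislice C)"


section \<open>Actions and cofunctors\<close>

text \<open>The pullback of \<open>d : C\<^sub>1 \<rightarrow> C\<^sub>0\<close> along \<open>f : X \<rightarrow> C\<^sub>0\<close>, as a set and as a space.\<close>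

definition pullback_set :: "('c, 'o) top_cat \<Rightarrow> 'x topology \<Rightarrow> ('x \<Rightarrow> 'o) \<Rightarrow> ('c \<times> 'x) set" where
  "pullback_set C X f = {(s, x). s \<in> topspace (C1 C) \<and> x \<in> topspace X \<and> dm C s = f x}"

definition pullback_top :: "('c, 'o) top_cat \<Rightarrow> 'x topology \<Rightarrow> ('x \<Rightarrow> 'o) \<Rightarrow> ('c \<times> 'x) topology" where
  "pullback_top C X f = subtopology (prod_topology (C1 C) X) (pullback_set C X f)"

definition is_action ::
  "('c, 'o) top_cat \<Rightarrow> 'x topology \<Rightarrow> ('c \<times> 'x \<Rightarrow> 'x) \<Rightarrow> ('x \<Rightarrow> 'o) \<Rightarrow> bool" where
  "is_action C X \<mu> f \<longleftrightarrow>
    continuous_map X (C0 C) f \<and>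
    continuous_map (pullback_top C X f) X \<mu> \<and>
    (\<forall>(s, x)\<in>pullback_set C X f. f (\<mu> (s, x)) = rg C s) \<and>
    (\<forall>s t x. (s, t) \<in> composable C \<longrightarrow> (t, x) \<in> pullback_set C X f \<longrightarrow>
      \<mu> (s, \<mu> (t, x)) = \<mu> (mu C s t, x)) \<and>
    (\<forall>x\<in>topspace X. \<mu> (un C (f x), x) = x)"

definition transformation_category ::
  "('c, 'o) top_cat \<Rightarrow> 'x topology \<Rightarrow> ('c \<times> 'x \<Rightarrow> 'x) \<Rightarrow> ('x \<Rightarrow> 'o) \<Rightarrow> ('c \<times> 'x, 'x) top_cat" where
  "transformation_category C X \<mu> f =
    \<lparr>C1 = pullback_top C X f,
     C0 = X,
     un = (\<lambda>x. (un C (f x), x)),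
     dm = (\<lambda>(s, x). x),
     rg = \<mu>,
     mu = (\<lambda>(s, y) (t, x). (mu C s t, x))\<rparr>"

definition continuous_functor ::
  "('c, 'o) top_cat \<Rightarrow> ('d, 'p) top_cat \<Rightarrow> ('c \<Rightarrow> 'd) \<Rightarrow> ('o \<Rightarrow> 'p) \<Rightarrow> bool" where
  "continuous_functor C D \<rho>1 \<rho>0 \<longleftrightarrow>
    continuous_map (C1 C) (C1 D) \<rho>1 \<and>
    continuous_map (C0 C) (C0 D) \<rho>0 \<and>
    (\<forall>x\<in>topspace (C0 C). \<rho>1 (un C x) = un D (\<rho>0 x)) \<and>
    (\<forall>s\<in>topspace (C1 C). dm D (\<rho>1 s) = \<rho>0 (dm C s) \<and> rg D (\<rho>1 s) = \<rho>0 (rg C s)) \<and>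
    (\<forall>(s, t)\<in>composable C. \<rho>1 (mu C s t) = mu D (\<rho>1 s) (\<rho>1 t))"

record ('c, 'o, 'd, 'p) cofun =
  act :: "'c \<times> 'p \<Rightarrow> 'p"
  anchor :: "'p \<Rightarrow> 'o"
  arr_map :: "'c \<times> 'p \<Rightarrow> 'd"
  obj_map :: "'p \<Rightarrow> 'p"

abbreviation cofun_arrows ::
  "('c, 'o) top_cat \<Rightarrow> ('d, 'p) top_cat \<Rightarrow> ('c, 'o, 'd, 'p) cofun \<Rightarrow> ('c \<times> 'p) set" where
  "cofun_arrows C D F \<equiv> pullback_set C (C0 D) (anchor F)"

definition cofun_image ::
  "('c, 'o) top_cat \<Rightarrow> ('d, 'p) top_cat \<Rightarrow> ('c, 'o, 'd, 'p) cofun \<Rightarrow> 'c set \<Rightarrow> 'd set" where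
  "cofun_image C D F A = {arr_map F (s, x) | s x. s \<in> A \<and> (s, x) \<in> cofun_arrows C D F}"

text \<open>The extensionality conditions make equality of cofunctors equality of the underlying maps on
  their domains of definition.\<close>

definition is_cofunctor ::
  "('c, 'o) top_cat \<Rightarrow> ('d, 'p) top_cat \<Rightarrow> ('c, 'o, 'd, 'p) cofun \<Rightarrow> bool" where
  "is_cofunctor C D F \<longleftrightarrow>
    act F \<in> extensional (cofun_arrows C D F) \<and>
    anchor F \<in> extensional (topspace (C0 D)) \<and>
    arr_map F \<in> extensional (cofun_arrows C D F) \<and>
    obj_map F \<in> extensional (topspace (C0 D)) \<and>
    is_action C (C0 D) (act F) (anchor F) \<and>
    (\<forall>K. compactin (C0 C) K \<longrightarrow> compactin (C0 D) {x \<in> topspace (C0 D). anchor F x \<in> K}) \<and>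
    continuous_functor (transformation_category C (C0 D) (act F) (anchor F)) D
      (arr_map F) (obj_map F) \<and>
    (\<forall>x\<in>topspace (C0 D). obj_map F x = x) \<and>
    (\<forall>A. compact_slice C A \<longrightarrow>
      openin (C1 D) (cofun_image C D F A) \<and> compactin (C1 D) (cofun_image C D F A))"

definition injective_action ::
  "('c, 'o) top_cat \<Rightarrow> ('d, 'p) top_cat \<Rightarrow> ('c, 'o, 'd, 'p) cofun \<Rightarrow> bool" where
  "injective_action C D F \<longleftrightarrow>
    (\<forall>s x y. (s, x) \<in> cofun_arrows C D F \<longrightarrow> (s, y) \<in> cofun_arrows C D F \<longrightarrow>
      act F (s, x) = act F (s, y) \<longrightarrow> x = y)"

definition injective_on_arrows ::
  "('c, 'o) top_cat \<Rightarrow> ('d, 'p) top_cat \<Rightarrow> ('c, 'o, 'd, 'p) cofun \<Rightarrow> bool" where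
  "injective_on_arrows C D F \<longleftrightarrow>
    (\<forall>s t x. (s, x) \<in> cofun_arrows C D F \<longrightarrow> (t, x) \<in> cofun_arrows C D F \<longrightarrow>
      arr_map F (s, x) = arr_map F (t, x) \<longrightarrow> s = t)"

definition surjective_on_arrows ::
  "('c, 'o) top_cat \<Rightarrow> ('d, 'p) top_cat \<Rightarrow> ('c, 'o, 'd, 'p) cofun \<Rightarrow> bool" where
  "surjective_on_arrows C D F \<longleftrightarrow>
    (\<forall>t\<in>topspace (C1 D). \<exists>s. (s, dm D t) \<in> cofun_arrows C D F \<and> arr_map F (s, dm D t) = t)"

definition cofunctor_of_type ::
  "nat \<Rightarrow> ('c, 'o) top_cat \<Rightarrow> ('d, 'p) top_cat \<Rightarrow> ('c, 'o, 'd, 'p) cofun \<Rightarrow> bool" where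
  "cofunctor_of_type i C D F \<longleftrightarrow> is_cofunctor C D F \<and>
    (i \<in> {2, 4} \<longrightarrow> injective_on_arrows C D F) \<and>
    (i \<in> {3, 4} \<longrightarrow> surjective_on_arrows C D F)"

definition id_cofun :: "('c, 'o) top_cat \<Rightarrow> ('c, 'o, 'c, 'o) cofun" where
  "id_cofun C =
    (let P = pullback_set C (C0 C) (\<lambda>x. x) in
      \<lparr>act = restrict (\<lambda>(s, x). rg C s) P,
       anchor = restrict (\<lambda>x. x) (topspace (C0 C)),
       arr_map = restrict (\<lambda>(s, x). s) P,
       obj_map = restrict (\<lambda>x. x) (topspace (C0 C))\<rparr>)"

text \<open>The composite of \<open>F\<close> from \<open>C\<close> to \<open>D\<close> and \<open>G\<close> from \<open>D\<close> to \<open>E\<close>.\<close>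

definition comp_cofun ::
  "('c, 'o) top_cat \<Rightarrow> ('e, 'q) top_cat \<Rightarrow> ('d, 'p, 'e, 'q) cofun \<Rightarrow> ('c, 'o, 'd, 'p) cofun \<Rightarrow>
    ('c, 'o, 'e, 'q) cofun" where
  "comp_cofun C E G F =
    (let f = restrict (\<lambda>x. anchor F (anchor G x)) (topspace (C0 E));
         P = pullback_set C (C0 E) f in
      \<lparr>act = restrict (\<lambda>(s, x). act G (arr_map F (s, anchor G x), x)) P,
       anchor = f,
       arr_map = restrict (\<lambda>(s, x). arr_map G (arr_map F (s, anchor G x), x)) P,
       obj_map = restrict (\<lambda>x. x) (topspace (C0 E))\<rparr>)"

definition cofun_cat ::
  "(('c, 'o) top_cat \<Rightarrow> ('c, 'o) top_cat \<Rightarrow> ('c, 'o, 'c, 'o) cofun \<Rightarrow> bool) \<Rightarrow>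
    ('c, 'o) top_cat set \<Rightarrow> (('c, 'o) top_cat, ('c, 'o, 'c, 'o) cofun) cat" where
  "cofun_cat Q Ob =
    \<lparr>objs = Ob,
     hom = (\<lambda>C D. {F. Q C D F}),
     ident = id_cofun,
     cmp = (\<lambda>C D E G F. comp_cofun C E G F)\<rparr>"


section \<open>Size\<close>

text \<open>No type contains a copy of every semigroup or of every topological category, so the objects
  are taken relative to a notion of smallness of subsets of a type \<open>'a\<close>, which plays the role of
  a universe. A semigroup is small if its carrier is; an ample category is small if its compact
  slices can be indexed by a small set. Its set of arrows is not bounded by the same set, since a
  semigroup of cardinality \<open>\<kappa>\<close> may correspond to a category with \<open>2\<^sup>\<kappa>\<close> objects; the last two
  conditions in \<open>smallness\<close> make \<open>'c\<close> and \<open>'o\<close> large enough for arrows and objects.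

  Two instances: all sets are small, \<open>'a\<close> is any infinite type and \<open>'c = 'o = 'a set\<close> (any given
  semigroup and ample category are covered by a suitable \<open>'a\<close>); or \<open>'a = 'c = 'o\<close>
  has strong limit (e.g. inaccessible) cardinality and \<open>X\<close> is small iff \<open>X \<prec> UNIV\<close>, in which case
  an ample category is small iff its set of arrows has cardinality less than \<open>UNIV\<close>.\<close>

definition smallness :: "('a set \<Rightarrow> bool) \<Rightarrow> 'c itself \<Rightarrow> 'o itself \<Rightarrow> bool" where
  "smallness small _ _ \<longleftrightarrow>
    infinite (UNIV :: 'a set) \<and>
    (\<forall>X. finite X \<longrightarrow> small X) \<and>
    (\<forall>X Y. small X \<longrightarrow> Y \<lesssim> X \<longrightarrow> small Y) \<and>
    (\<forall>X. small X \<longrightarrow> Pow X \<lesssim> (UNIV :: 'c set)) \<and>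
    (\<forall>X. small X \<longrightarrow> Pow X \<lesssim> (UNIV :: 'o set))"

definition small_category :: "('a set \<Rightarrow> bool) \<Rightarrow> ('c, 'o) top_cat \<Rightarrow> bool" where
  "small_category small C \<longleftrightarrow> (\<exists>X. small X \<and> {A. compact_slice C A} \<lesssim> X)"

end

theory Submission
  imports Defs
begin

text \<open>The equivalence sends an ample category \<open>C\<close> to the semigroup of its compact slices (compact bislices
  in the birestriction case) and a cofunctor \<open>F\<close> to \<open>A \<mapsto> F\<^sub>*(A)\<close>. A semigroup \<open>S\<close> isomorphic, through
  some \<open>\<delta>\<close>, to a semigroup of compact slices of \<open>C\<close> that contains the compact open sets of units and forms
  a basis is represented by \<open>C\<close>. If \<open>S\<close> and \<open>T\<close> are represented by \<open>C\<close> and \<open>D\<close>, a morphism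
  \<open>\<phi> : S \<rightarrow> T\<close> determines a unique cofunctor: \<open>f(x)\<close> is the point whose compact open neighbourhoods are
  the \<open>U\<close> with \<open>x \<in> \<phi>(U)\<close>, and \<open>\<rho>(s, x)\<close> is the arrow of \<open>\<phi>(A)\<close> with domain \<open>x\<close>, for any \<open>A\<close>
  containing \<open>s\<close>. So morphisms and cofunctors correspond bijectively, and it remains to represent each
  semigroup by its category of germs over the prime filters of projections, and to read off from the
  semigroup when range is open (\<open>r(A)\<close> is the least compact open \<open>U\<close> with \<open>U A = A\<close>) or a slice is a
  bislice.\<close>

section \<open>Equivalences from correspondences of morphisms\<close>

text \<open>The category laws for cofunctors are never verified directly. A triple of a semigroup, a
  category and a representation links the two sides, and \<open>Rel\<close> matches the morphisms
  between two triples one to one; cofunctors then satisfy the laws because the functions behind them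
  do. Choosing one triple over each object gives the functors, and comparing two triples over one
  object gives the natural isomorphisms. Three obstacles shape the rest. The topological conditions
  make cofunctors awkward to build, so they are recovered from a purely set-theoretic relation to a
  semigroup morphism. Not every compact slice need be represented, as the case of bislices shows, so
  compactness is used to write slices as finite unions of represented ones. Finally, right
  multiplication preserves joins by axiom in Boolean restriction semigroups but not in Boolean
  birestriction semigroups. The germ construction therefore rests on weaker common properties, of
  which the decisive one is that \<open>e \<mapsto> (e s)\<^sup>*\<close> preserves joins of
  projections: it makes the range of a germ a prime filter.\<close>

lemma equivalent_categories_of_correspondence:
  fixes A :: "('o, 'm) cat" and B :: "('p, 'n) cat"
    and T :: "'t set" and a :: "'t \<Rightarrow> 'o" and b :: "'t \<Rightarrow> 'p"
    and Rel :: "'t \<Rightarrow> 't \<Rightarrow> 'm \<Rightarrow> 'n \<Rightarrow> bool"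
  assumes catA: "is_category A"
    and objs: "\<And>t. t \<in> T \<Longrightarrow> a t \<in> objs A" "\<And>t. t \<in> T \<Longrightarrow> b t \<in> objs B"
    and L: "\<And>X. X \<in> objs A \<Longrightarrow> \<exists>t\<in>T. a t = X"
    and R: "\<And>Y. Y \<in> objs B \<Longrightarrow> \<exists>t\<in>T. b t = Y"
    and fwd: "\<And>t t' f. t \<in> T \<Longrightarrow> t' \<in> T \<Longrightarrow> f \<in> hom A (a t) (a t') \<Longrightarrow>
      \<exists>!g. g \<in> hom B (b t) (b t') \<and> Rel t t' f g"
    and bwd: "\<And>t t' g. t \<in> T \<Longrightarrow> t' \<in> T \<Longrightarrow> g \<in> hom B (b t) (b t') \<Longrightarrow>
      \<exists>!f. f \<in> hom A (a t) (a t') \<and> Rel t t' f g"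
    and idn: "\<And>t. t \<in> T \<Longrightarrow> ident B (b t) \<in> hom B (b t) (b t) \<and>
      Rel t t (ident A (a t)) (ident B (b t))"
    and comp: "\<And>t t' t'' f f' g g'. t \<in> T \<Longrightarrow> t' \<in> T \<Longrightarrow> t'' \<in> T \<Longrightarrow>
      f \<in> hom A (a t) (a t') \<Longrightarrow> f' \<in> hom A (a t') (a t'') \<Longrightarrow>
      g \<in> hom B (b t) (b t') \<Longrightarrow> g' \<in> hom B (b t') (b t'') \<Longrightarrow>
      Rel t t' f g \<Longrightarrow> Rel t' t'' f' g' \<Longrightarrow>
      cmp B (b t) (b t') (b t'') g' g \<in> hom B (b t) (b t'') \<and>
      Rel t t'' (cmp A (a t) (a t') (a t'') f' f) (cmp B (b t) (b t') (b t'') g' g)"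
  shows "equivalent_categories A B"
proof -
  \<comment> \<open>The hypotheses make \<open>Rel t t'\<close> the graph of a bijection between
    hom-sets; \<open>fw\<close> and \<open>bw\<close> are its two directions.\<close>
  define fw where "fw t t' f = (THE g. g \<in> hom B (b t) (b t') \<and> Rel t t' f g)" for t t' f
  define bw where "bw t t' g = (THE f. f \<in> hom A (a t) (a t') \<and> Rel t t' f g)" for t t' g
  have fw: "fw t t' f \<in> hom B (b t) (b t')" "Rel t t' f (fw t t' f)"
    if "t \<in> T" "t' \<in> T" "f \<in> hom A (a t) (a t')" for t t' f
    using theI'[OF fwd[OF that]] by (simp_all add: fw_def)
  have bw: "bw t t' g \<in> hom A (a t) (a t')" "Rel t t' (bw t t' g) g"
    if "t \<in> T" "t' \<in> T" "g \<in> hom B (b t) (b t')" for t t' g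
    using theI'[OF bwd[OF that]] by (simp_all add: bw_def)
  have fw_eq: "g = g'" if "t \<in> T" "t' \<in> T" "f \<in> hom A (a t) (a t')"
    "g \<in> hom B (b t) (b t')" "g' \<in> hom B (b t) (b t')" "Rel t t' f g" "Rel t t' f g'" for t t' f g g'
    using fwd[OF that(1-3)] that by blast
  have bw_eq: "f = f'" if "t \<in> T" "t' \<in> T" "g \<in> hom B (b t) (b t')"
    "f \<in> hom A (a t) (a t')" "f' \<in> hom A (a t) (a t')" "Rel t t' f g" "Rel t t' f' g" for t t' f f' g
    using bwd[OF that(1-3)] that by blast
  have idA: "ident A X \<in> hom A X X" if "X \<in> objs A" for X
    using catA that by (simp add: is_category_def)
  have cmpA: "cmp A X Y Z g f \<in> hom A X Z"
    if "X \<in> objs A" "Y \<in> objs A" "Z \<in> objs A" "f \<in> hom A X Y" "g \<in> hom A Y Z" for X Y Z f g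
    using catA that by (simp add: is_category_def)
  have unitA: "cmp A X X Y f (ident A X) = f" "cmp A X Y Y (ident A Y) f = f"
    if "X \<in> objs A" "Y \<in> objs A" "f \<in> hom A X Y" for X Y f
    using catA that by (simp_all add: is_category_def)
  have assocA: "cmp A W X Z (cmp A X Y Z h g) f = cmp A W Y Z h (cmp A W X Y g f)"
    if "W \<in> objs A" "X \<in> objs A" "Y \<in> objs A" "Z \<in> objs A" "f \<in> hom A W X" "g \<in> hom A X Y" "h \<in> hom A Y Z"
    for W X Y Z f g h
    using catA that unfolding is_category_def by blast
  \<comment> \<open>One triple is chosen over each object, \<open>s X\<close> over \<open>X\<close>
    in \<open>A\<close> and \<open>r Y\<close> over \<open>Y\<close> in \<open>B\<close>. The two
    choices need not be compatible; the natural isomorphisms below measure the difference.\<close>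
  obtain s where s: "\<And>X. X \<in> objs A \<Longrightarrow> s X \<in> T" "\<And>X. X \<in> objs A \<Longrightarrow> a (s X) = X"
    using L by metis
  obtain r where r: "\<And>Y. Y \<in> objs B \<Longrightarrow> r Y \<in> T" "\<And>Y. Y \<in> objs B \<Longrightarrow> b (r Y) = Y"
    using R by metis
  have idB: "ident B Y \<in> hom B Y Y" if "Y \<in> objs B" for Y
    using idn[OF r(1)[OF that]] r(2)[OF that] by simp
  have cmpT: "cmp B (b t) (b t') (b t'') g' g \<in> hom B (b t) (b t'')"
    "Rel t t'' (cmp A (a t) (a t') (a t'') (bw t' t'' g') (bw t t' g)) (cmp B (b t) (b t') (b t'') g' g)"
    if "t \<in> T" "t' \<in> T" "t'' \<in> T" "g \<in> hom B (b t) (b t')" "g' \<in> hom B (b t') (b t'')" for t t' t'' g g'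
    using comp[OF that(1-3) bw(1)[OF that(1,2,4)] bw(1)[OF that(2,3,5)] that(4,5)
        bw(2)[OF that(1,2,4)] bw(2)[OF that(2,3,5)]] by simp_all
  have cmpB: "cmp B X Y Z g f \<in> hom B X Z"
    if "X \<in> objs B" "Y \<in> objs B" "Z \<in> objs B" "f \<in> hom B X Y" "g \<in> hom B Y Z" for X Y Z f g
    using cmpT(1)[of "r X" "r Y" "r Z" f g] r that by simp
  \<comment> \<open>Transport: by the unit laws of \<open>A\<close>, both composites and
    \<open>g\<close> itself are related to \<open>bw t t' g\<close>, and \<open>fw_eq\<close>
    identifies whatever is related to the same morphism. Associativity below goes the same
    way.\<close>
  have unitT: "cmp B (b t) (b t) (b t') g (ident B (b t)) = g \<and>
     cmp B (b t) (b t') (b t') (ident B (b t')) g = g"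
    if t: "t \<in> T" "t' \<in> T" and g: "g \<in> hom B (b t) (b t')" for t t' g
  proof -
    note f = bw[OF t g]
    have "Rel t t' (cmp A (a t) (a t) (a t') (bw t t' g) (ident A (a t)))
        (cmp B (b t) (b t) (b t') g (ident B (b t)))"
      "Rel t t' (cmp A (a t) (a t') (a t') (ident A (a t')) (bw t t' g))
        (cmp B (b t) (b t') (b t') (ident B (b t')) g)"
      using comp[OF t(1,1,2) idA[OF objs(1)] f(1) _ g _ f(2)]
        comp[OF t(1,2,2) f(1) idA[OF objs(1)] g _ f(2)] idn t by blast+
    then have "Rel t t' (bw t t' g) (cmp B (b t) (b t) (b t') g (ident B (b t)))"
      "Rel t t' (bw t t' g) (cmp B (b t) (b t') (b t') (ident B (b t')) g)"
      using unitA f(1) objs t by simp_all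
    then show ?thesis
      using fw_eq[OF t f(1) _ g _ f(2)] cmpB idB objs t g by metis
  qed
  have unitB: "cmp B X X Y g (ident B X) = g \<and> cmp B X Y Y (ident B Y) g = g"
    if "X \<in> objs B" "Y \<in> objs B" "g \<in> hom B X Y" for X Y g
    using unitT[of "r X" "r Y" g] r that by simp
  have assocB: "cmp B W X Z (cmp B X Y Z h g) f = cmp B W Y Z h (cmp B W X Y g f)"
    if o: "W \<in> objs B" "X \<in> objs B" "Y \<in> objs B" "Z \<in> objs B" and
      m: "f \<in> hom B W X" "g \<in> hom B X Y" "h \<in> hom B Y Z" for W X Y Z f g h
  proof -
    let ?f = "bw (r W) (r X) f" and ?g = "bw (r X) (r Y) g" and ?h = "bw (r Y) (r Z) h"
    let ?a = "\<lambda>X. a (r X)"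
    have F: "?f \<in> hom A (?a W) (?a X)" "Rel (r W) (r X) ?f f" using bw[of "r W" "r X" f] r o m by simp_all
    have G: "?g \<in> hom A (?a X) (?a Y)" "Rel (r X) (r Y) ?g g" using bw[of "r X" "r Y" g] r o m by simp_all
    have H: "?h \<in> hom A (?a Y) (?a Z)" "Rel (r Y) (r Z) ?h h" using bw[of "r Y" "r Z" h] r o m by simp_all
    have oa: "?a W \<in> objs A" "?a X \<in> objs A" "?a Y \<in> objs A" "?a Z \<in> objs A" using objs r o by simp_all
    have c: "Rel (r X) (r'') (cmp A (?a X) (?a Y) (a r'') h' g') (cmp B X Y (b r'') h'' g'')"
      if "X \<in> objs B" "Y \<in> objs B" "r'' \<in> T" "g' \<in> hom A (?a X) (?a Y)" "h' \<in> hom A (?a Y) (a r'')"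
        "g'' \<in> hom B X Y" "h'' \<in> hom B Y (b r'')" "Rel (r X) (r Y) g' g''" "Rel (r Y) r'' h' h''"
      for X Y r'' g' h' g'' h''
      using comp[of "r X" "r Y" r'' g' h' g'' h''] that r by simp
    have "Rel (r W) (r Z) (cmp A (?a W) (?a X) (?a Z) (cmp A (?a X) (?a Y) (?a Z) ?h ?g) ?f)
        (cmp B W X Z (cmp B X Y Z h g) f)"
      using c[of W X "r Z"] c[of X Y "r Z"] F G H o r m cmpA cmpB oa by simp
    moreover have "Rel (r W) (r Z) (cmp A (?a W) (?a Y) (?a Z) ?h (cmp A (?a W) (?a X) (?a Y) ?g ?f))
        (cmp B W Y Z h (cmp B W X Y g f))"
      using c[of W Y "r Z"] c[of W X "r Y"] F G H o r m cmpA cmpB oa by simp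
    moreover have "cmp A (?a W) (?a X) (?a Z) (cmp A (?a X) (?a Y) (?a Z) ?h ?g) ?f =
        cmp A (?a W) (?a Y) (?a Z) ?h (cmp A (?a W) (?a X) (?a Y) ?g ?f)"
      using assocA oa F G H by simp
    ultimately show ?thesis
      using fw_eq[of "r W" "r Z"] r o m F G H cmpA[OF oa(1,2,4) F(1) cmpA[OF oa(2-4) G(1) H(1)]] cmpB by simp
  qed
  have catB: "is_category B"
    unfolding is_category_def using idB cmpB unitB assocB by blast
  define F0 where "F0 X = b (s X)" for X
  define F1 where "F1 X X' f = fw (s X) (s X') f" for X X' f
  define G0 where "G0 Y = a (r Y)" for Y
  define G1 where "G1 Y Y' g = bw (r Y) (r Y') g" for Y Y' g
  have oF: "F0 X \<in> objs B" if "X \<in> objs A" for X using that s objs by (simp add: F0_def)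
  have oG: "G0 Y \<in> objs A" if "Y \<in> objs B" for Y using that r objs by (simp add: G0_def)
  have F1: "F1 X X' f \<in> hom B (F0 X) (F0 X')" "Rel (s X) (s X') f (F1 X X' f)"
    if "X \<in> objs A" "X' \<in> objs A" "f \<in> hom A X X'" for X X' f
    using fw[of "s X" "s X'" f] s that by (simp_all add: F0_def F1_def)
  have G1: "G1 Y Y' g \<in> hom A (G0 Y) (G0 Y')" "Rel (r Y) (r Y') (G1 Y Y' g) g"
    if "Y \<in> objs B" "Y' \<in> objs B" "g \<in> hom B Y Y'" for Y Y' g
    using bw[of "r Y" "r Y'" g] r that by (simp_all add: G0_def G1_def)
  have "F1 X X (ident A X) = ident B (F0 X)" if "X \<in> objs A" for X
    using fw_eq[of "s X" "s X" "ident A X"] idA idB idn[of "s X"] F1 s that oF by (simp add: F0_def)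
  moreover have "F1 X Z (cmp A X Y Z g f) = cmp B (F0 X) (F0 Y) (F0 Z) (F1 Y Z g) (F1 X Y f)"
    if "X \<in> objs A" "Y \<in> objs A" "Z \<in> objs A" "f \<in> hom A X Y" "g \<in> hom A Y Z" for X Y Z f g
    using fw_eq[of "s X" "s Z" "cmp A X Y Z g f"] comp[of "s X" "s Y" "s Z" f g "F1 X Y f" "F1 Y Z g"]
      F1 that s cmpA by (simp add: F0_def)
  ultimately have FF: "is_functor A B F0 F1"
    unfolding is_functor_def using oF F1 by blast
  have "G1 X X (ident B X) = ident A (G0 X)" if "X \<in> objs B" for X
    using bw_eq[of "r X" "r X" "ident B X"] idA idB idn[of "r X"] G1 r that oG by (simp add: G0_def)
  moreover have "G1 X Z (cmp B X Y Z g f) = cmp A (G0 X) (G0 Y) (G0 Z) (G1 Y Z g) (G1 X Y f)"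
    if "X \<in> objs B" "Y \<in> objs B" "Z \<in> objs B" "f \<in> hom B X Y" "g \<in> hom B Y Z" for X Y Z f g
    using bw_eq[of "r X" "r Z" "cmp B X Y Z g f"] comp[of "r X" "r Y" "r Z" "G1 X Y f" "G1 Y Z g" f g]
      G1 that r oG cmpB cmpA[of "G0 X" "G0 Y" "G0 Z"] by (simp add: G0_def)
  ultimately have GG: "is_functor B A G0 G1"
    unfolding is_functor_def using oG G1 by blast
  \<comment> \<open>\<open>s X\<close> and \<open>r (F0 X)\<close> both lie over \<open>F0 X\<close>
    in \<open>B\<close>, so the identity of \<open>F0 X\<close> has a counterpart between their
    \<open>A\<close>-objects. The inverse corresponds to the same identity read in the other
    direction.\<close>
  define \<eta> where "\<eta> X = bw (s X) (r (F0 X)) (ident B (F0 X))" for X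
  have \<eta>: "\<eta> X \<in> hom A X (G0 (F0 X))" "Rel (s X) (r (F0 X)) (\<eta> X) (ident B (F0 X))"
    if "X \<in> objs A" for X
    using bw[of "s X" "r (F0 X)" "ident B (F0 X)"] that s r oF idB by (simp_all add: F0_def G0_def \<eta>_def)
  define \<epsilon> where "\<epsilon> Y = fw (s (G0 Y)) (r Y) (ident A (G0 Y))" for Y
  have \<epsilon>: "\<epsilon> Y \<in> hom B (F0 (G0 Y)) Y" "Rel (s (G0 Y)) (r Y) (ident A (G0 Y)) (\<epsilon> Y)"
    if "Y \<in> objs B" for Y
    using fw[of "s (G0 Y)" "r Y" "ident A (G0 Y)"] that s r oG idA by (simp_all add: F0_def G0_def \<epsilon>_def)
  have iso\<eta>: "is_iso A X (G0 (F0 X)) (\<eta> X)" if X: "X \<in> objs A" for X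
  proof -
    let ?t = "s X" and ?t' = "r (F0 X)"
    let ?g = "bw ?t' ?t (ident B (F0 X))"
    have T: "?t \<in> T" "?t' \<in> T" "a ?t = X" "b ?t = F0 X" "a ?t' = G0 (F0 X)" "b ?t' = F0 X"
      using X s r oF by (simp_all add: F0_def G0_def)
    have g: "?g \<in> hom A (G0 (F0 X)) X" "Rel ?t' ?t ?g (ident B (F0 X))"
      using bw[of ?t' ?t "ident B (F0 X)"] T idB oF X by simp_all
    have i: "ident B (F0 X) \<in> hom B (F0 X) (F0 X)" using idB oF X by simp
    have ii: "cmp B (F0 X) (F0 X) (F0 X) (ident B (F0 X)) (ident B (F0 X)) = ident B (F0 X)"
      using unitB i oF X by simp
    have "Rel ?t ?t (cmp A X (G0 (F0 X)) X ?g (\<eta> X)) (ident B (F0 X))"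
      using comp[of ?t ?t' ?t "\<eta> X" ?g "ident B (F0 X)" "ident B (F0 X)"] T \<eta>[OF X] g i ii by simp
    moreover have "Rel ?t' ?t' (cmp A (G0 (F0 X)) X (G0 (F0 X)) (\<eta> X) ?g) (ident B (F0 X))"
      using comp[of ?t' ?t ?t' ?g "\<eta> X" "ident B (F0 X)" "ident B (F0 X)"] T \<eta>[OF X] g i ii by simp
    ultimately have "cmp A X (G0 (F0 X)) X ?g (\<eta> X) = ident A X"
      "cmp A (G0 (F0 X)) X (G0 (F0 X)) (\<eta> X) ?g = ident A (G0 (F0 X))"
      using bw_eq[of ?t ?t "ident B (F0 X)"] bw_eq[of ?t' ?t' "ident B (F0 X)"] T i idn[of ?t] idn[of ?t']
        cmpA \<eta>(1) g(1) X oF oG idA by simp_all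
    then show ?thesis unfolding is_iso_def using \<eta>(1)[OF X] g(1) by blast
  qed
  have iso\<epsilon>: "is_iso B (F0 (G0 Y)) Y (\<epsilon> Y)" if Y: "Y \<in> objs B" for Y
  proof -
    let ?t = "r Y" and ?t' = "s (G0 Y)"
    let ?g = "fw ?t ?t' (ident A (G0 Y))"
    have T: "?t \<in> T" "?t' \<in> T" "b ?t = Y" "a ?t = G0 Y" "b ?t' = F0 (G0 Y)" "a ?t' = G0 Y"
      using Y s r oG by (simp_all add: F0_def G0_def)
    have i: "ident A (G0 Y) \<in> hom A (G0 Y) (G0 Y)" using idA oG Y by simp
    have g: "?g \<in> hom B Y (F0 (G0 Y))" "Rel ?t ?t' (ident A (G0 Y)) ?g"
      using fw[of ?t ?t' "ident A (G0 Y)"] T i by simp_all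
    have ii: "cmp A (G0 Y) (G0 Y) (G0 Y) (ident A (G0 Y)) (ident A (G0 Y)) = ident A (G0 Y)"
      using unitA i oG Y by simp
    have "Rel ?t ?t (ident A (G0 Y)) (cmp B Y (F0 (G0 Y)) Y (\<epsilon> Y) ?g)"
      using comp[of ?t ?t' ?t "ident A (G0 Y)" "ident A (G0 Y)" ?g "\<epsilon> Y"] T \<epsilon>[OF Y] g i ii by simp
    moreover have "Rel ?t' ?t' (ident A (G0 Y)) (cmp B (F0 (G0 Y)) Y (F0 (G0 Y)) ?g (\<epsilon> Y))"
      using comp[of ?t' ?t ?t' "ident A (G0 Y)" "ident A (G0 Y)" "\<epsilon> Y" ?g] T \<epsilon>[OF Y] g i ii by simp
    ultimately have "cmp B Y (F0 (G0 Y)) Y (\<epsilon> Y) ?g = ident B Y"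
      "cmp B (F0 (G0 Y)) Y (F0 (G0 Y)) ?g (\<epsilon> Y) = ident B (F0 (G0 Y))"
      using fw_eq[of ?t ?t "ident A (G0 Y)"] fw_eq[of ?t' ?t' "ident A (G0 Y)"] T i idn[of ?t] idn[of ?t']
        cmpB \<epsilon>(1) g(1) Y oF oG idB by simp_all
    then show ?thesis unfolding is_iso_def using \<epsilon>(1)[OF Y] g(1) by blast
  qed
  have nat\<eta>: "cmp A X Y (G0 (F0 Y)) (\<eta> Y) f =
      cmp A X (G0 (F0 X)) (G0 (F0 Y)) (G1 (F0 X) (F0 Y) (F1 X Y f)) (\<eta> X)"
    if X: "X \<in> objs A" "Y \<in> objs A" "f \<in> hom A X Y" for X Y f
  proof -
    have T: "s X \<in> T" "s Y \<in> T" "r (F0 X) \<in> T" "r (F0 Y) \<in> T" "a (s X) = X" "a (s Y) = Y"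
      "b (s X) = F0 X" "b (s Y) = F0 Y" "a (r (F0 X)) = G0 (F0 X)" "b (r (F0 X)) = F0 X"
      "a (r (F0 Y)) = G0 (F0 Y)" "b (r (F0 Y)) = F0 Y"
      using X s r oF by (simp_all add: F0_def G0_def)
    have g: "F1 X Y f \<in> hom B (F0 X) (F0 Y)" and h: "G1 (F0 X) (F0 Y) (F1 X Y f) \<in> hom A (G0 (F0 X)) (G0 (F0 Y))"
      using F1(1)[OF X] G1(1) oF X by simp_all
    \<comment> \<open>Both sides of the square are related to \<open>F1 X Y f\<close>, hence agree
      by uniqueness.\<close>
    have "Rel (s X) (r (F0 Y)) (cmp A X Y (G0 (F0 Y)) (\<eta> Y) f) (F1 X Y f)"
      using comp[of "s X" "s Y" "r (F0 Y)" f "\<eta> Y" "F1 X Y f" "ident B (F0 Y)"] T F1 X \<eta> unitB g oF idB by simp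
    moreover have "Rel (s X) (r (F0 Y))
        (cmp A X (G0 (F0 X)) (G0 (F0 Y)) (G1 (F0 X) (F0 Y) (F1 X Y f)) (\<eta> X)) (F1 X Y f)"
      using comp[of "s X" "r (F0 X)" "r (F0 Y)" "\<eta> X" "G1 (F0 X) (F0 Y) (F1 X Y f)" "ident B (F0 X)" "F1 X Y f"]
        T G1 X \<eta> unitB g h oF idB by simp
    ultimately show ?thesis
      using bw_eq[of "s X" "r (F0 Y)" "F1 X Y f"] T g cmpA X \<eta>(1) h oF oG by simp
  qed
  have nat\<epsilon>: "cmp B (F0 (G0 X)) (F0 (G0 Y)) Y (\<epsilon> Y) (F1 (G0 X) (G0 Y) (G1 X Y f)) =
      cmp B (F0 (G0 X)) X Y f (\<epsilon> X)"
    if X: "X \<in> objs B" "Y \<in> objs B" "f \<in> hom B X Y" for X Y f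
  proof -
    have T: "r X \<in> T" "r Y \<in> T" "s (G0 X) \<in> T" "s (G0 Y) \<in> T" "b (r X) = X" "b (r Y) = Y"
      "a (r X) = G0 X" "a (r Y) = G0 Y" "b (s (G0 X)) = F0 (G0 X)" "a (s (G0 X)) = G0 X"
      "b (s (G0 Y)) = F0 (G0 Y)" "a (s (G0 Y)) = G0 Y"
      using X s r oG by (simp_all add: F0_def G0_def)
    have g: "G1 X Y f \<in> hom A (G0 X) (G0 Y)" and h: "F1 (G0 X) (G0 Y) (G1 X Y f) \<in> hom B (F0 (G0 X)) (F0 (G0 Y))"
      using G1(1)[OF X] F1(1) oG X by simp_all
    have "Rel (s (G0 X)) (r Y) (G1 X Y f) (cmp B (F0 (G0 X)) (F0 (G0 Y)) Y (\<epsilon> Y) (F1 (G0 X) (G0 Y) (G1 X Y f)))"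
      using comp[of "s (G0 X)" "s (G0 Y)" "r Y" "G1 X Y f" "ident A (G0 Y)" "F1 (G0 X) (G0 Y) (G1 X Y f)" "\<epsilon> Y"]
        T F1 X \<epsilon> unitA g h oG idA by simp
    moreover have "Rel (s (G0 X)) (r Y) (G1 X Y f) (cmp B (F0 (G0 X)) X Y f (\<epsilon> X))"
      using comp[of "s (G0 X)" "r X" "r Y" "ident A (G0 X)" "G1 X Y f" "\<epsilon> X" f]
        T G1 X \<epsilon> unitA g h oG idA by simp
    ultimately show ?thesis
      using fw_eq[of "s (G0 X)" "r Y" "G1 X Y f"] T g cmpB X \<epsilon>(1) h oF oG by simp
  qed
  have "natural_iso A A (\<lambda>X. X) (\<lambda>X Y f. f) (\<lambda>X. G0 (F0 X)) (\<lambda>X Y f. G1 (F0 X) (F0 Y) (F1 X Y f)) \<eta>"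
    unfolding natural_iso_def using iso\<eta> nat\<eta> by blast
  moreover have "natural_iso B B (\<lambda>X. F0 (G0 X)) (\<lambda>X Y f. F1 (G0 X) (G0 Y) (G1 X Y f)) (\<lambda>X. X) (\<lambda>X Y f. f) \<epsilon>"
    unfolding natural_iso_def using iso\<epsilon> nat\<epsilon> by blast
  ultimately show ?thesis
    unfolding equivalent_categories_def using catA catB FF GG by blast
qed

section \<open>Compact slices of ample categories\<close>

definition compact_open :: "'x topology \<Rightarrow> 'x set \<Rightarrow> bool" where
  "compact_open X U \<longleftrightarrow> openin X U \<and> compactin X U"

definition slice_prod :: "('c, 'o) top_cat \<Rightarrow> 'c set \<Rightarrow> 'c set \<Rightarrow> 'c set" where
  "slice_prod C A B = {mu C a b | a b. a \<in> A \<and> b \<in> B \<and> rg C b = dm C a}"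

lemma compactin_finite_cover:
  assumes "compactin X K" "\<And>x. x \<in> K \<Longrightarrow> \<exists>U\<in>\<U>. openin X U \<and> x \<in> U"
  obtains \<F> where "finite \<F>" "\<F> \<subseteq> \<U>" "K \<subseteq> \<Union>\<F>"
proof -
  have "K \<subseteq> \<Union>{U \<in> \<U>. openin X U}" using assms(2) by blast
  then obtain \<F> where "finite \<F>" "\<F> \<subseteq> {U \<in> \<U>. openin X U}" "K \<subseteq> \<Union>\<F>"
    using compactinD[OF assms(1), of "{U \<in> \<U>. openin X U}"] by blast
  then show ?thesis using that[of \<F>] by blast
qed

lemma open_map_local_homeomorphism:
  assumes "local_homeomorphism X Y f"
  shows "open_map X Y f"
  unfolding open_map_def
proof (intro allI impI)
  fix U assume U: "openin X U"
  show "openin Y (f ` U)"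
  proof (subst openin_subopen, intro ballI)
    fix y assume "y \<in> f ` U"
    then obtain x where x: "x \<in> U" "y = f x" by blast
    then have "x \<in> topspace X" using U openin_subset by blast
    then obtain W where W: "openin X W" "x \<in> W" "openin Y (f ` W)"
      "homeomorphic_map (subtopology X W) (subtopology Y (f ` W)) f"
      using assms unfolding local_homeomorphism_def by blast
    have "openin (subtopology X W) (U \<inter> W)" using U by (simp add: openin_subtopology_Int)
    then have "openin (subtopology Y (f ` W)) (f ` (U \<inter> W))"
      using W(4) homeomorphic_imp_open_map open_map_def by blast
    then have "openin Y (f ` (U \<inter> W))" using W(3) openin_trans_full by blast
    then show "\<exists>T. openin Y T \<and> y \<in> T \<and> T \<subseteq> f ` U" using x W(2) by blast
  qed
qed

lemma compact_open_empty [simp]: "compact_open X {}"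
  by (simp add: compact_open_def)

lemma compact_open_Un: "compact_open X U \<Longrightarrow> compact_open X V \<Longrightarrow> compact_open X (U \<union> V)"
  by (simp add: compact_open_def compactin_Un openin_Un)

lemma compact_open_Union:
  "finite \<U> \<Longrightarrow> (\<And>U. U \<in> \<U> \<Longrightarrow> compact_open X U) \<Longrightarrow> compact_open X (\<Union>\<U>)"
  by (induction rule: finite_induct) (simp_all add: compact_open_Un)

lemma compact_open_subset: "compact_open X U \<Longrightarrow> U \<subseteq> topspace X"
  by (simp add: compact_open_def openin_subset)

lemma compact_slice_subset: "compact_slice C A \<Longrightarrow> A \<subseteq> topspace (C1 C)"
  by (simp add: compact_slice_def is_slice_def openin_subset)

lemma compact_slice_compact_open: "compact_slice C A \<Longrightarrow> compact_open (C1 C) A"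
  by (simp add: compact_slice_def is_slice_def compact_open_def)

lemma compact_slice_inj: "compact_slice C A \<Longrightarrow> a \<in> A \<Longrightarrow> b \<in> A \<Longrightarrow> dm C a = dm C b \<Longrightarrow> a = b"
  by (auto simp add: compact_slice_def is_slice_def inj_on_def)

lemma compact_slice_sub:
  "compact_slice C A \<Longrightarrow> compact_open (C1 C) V \<Longrightarrow> V \<subseteq> A \<Longrightarrow> compact_slice C V"
  by (auto simp add: compact_slice_def is_slice_def compact_open_def intro: inj_on_subset)

lemma compact_bislice_slice: "compact_bislice C A \<Longrightarrow> compact_slice C A"
  by (simp add: compact_bislice_def compact_slice_def is_bislice_def)

lemma compact_bislice_iff: "compact_bislice C A \<longleftrightarrow> compact_slice C A \<and> inj_on (rg C) A"
  by (auto simp add: compact_bislice_def compact_slice_def is_bislice_def)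

section \<open>Structure maps, neighbourhoods and sections in an ample category\<close>

locale ample_category =
  fixes C :: "('c, 'o) top_cat"
  assumes ample: "ample C"
begin

abbreviation "Arr \<equiv> topspace (C1 C)"
abbreviation "Ob \<equiv> topspace (C0 C)"

lemma topological: "topological_category C"
  and Hausdorff: "Hausdorff_space (C0 C)"
  and local_homeo_dm: "local_homeomorphism (C1 C) (C0 C) (dm C)"
  using ample by (simp_all add: ample_def etale_category_def)

lemma cont_un: "continuous_map (C0 C) (C1 C) (un C)"
  and cont_dm: "continuous_map (C1 C) (C0 C) (dm C)"
  and cont_rg: "continuous_map (C1 C) (C0 C) (rg C)"
  and cont_mu: "continuous_map (subtopology (prod_topology (C1 C) (C1 C)) (composable C)) (C1 C)
      (\<lambda>(x, y). mu C x y)"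
  using topological by (simp_all add: topological_category_def)

lemma un_in: "x \<in> Ob \<Longrightarrow> un C x \<in> Arr"
  using cont_un by (auto simp add: continuous_map_def Pi_iff)

lemma dm_in: "a \<in> Arr \<Longrightarrow> dm C a \<in> Ob"
  using cont_dm by (auto simp add: continuous_map_def Pi_iff)

lemma rg_in: "a \<in> Arr \<Longrightarrow> rg C a \<in> Ob"
  using cont_rg by (auto simp add: continuous_map_def Pi_iff)

lemma dm_un [simp]: "x \<in> Ob \<Longrightarrow> dm C (un C x) = x"
  and rg_un [simp]: "x \<in> Ob \<Longrightarrow> rg C (un C x) = x"
  using topological by (simp_all add: topological_category_def)

lemma mu_in: "a \<in> Arr \<Longrightarrow> b \<in> Arr \<Longrightarrow> rg C b = dm C a \<Longrightarrow> mu C a b \<in> Arr"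
proof -
  assume "a \<in> Arr" "b \<in> Arr" "rg C b = dm C a"
  then have "(a, b) \<in> topspace (subtopology (prod_topology (C1 C) (C1 C)) (composable C))"
    by (simp add: composable_def)
  then show ?thesis using continuous_map_image_subset_topspace[OF cont_mu] by fastforce
qed

lemma dm_mu [simp]: "a \<in> Arr \<Longrightarrow> b \<in> Arr \<Longrightarrow> rg C b = dm C a \<Longrightarrow> dm C (mu C a b) = dm C b"
  and rg_mu [simp]: "a \<in> Arr \<Longrightarrow> b \<in> Arr \<Longrightarrow> rg C b = dm C a \<Longrightarrow> rg C (mu C a b) = rg C a"
  using topological by (auto simp add: topological_category_def composable_def)

lemma mu_un_right [simp]: "a \<in> Arr \<Longrightarrow> mu C a (un C (dm C a)) = a"
  and mu_un_left [simp]: "a \<in> Arr \<Longrightarrow> mu C (un C (rg C a)) a = a"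
  using topological by (auto simp add: topological_category_def)

lemma mu_assoc: "a \<in> Arr \<Longrightarrow> b \<in> Arr \<Longrightarrow> c \<in> Arr \<Longrightarrow> rg C b = dm C a \<Longrightarrow> rg C c = dm C b \<Longrightarrow>
    mu C (mu C a b) c = mu C a (mu C b c)"
  using topological by (simp add: topological_category_def composable_def)

lemma open_dm: "openin (C1 C) U \<Longrightarrow> openin (C0 C) (dm C ` U)"
  using open_map_local_homeomorphism[OF local_homeo_dm] by (simp add: open_map_def)

lemma slice_nbhd:
  assumes "openin (C1 C) U" "a \<in> U"
  obtains A where "compact_slice C A" "a \<in> A" "A \<subseteq> U"
proof -
  have "(arbitrary union_of (compact_slice C)) U"
    using ample assms(1) by (simp add: ample_def)
  then show ?thesis using assms(2) that by (auto simp add: arbitrary_union_of_alt)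
qed

text \<open>Around \<open>\<sigma> x\<close> the image is cut out of a compact slice
  \<open>A\<close> by the open set of those \<open>y\<close> with \<open>\<sigma> y \<in> A\<close>:
  an arrow of \<open>A\<close> with such a domain \<open>y\<close> must equal
  \<open>\<sigma> y\<close>. Sets of units and products of slices are recognized as slices in this
  form.\<close>

lemma section_image:
  assumes V: "openin (C0 C) V" and \<sigma>: "continuous_map (subtopology (C0 C) V) (C1 C) \<sigma>"
    and d: "\<And>x. x \<in> V \<Longrightarrow> dm C (\<sigma> x) = x"
  shows "is_slice C (\<sigma> ` V)"
proof -
  have VO: "V \<subseteq> Ob" using V openin_subset by blast
  have \<sigma>in: "\<sigma> x \<in> Arr" if "x \<in> V" for x
    using continuous_map_image_subset_topspace[OF \<sigma>] that VO by auto
  have "openin (C1 C) (\<sigma> ` V)"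
  proof (subst openin_subopen, intro ballI)
    fix c assume "c \<in> \<sigma> ` V"
    then obtain x where x: "x \<in> V" "c = \<sigma> x" by blast
    obtain A where A: "compact_slice C A" "c \<in> A"
      using slice_nbhd[of Arr c] \<sigma>in x by (metis openin_topspace)
    let ?W = "{y \<in> topspace (subtopology (C0 C) V). \<sigma> y \<in> A}"
    have "openin (subtopology (C0 C) V) ?W"
      using openin_continuous_map_preimage[OF \<sigma>] A(1) by (simp add: compact_slice_def is_slice_def)
    then have W: "openin (C0 C) ?W" using V openin_trans_full by blast
    let ?T = "A \<inter> {a \<in> Arr. dm C a \<in> ?W}"
    have "openin (C1 C) ?T"
      using A(1) openin_continuous_map_preimage[OF cont_dm W]
      by (auto simp add: compact_slice_def is_slice_def)
    moreover have "c \<in> ?T" using x A(2) d VO \<sigma>in by auto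
    moreover have "?T \<subseteq> \<sigma> ` V"
    proof
      fix a assume a: "a \<in> ?T"
      then have "\<sigma> (dm C a) \<in> A" "dm C a \<in> V" by auto
      moreover have "a \<in> A" using a by blast
      ultimately have "a = \<sigma> (dm C a)" using compact_slice_inj[OF A(1)] d by metis
      then show "a \<in> \<sigma> ` V" using \<open>dm C a \<in> V\<close> by blast
    qed
    ultimately show "\<exists>T. openin (C1 C) T \<and> c \<in> T \<and> T \<subseteq> \<sigma> ` V" by blast
  qed
  moreover have "inj_on (dm C) (\<sigma> ` V)" using d by (auto simp add: inj_on_def)
  ultimately show ?thesis by (simp add: is_slice_def)
qed

lemma compact_section_image:
  assumes V: "compact_open (C0 C) V" and \<sigma>: "continuous_map (subtopology (C0 C) V) (C1 C) \<sigma>"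
    and d: "\<And>x. x \<in> V \<Longrightarrow> dm C (\<sigma> x) = x"
  shows "compact_slice C (\<sigma> ` V)"
proof -
  have "compactin (subtopology (C0 C) V) V" using V by (simp add: compact_open_def compactin_subtopology)
  then have "compactin (C1 C) (\<sigma> ` V)" using image_compactin[OF _ \<sigma>] by blast
  then show ?thesis using section_image[OF _ \<sigma> d] V by (simp add: compact_slice_def compact_open_def)
qed

text \<open>Continuity is openness of \<open>dm\<close> read backwards: the preimage of an open
  \<open>U\<close> is the set of domains of arrows in \<open>A \<inter> U\<close>.\<close>

lemma slice_section:
  assumes "is_slice C A"
  shows "continuous_map (subtopology (C0 C) (dm C ` A)) (C1 C) (inv_into A (dm C))"
proof -
  have A: "openin (C1 C) A" "inj_on (dm C) A" "A \<subseteq> Arr"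
    using assms openin_subset by (auto simp add: is_slice_def)
  have top: "topspace (subtopology (C0 C) (dm C ` A)) = dm C ` A"
    using A(3) dm_in by auto
  have pre: "openin (subtopology (C0 C) (dm C ` A)) {x \<in> dm C ` A. inv_into A (dm C) x \<in> U}"
    if U: "openin (C1 C) U" for U
  proof -
    have "{x \<in> dm C ` A. inv_into A (dm C) x \<in> U} = dm C ` (A \<inter> U)"
      using A(2) by auto
    moreover have "openin (C0 C) (dm C ` (A \<inter> U))" using open_dm A(1) U by blast
    ultimately show ?thesis
      by (metis (no_types, lifting) Int_lower1 image_mono inf.absorb_iff2 openin_subtopology_Int2)
  qed
  have "inv_into A (dm C) x \<in> Arr" if "x \<in> dm C ` A" for x
    using A(3) inv_into_into[OF that] by blast
  then show ?thesis using pre unfolding continuous_map_def top by blast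
qed

lemma compact_open_dm: "compact_slice C A \<Longrightarrow> compact_open (C0 C) (dm C ` A)"
  using open_dm image_compactin[OF _ cont_dm]
  by (auto simp add: compact_open_def compact_slice_def is_slice_def)

lemma compact_bislice_un:
  assumes "compact_open (C0 C) U"
  shows "compact_bislice C (un C ` U)"
proof -
  have U: "U \<subseteq> Ob" using assms compact_open_subset by blast
  have "compact_slice C (un C ` U)"
    using compact_section_image[OF assms continuous_map_from_subtopology[OF cont_un]] U dm_un by blast
  moreover have "inj_on (rg C) (un C ` U)" using U by (auto simp add: inj_on_def subset_iff)
  ultimately show ?thesis by (simp add: compact_bislice_iff)
qed

lemma compact_slice_un: "compact_open (C0 C) U \<Longrightarrow> compact_slice C (un C ` U)"
  by (simp add: compact_bislice_un compact_bislice_slice)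

lemma dm_un_image [simp]: "U \<subseteq> Ob \<Longrightarrow> dm C ` un C ` U = U"
  by (force simp add: image_iff subset_iff)

text \<open>Zero-dimensionality of the object space comes from the arrows: a compact slice around
  the unit at \<open>x\<close>, inside the preimage of \<open>V\<close>, has a compact open set of
  domains.\<close>

lemma compact_open_nbhd:
  assumes "openin (C0 C) V" "x \<in> V"
  obtains U where "compact_open (C0 C) U" "x \<in> U" "U \<subseteq> V"
proof -
  have x: "x \<in> Ob" using assms openin_subset by blast
  have "openin (C1 C) {a \<in> Arr. dm C a \<in> V}"
    using openin_continuous_map_preimage[OF cont_dm assms(1)] .
  moreover have "un C x \<in> {a \<in> Arr. dm C a \<in> V}" using x un_in assms(2) by simp
  ultimately obtain A where "compact_slice C A" "un C x \<in> A" "A \<subseteq> {a \<in> Arr. dm C a \<in> V}"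
    using slice_nbhd[of "{a \<in> Arr. dm C a \<in> V}" "un C x"] by blast
  then show ?thesis using that[of "dm C ` A"] compact_open_dm x
    by (metis (mono_tags, lifting) dm_un image_eqI image_subset_iff mem_Collect_eq subset_iff)
qed

lemma compact_open_cover:
  assumes "compactin (C0 C) K"
  obtains U where "compact_open (C0 C) U" "K \<subseteq> U"
proof -
  have "\<exists>U\<in>Collect (compact_open (C0 C)). openin (C0 C) U \<and> x \<in> U" if "x \<in> K" for x
    using compact_open_nbhd[of Ob x] that compactin_subset_topspace[OF assms]
    by (metis compact_open_def mem_Collect_eq openin_topspace subsetD)
  then obtain \<F> where \<F>: "finite \<F>" "\<F> \<subseteq> Collect (compact_open (C0 C))" "K \<subseteq> \<Union>\<F>"
    using compactin_finite_cover[OF assms, of "Collect (compact_open (C0 C))"] by auto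
  then show ?thesis using that[of "\<Union>\<F>"] compact_open_Union[of \<F>] by blast
qed

lemma compact_closed: "compactin (C0 C) K \<Longrightarrow> closedin (C0 C) K"
  using Hausdorff compactin_imp_closedin by blast

text \<open>Compact sets are closed in the Hausdorff object space, so the difference is open, and it
  is a closed subset of a compact set.\<close>

lemma compact_open_Diff:
  assumes "compact_open (C0 C) U" "compact_open (C0 C) V"
  shows "compact_open (C0 C) (U - V)"
proof -
  have "closedin (C0 C) V" using assms compact_closed by (simp add: compact_open_def)
  then have "openin (C0 C) (U - V)" using assms by (simp add: compact_open_def openin_diff)
  moreover have "closedin (C0 C) (U - V)"
    using assms compact_closed by (auto simp add: compact_open_def intro: closedin_diff)
  ultimately show ?thesis
    using assms closed_compactin[of "C0 C" U "U - V"] by (auto simp add: compact_open_def)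
qed

lemma separate:
  assumes "x \<in> Ob" "y \<in> Ob" "x \<noteq> y"
  obtains U V where "compact_open (C0 C) U" "compact_open (C0 C) V" "x \<in> U" "y \<in> V" "U \<inter> V = {}"
proof -
  obtain U V where UV: "openin (C0 C) U" "openin (C0 C) V" "x \<in> U" "y \<in> V" "disjnt U V"
    using Hausdorff assms unfolding Hausdorff_space_def by blast
  obtain U' where U': "compact_open (C0 C) U'" "x \<in> U'" "U' \<subseteq> U" using compact_open_nbhd UV by metis
  obtain V' where V': "compact_open (C0 C) V'" "y \<in> V'" "V' \<subseteq> V" using compact_open_nbhd UV by metis
  show ?thesis using that[OF U'(1) V'(1) U'(2) V'(2)] U' V' UV(5) by (auto simp add: disjnt_iff)
qed

lemma separation_eq:
  assumes "x \<in> Ob" "y \<in> Ob" "\<And>U. compact_open (C0 C) U \<Longrightarrow> x \<in> U \<Longrightarrow> y \<in> U"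
  shows "x = y"
  using separate[OF assms(1,2)] assms(3) by (metis disjoint_iff)

text \<open>The product is the image of the continuous section \<open>\<sigma>\<close> over the set
  \<open>V\<close> of those domains of \<open>B\<close> whose arrow ends in a domain of
  \<open>A\<close>. For compactness of \<open>V\<close> the set of domains of \<open>A\<close> has
  to be closed; the arrow space need not be Hausdorff, but the object space is.\<close>

lemma compact_slice_prod:
  assumes A: "compact_slice C A" and B: "compact_slice C B"
  shows "compact_slice C (slice_prod C A B)"
proof -
  have As: "A \<subseteq> Arr" and Bs: "B \<subseteq> Arr" using A B compact_slice_subset by blast+
  have iA: "inj_on (dm C) A" and iB: "inj_on (dm C) B"
    using A B by (simp_all add: compact_slice_def is_slice_def)
  define W where "W = B \<inter> {b \<in> Arr. rg C b \<in> dm C ` A}"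
  define V where "V = dm C ` W"
  define \<alpha> where "\<alpha> = inv_into A (dm C)"
  define \<beta> where "\<beta> = inv_into B (dm C)"
  define \<sigma> where "\<sigma> x = mu C (\<alpha> (rg C (\<beta> x))) (\<beta> x)" for x
  have dA: "compact_open (C0 C) (dm C ` A)" using compact_open_dm A by blast
  have "openin (C1 C) W"
    using B openin_continuous_map_preimage[OF cont_rg] dA
    by (auto simp add: W_def compact_slice_def is_slice_def compact_open_def)
  moreover have "compactin (C1 C) W"
  proof -
    have "closedin (C1 C) {b \<in> Arr. rg C b \<in> dm C ` A}"
      using closedin_continuous_map_preimage[OF cont_rg] compact_closed dA by (simp add: compact_open_def)
    then have "compactin (C1 C) ({b \<in> Arr. rg C b \<in> dm C ` A} \<inter> B)"
      using B closed_Int_compactin by (auto simp add: compact_slice_def)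
    then show ?thesis by (simp add: W_def Int_commute)
  qed
  ultimately have V: "compact_open (C0 C) V"
    using open_dm image_compactin[OF _ cont_dm] by (simp add: V_def compact_open_def)
  have VB: "V \<subseteq> dm C ` B" by (auto simp add: V_def W_def)
  have \<beta>: "\<beta> x \<in> B" "dm C (\<beta> x) = x" "rg C (\<beta> x) \<in> dm C ` A" if x: "x \<in> V" for x
  proof -
    show "\<beta> x \<in> B" "dm C (\<beta> x) = x"
      using x VB by (auto simp add: \<beta>_def inv_into_into f_inv_into_f)
    obtain b where "b \<in> W" "x = dm C b" using x by (auto simp add: V_def)
    then show "rg C (\<beta> x) \<in> dm C ` A"
      using iB by (simp add: \<beta>_def W_def)
  qed
  have \<alpha>: "\<alpha> y \<in> A" "dm C (\<alpha> y) = y" if "y \<in> dm C ` A" for y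
    using that by (auto simp add: \<alpha>_def inv_into_into f_inv_into_f)
  have c\<beta>: "continuous_map (subtopology (C0 C) V) (C1 C) \<beta>"
    using slice_section[of B] B VB continuous_map_from_subtopology_mono
    by (fastforce simp add: \<beta>_def compact_slice_def)
  have "continuous_map (subtopology (C0 C) V) (subtopology (C0 C) (dm C ` A)) (\<lambda>x. rg C (\<beta> x))"
    using continuous_map_compose[OF c\<beta> cont_rg] \<beta>(3)
    by (auto simp add: continuous_map_in_subtopology o_def image_subset_iff)
  then have c\<alpha>: "continuous_map (subtopology (C0 C) V) (C1 C) (\<lambda>x. \<alpha> (rg C (\<beta> x)))"
    using continuous_map_compose[OF _ slice_section[of A]] A
    by (fastforce simp add: \<alpha>_def compact_slice_def o_def)
  have "continuous_map (subtopology (C0 C) V) (prod_topology (C1 C) (C1 C)) (\<lambda>x. (\<alpha> (rg C (\<beta> x)), \<beta> x))"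
    using c\<alpha> c\<beta> by (simp add: continuous_map_pairedI)
  moreover have comp: "(\<alpha> (rg C (\<beta> x)), \<beta> x) \<in> composable C" if "x \<in> V" for x
    using \<alpha> \<beta>[OF that] As Bs by (auto simp add: composable_def)
  ultimately have "continuous_map (subtopology (C0 C) V)
      (subtopology (prod_topology (C1 C) (C1 C)) (composable C)) (\<lambda>x. (\<alpha> (rg C (\<beta> x)), \<beta> x))"
    by (auto simp add: continuous_map_in_subtopology)
  from continuous_map_compose[OF this cont_mu]
  have c\<sigma>: "continuous_map (subtopology (C0 C) V) (C1 C) \<sigma>"
    by (simp add: o_def \<sigma>_def[abs_def])
  have d\<sigma>: "dm C (\<sigma> x) = x" if "x \<in> V" for x
    using comp[OF that] \<beta>[OF that] by (simp add: \<sigma>_def composable_def)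
  have "slice_prod C A B = \<sigma> ` V"
  proof (intro equalityI subsetI)
    fix c assume "c \<in> slice_prod C A B"
    then obtain a b where ab: "c = mu C a b" "a \<in> A" "b \<in> B" "rg C b = dm C a"
      by (auto simp add: slice_prod_def)
    then have b: "b \<in> W" using Bs by (auto simp add: W_def)
    have "\<beta> (dm C b) = b" "\<alpha> (dm C a) = a" using ab iA iB by (simp_all add: \<alpha>_def \<beta>_def)
    then have "c = \<sigma> (dm C b)" by (simp add: \<sigma>_def ab)
    then show "c \<in> \<sigma> ` V" using b by (auto simp add: V_def)
  next
    fix c assume "c \<in> \<sigma> ` V"
    then obtain x where x: "x \<in> V" "c = \<sigma> x" by blast
    note b = \<beta>[OF x(1)]
    show "c \<in> slice_prod C A B"
      unfolding slice_prod_def x(2) \<sigma>_def using b(1) \<alpha>[OF b(3)] by (metis (mono_tags, lifting) mem_Collect_eq)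
  qed
  then show ?thesis using compact_section_image[OF V c\<sigma> d\<sigma>] by simp
qed

lemma compact_bislice_prod:
  assumes A: "compact_bislice C A" and B: "compact_bislice C B"
  shows "compact_bislice C (slice_prod C A B)"
proof -
  have As: "A \<subseteq> Arr" and Bs: "B \<subseteq> Arr" using A B compact_slice_subset compact_bislice_slice by blast+
  have iA: "inj_on (rg C) A" and iB: "inj_on (rg C) B" using A B by (simp_all add: compact_bislice_iff)
  have "inj_on (rg C) (slice_prod C A B)"
  proof (rule inj_onI)
    fix c c' assume "c \<in> slice_prod C A B" "c' \<in> slice_prod C A B" and eq: "rg C c = rg C c'"
    then obtain a b a' b' where ab: "c = mu C a b" "a \<in> A" "b \<in> B" "rg C b = dm C a"
      "c' = mu C a' b'" "a' \<in> A" "b' \<in> B" "rg C b' = dm C a'"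
      by (auto simp add: slice_prod_def)
    then have "rg C a = rg C a'" using eq As Bs by (metis rg_mu subsetD)
    then have "a = a'" using ab iA by (simp add: inj_on_def)
    moreover from this have "b = b'" using ab iB by (simp add: inj_on_def)
    ultimately show "c = c'" using ab by simp
  qed
  then show ?thesis using compact_slice_prod A B by (simp add: compact_bislice_iff)
qed

section \<open>Set-theoretic calculus of products of slices\<close>

lemma slice_prod_assoc:
  assumes "A \<subseteq> Arr" "B \<subseteq> Arr" "D \<subseteq> Arr"
  shows "slice_prod C (slice_prod C A B) D = slice_prod C A (slice_prod C B D)"
proof (intro equalityI subsetI)
  fix x assume "x \<in> slice_prod C (slice_prod C A B) D"
  then obtain a b c where "x = mu C (mu C a b) c" "a \<in> A" "b \<in> B" "c \<in> D"
    "rg C b = dm C a" "rg C c = dm C (mu C a b)"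
    by (auto simp add: slice_prod_def)
  moreover from this have "a \<in> Arr" "b \<in> Arr" "c \<in> Arr" using assms by auto
  moreover from calculation have "rg C c = dm C b" by (metis dm_mu)
  moreover have "mu C b c \<in> slice_prod C B D" using calculation by (auto simp add: slice_prod_def)
  moreover have "rg C (mu C b c) = dm C a" using calculation by simp
  ultimately show "x \<in> slice_prod C A (slice_prod C B D)"
    using mu_assoc[of a b c] unfolding slice_prod_def[of C A] by blast
next
  fix x assume "x \<in> slice_prod C A (slice_prod C B D)"
  then obtain a b c where "x = mu C a (mu C b c)" "a \<in> A" "b \<in> B" "c \<in> D"
    "rg C (mu C b c) = dm C a" "rg C c = dm C b"
    by (auto simp add: slice_prod_def)
  moreover from this have "a \<in> Arr" "b \<in> Arr" "c \<in> Arr" using assms by auto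
  moreover from calculation have "rg C b = dm C a" by (metis rg_mu)
  moreover have "mu C a b \<in> slice_prod C A B" using calculation by (auto simp add: slice_prod_def)
  moreover have "rg C c = dm C (mu C a b)" using calculation dm_mu by metis
  moreover have "x = mu C (mu C a b) c" using calculation mu_assoc[of a b c] by simp
  ultimately show "x \<in> slice_prod C (slice_prod C A B) D"
    unfolding slice_prod_def[of C _ D] by blast
qed

lemma slice_prod_un_left:
  assumes "A \<subseteq> Arr" "U \<subseteq> Ob"
  shows "slice_prod C (un C ` U) A = {a \<in> A. rg C a \<in> U}"
proof (intro equalityI subsetI)
  fix x assume "x \<in> slice_prod C (un C ` U) A"
  then obtain u b where "x = mu C (un C u) b" "u \<in> U" "b \<in> A" "rg C b = dm C (un C u)"
    by (auto simp add: slice_prod_def)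
  moreover from this have "rg C b = u" using assms by auto
  ultimately show "x \<in> {a \<in> A. rg C a \<in> U}" using assms by auto
next
  fix x assume x: "x \<in> {a \<in> A. rg C a \<in> U}"
  then have "x = mu C (un C (rg C x)) x" "rg C x = dm C (un C (rg C x))" using assms by auto
  then show "x \<in> slice_prod C (un C ` U) A" unfolding slice_prod_def using x by blast
qed

lemma slice_prod_un_right:
  assumes "A \<subseteq> Arr" "U \<subseteq> Ob"
  shows "slice_prod C A (un C ` U) = {a \<in> A. dm C a \<in> U}"
proof (intro equalityI subsetI)
  fix x assume "x \<in> slice_prod C A (un C ` U)"
  then obtain u a where "x = mu C a (un C u)" "u \<in> U" "a \<in> A" "rg C (un C u) = dm C a"
    by (auto simp add: slice_prod_def)
  moreover from this have "dm C a = u" using assms by auto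
  ultimately show "x \<in> {a \<in> A. dm C a \<in> U}" using assms by auto
next
  fix x assume x: "x \<in> {a \<in> A. dm C a \<in> U}"
  then have "x = mu C x (un C (dm C x))" "rg C (un C (dm C x)) = dm C x" using assms dm_in by auto
  then show "x \<in> slice_prod C A (un C ` U)" unfolding slice_prod_def using x by blast
qed

lemma dm_slice_prod:
  assumes "A \<subseteq> Arr" "B \<subseteq> Arr"
  shows "dm C ` slice_prod C A B = dm C ` {b \<in> B. rg C b \<in> dm C ` A}"
proof (intro equalityI subsetI)
  fix x assume "x \<in> dm C ` slice_prod C A B"
  then show "x \<in> dm C ` {b \<in> B. rg C b \<in> dm C ` A}"
    using assms by (auto simp add: slice_prod_def subset_iff)
next
  fix x assume "x \<in> dm C ` {b \<in> B. rg C b \<in> dm C ` A}"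
  then obtain a b where ab: "x = dm C b" "b \<in> B" "a \<in> A" "rg C b = dm C a" by auto
  then have "mu C a b \<in> slice_prod C A B" "dm C (mu C a b) = x"
    using assms by (auto simp add: slice_prod_def subset_iff)
  then show "x \<in> dm C ` slice_prod C A B" by blast
qed

text \<open>An arrow of a slice is fixed by its domain, so a subset of the slice is a restriction to
  a set of domains. In the semigroup of slices this turns the natural order into inclusion.\<close>

lemma slice_eq_restriction:
  assumes "compact_slice C A" "V \<subseteq> A"
  shows "V = slice_prod C A (un C ` dm C ` V)"
proof -
  have "A \<subseteq> Arr" using assms compact_slice_subset by blast
  then show ?thesis
    using assms slice_prod_un_right[of A "dm C ` V"] compact_slice_inj[OF assms(1)] dm_in by blast
qed

lemma compact_slice_Un:
  assumes "compact_slice C A" "compact_slice C B" "inj_on (dm C) (A \<union> B)"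
  shows "compact_slice C (A \<union> B)"
  using assms by (auto simp add: compact_slice_def is_slice_def compactin_Un openin_Un)

end

section \<open>Semigroups represented by compact slices\<close>

lemma (in ample_category) dm_image_subset: "A \<subseteq> Arr \<Longrightarrow> dm C ` A \<subseteq> Ob"
  using dm_in by blast

lemma (in ample_category) un_image_subset: "U \<subseteq> Ob \<Longrightarrow> un C ` U \<subseteq> Arr"
  using un_in by blast

lemma (in ample_category) un_inj: "x \<in> Ob \<Longrightarrow> y \<in> Ob \<Longrightarrow> un C x = un C y \<Longrightarrow> x = y"
  using dm_un by metis

lemma (in ample_category) un_image_Int:
  "U \<subseteq> Ob \<Longrightarrow> V \<subseteq> Ob \<Longrightarrow> un C ` U \<inter> un C ` V = un C ` (U \<inter> V)"
  using un_inj by blast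

lemma (in ample_category) un_image_Diff:
  "U \<subseteq> Ob \<Longrightarrow> V \<subseteq> Ob \<Longrightarrow> un C ` U - un C ` V = un C ` (U - V)"
  using un_inj by blast

lemma (in ample_category) slice_prod_un_un:
  "U \<subseteq> Ob \<Longrightarrow> V \<subseteq> Ob \<Longrightarrow> slice_prod C (un C ` U) (un C ` V) = un C ` (U \<inter> V)"
  using slice_prod_un_left[of "un C ` V" U] un_image_subset rg_un by auto

locale representation = ample_category C
  for C :: "('c, 'o) top_cat" +
  fixes S :: "('a, 'z) restr_sgp_scheme" and \<delta> :: "'a \<Rightarrow> 'c set"
  assumes inj: "inj_on \<delta> (carrier S)"
    and slice: "s \<in> carrier S \<Longrightarrow> compact_slice C (\<delta> s)"
    and mult_closed: "s \<in> carrier S \<Longrightarrow> t \<in> carrier S \<Longrightarrow> mult S s t \<in> carrier S"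
    and star_closed: "s \<in> carrier S \<Longrightarrow> star S s \<in> carrier S"
    and rep_mult: "s \<in> carrier S \<Longrightarrow> t \<in> carrier S \<Longrightarrow> \<delta> (mult S s t) = slice_prod C (\<delta> s) (\<delta> t)"
    and rep_star: "s \<in> carrier S \<Longrightarrow> \<delta> (star S s) = un C ` dm C ` \<delta> s"
    and units: "compact_open (C0 C) U \<Longrightarrow> \<exists>e\<in>carrier S. \<delta> e = un C ` U"
    and basis: "openin (C1 C) W \<Longrightarrow> a \<in> W \<Longrightarrow> \<exists>s\<in>carrier S. a \<in> \<delta> s \<and> \<delta> s \<subseteq> W"
begin

lemma rep_subset: "s \<in> carrier S \<Longrightarrow> \<delta> s \<subseteq> Arr"
  using slice compact_slice_subset by blast

lemma dm_rep_subset: "s \<in> carrier S \<Longrightarrow> dm C ` \<delta> s \<subseteq> Ob"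
  using rep_subset dm_image_subset by blast

lemma rep_eqI: "s \<in> carrier S \<Longrightarrow> t \<in> carrier S \<Longrightarrow> \<delta> s = \<delta> t \<Longrightarrow> s = t"
  using inj by (simp add: inj_on_def)

lemma rep_inj: "s \<in> carrier S \<Longrightarrow> a \<in> \<delta> s \<Longrightarrow> b \<in> \<delta> s \<Longrightarrow> dm C a = dm C b \<Longrightarrow> a = b"
  using compact_slice_inj[OF slice] .

lemma rep_star_mult:
  "s \<in> carrier S \<Longrightarrow> t \<in> carrier S \<Longrightarrow> \<delta> (mult S (star S s) t) = {b \<in> \<delta> t. rg C b \<in> dm C ` \<delta> s}"
  by (simp add: rep_mult star_closed rep_star slice_prod_un_left rep_subset dm_rep_subset)

lemma rep_mult_star:
  "s \<in> carrier S \<Longrightarrow> t \<in> carrier S \<Longrightarrow> \<delta> (mult S s (star S t)) = {a \<in> \<delta> s. dm C a \<in> dm C ` \<delta> t}"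
  by (simp add: rep_mult star_closed rep_star slice_prod_un_right rep_subset dm_rep_subset)

text \<open>Restricting \<open>\<delta> t\<close> to the domains of \<open>\<delta> s\<close> picks
  the arrows of \<open>\<delta> t\<close> with these domains. They form \<open>\<delta> s\<close>
  exactly when \<open>\<delta> s\<close> is a subset, since domains determine the arrows of a
  slice.\<close>

lemma le_iff: "s \<in> carrier S \<Longrightarrow> t \<in> carrier S \<Longrightarrow> le S s t \<longleftrightarrow> \<delta> s \<subseteq> \<delta> t"
proof -
  assume st: "s \<in> carrier S" "t \<in> carrier S"
  have "le S s t \<longleftrightarrow> \<delta> s = \<delta> (mult S t (star S s))"
    unfolding le_def using rep_eqI[OF st(1) mult_closed[OF st(2) star_closed[OF st(1)]]]
      arg_cong[of s "mult S t (star S s)" \<delta>] by blast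
  also have "\<dots> \<longleftrightarrow> \<delta> s \<subseteq> \<delta> t"
    unfolding rep_mult_star[OF st(2,1)] using rep_inj[OF st(2)] by blast
  finally show ?thesis .
qed

text \<open>Each law is a statement about sets of arrows, pulled back along the injective
  \<open>\<delta>\<close>. The locale assumes closure only, so this yields the axioms also for
  semigroups built out of slices.\<close>

lemma restriction_semigroup: "restriction_semigroup S"
proof -
  have assoc: "mult S (mult S x y) z = mult S x (mult S y z)"
    if "x \<in> carrier S" "y \<in> carrier S" "z \<in> carrier S" for x y z
    by (rule rep_eqI) (simp_all add: that mult_closed rep_mult slice_prod_assoc rep_subset)
  have xx: "mult S x (star S x) = x" if "x \<in> carrier S" for x
    by (rule rep_eqI) (auto simp add: that mult_closed star_closed rep_mult_star)
  have ss: "\<delta> (mult S (star S x) (star S y)) = un C ` (dm C ` \<delta> x \<inter> dm C ` \<delta> y)"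
    if "x \<in> carrier S" "y \<in> carrier S" for x y
    by (simp add: that star_closed rep_mult rep_star slice_prod_un_un dm_rep_subset)
  have comm: "mult S (star S x) (star S y) = mult S (star S y) (star S x)"
    if "x \<in> carrier S" "y \<in> carrier S" for x y
    by (rule rep_eqI) (simp_all add: that mult_closed star_closed ss Int_commute)
  have s2: "mult S (star S y) (star S x) = star S (mult S (star S x) (star S y))"
    if "x \<in> carrier S" "y \<in> carrier S" for x y
  proof (rule rep_eqI)
    have "dm C ` \<delta> x \<inter> dm C ` \<delta> y \<subseteq> Ob" using that dm_rep_subset by blast
    then show "\<delta> (mult S (star S y) (star S x)) = \<delta> (star S (mult S (star S x) (star S y)))"
      using that by (simp add: mult_closed star_closed rep_star ss Int_commute)
  qed (simp_all add: that mult_closed star_closed)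
  have s3: "star S (mult S x y) = star S (mult S (star S x) y)"
    if "x \<in> carrier S" "y \<in> carrier S" for x y
    by (rule rep_eqI) (simp_all add: that mult_closed star_closed rep_star rep_mult
        dm_slice_prod rep_subset slice_prod_un_left dm_rep_subset)
  have s4: "mult S (star S x) y = mult S y (star S (mult S x y))"
    if "x \<in> carrier S" "y \<in> carrier S" for x y
  proof (rule rep_eqI)
    show "\<delta> (mult S (star S x) y) = \<delta> (mult S y (star S (mult S x y)))"
      unfolding rep_star_mult[OF that] rep_mult_star[OF that(2) mult_closed[OF that]] rep_mult[OF that]
        dm_slice_prod[OF rep_subset[OF that(1)] rep_subset[OF that(2)]]
      using rep_inj[OF that(2)] by blast
  qed (simp_all add: that mult_closed star_closed)
  show ?thesis
    unfolding restriction_semigroup_def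
    by (intro conjI ballI; (rule assoc xx comm s2 s3 s4 mult_closed star_closed; assumption))
qed

text \<open>A compact open part of a slice is the product of the slice with the projection on the
  domains of that part. This stands in for surjectivity of \<open>\<delta>\<close>: elements can be
  built freely below a given one.\<close>

lemma restrict:
  assumes s: "s \<in> carrier S" and V: "compact_open (C1 C) V" "V \<subseteq> \<delta> s"
  obtains v where "v \<in> carrier S" "\<delta> v = V"
proof -
  have "compact_open (C0 C) (dm C ` V)"
    using compact_open_dm compact_slice_sub slice s V by blast
  then obtain e where "e \<in> carrier S" "\<delta> e = un C ` dm C ` V" using units by blast
  then show ?thesis
    using that[of "mult S s e"] slice_eq_restriction[OF slice[OF s] V(2)] s by (simp add: mult_closed rep_mult)
qed

text \<open>Compactness together with the basis of represented slices. It gives access to compact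
  slices that \<open>\<delta>\<close> does not hit, which may occur when only bislices are
  represented.\<close>

lemma compact_slice_finite_union:
  assumes A: "compact_slice C A"
  obtains B where "finite B" "B \<subseteq> carrier S" "A = \<Union>(\<delta> ` B)"
proof -
  have cov: "\<exists>V\<in>\<delta> ` {a \<in> carrier S. \<delta> a \<subseteq> A}. openin (C1 C) V \<and> s \<in> V" if s: "s \<in> A" for s
  proof -
    obtain a where a: "a \<in> carrier S" "s \<in> \<delta> a" "\<delta> a \<subseteq> A"
      using basis[of A s] A s by (auto simp add: compact_slice_def is_slice_def)
    then show ?thesis using slice[OF a(1)] by (auto simp add: compact_slice_def is_slice_def)
  qed
  have K: "compactin (C1 C) A" using A by (simp add: compact_slice_def)
  obtain \<F> where \<F>: "finite \<F>" "\<F> \<subseteq> \<delta> ` {a \<in> carrier S. \<delta> a \<subseteq> A}" "A \<subseteq> \<Union>\<F>"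
    using compactin_finite_cover[OF K cov] .
  obtain B where B: "B \<subseteq> {a \<in> carrier S. \<delta> a \<subseteq> A}" "finite B" "\<F> = \<delta> ` B"
    using finite_subset_image[OF \<F>(1,2)] by blast
  have "A = \<Union>(\<delta> ` B)" using B(1,3) \<F>(3) by auto
  moreover have "B \<subseteq> carrier S" using B(1) by blast
  ultimately show ?thesis using that B(2) by blast
qed

section \<open>Projections as compact open sets of objects\<close>

lemma projection_carrier: "e \<in> projections S \<Longrightarrow> e \<in> carrier S"
  using star_closed by (auto simp add: projections_def)

lemma rep_projection:
  assumes "e \<in> projections S"
  shows "\<delta> e = un C ` dm C ` \<delta> e"
proof -
  obtain s where s: "e = star S s" "s \<in> carrier S" using assms by (auto simp add: projections_def)
  then show ?thesis by (simp add: rep_star dm_rep_subset)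
qed

lemma compact_open_dm_rep: "s \<in> carrier S \<Longrightarrow> compact_open (C0 C) (dm C ` \<delta> s)"
  using compact_open_dm slice by blast

lemma projection_star: "e \<in> projections S \<Longrightarrow> star S e = e"
  by (rule rep_eqI) (simp_all add: projection_carrier star_closed rep_star flip: rep_projection)

lemma projectionI:
  assumes "e \<in> carrier S" "\<delta> e = un C ` U" "U \<subseteq> Ob"
  shows "e \<in> projections S"
proof -
  have "star S e = e" by (rule rep_eqI) (simp_all add: assms star_closed rep_star)
  then show ?thesis using assms(1) unfolding projections_def by force
qed

lemma projection_exists:
  assumes "compact_open (C0 C) U"
  obtains e where "e \<in> projections S" "\<delta> e = un C ` U" "dm C ` \<delta> e = U"
proof -
  have U: "U \<subseteq> Ob" using assms compact_open_subset by blast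
  obtain e where "e \<in> carrier S" "\<delta> e = un C ` U" using units[OF assms] by blast
  then show ?thesis using that[of e] projectionI[of e U] U by simp
qed

lemma is_zero_iff: "is_zero S z \<longleftrightarrow> z \<in> carrier S \<and> \<delta> z = {}"
proof
  assume z: "is_zero S z"
  then have zc: "z \<in> carrier S" "\<And>x. x \<in> carrier S \<Longrightarrow> mult S z x = z"
    using projection_carrier by (auto simp add: is_zero_def)
  obtain e where e: "e \<in> carrier S" "\<delta> e = {}" using units[of "{}"] by auto
  then have "\<delta> (mult S z e) = {}" using zc(1) by (simp add: rep_mult slice_prod_def)
  then show "z \<in> carrier S \<and> \<delta> z = {}" using zc(1) zc(2)[OF e(1)] by simp
next
  assume z: "z \<in> carrier S \<and> \<delta> z = {}"
  then have "z \<in> projections S" using projectionI[of z "{}"] by simp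
  moreover have "mult S z x = z" if "x \<in> carrier S" for x
    by (rule rep_eqI) (use z that in \<open>simp_all add: mult_closed rep_mult slice_prod_def\<close>)
  ultimately show "is_zero S z" by (simp add: is_zero_def)
qed

lemma ex_zero: "\<exists>z. is_zero S z"
  using units[of "{}"] is_zero_iff by auto

lemma zero_of: "zero_of S \<in> projections S" "\<delta> (zero_of S) = {}"
proof -
  have "is_zero S (zero_of S)"
    unfolding zero_of_def by (rule theI') (use ex_zero rep_eqI is_zero_iff in metis)
  then show "zero_of S \<in> projections S" "\<delta> (zero_of S) = {}"
    using is_zero_iff by (auto simp add: is_zero_def)
qed

text \<open>Joins are unions whenever they exist: an upper bound contains the union, which is
  compact open and thus represented below that bound by \<open>restrict\<close>, so a least upper
  bound cannot be larger.\<close>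

lemma is_join_iff:
  assumes "finite A" "A \<subseteq> carrier S"
  shows "is_join S A v \<longleftrightarrow> v \<in> carrier S \<and> \<delta> v = \<Union>(\<delta> ` A)"
proof
  assume v: "is_join S A v"
  then have vc: "v \<in> carrier S" and up: "\<And>a. a \<in> A \<Longrightarrow> le S a v"
    and least: "\<And>w. w \<in> carrier S \<Longrightarrow> \<forall>a\<in>A. le S a w \<Longrightarrow> le S v w"
    by (auto simp add: is_join_def is_lub_on_def)
  have sub: "\<Union>(\<delta> ` A) \<subseteq> \<delta> v" using up assms vc le_iff by blast
  have "compact_open (C1 C) (\<Union>(\<delta> ` A))"
    using assms slice compact_slice_compact_open by (intro compact_open_Union) auto
  then obtain w where w: "w \<in> carrier S" "\<delta> w = \<Union>(\<delta> ` A)" using restrict[OF vc _ sub] by blast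
  then have "\<forall>a\<in>A. le S a w" using assms le_iff by blast
  then have "\<delta> v \<subseteq> \<delta> w" using least[OF w(1)] le_iff vc w(1) by blast
  then show "v \<in> carrier S \<and> \<delta> v = \<Union>(\<delta> ` A)" using vc w sub by auto
next
  assume v: "v \<in> carrier S \<and> \<delta> v = \<Union>(\<delta> ` A)"
  then show "is_join S A v"
    unfolding is_join_def is_lub_on_def using assms(2) le_iff
    by (metis SUP_least UN_upper subsetD)
qed

lemma projection_mult:
  assumes "e \<in> projections S" "f \<in> projections S"
  shows "mult S e f \<in> projections S" "\<delta> (mult S e f) = \<delta> e \<inter> \<delta> f"
proof -
  have c: "e \<in> carrier S" "f \<in> carrier S" using assms projection_carrier by auto
  note s = dm_rep_subset[OF c(1)] dm_rep_subset[OF c(2)]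
  have "\<delta> (mult S e f) = slice_prod C (un C ` dm C ` \<delta> e) (un C ` dm C ` \<delta> f)"
    using c rep_mult rep_projection assms by metis
  also have *: "\<dots> = un C ` (dm C ` \<delta> e \<inter> dm C ` \<delta> f)" using slice_prod_un_un s by blast
  also have "\<dots> = \<delta> e \<inter> \<delta> f" using un_image_Int[OF s] rep_projection assms by metis
  finally show "\<delta> (mult S e f) = \<delta> e \<inter> \<delta> f" .
  then show "mult S e f \<in> projections S"
    using projectionI[of "mult S e f" "dm C ` \<delta> e \<inter> dm C ` \<delta> f"] mult_closed[OF c] s
      un_image_Int[OF s] rep_projection assms by (metis le_infI1)
qed

lemma projection_Un:
  assumes "e \<in> projections S" "f \<in> projections S"
  obtains g where "g \<in> projections S" "\<delta> g = \<delta> e \<union> \<delta> f"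
proof -
  have c: "e \<in> carrier S" "f \<in> carrier S" using assms projection_carrier by auto
  obtain g where "g \<in> projections S" "\<delta> g = un C ` (dm C ` \<delta> e \<union> dm C ` \<delta> f)"
    using projection_exists compact_open_Un compact_open_dm_rep c by metis
  then show ?thesis using that rep_projection assms by (metis image_Un)
qed

lemma projection_Diff:
  assumes "e \<in> projections S" "f \<in> projections S"
  obtains g where "g \<in> projections S" "\<delta> g = \<delta> e - \<delta> f"
proof -
  have c: "e \<in> carrier S" "f \<in> carrier S" using assms projection_carrier by auto
  obtain g where "g \<in> projections S" "\<delta> g = un C ` (dm C ` \<delta> e - dm C ` \<delta> f)"
    using projection_exists compact_open_Diff compact_open_dm_rep c by metis
  then show ?thesis using that rep_projection assms un_image_Diff dm_rep_subset c by metis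
qed

lemma lub_projection_iff:
  assumes "e \<in> projections S" "f \<in> projections S"
  shows "is_lub_on (projections S) (le S) {e, f} g \<longleftrightarrow> g \<in> projections S \<and> \<delta> g = \<delta> e \<union> \<delta> f"
proof -
  obtain h where h: "h \<in> projections S" "\<delta> h = \<delta> e \<union> \<delta> f" using projection_Un assms by blast
  have le: "\<And>x y. x \<in> projections S \<Longrightarrow> y \<in> projections S \<Longrightarrow> le S x y \<longleftrightarrow> \<delta> x \<subseteq> \<delta> y"
    using le_iff projection_carrier by blast
  show ?thesis
  proof
    assume g: "is_lub_on (projections S) (le S) {e, f} g"
    then have gp: "g \<in> projections S" "\<delta> e \<subseteq> \<delta> g" "\<delta> f \<subseteq> \<delta> g"
      using assms le by (auto simp add: is_lub_on_def)
    have "le S e h" "le S f h" using le assms h by simp_all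
    then have "le S g h" using g h(1) unfolding is_lub_on_def by blast
    then have "\<delta> g \<subseteq> \<delta> e \<union> \<delta> f" using le[OF gp(1) h(1)] h(2) by simp
    then show "g \<in> projections S \<and> \<delta> g = \<delta> e \<union> \<delta> f" using gp by blast
  next
    assume "g \<in> projections S \<and> \<delta> g = \<delta> e \<union> \<delta> f"
    then show "is_lub_on (projections S) (le S) {e, f} g"
      using assms le by (auto simp add: is_lub_on_def)
  qed
qed

lemma glb_projection_iff:
  assumes "e \<in> projections S" "f \<in> projections S"
  shows "is_glb_on (projections S) (le S) {e, f} g \<longleftrightarrow> g \<in> projections S \<and> \<delta> g = \<delta> e \<inter> \<delta> f"
proof -
  note h = projection_mult[OF assms]
  have le: "\<And>x y. x \<in> projections S \<Longrightarrow> y \<in> projections S \<Longrightarrow> le S x y \<longleftrightarrow> \<delta> x \<subseteq> \<delta> y"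
    using le_iff projection_carrier by blast
  show ?thesis
  proof
    assume g: "is_glb_on (projections S) (le S) {e, f} g"
    then have gp: "g \<in> projections S" "\<delta> g \<subseteq> \<delta> e" "\<delta> g \<subseteq> \<delta> f"
      using assms le by (auto simp add: is_glb_on_def)
    have "le S (mult S e f) e" "le S (mult S e f) f" using le assms h by simp_all
    then have "le S (mult S e f) g" using g h(1) unfolding is_glb_on_def by blast
    then have "\<delta> e \<inter> \<delta> f \<subseteq> \<delta> g" using le[OF h(1) gp(1)] h(2) by simp
    then show "g \<in> projections S \<and> \<delta> g = \<delta> e \<inter> \<delta> f" using gp by blast
  next
    assume "g \<in> projections S \<and> \<delta> g = \<delta> e \<inter> \<delta> f"
    then show "is_glb_on (projections S) (le S) {e, f} g"
      using assms le by (auto simp add: is_glb_on_def)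
  qed
qed

lemma join_projections:
  assumes "e \<in> projections S" "f \<in> projections S"
  shows "join_on (projections S) (le S) e f \<in> projections S"
    "\<delta> (join_on (projections S) (le S) e f) = \<delta> e \<union> \<delta> f"
proof -
  have "\<exists>!g. is_lub_on (projections S) (le S) {e, f} g"
    using projection_Un[OF assms] lub_projection_iff[OF assms] rep_eqI projection_carrier by metis
  then have "is_lub_on (projections S) (le S) {e, f} (join_on (projections S) (le S) e f)"
    unfolding join_on_def by (rule theI')
  then show "join_on (projections S) (le S) e f \<in> projections S"
    "\<delta> (join_on (projections S) (le S) e f) = \<delta> e \<union> \<delta> f"
    using lub_projection_iff[OF assms] by blast+
qed

lemma meet_projections:
  assumes "e \<in> projections S" "f \<in> projections S"
  shows "meet_on (projections S) (le S) e f = mult S e f"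
  unfolding meet_on_def
proof (rule the_equality)
  show "is_glb_on (projections S) (le S) {e, f} (mult S e f)"
    using projection_mult[OF assms] glb_projection_iff[OF assms] by blast
  show "g = mult S e f" if "is_glb_on (projections S) (le S) {e, f} g" for g
    using that projection_mult[OF assms] glb_projection_iff[OF assms] rep_eqI projection_carrier by metis
qed

text \<open>\<open>\<delta>\<close> turns projections into the compact open sets of units, where
  join, meet and relative complement come from union, intersection and difference.\<close>

lemma gba: "generalized_boolean_algebra (projections S) (le S) (zero_of S)"
proof -
  let ?P = "projections S"
  have le: "\<And>x y. x \<in> ?P \<Longrightarrow> y \<in> ?P \<Longrightarrow> le S x y \<longleftrightarrow> \<delta> x \<subseteq> \<delta> y"
    using le_iff projection_carrier by blast
  have eq: "\<And>x y. x \<in> ?P \<Longrightarrow> y \<in> ?P \<Longrightarrow> \<delta> x = \<delta> y \<Longrightarrow> x = y"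
    using rep_eqI projection_carrier by blast
  have lat: "lattice_on ?P (le S)"
    unfolding lattice_on_def
  proof (intro conjI ballI impI)
    show "le S x x" if "x \<in> ?P" for x using le that by simp
    show "x = y" if "x \<in> ?P" "y \<in> ?P" "le S x y" "le S y x" for x y using le eq that by simp
    show "le S x z" if "x \<in> ?P" "y \<in> ?P" "z \<in> ?P" "le S x y" "le S y z" for x y z
      using le that by auto
    show "\<exists>u. is_lub_on ?P (le S) {x, y} u" if "x \<in> ?P" "y \<in> ?P" for x y
      using lub_projection_iff[OF that] join_projections[OF that] by blast
    show "\<exists>u. is_glb_on ?P (le S) {x, y} u" if "x \<in> ?P" "y \<in> ?P" for x y
      using glb_projection_iff[OF that] projection_mult[OF that] by blast
  qed
  have dist: "meet_on ?P (le S) x (join_on ?P (le S) y w) =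
      join_on ?P (le S) (meet_on ?P (le S) x y) (meet_on ?P (le S) x w)"
    if "x \<in> ?P" "y \<in> ?P" "w \<in> ?P" for x y w
    by (rule eq) (use that in \<open>simp_all add: meet_projections join_projections projection_mult Int_Un_distrib\<close>)
  have compl: "\<exists>y\<in>?P. le S a y \<and> le S y b \<and> meet_on ?P (le S) x y = a \<and> join_on ?P (le S) x y = b"
    if ab: "a \<in> ?P" "b \<in> ?P" "x \<in> ?P" "le S a x" "le S x b" for a b x
  proof -
    obtain c where c: "c \<in> ?P" "\<delta> c = \<delta> b - \<delta> x" using projection_Diff[OF ab(2,3)] by blast
    \<comment> \<open>The complement of \<open>x\<close> in the interval from \<open>a\<close> to
      \<open>b\<close> consists of \<open>a\<close> and the part of \<open>b\<close> outside
      \<open>x\<close>.\<close>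
    obtain y where y: "y \<in> ?P" "\<delta> y = \<delta> a \<union> (\<delta> b - \<delta> x)" using projection_Un[OF ab(1) c(1)] c(2) by metis
    have "\<delta> a \<subseteq> \<delta> x" "\<delta> x \<subseteq> \<delta> b" using ab le by auto
    then have "le S a y" "le S y b" "\<delta> (mult S x y) = \<delta> a" "\<delta> (join_on ?P (le S) x y) = \<delta> b"
      using that y le by (auto simp add: projection_mult join_projections)
    then show ?thesis
      using eq that y by (metis join_projections(1) meet_projections projection_mult(1))
  qed
  have bot: "le S (zero_of S) x" if "x \<in> ?P" for x
    using le zero_of that by simp
  show ?thesis
    unfolding generalized_boolean_algebra_def
    by (intro conjI ballI impI; (rule lat zero_of(1) bot dist compl; assumption))
qed

text \<open>The ranges of \<open>\<delta> s\<close> form a compact set that need not be open; a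
  compact open \<open>U\<close> containing it gives the unit.\<close>

lemma local_units: "local_units S"
  unfolding local_units_def
proof
  fix s assume s: "s \<in> carrier S"
  have "compactin (C0 C) (rg C ` \<delta> s)"
    using image_compactin[OF _ cont_rg] slice[OF s] by (simp add: compact_slice_def)
  then obtain U where U: "compact_open (C0 C) U" "rg C ` \<delta> s \<subseteq> U" using compact_open_cover by metis
  obtain e where e: "e \<in> projections S" "\<delta> e = un C ` U" using projection_exists[OF U(1)] by metis
  have "mult S e s = s"
    using e s U compact_open_subset[OF U(1)] projection_carrier
    by (intro rep_eqI) (auto simp add: mult_closed rep_mult slice_prod_un_left rep_subset)
  then show "\<exists>e\<in>projections S. mult S e s = s" using e by blast
qed

lemma join_mult:
  assumes "s \<in> carrier S" "t \<in> carrier S" "u \<in> carrier S" "is_join S {s, t} v"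
  shows "is_join S {mult S s u, mult S t u} (mult S v u)"
  using assms by (auto simp add: is_join_iff mult_closed rep_mult slice_prod_def)

text \<open>Restricting each slice to the domains of the other gives the same set exactly when
  arrows with a common domain coincide, which is what makes the union a slice.\<close>

lemma compatible_iff:
  assumes "s \<in> carrier S" "t \<in> carrier S"
  shows "compatible S s t \<longleftrightarrow> inj_on (dm C) (\<delta> s \<union> \<delta> t)"
proof -
  have "compatible S s t \<longleftrightarrow> {a \<in> \<delta> s. dm C a \<in> dm C ` \<delta> t} = {a \<in> \<delta> t. dm C a \<in> dm C ` \<delta> s}"
    unfolding compatible_def
    using rep_eqI[OF mult_closed[OF assms(1) star_closed[OF assms(2)]]
        mult_closed[OF assms(2) star_closed[OF assms(1)]]]
    by (metis rep_mult_star[OF assms] rep_mult_star[OF assms(2,1)])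
  also have "\<dots> \<longleftrightarrow> inj_on (dm C) (\<delta> s \<union> \<delta> t)"
  proof
    assume *: "{a \<in> \<delta> s. dm C a \<in> dm C ` \<delta> t} = {a \<in> \<delta> t. dm C a \<in> dm C ` \<delta> s}"
    have "a = b" if "a \<in> \<delta> s" "b \<in> \<delta> t" "dm C a = dm C b" for a b
    proof -
      have "dm C a \<in> dm C ` \<delta> t" using that(2,3) by auto
      then have "a \<in> \<delta> t" using * that(1) by blast
      then show ?thesis using rep_inj[OF assms(2)] that by blast
    qed
    then show "inj_on (dm C) (\<delta> s \<union> \<delta> t)"
      using rep_inj[OF assms(1)] rep_inj[OF assms(2)] unfolding inj_on_def by (metis (no_types) Un_iff)
  next
    assume *: "inj_on (dm C) (\<delta> s \<union> \<delta> t)"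
    then show "{a \<in> \<delta> s. dm C a \<in> dm C ` \<delta> t} = {a \<in> \<delta> t. dm C a \<in> dm C ` \<delta> s}"
      unfolding inj_on_def by blast
  qed
  finally show ?thesis .
qed

lemma boolean_restriction:
  assumes "\<And>A. compact_slice C A \<Longrightarrow> A \<in> \<delta> ` carrier S"
  shows "boolean_restriction_semigroup S"
proof -
  have join: "\<exists>v. is_join S {s, t} v" if st: "s \<in> carrier S" "t \<in> carrier S" "compatible S s t" for s t
  proof -
    have "compact_slice C (\<delta> s \<union> \<delta> t)"
      using compact_slice_Un slice st compatible_iff by blast
    then obtain v where "v \<in> carrier S" "\<delta> v = \<delta> s \<union> \<delta> t" using assms by (metis image_iff)
    then show ?thesis using is_join_iff[of "{s, t}" v] st by auto
  qed
  show ?thesis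
    unfolding boolean_restriction_semigroup_def
    by (intro conjI ballI allI impI; (rule restriction_semigroup ex_zero gba join_mult join; assumption))
qed

end

section \<open>Morphisms and cofunctors\<close>

lemma topspace_pullback_top [simp]:
  "topspace (pullback_top C X f) = pullback_set C X f"
  by (auto simp add: pullback_top_def pullback_set_def)

text \<open>A cofunctor \<open>F\<close> is recovered from the map \<open>A \<mapsto> F\<^sub>*(A)\<close>: if \<open>s \<in> A\<close>, then \<open>\<rho>(s, x)\<close> is the
  unique arrow of \<open>F\<^sub>*(A)\<close> with domain \<open>x\<close>. This is recorded without any topology, so that a set-theoretic
  check suffices to recognize cofunctors and to compare them.\<close>

definition realizes :: "('c, 'o) top_cat \<Rightarrow> ('a, 'z) restr_sgp_scheme \<Rightarrow> ('a \<Rightarrow> 'c set) \<Rightarrow>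
    ('d, 'p) top_cat \<Rightarrow> ('b \<Rightarrow> 'd set) \<Rightarrow> ('a \<Rightarrow> 'b) \<Rightarrow> ('c, 'o, 'd, 'p) cofun \<Rightarrow> bool" where
  "realizes C S \<delta> D \<epsilon> \<phi> F \<longleftrightarrow>
    act F \<in> extensional (cofun_arrows C D F) \<and> anchor F \<in> extensional (topspace (C0 D)) \<and>
    arr_map F \<in> extensional (cofun_arrows C D F) \<and> obj_map F \<in> extensional (topspace (C0 D)) \<and>
    (\<forall>x\<in>topspace (C0 D). anchor F x \<in> topspace (C0 C) \<and> obj_map F x = x) \<and>
    (\<forall>s x. (s, x) \<in> cofun_arrows C D F \<longrightarrow>
      dm D (arr_map F (s, x)) = x \<and> act F (s, x) = rg D (arr_map F (s, x)) \<and>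
      (\<forall>a\<in>carrier S. s \<in> \<delta> a \<longrightarrow> arr_map F (s, x) \<in> \<epsilon> (\<phi> a)))"

locale representation_pair = X: representation C S \<delta> + Y: representation D T \<epsilon>
  for C :: "('c, 'o) top_cat" and S :: "('a, 'z) restr_sgp_scheme" and \<delta> :: "'a \<Rightarrow> 'c set"
    and D :: "('d, 'p) top_cat" and T :: "('b, 'y) restr_sgp_scheme" and \<epsilon> :: "'b \<Rightarrow> 'd set"
begin

definition corr :: "('a \<Rightarrow> 'b) \<Rightarrow> ('c, 'o, 'd, 'p) cofun \<Rightarrow> bool" where
  "corr \<phi> F \<longleftrightarrow> (\<forall>s\<in>carrier S. \<epsilon> (\<phi> s) = cofun_image C D F (\<delta> s))"

subsection \<open>From cofunctors to morphisms\<close>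

lemma in_cofun_arrows:
  "(s, x) \<in> cofun_arrows C D F \<longleftrightarrow> s \<in> X.Arr \<and> x \<in> Y.Ob \<and> dm C s = anchor F x"
  by (simp add: pullback_set_def)

context
  fixes F :: "('c, 'o, 'd, 'p) cofun"
  assumes F: "is_cofunctor C D F"
begin

lemma anchor_in: "x \<in> Y.Ob \<Longrightarrow> anchor F x \<in> X.Ob"
  using F continuous_map_image_subset_topspace by (fastforce simp add: is_cofunctor_def is_action_def)

lemma arr_map_facts:
  assumes "(s, x) \<in> cofun_arrows C D F"
  shows "arr_map F (s, x) \<in> Y.Arr" "dm D (arr_map F (s, x)) = x"
    "rg D (arr_map F (s, x)) = act F (s, x)" "act F (s, x) \<in> Y.Ob" "anchor F (act F (s, x)) = rg C s"
proof -
  have cf: "continuous_functor (transformation_category C (C0 D) (act F) (anchor F)) D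
      (arr_map F) (obj_map F)" and o: "\<forall>x\<in>topspace (C0 D). obj_map F x = x"
    and A: "is_action C (C0 D) (act F) (anchor F)"
    using F by (simp_all add: is_cofunctor_def)
  have x: "x \<in> Y.Ob" using assms by (simp add: in_cofun_arrows)
  have "continuous_map (pullback_top C (C0 D) (anchor F)) (C1 D) (arr_map F)"
    using cf by (simp add: continuous_functor_def transformation_category_def)
  from continuous_map_image_subset_topspace[OF this]
  show 1: "arr_map F (s, x) \<in> Y.Arr" using assms by auto
  have "continuous_map (pullback_top C (C0 D) (anchor F)) (C0 D) (act F)"
    using A by (simp add: is_action_def)
  from continuous_map_image_subset_topspace[OF this]
  show 2: "act F (s, x) \<in> Y.Ob" using assms by auto
  have "\<forall>s\<in>cofun_arrows C D F. dm D (arr_map F s) = obj_map F (case s of (s, x) \<Rightarrow> x) \<and>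
      rg D (arr_map F s) = obj_map F (act F s)"
    using cf by (simp add: continuous_functor_def transformation_category_def)
  then show "dm D (arr_map F (s, x)) = x" "rg D (arr_map F (s, x)) = act F (s, x)"
    using assms o x 2 by fastforce+
  show "anchor F (act F (s, x)) = rg C s"
    using A assms by (auto simp add: is_action_def)
qed

lemma arr_map_un: "x \<in> Y.Ob \<Longrightarrow> arr_map F (un C (anchor F x), x) = un D x"
  using F by (simp add: is_cofunctor_def continuous_functor_def transformation_category_def)

lemma arr_map_mu:
  assumes "s \<in> X.Arr" "rg C t = dm C s" "(t, x) \<in> cofun_arrows C D F"
  shows "(s, act F (t, x)) \<in> cofun_arrows C D F"
    "arr_map F (mu C s t, x) = mu D (arr_map F (s, act F (t, x))) (arr_map F (t, x))"
proof -
  show 1: "(s, act F (t, x)) \<in> cofun_arrows C D F"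
    using assms arr_map_facts[OF assms(3)] by (simp add: in_cofun_arrows)
  have "continuous_functor (transformation_category C (C0 D) (act F) (anchor F)) D
      (arr_map F) (obj_map F)"
    using F by (simp add: is_cofunctor_def)
  moreover have "((s, act F (t, x)), (t, x)) \<in>
      composable (transformation_category C (C0 D) (act F) (anchor F))"
    using 1 assms(3) by (simp add: composable_def transformation_category_def)
  ultimately show "arr_map F (mu C s t, x) = mu D (arr_map F (s, act F (t, x))) (arr_map F (t, x))"
    by (fastforce simp add: continuous_functor_def transformation_category_def)
qed

lemma cofun_imageI: "s \<in> A \<Longrightarrow> (s, x) \<in> cofun_arrows C D F \<Longrightarrow> arr_map F (s, x) \<in> cofun_image C D F A"
  unfolding cofun_image_def by blast

text \<open>Forwards this is functoriality of \<open>arr_map F\<close>. Backwards, if the images of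
  \<open>(a, y)\<close> and \<open>(b, x)\<close> compose, then \<open>y\<close> is
  \<open>act F (b, x)\<close>, and the anchor of this point is both \<open>dm C a\<close> and
  \<open>rg C b\<close>, so \<open>a\<close> and \<open>b\<close> already compose in
  \<open>C\<close>.\<close>

lemma cofun_image_prod:
  assumes "A \<subseteq> X.Arr" "B \<subseteq> X.Arr"
  shows "cofun_image C D F (slice_prod C A B) = slice_prod D (cofun_image C D F A) (cofun_image C D F B)"
proof (intro equalityI subsetI)
  fix c assume "c \<in> cofun_image C D F (slice_prod C A B)"
  then obtain a b x where ab: "c = arr_map F (mu C a b, x)" "a \<in> A" "b \<in> B" "rg C b = dm C a"
    "(mu C a b, x) \<in> cofun_arrows C D F"
    by (auto simp add: cofun_image_def slice_prod_def)
  have a: "a \<in> X.Arr" "b \<in> X.Arr" using ab assms by auto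
  have b: "(b, x) \<in> cofun_arrows C D F" using ab a by (simp add: in_cofun_arrows)
  note m = arr_map_mu[OF a(1) ab(4) b]
  have "rg D (arr_map F (b, x)) = dm D (arr_map F (a, act F (b, x)))"
    using arr_map_facts[OF b] arr_map_facts[OF m(1)] by simp
  then show "c \<in> slice_prod D (cofun_image C D F A) (cofun_image C D F B)"
    unfolding slice_prod_def ab(1) m(2) using cofun_imageI[OF ab(2) m(1)] cofun_imageI[OF ab(3) b] by blast
next
  fix c assume "c \<in> slice_prod D (cofun_image C D F A) (cofun_image C D F B)"
  then obtain a y b x where ab: "c = mu D (arr_map F (a, y)) (arr_map F (b, x))" "a \<in> A" "b \<in> B"
    "(a, y) \<in> cofun_arrows C D F" "(b, x) \<in> cofun_arrows C D F"
    "rg D (arr_map F (b, x)) = dm D (arr_map F (a, y))"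
    by (auto simp add: cofun_image_def slice_prod_def)
  have a: "a \<in> X.Arr" "b \<in> X.Arr" using ab assms by auto
  have y: "y = act F (b, x)" using ab arr_map_facts by metis
  then have r: "rg C b = dm C a" using arr_map_facts(5)[OF ab(5)] ab(4) by (simp add: in_cofun_arrows)
  have "c = arr_map F (mu C a b, x)" using arr_map_mu(2)[OF a(1) r ab(5)] ab(1) y by simp
  moreover have "mu C a b \<in> slice_prod C A B" using ab r by (auto simp add: slice_prod_def)
  moreover have "(mu C a b, x) \<in> cofun_arrows C D F"
    using a r ab(5) X.mu_in by (simp add: in_cofun_arrows)
  ultimately show "c \<in> cofun_image C D F (slice_prod C A B)" using cofun_imageI by blast
qed

lemma cofun_image_un:
  assumes "U \<subseteq> X.Ob"
  shows "cofun_image C D F (un C ` U) = un D ` {x \<in> Y.Ob. anchor F x \<in> U}"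
proof (intro equalityI subsetI)
  fix c assume "c \<in> cofun_image C D F (un C ` U)"
  then obtain u x where u: "c = arr_map F (un C u, x)" "u \<in> U" "(un C u, x) \<in> cofun_arrows C D F"
    by (auto simp add: cofun_image_def)
  then have "u = anchor F x" "x \<in> Y.Ob" using assms by (auto simp add: in_cofun_arrows)
  then show "c \<in> un D ` {x \<in> Y.Ob. anchor F x \<in> U}" using u arr_map_un by auto
next
  fix c assume "c \<in> un D ` {x \<in> Y.Ob. anchor F x \<in> U}"
  then obtain x where x: "c = un D x" "x \<in> Y.Ob" "anchor F x \<in> U" by auto
  then have "(un C (anchor F x), x) \<in> cofun_arrows C D F"
    using anchor_in X.un_in by (simp add: in_cofun_arrows)
  moreover have "un C (anchor F x) \<in> un C ` U" using x by blast
  ultimately show "c \<in> cofun_image C D F (un C ` U)" using cofun_imageI arr_map_un x by metis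
qed

lemma dm_cofun_image:
  assumes "A \<subseteq> X.Arr"
  shows "dm D ` cofun_image C D F A = {x \<in> Y.Ob. anchor F x \<in> dm C ` A}"
proof (intro equalityI subsetI)
  fix x assume "x \<in> dm D ` cofun_image C D F A"
  then obtain s y where "x = dm D (arr_map F (s, y))" "s \<in> A" "(s, y) \<in> cofun_arrows C D F"
    by (auto simp add: cofun_image_def)
  then show "x \<in> {x \<in> Y.Ob. anchor F x \<in> dm C ` A}"
    using arr_map_facts(2) by (auto simp add: in_cofun_arrows intro: rev_image_eqI)
next
  fix x assume "x \<in> {x \<in> Y.Ob. anchor F x \<in> dm C ` A}"
  then obtain s where "s \<in> A" "x \<in> Y.Ob" "anchor F x = dm C s" by auto
  then have "s \<in> A" "(s, x) \<in> cofun_arrows C D F" using assms by (auto simp add: in_cofun_arrows)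
  then show "x \<in> dm D ` cofun_image C D F A" using cofun_imageI arr_map_facts(2) by (metis image_eqI)
qed

text \<open>Arrows of the image with a common domain \<open>x\<close> come from arrows of
  \<open>A\<close> with the common domain \<open>anchor F x\<close>, hence from the same
  arrow.\<close>

lemma compact_slice_cofun_image:
  assumes "compact_slice C A"
  shows "compact_slice D (cofun_image C D F A)"
proof -
  have "inj_on (dm D) (cofun_image C D F A)"
  proof (rule inj_onI)
    fix b c assume "b \<in> cofun_image C D F A" "c \<in> cofun_image C D F A" "dm D b = dm D c"
    then obtain s x t y where st: "b = arr_map F (s, x)" "s \<in> A" "(s, x) \<in> cofun_arrows C D F"
      "c = arr_map F (t, y)" "t \<in> A" "(t, y) \<in> cofun_arrows C D F"
      "dm D (arr_map F (s, x)) = dm D (arr_map F (t, y))"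
      by (auto simp add: cofun_image_def)
    then have xy: "x = y" using arr_map_facts(2) by metis
    then have "dm C s = dm C t" using st by (simp add: in_cofun_arrows)
    then show "b = c" using st xy compact_slice_inj[OF assms] by metis
  qed
  then show ?thesis using F assms by (simp add: is_cofunctor_def compact_slice_def is_slice_def)
qed

text \<open>The morphism is \<open>cofun_image C D F\<close> pulled back along
  \<open>\<epsilon>\<close>. The assumption \<open>closed\<close> says that images stay among the
  represented slices of \<open>D\<close>; for bislices this is where injectivity of the action
  enters.\<close>

lemma morphism_of_cofunctor:
  assumes closed: "\<And>s. s \<in> carrier S \<Longrightarrow> cofun_image C D F (\<delta> s) \<in> \<epsilon> ` carrier T"
  obtains \<phi> where "sgp_morphism S T \<phi>" "corr \<phi> F"
proof -
  define \<phi> where "\<phi> = restrict (\<lambda>s. inv_into (carrier T) \<epsilon> (cofun_image C D F (\<delta> s))) (carrier S)"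
  have \<phi>c: "\<phi> s \<in> carrier T" and \<epsilon>\<phi>: "\<epsilon> (\<phi> s) = cofun_image C D F (\<delta> s)" if "s \<in> carrier S" for s
    using closed[OF that] that by (auto simp add: \<phi>_def inv_into_into f_inv_into_f)
  have mult: "\<phi> (mult S s t) = mult T (\<phi> s) (\<phi> t)" if "s \<in> carrier S" "t \<in> carrier S" for s t
    by (rule Y.rep_eqI) (simp_all add: that \<phi>c \<epsilon>\<phi> X.mult_closed Y.mult_closed X.rep_mult Y.rep_mult
        cofun_image_prod X.rep_subset)
  have star: "\<phi> (star S s) = star T (\<phi> s)" if "s \<in> carrier S" for s
    by (rule Y.rep_eqI) (simp_all add: that \<phi>c \<epsilon>\<phi> X.star_closed Y.star_closed X.rep_star Y.rep_star
        cofun_image_un dm_cofun_image X.rep_subset X.dm_rep_subset)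
  have proj: "\<phi> e \<in> projections T" if "e \<in> projections S" for e
    using that star X.projection_star X.projection_carrier \<phi>c by (metis imageI projections_def)
  have pc: "\<And>e. e \<in> projections S \<Longrightarrow> e \<in> carrier S" "\<And>e. e \<in> projections T \<Longrightarrow> e \<in> carrier T"
    using X.projection_carrier Y.projection_carrier by auto
  have zero: "\<phi> (zero_of S) = zero_of T"
    by (rule Y.rep_eqI)
      (use \<phi>c \<epsilon>\<phi> X.zero_of Y.zero_of pc in \<open>simp_all add: cofun_image_def\<close>)
  have join: "\<phi> (join_on (projections S) (le S) e f) = join_on (projections T) (le T) (\<phi> e) (\<phi> f)"
    if "e \<in> projections S" "f \<in> projections S" for e f
  proof (rule Y.rep_eqI)
    note j = X.join_projections[OF that] Y.join_projections[OF proj[OF that(1)] proj[OF that(2)]]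
    show "\<phi> (join_on (projections S) (le S) e f) \<in> carrier T"
      "join_on (projections T) (le T) (\<phi> e) (\<phi> f) \<in> carrier T"
      using j \<phi>c pc by auto
    show "\<epsilon> (\<phi> (join_on (projections S) (le S) e f)) = \<epsilon> (join_on (projections T) (le T) (\<phi> e) (\<phi> f))"
      using j \<epsilon>\<phi> pc that by (auto simp add: cofun_image_def)
  qed
  have meet: "\<phi> (meet_on (projections S) (le S) e f) = meet_on (projections T) (le T) (\<phi> e) (\<phi> f)"
    if "e \<in> projections S" "f \<in> projections S" for e f
    using that by (simp add: X.meet_projections Y.meet_projections proj mult pc)
  \<comment> \<open>The anchors of the objects in \<open>q\<close> form a compact set, being a
    continuous image; the projection over a compact open set containing them has an image above
    \<open>q\<close>.\<close>
  have proper: "\<exists>p\<in>projections S. le T q (\<phi> p)" if q: "q \<in> projections T" for q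
  proof -
    have K: "compactin (C0 C) (anchor F ` dm D ` \<epsilon> q)"
    proof (rule image_compactin)
      show "compactin (C0 D) (dm D ` \<epsilon> q)"
        using Y.compact_open_dm_rep[OF pc(2)[OF q]] by (simp add: compact_open_def)
      show "continuous_map (C0 D) (C0 C) (anchor F)"
        using F by (simp add: is_cofunctor_def is_action_def)
    qed
    obtain U where U: "compact_open (C0 C) U" "anchor F ` dm D ` \<epsilon> q \<subseteq> U"
      using X.compact_open_cover[OF K] .
    obtain p where p: "p \<in> projections S" "\<delta> p = un C ` U" using X.projection_exists[OF U(1)] .
    have img: "\<epsilon> (\<phi> p) = un D ` {x \<in> Y.Ob. anchor F x \<in> U}"
      using p \<epsilon>\<phi>[OF pc(1)[OF p(1)]] cofun_image_un compact_open_subset[OF U(1)] by simp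
    have "dm D ` \<epsilon> q \<subseteq> {x \<in> Y.Ob. anchor F x \<in> U}"
      using U(2) Y.dm_rep_subset[OF pc(2)[OF q]] by blast
    then have "un D ` dm D ` \<epsilon> q \<subseteq> \<epsilon> (\<phi> p)" unfolding img by (rule image_mono)
    then have "\<epsilon> q \<subseteq> \<epsilon> (\<phi> p)" unfolding Y.rep_projection[OF q, symmetric] .
    then show ?thesis using p Y.le_iff pc q \<phi>c by blast
  qed
  have "gba_morphism (projections S) (le S) (zero_of S) (projections T) (le T) (zero_of T) \<phi>"
    unfolding gba_morphism_def using proj zero join meet by blast
  moreover have "\<phi> \<in> carrier S \<rightarrow>\<^sub>E carrier T" using \<phi>c by (auto simp add: \<phi>_def)
  ultimately have "sgp_morphism S T \<phi>"
    unfolding sgp_morphism_def using mult star proper by blast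
  moreover have "corr \<phi> F" using \<epsilon>\<phi> by (simp add: corr_def)
  ultimately show ?thesis using that by blast
qed

end

lemma corr_unique:
  assumes "\<phi> \<in> carrier S \<rightarrow>\<^sub>E carrier T" "\<psi> \<in> carrier S \<rightarrow>\<^sub>E carrier T" "corr \<phi> F" "corr \<psi> F"
  shows "\<phi> = \<psi>"
proof (rule PiE_ext[OF assms(1,2)])
  fix s assume s: "s \<in> carrier S"
  show "\<phi> s = \<psi> s"
    by (rule Y.rep_eqI) (use assms s in \<open>auto simp add: corr_def\<close>)
qed

lemma cofunctor_realizes:
  assumes F: "is_cofunctor C D F" and \<phi>: "corr \<phi> F"
  shows "realizes C S \<delta> D \<epsilon> \<phi> F"
proof -
  have "arr_map F (s, x) \<in> \<epsilon> (\<phi> a)" if "(s, x) \<in> cofun_arrows C D F" "a \<in> carrier S" "s \<in> \<delta> a" for s x a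
    using cofun_imageI[OF F that(3,1)] \<phi> that(2) by (simp add: corr_def)
  moreover have "act F \<in> extensional (cofun_arrows C D F)" "anchor F \<in> extensional (topspace (C0 D))"
    "arr_map F \<in> extensional (cofun_arrows C D F)" "obj_map F \<in> extensional (topspace (C0 D))"
    "\<forall>x\<in>topspace (C0 D). obj_map F x = x"
    using F by (simp_all add: is_cofunctor_def)
  ultimately show ?thesis
    unfolding realizes_def using anchor_in[OF F] arr_map_facts[OF F] by simp
qed

end

subsection \<open>From morphisms to cofunctors\<close>

context representation
begin

lemma un_projection_iff:
  assumes "e \<in> projections S" "x \<in> Ob"
  shows "un C x \<in> \<delta> e \<longleftrightarrow> x \<in> dm C ` \<delta> e"
proof
  show "x \<in> dm C ` \<delta> e" if "un C x \<in> \<delta> e" using that assms(2) by (metis dm_un image_eqI)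
  show "un C x \<in> \<delta> e" if "x \<in> dm C ` \<delta> e" using that rep_projection[OF assms(1)] by blast
qed

lemma un_star_iff:
  assumes "s \<in> carrier S" "x \<in> Ob"
  shows "un C x \<in> \<delta> (star S s) \<longleftrightarrow> x \<in> dm C ` \<delta> s"
  using assms un_projection_iff[of "star S s" x] dm_rep_subset[OF assms(1)]
  by (auto simp add: rep_star projections_def)

lemma projection_separation:
  assumes "x \<in> Ob" "y \<in> Ob" "\<And>e. e \<in> projections S \<Longrightarrow> un C x \<in> \<delta> e \<Longrightarrow> un C y \<in> \<delta> e"
  shows "x = y"
proof (rule separation_eq[OF assms(1,2)])
  fix U assume U: "compact_open (C0 C) U" "x \<in> U"
  obtain e where e: "e \<in> projections S" "\<delta> e = un C ` U" "dm C ` \<delta> e = U"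
    using projection_exists[OF U(1)] .
  then show "y \<in> U" using assms(3)[OF e(1)] U(2) un_projection_iff[OF e(1) assms(2)] by auto
qed

lemma unit_in_projection:
  assumes "x \<in> Ob"
  obtains e where "e \<in> projections S" "un C x \<in> \<delta> e"
proof -
  obtain U where U: "compact_open (C0 C) U" "x \<in> U" using compact_open_nbhd[of Ob x] assms by auto
  obtain e where "e \<in> projections S" "\<delta> e = un C ` U" "dm C ` \<delta> e = U" using projection_exists[OF U(1)] .
  then show ?thesis using that U by auto
qed

end

context representation_pair
begin

context
  fixes \<phi> :: "'a \<Rightarrow> 'b"
  assumes \<phi>: "sgp_morphism S T \<phi>"
begin

lemma mor_in: "s \<in> carrier S \<Longrightarrow> \<phi> s \<in> carrier T"
  using \<phi> by (auto simp add: sgp_morphism_def)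

lemma mor_mult: "s \<in> carrier S \<Longrightarrow> t \<in> carrier S \<Longrightarrow> \<epsilon> (\<phi> (mult S s t)) = slice_prod D (\<epsilon> (\<phi> s)) (\<epsilon> (\<phi> t))"
  using \<phi> Y.rep_mult mor_in by (simp add: sgp_morphism_def)

lemma mor_star: "s \<in> carrier S \<Longrightarrow> \<phi> (star S s) = star T (\<phi> s)"
  using \<phi> by (simp add: sgp_morphism_def)

lemma mor_proj: "e \<in> projections S \<Longrightarrow> \<phi> e \<in> projections T"
  using \<phi> by (auto simp add: sgp_morphism_def gba_morphism_def)

lemma mor_Un:
  assumes "e \<in> projections S" "f \<in> projections S" "g \<in> carrier S" "\<delta> g = \<delta> e \<union> \<delta> f"
  shows "\<epsilon> (\<phi> g) = \<epsilon> (\<phi> e) \<union> \<epsilon> (\<phi> f)"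
proof -
  have "g = join_on (projections S) (le S) e f"
    using X.join_projections[OF assms(1,2)] assms X.projection_carrier by (intro X.rep_eqI) auto
  then have "\<phi> g = join_on (projections T) (le T) (\<phi> e) (\<phi> f)"
    using \<phi> assms(1,2) by (simp add: sgp_morphism_def gba_morphism_def)
  then show ?thesis using Y.join_projections mor_proj assms by simp
qed

lemma mor_empty: "z \<in> carrier S \<Longrightarrow> \<delta> z = {} \<Longrightarrow> \<epsilon> (\<phi> z) = {}"
  using X.zero_of X.rep_eqI[of z "zero_of S"] X.projection_carrier Y.zero_of(2) \<phi>
  by (auto simp add: sgp_morphism_def gba_morphism_def)

lemma mor_mono:
  assumes "s \<in> carrier S" "t \<in> carrier S" "\<delta> s \<subseteq> \<delta> t"
  shows "\<epsilon> (\<phi> s) \<subseteq> \<epsilon> (\<phi> t)"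
proof -
  have "s = mult S t (star S s)" using assms X.le_iff by (simp add: le_def)
  then have "\<phi> s = mult T (\<phi> t) (star T (\<phi> s))"
    using \<phi> assms X.star_closed unfolding sgp_morphism_def by metis
  then show ?thesis using Y.le_iff mor_in assms by (simp add: le_def)
qed

lemma mor_disjoint:
  assumes "e \<in> projections S" "f \<in> projections S" "\<delta> e \<inter> \<delta> f = {}"
  shows "\<epsilon> (\<phi> e) \<inter> \<epsilon> (\<phi> f) = {}"
proof -
  have c: "e \<in> carrier S" "f \<in> carrier S" using assms X.projection_carrier by auto
  have "\<epsilon> (\<phi> e) \<inter> \<epsilon> (\<phi> f) = \<epsilon> (\<phi> (mult S e f))"
    using Y.projection_mult(2) mor_proj assms(1,2) \<phi> c by (simp add: sgp_morphism_def)
  then show ?thesis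
    using mor_empty X.projection_mult[OF assms(1,2)] assms(3) X.projection_carrier by simp
qed

section \<open>Points and arrows determined by a morphism\<close>

lemma mor_cover:
  assumes "x \<in> Y.Ob"
  obtains e where "e \<in> projections S" "un D x \<in> \<epsilon> (\<phi> e)"
proof -
  obtain q where q: "q \<in> projections T" "un D x \<in> \<epsilon> q" using Y.unit_in_projection[OF assms] .
  obtain p where p: "p \<in> projections S" "le T q (\<phi> p)" using \<phi> q by (auto simp add: sgp_morphism_def)
  then have "\<epsilon> q \<subseteq> \<epsilon> (\<phi> p)" using Y.le_iff Y.projection_carrier mor_proj q(1) by blast
  then show ?thesis using that p q by blast
qed

text \<open>If no point worked, each point of a projection \<open>e0\<close> whose image contains
  \<open>un D x\<close> would lie in a member of \<open>G\<close>, a projection whose image misses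
  \<open>un D x\<close>. By compactness finitely many of these cover \<open>e0\<close>. Their join
  is again in \<open>G\<close> because \<open>\<phi>\<close> preserves joins, so the image of
  \<open>e0\<close> would miss \<open>un D x\<close> after all.\<close>

lemma point_exists:
  assumes x: "x \<in> Y.Ob"
  shows "\<exists>y\<in>X.Ob. \<forall>e\<in>projections S. un C y \<in> \<delta> e \<longleftrightarrow> un D x \<in> \<epsilon> (\<phi> e)"
proof (rule ccontr)
  assume neg: "\<not> ?thesis"
  define G where "G = {g \<in> projections S. un D x \<notin> \<epsilon> (\<phi> g)}"
  obtain e0 where e0: "e0 \<in> projections S" "un D x \<in> \<epsilon> (\<phi> e0)" using mor_cover[OF x] .
  have e0c: "e0 \<in> carrier S" using e0 X.projection_carrier by blast
  have cov: "\<exists>V\<in>\<delta> ` G. openin (C1 C) V \<and> a \<in> V" if a: "a \<in> \<delta> e0" for a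
  proof -
    have "a \<in> un C ` dm C ` \<delta> e0" using X.rep_projection[OF e0(1)] a by simp
    then obtain y where y: "a = un C y" "y \<in> X.Ob" using X.dm_rep_subset[OF e0c] by blast
    obtain e where e: "e \<in> projections S" "(un C y \<in> \<delta> e) \<noteq> (un D x \<in> \<epsilon> (\<phi> e))"
      using neg y(2) by blast
    have "\<exists>g\<in>G. a \<in> \<delta> g"
    proof (cases "un C y \<in> \<delta> e")
      case True
      then show ?thesis using e y by (auto simp add: G_def)
    next
      case False
      \<comment> \<open>Here \<open>y\<close> lies outside \<open>e\<close> although
        \<open>x\<close> lies in the image of \<open>e\<close>. The difference of \<open>e0\<close>
        and \<open>e\<close> contains \<open>y\<close>, and its image is disjoint from that of
        \<open>e\<close>.\<close>
      obtain g where g: "g \<in> projections S" "\<delta> g = \<delta> e0 - \<delta> e" using X.projection_Diff[OF e0(1) e(1)] .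
      have "\<epsilon> (\<phi> e) \<inter> \<epsilon> (\<phi> g) = {}" using mor_disjoint[OF e(1) g(1)] g(2) by blast
      then have "g \<in> G" using False e(2) g(1) by (auto simp add: G_def)
      then show ?thesis using False a y g by auto
    qed
    then show ?thesis
      using X.slice X.projection_carrier by (auto simp add: G_def compact_slice_def is_slice_def)
  qed
  have "compactin (C1 C) (\<delta> e0)" using X.slice[OF e0c] by (simp add: compact_slice_def)
  then obtain \<F> where \<F>: "finite \<F>" "\<F> \<subseteq> \<delta> ` G" "\<delta> e0 \<subseteq> \<Union>\<F>"
    using compactin_finite_cover[of "C1 C" "\<delta> e0" "\<delta> ` G"] cov by blast
  have "\<exists>h\<in>G. \<delta> h = \<Union>\<F>" using \<F>(1,2)
  proof (induction rule: finite_induct)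
    case empty
    have "zero_of S \<in> G" using X.zero_of mor_empty X.projection_carrier by (auto simp add: G_def)
    then show ?case using X.zero_of by auto
  next
    case (insert V \<F>)
    then obtain g h where gh: "g \<in> G" "\<delta> g = V" "h \<in> G" "\<delta> h = \<Union>\<F>" by blast
    then have p: "g \<in> projections S" "h \<in> projections S" by (simp_all add: G_def)
    obtain k where k: "k \<in> projections S" "\<delta> k = \<delta> g \<union> \<delta> h" using X.projection_Un[OF p] .
    have "\<epsilon> (\<phi> k) = \<epsilon> (\<phi> g) \<union> \<epsilon> (\<phi> h)" using mor_Un[OF p X.projection_carrier[OF k(1)] k(2)] .
    then have "k \<in> G" using gh k by (simp add: G_def)
    then show ?case using k gh by auto
  qed
  then obtain h where h: "h \<in> G" "\<delta> e0 \<subseteq> \<delta> h" using \<F>(3) by auto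
  then have "\<epsilon> (\<phi> e0) \<subseteq> \<epsilon> (\<phi> h)"
    using mor_mono e0c X.projection_carrier by (simp add: G_def)
  then show False using h e0 by (auto simp add: G_def)
qed

text \<open>The image of each represented slice around \<open>s\<close> offers one arrow with domain
  \<open>x\<close>. Two such slices offer the same arrow: a third one inside their intersection has
  its image inside both images, and a slice holds at most one arrow with domain
  \<open>x\<close>.\<close>

lemma arrow_exists:
  assumes s: "s \<in> X.Arr" and x: "x \<in> Y.Ob"
    and p: "\<forall>e\<in>projections S. un C (dm C s) \<in> \<delta> e \<longleftrightarrow> un D x \<in> \<epsilon> (\<phi> e)"
  shows "\<exists>b. dm D b = x \<and> (\<forall>a\<in>carrier S. s \<in> \<delta> a \<longrightarrow> b \<in> \<epsilon> (\<phi> a))"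
proof -
  have ex: "\<exists>b\<in>\<epsilon> (\<phi> a). dm D b = x" if a: "a \<in> carrier S" "s \<in> \<delta> a" for a
  proof -
    have "un C (dm C s) \<in> \<delta> (star S a)" using a by (auto simp add: X.rep_star)
    moreover have "star S a \<in> projections S" using a by (simp add: projections_def)
    ultimately have "un D x \<in> \<epsilon> (star T (\<phi> a))" using p mor_star a by simp
    then have "x \<in> dm D ` \<epsilon> (\<phi> a)" using Y.un_star_iff x a mor_in by simp
    then show ?thesis by blast
  qed
  obtain a0 where a0: "a0 \<in> carrier S" "s \<in> \<delta> a0" using X.basis[of X.Arr s] s by auto
  obtain b where b: "b \<in> \<epsilon> (\<phi> a0)" "dm D b = x" using ex[OF a0] by blast
  have "b \<in> \<epsilon> (\<phi> a)" if a: "a \<in> carrier S" "s \<in> \<delta> a" for a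
  proof -
    have "openin (C1 C) (\<delta> a \<inter> \<delta> a0)"
      using X.slice a a0 by (auto simp add: compact_slice_def is_slice_def)
    then obtain c where c: "c \<in> carrier S" "s \<in> \<delta> c" "\<delta> c \<subseteq> \<delta> a \<inter> \<delta> a0"
      using X.basis[of "\<delta> a \<inter> \<delta> a0" s] a a0 by blast
    obtain b' where b': "b' \<in> \<epsilon> (\<phi> c)" "dm D b' = x" using ex[OF c(1,2)] by blast
    have "b' \<in> \<epsilon> (\<phi> a0)" "b' \<in> \<epsilon> (\<phi> a)" using b' mor_mono c a a0 by blast+
    then show ?thesis using Y.rep_inj[OF mor_in[OF a0(1)]] b b' by metis
  qed
  then show ?thesis using b by blast
qed

lemma realizing_exists: "\<exists>F. realizes C S \<delta> D \<epsilon> \<phi> F"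
proof -
  obtain f where f: "\<And>x. x \<in> Y.Ob \<Longrightarrow> f x \<in> X.Ob"
    "\<And>x. x \<in> Y.Ob \<Longrightarrow> \<forall>e\<in>projections S. un C (f x) \<in> \<delta> e \<longleftrightarrow> un D x \<in> \<epsilon> (\<phi> e)"
    using point_exists by metis
  have "\<forall>s x. \<exists>b. s \<in> X.Arr \<longrightarrow> x \<in> Y.Ob \<longrightarrow> dm C s = f x \<longrightarrow>
      dm D b = x \<and> (\<forall>a\<in>carrier S. s \<in> \<delta> a \<longrightarrow> b \<in> \<epsilon> (\<phi> a))"
    using arrow_exists f(2) by metis
  then obtain r where r: "\<And>s x. s \<in> X.Arr \<Longrightarrow> x \<in> Y.Ob \<Longrightarrow> dm C s = f x \<Longrightarrow>
      dm D (r s x) = x \<and> (\<forall>a\<in>carrier S. s \<in> \<delta> a \<longrightarrow> r s x \<in> \<epsilon> (\<phi> a))"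
    by metis
  define f' where "f' = restrict f Y.Ob"
  define P where "P = pullback_set C (C0 D) f'"
  define F where "F = \<lparr>act = restrict (\<lambda>(s, x). rg D (r s x)) P, anchor = f',
    arr_map = restrict (\<lambda>(s, x). r s x) P, obj_map = restrict (\<lambda>x. x) Y.Ob\<rparr>"
  have P: "(s, x) \<in> P \<Longrightarrow> s \<in> X.Arr \<and> x \<in> Y.Ob \<and> dm C s = f x" for s x
    by (simp add: P_def pullback_set_def f'_def)
  have "f' \<in> extensional Y.Ob" "\<And>x. x \<in> Y.Ob \<Longrightarrow> f' x \<in> X.Ob" using f(1) by (simp_all add: f'_def)
  then have "realizes C S \<delta> D \<epsilon> \<phi> F"
    unfolding realizes_def using r P by (auto simp add: F_def f'_def simp flip: P_def f'_def)
  then show ?thesis by blast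
qed

section \<open>Cofunctors realizing a given morphism\<close>

context
  fixes F :: "('c, 'o, 'd, 'p) cofun"
  assumes F: "realizes C S \<delta> D \<epsilon> \<phi> F"
begin

text \<open>\<open>realizes\<close> gives one implication, for all projections at once. The converse
  follows from a complement: a projection around the anchor that misses \<open>e\<close> has an
  image disjoint from that of \<open>e\<close>.\<close>

lemma anchor_iff:
  assumes x: "x \<in> Y.Ob" and e: "e \<in> projections S"
  shows "un C (anchor F x) \<in> \<delta> e \<longleftrightarrow> un D x \<in> \<epsilon> (\<phi> e)"
proof -
  have f: "anchor F x \<in> X.Ob" using F x by (simp add: realizes_def)
  then have P: "(un C (anchor F x), x) \<in> cofun_arrows C D F"
    using x X.un_in by (simp add: in_cofun_arrows)
  have imp: "un D x \<in> \<epsilon> (\<phi> e)" if e: "e \<in> projections S" "un C (anchor F x) \<in> \<delta> e" for e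
  proof -
    have "dm D (arr_map F (un C (anchor F x), x)) = x" "arr_map F (un C (anchor F x), x) \<in> \<epsilon> (\<phi> e)"
      using F P e X.projection_carrier unfolding realizes_def by blast+
    then have "x \<in> dm D ` \<epsilon> (\<phi> e)" by (metis image_eqI)
    then show ?thesis using Y.un_projection_iff[OF mor_proj[OF e(1)] x] by simp
  qed
  show ?thesis
  proof
    show "un D x \<in> \<epsilon> (\<phi> e)" if "un C (anchor F x) \<in> \<delta> e" using imp e that .
    show "un C (anchor F x) \<in> \<delta> e" if "un D x \<in> \<epsilon> (\<phi> e)"
    proof (rule ccontr)
      assume n: "un C (anchor F x) \<notin> \<delta> e"
      obtain e' where e': "e' \<in> projections S" "un C (anchor F x) \<in> \<delta> e'"
        using X.unit_in_projection[OF f] .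
      obtain g where g: "g \<in> projections S" "\<delta> g = \<delta> e' - \<delta> e" using X.projection_Diff[OF e'(1) e] .
      then have "un D x \<in> \<epsilon> (\<phi> g)" using imp e' n by simp
      moreover have "\<epsilon> (\<phi> g) \<inter> \<epsilon> (\<phi> e) = {}" using mor_disjoint[OF g(1) e] g(2) by blast
      ultimately show False using that by blast
    qed
  qed
qed

lemma realized:
  assumes "(s, x) \<in> cofun_arrows C D F"
  shows "s \<in> X.Arr" "x \<in> Y.Ob" "dm C s = anchor F x"
    "dm D (arr_map F (s, x)) = x" "act F (s, x) = rg D (arr_map F (s, x))" "arr_map F (s, x) \<in> Y.Arr"
    "\<And>a. a \<in> carrier S \<Longrightarrow> s \<in> \<delta> a \<Longrightarrow> arr_map F (s, x) \<in> \<epsilon> (\<phi> a)"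
proof -
  show 1: "s \<in> X.Arr" "x \<in> Y.Ob" "dm C s = anchor F x" using assms by (simp_all add: in_cofun_arrows)
  show 2: "dm D (arr_map F (s, x)) = x" "act F (s, x) = rg D (arr_map F (s, x))"
    "\<And>a. a \<in> carrier S \<Longrightarrow> s \<in> \<delta> a \<Longrightarrow> arr_map F (s, x) \<in> \<epsilon> (\<phi> a)"
    using F assms unfolding realizes_def by blast+
  obtain a where a: "a \<in> carrier S" "s \<in> \<delta> a" using X.basis[of X.Arr s] 1 by auto
  show "arr_map F (s, x) \<in> Y.Arr"
    using Y.rep_subset[OF mor_in[OF a(1)]] 2(3)[OF a] by blast
qed

text \<open>By \<open>anchor_iff\<close> the anchor of \<open>dm D b\<close> is the domain of some
  \<open>s\<close> in \<open>\<delta> a\<close>; then \<open>b\<close> and the image of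
  \<open>s\<close> are arrows of one slice with the same domain. So \<open>realizes\<close>, which
  speaks of single arrows, already determines whole images.\<close>

lemma realizing_surj:
  assumes a: "a \<in> carrier S" and b: "b \<in> \<epsilon> (\<phi> a)"
  obtains s where "s \<in> \<delta> a" "(s, dm D b) \<in> cofun_arrows C D F" "arr_map F (s, dm D b) = b"
proof -
  have x: "dm D b \<in> Y.Ob" using Y.dm_rep_subset[OF mor_in[OF a]] b by blast
  have "un D (dm D b) \<in> \<epsilon> (\<phi> (star S a))" using b a mor_star mor_in by (simp add: Y.rep_star)
  moreover have "star S a \<in> projections S" using a by (simp add: projections_def)
  ultimately have "un C (anchor F (dm D b)) \<in> \<delta> (star S a)" using anchor_iff x by blast
  moreover have "anchor F (dm D b) \<in> X.Ob" using F x by (simp add: realizes_def)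
  ultimately obtain s where s: "s \<in> \<delta> a" "dm C s = anchor F (dm D b)"
    using X.un_star_iff[OF a] by auto
  then have P: "(s, dm D b) \<in> cofun_arrows C D F" using x X.rep_subset[OF a] by (auto simp add: in_cofun_arrows)
  have "arr_map F (s, dm D b) = b"
    using Y.rep_inj[OF mor_in[OF a] realized(7)[OF P a s(1)] b] realized(4)[OF P] by simp
  then show ?thesis using that s P by blast
qed

lemma realizing_corr: "corr \<phi> F"
  unfolding corr_def
proof (intro ballI equalityI subsetI)
  fix a b assume a: "a \<in> carrier S" and b: "b \<in> \<epsilon> (\<phi> a)"
  obtain s where "s \<in> \<delta> a" "(s, dm D b) \<in> cofun_arrows C D F" "arr_map F (s, dm D b) = b"
    using realizing_surj[OF a b] .
  then show "b \<in> cofun_image C D F (\<delta> a)"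
    unfolding cofun_image_def by (intro CollectI exI[of _ s] exI[of _ "dm D b"]) simp
next
  fix a b assume a: "a \<in> carrier S" and b: "b \<in> cofun_image C D F (\<delta> a)"
  then show "b \<in> \<epsilon> (\<phi> a)" using realized(7) by (auto simp add: cofun_image_def)
qed

text \<open>If a projection \<open>e\<close> contains \<open>rg C t\<close>, then \<open>t\<close>
  lies in the product of \<open>e\<close> and a slice \<open>a\<close> around \<open>t\<close>, so
  the image of \<open>t\<close> lies in the product of the images and ends in that of
  \<open>e\<close>. Thus the anchor of \<open>act F (t, x)\<close> lies in every \<open>e\<close>
  around \<open>rg C t\<close>, and projections separate points.\<close>

lemma anchor_act:
  assumes P: "(t, x) \<in> cofun_arrows C D F"
  shows "act F (t, x) \<in> Y.Ob" "anchor F (act F (t, x)) = rg C t"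
proof -
  note t = realized[OF P]
  show 1: "act F (t, x) \<in> Y.Ob" using t Y.rg_in by simp
  obtain a where a: "a \<in> carrier S" "t \<in> \<delta> a" using X.basis[of X.Arr t] t by auto
  have "rg C t = anchor F (act F (t, x))"
  proof (rule X.projection_separation)
    show "rg C t \<in> X.Ob" using t X.rg_in by simp
    show "anchor F (act F (t, x)) \<in> X.Ob" using 1 F by (simp add: realizes_def)
    fix e assume e: "e \<in> projections S" "un C (rg C t) \<in> \<delta> e"
    then have ec: "e \<in> carrier S" using X.projection_carrier by blast
    have "mu C (un C (rg C t)) t \<in> slice_prod C (\<delta> e) (\<delta> a)"
      unfolding slice_prod_def using e(2) a(2) X.dm_un[OF X.rg_in[OF t(1)]]
      by (intro CollectI exI[of _ "un C (rg C t)"] exI[of _ t]) simp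
    then have "t \<in> \<delta> (mult S e a)" using t(1) ec a X.rep_mult by simp
    then have "arr_map F (t, x) \<in> slice_prod D (\<epsilon> (\<phi> e)) (\<epsilon> (\<phi> a))"
      using t(7)[OF X.mult_closed[OF ec a(1)]] mor_mult ec a by simp
    then obtain c d where cd: "arr_map F (t, x) = mu D c d" "c \<in> \<epsilon> (\<phi> e)" "d \<in> \<epsilon> (\<phi> a)" "rg D d = dm D c"
      by (auto simp add: slice_prod_def)
    have "c \<in> un D ` dm D ` \<epsilon> (\<phi> e)" using Y.rep_projection[OF mor_proj[OF e(1)]] cd(2) by simp
    then obtain y where y: "c = un D y" "y \<in> Y.Ob"
      using Y.dm_rep_subset[OF mor_in[OF ec]] by blast
    have "rg D (mu D c d) = rg D c"
      using cd Y.rep_subset[OF mor_in[OF ec]] Y.rep_subset[OF mor_in[OF a(1)]] by (intro Y.rg_mu) auto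
    then have "act F (t, x) = y" using t(5) cd(1) y by simp
    then have "un D (act F (t, x)) \<in> \<epsilon> (\<phi> e)" using y cd(2) by simp
    then show "un C (anchor F (act F (t, x))) \<in> \<delta> e" using anchor_iff[OF 1 e(1)] by simp
  qed
  then show "anchor F (act F (t, x)) = rg C t" by simp
qed

text \<open>The image of \<open>mu C s t\<close> lies in the product of the images of two slices.
  Its right factor has domain \<open>x\<close> and its left factor has domain
  \<open>act F (t, x)\<close>; within these slices only the images of \<open>t\<close> and
  \<open>s\<close> qualify.\<close>

lemma arr_map_mult:
  assumes P: "(t, x) \<in> cofun_arrows C D F" and s: "(s, act F (t, x)) \<in> cofun_arrows C D F"
  shows "(mu C s t, x) \<in> cofun_arrows C D F"
    "arr_map F (mu C s t, x) = mu D (arr_map F (s, act F (t, x))) (arr_map F (t, x))"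
proof -
  note t = realized[OF P] and s' = realized[OF s]
  have r: "rg C t = dm C s" using s'(3) anchor_act[OF P] by simp
  show m: "(mu C s t, x) \<in> cofun_arrows C D F"
    using t s' r X.mu_in by (simp add: in_cofun_arrows)
  obtain a where a: "a \<in> carrier S" "s \<in> \<delta> a" using X.basis[of X.Arr s] s' by auto
  obtain b where b: "b \<in> carrier S" "t \<in> \<delta> b" using X.basis[of X.Arr t] t by auto
  have "mu C s t \<in> \<delta> (mult S a b)" using a b r by (auto simp add: X.rep_mult slice_prod_def)
  then have "arr_map F (mu C s t, x) \<in> slice_prod D (\<epsilon> (\<phi> a)) (\<epsilon> (\<phi> b))"
    using realized(7)[OF m X.mult_closed[OF a(1) b(1)]] mor_mult a b by simp
  then obtain c d where cd: "arr_map F (mu C s t, x) = mu D c d" "c \<in> \<epsilon> (\<phi> a)" "d \<in> \<epsilon> (\<phi> b)" "rg D d = dm D c"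
    by (auto simp add: slice_prod_def)
  have arr: "c \<in> Y.Arr" "d \<in> Y.Arr" using cd Y.rep_subset mor_in a b by blast+
  have "dm D d = x" using Y.dm_mu[OF arr cd(4)] cd(1) realized(4)[OF m] by simp
  then have d: "d = arr_map F (t, x)"
    using Y.rep_inj[OF mor_in[OF b(1)] cd(3) t(7)[OF b]] t(4) by simp
  then have "dm D c = act F (t, x)" using cd(4) t(5) by simp
  then have "c = arr_map F (s, act F (t, x))"
    using Y.rep_inj[OF mor_in[OF a(1)] cd(2) s'(7)[OF a]] s'(4) by simp
  then show "arr_map F (mu C s t, x) = mu D (arr_map F (s, act F (t, x))) (arr_map F (t, x))"
    using cd(1) d by simp
qed

lemma arr_map_unit:
  assumes x: "x \<in> Y.Ob"
  shows "arr_map F (un C (anchor F x), x) = un D x"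
proof -
  have f: "anchor F x \<in> X.Ob" using F x by (simp add: realizes_def)
  then have P: "(un C (anchor F x), x) \<in> cofun_arrows C D F"
    using x X.un_in by (simp add: in_cofun_arrows)
  obtain e where e: "e \<in> projections S" "un C (anchor F x) \<in> \<delta> e" using X.unit_in_projection[OF f] .
  have "un D x \<in> \<epsilon> (\<phi> e)" using anchor_iff[OF x e(1)] e(2) by simp
  moreover have "e \<in> carrier S" using e X.projection_carrier by blast
  ultimately show ?thesis
    using Y.rep_inj[OF mor_in] realized(7)[OF P _ e(2)] realized(4)[OF P] x Y.dm_un by metis
qed

text \<open>While \<open>t\<close> stays in a slice \<open>\<delta> a\<close> around
  \<open>s\<close>, the image of \<open>(t, y)\<close> is the arrow of the slice
  \<open>\<epsilon> (\<phi> a)\<close> with domain \<open>y\<close>. It depends on \<open>y\<close>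
  alone and stays in \<open>\<epsilon> v\<close> as long as \<open>y\<close> is a domain of
  \<open>\<epsilon> v\<close>.\<close>

lemma continuous_arr_map: "continuous_map (pullback_top C (C0 D) (anchor F)) (C1 D) (arr_map F)"
  unfolding continuous_map_def
proof (intro conjI allI impI)
  let ?P = "cofun_arrows C D F"
  show "arr_map F \<in> topspace (pullback_top C (C0 D) (anchor F)) \<rightarrow> Y.Arr"
    using realized(6) by auto
  fix W assume W: "openin (C1 D) W"
  show "openin (pullback_top C (C0 D) (anchor F))
      {p \<in> topspace (pullback_top C (C0 D) (anchor F)). arr_map F p \<in> W}"
  proof (subst openin_subopen, intro ballI)
    fix p assume "p \<in> {p \<in> topspace (pullback_top C (C0 D) (anchor F)). arr_map F p \<in> W}"
    then obtain s x where p: "p = (s, x)" "(s, x) \<in> ?P" "arr_map F (s, x) \<in> W" by (cases p) auto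
    note sx = realized[OF p(2)]
    obtain a where a: "a \<in> carrier S" "s \<in> \<delta> a" using X.basis[of X.Arr s] sx by auto
    have "openin (C1 D) (W \<inter> \<epsilon> (\<phi> a))"
      using W Y.slice mor_in a by (auto simp add: compact_slice_def is_slice_def)
    then obtain v where v: "v \<in> carrier T" "arr_map F (s, x) \<in> \<epsilon> v" "\<epsilon> v \<subseteq> W \<inter> \<epsilon> (\<phi> a)"
      using Y.basis[of "W \<inter> \<epsilon> (\<phi> a)"] p(3) sx(7)[OF a] by blast
    let ?N = "(\<delta> a \<times> dm D ` \<epsilon> v) \<inter> ?P"
    have "openin (prod_topology (C1 C) (C0 D)) (\<delta> a \<times> dm D ` \<epsilon> v)"
      using X.slice[OF a(1)] Y.compact_open_dm_rep[OF v(1)]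
      by (auto simp add: openin_prod_Times_iff compact_slice_def is_slice_def compact_open_def)
    then have "openin (pullback_top C (C0 D) (anchor F)) ?N"
      unfolding pullback_top_def openin_subtopology by blast
    moreover have "p \<in> ?N" using p a v(2) sx(4) by (auto intro: rev_image_eqI)
    moreover have "?N \<subseteq> {p \<in> topspace (pullback_top C (C0 D) (anchor F)). arr_map F p \<in> W}"
    proof
      fix q assume q: "q \<in> ?N"
      then obtain t b where t: "q = (t, dm D b)" "t \<in> \<delta> a" "b \<in> \<epsilon> v" "(t, dm D b) \<in> ?P" by auto
      then have "b \<in> \<epsilon> (\<phi> a)" using v(3) by blast
      then have "arr_map F (t, dm D b) = b"
        using Y.rep_inj[OF mor_in[OF a(1)] realized(7)[OF t(4) a(1) t(2)]] realized(4)[OF t(4)] by simp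
      then show "q \<in> {p \<in> topspace (pullback_top C (C0 D) (anchor F)). arr_map F p \<in> W}"
        using t v(3) by auto
    qed
    ultimately show "\<exists>N. openin (pullback_top C (C0 D) (anchor F)) N \<and> p \<in> N \<and>
        N \<subseteq> {p \<in> topspace (pullback_top C (C0 D) (anchor F)). arr_map F p \<in> W}" by blast
  qed
qed

lemma anchor_preimage:
  assumes "compact_open (C0 C) U"
  obtains e where "e \<in> projections S" "\<delta> e = un C ` U" "{x \<in> Y.Ob. anchor F x \<in> U} = dm D ` \<epsilon> (\<phi> e)"
proof -
  obtain e where e: "e \<in> projections S" "\<delta> e = un C ` U" "dm C ` \<delta> e = U"
    using X.projection_exists[OF assms] .
  have "anchor F x \<in> U \<longleftrightarrow> x \<in> dm D ` \<epsilon> (\<phi> e)" if x: "x \<in> Y.Ob" for x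
  proof -
    have "anchor F x \<in> X.Ob" using F x by (simp add: realizes_def)
    then show ?thesis
      using anchor_iff[OF x e(1)] X.un_projection_iff[OF e(1)] Y.un_projection_iff[OF mor_proj[OF e(1)] x] e(3)
      by simp
  qed
  moreover have "dm D ` \<epsilon> (\<phi> e) \<subseteq> Y.Ob"
    using Y.dm_rep_subset mor_in X.projection_carrier e(1) by blast
  ultimately show ?thesis using that[OF e(1,2)] by blast
qed

lemma compact_open_anchor_preimage:
  assumes "compact_open (C0 C) U"
  shows "compact_open (C0 D) {x \<in> Y.Ob. anchor F x \<in> U}"
proof -
  obtain e where e: "e \<in> projections S" "{x \<in> Y.Ob. anchor F x \<in> U} = dm D ` \<epsilon> (\<phi> e)"
    using anchor_preimage[OF assms] by metis
  then show ?thesis using Y.compact_open_dm_rep[OF mor_in[OF X.projection_carrier[OF e(1)]]] by simp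
qed

lemma continuous_anchor: "continuous_map (C0 D) (C0 C) (anchor F)"
  unfolding continuous_map_def
proof (intro conjI allI impI)
  show "anchor F \<in> Y.Ob \<rightarrow> X.Ob" using F by (simp add: realizes_def)
  fix W assume W: "openin (C0 C) W"
  show "openin (C0 D) {x \<in> Y.Ob. anchor F x \<in> W}"
  proof (subst openin_subopen, intro ballI)
    fix x assume x: "x \<in> {x \<in> Y.Ob. anchor F x \<in> W}"
    then obtain U where U: "compact_open (C0 C) U" "anchor F x \<in> U" "U \<subseteq> W"
      using X.compact_open_nbhd[OF W, of "anchor F x"] by blast
    have "openin (C0 D) {x \<in> Y.Ob. anchor F x \<in> U}"
      using compact_open_anchor_preimage[OF U(1)] by (simp add: compact_open_def)
    then show "\<exists>N. openin (C0 D) N \<and> x \<in> N \<and> N \<subseteq> {x \<in> Y.Ob. anchor F x \<in> W}"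
      using x U(2,3) by blast
  qed
qed

text \<open>Any compact \<open>K\<close> sits in a compact open \<open>U\<close>. The preimage of
  \<open>U\<close> is compact, as the set of domains of a represented slice, and the preimage of
  \<open>K\<close> is closed in it.\<close>

lemma proper_anchor:
  assumes K: "compactin (C0 C) K"
  shows "compactin (C0 D) {x \<in> Y.Ob. anchor F x \<in> K}"
proof -
  obtain U where U: "compact_open (C0 C) U" "K \<subseteq> U" using X.compact_open_cover[OF K] .
  have "closedin (C0 D) {x \<in> Y.Ob. anchor F x \<in> K}"
    using closedin_continuous_map_preimage[OF continuous_anchor X.compact_closed[OF K]] .
  moreover have "compactin (C0 D) {x \<in> Y.Ob. anchor F x \<in> U}"
    using compact_open_anchor_preimage[OF U(1)] by (simp add: compact_open_def)
  ultimately show ?thesis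
    using closed_compactin[of "C0 D" "{x \<in> Y.Ob. anchor F x \<in> U}" "{x \<in> Y.Ob. anchor F x \<in> K}"] U(2) by blast
qed

text \<open>Cofunctors are tested on all compact slices, while the morphism is known on the
  represented ones. Finite unions bridge the gap, since \<open>cofun_image\<close> preserves
  unions.\<close>

lemma cofun_image_compact_open:
  assumes A: "compact_slice C A"
  shows "compact_open (C1 D) (cofun_image C D F A)"
proof -
  obtain B where B: "finite B" "B \<subseteq> carrier S" "A = \<Union>(\<delta> ` B)"
    using X.compact_slice_finite_union[OF A] .
  have "cofun_image C D F A = \<Union>((\<lambda>a. cofun_image C D F (\<delta> a)) ` B)"
    unfolding B(3) by (auto simp add: cofun_image_def)
  moreover have "compact_open (C1 D) (cofun_image C D F (\<delta> a))" if a: "a \<in> B" for a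
  proof -
    have c: "a \<in> carrier S" using a B(2) by blast
    then have "cofun_image C D F (\<delta> a) = \<epsilon> (\<phi> a)" using realizing_corr by (simp add: corr_def)
    then show ?thesis using compact_slice_compact_open[OF Y.slice[OF mor_in[OF c]]] by simp
  qed
  ultimately show ?thesis
    using compact_open_Union[of "(\<lambda>a. cofun_image C D F (\<delta> a)) ` B" "C1 D"] B(1) by auto
qed

lemma realizing_cofunctor: "is_cofunctor C D F"
proof -
  have ext: "act F \<in> extensional (cofun_arrows C D F)" "anchor F \<in> extensional (topspace (C0 D))"
    "arr_map F \<in> extensional (cofun_arrows C D F)" "obj_map F \<in> extensional (topspace (C0 D))"
    and o: "\<And>x. x \<in> Y.Ob \<Longrightarrow> obj_map F x = x"
    using F by (simp_all add: realizes_def)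
  have "continuous_map (pullback_top C (C0 D) (anchor F)) (C0 D) (rg D \<circ> arr_map F)"
    using continuous_map_compose[OF continuous_arr_map Y.cont_rg] .
  then have cact: "continuous_map (pullback_top C (C0 D) (anchor F)) (C0 D) (act F)"
    by (rule continuous_map_eq) (use realized(5) in auto)
  have act_unit: "act F (un C (anchor F x), x) = x" if x: "x \<in> Y.Ob" for x
  proof -
    have "(un C (anchor F x), x) \<in> cofun_arrows C D F"
      using x X.un_in F by (simp add: in_cofun_arrows realizes_def)
    then show ?thesis using realized(5) arr_map_unit[OF x] x by simp
  qed
  have act_mult: "act F (s, act F (t, x)) = act F (mu C s t, x)"
    if c: "(s, t) \<in> composable C" and t: "(t, x) \<in> cofun_arrows C D F" for s t x
  proof -
    have s: "(s, act F (t, x)) \<in> cofun_arrows C D F"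
      using c anchor_act[OF t] by (auto simp add: in_cofun_arrows composable_def)
    note m = arr_map_mult[OF t s]
    have "rg D (arr_map F (t, x)) = dm D (arr_map F (s, act F (t, x)))"
      using realized[OF t] realized[OF s] by simp
    then show ?thesis
      using m realized[OF m(1)] realized[OF t] realized[OF s] Y.rg_mu by simp
  qed
  have action: "is_action C (C0 D) (act F) (anchor F)"
    unfolding is_action_def
    using continuous_anchor cact anchor_act act_mult act_unit by blast
  have "continuous_map (C0 D) (C0 D) (obj_map F)"
    by (rule continuous_map_eq[OF continuous_map_id]) (simp add: o)
  moreover have "arr_map F (mu C s t, x) = mu D (arr_map F (s, y)) (arr_map F (t, x))"
    if "(s, y) \<in> cofun_arrows C D F" "(t, x) \<in> cofun_arrows C D F" "act F (t, x) = y" for s t x y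
    using arr_map_mult[of t x s] that by simp
  moreover have "dm D (arr_map F (s, x)) = obj_map F x \<and> rg D (arr_map F (s, x)) = obj_map F (act F (s, x))"
    if "(s, x) \<in> cofun_arrows C D F" for s x
    using realized[OF that] o anchor_act[OF that] by simp
  ultimately have cf: "continuous_functor (transformation_category C (C0 D) (act F) (anchor F)) D
      (arr_map F) (obj_map F)"
    using continuous_arr_map arr_map_unit o
    by (auto simp add: continuous_functor_def transformation_category_def composable_def)
  have proper: "\<forall>K. compactin (C0 C) K \<longrightarrow> compactin (C0 D) {x \<in> topspace (C0 D). anchor F x \<in> K}"
    using proper_anchor by blast
  have img: "\<forall>A. compact_slice C A \<longrightarrow>
      openin (C1 D) (cofun_image C D F A) \<and> compactin (C1 D) (cofun_image C D F A)"
    using cofun_image_compact_open by (simp add: compact_open_def)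
  show ?thesis
    unfolding is_cofunctor_def using ext o action proper cf img by simp
qed

end

text \<open>Projections separate points, which fixes the anchor. An arrow is fixed by its domain and
  a slice containing it, which fixes \<open>arr_map\<close>; the action is the range of the
  latter.\<close>

lemma realizes_unique:
  assumes F: "realizes C S \<delta> D \<epsilon> \<phi> F" and G: "realizes C S \<delta> D \<epsilon> \<phi> G"
  shows "F = G"
proof -
  have "anchor F x = anchor G x" if x: "x \<in> Y.Ob" for x
  proof (rule X.projection_separation)
    show "anchor F x \<in> X.Ob" "anchor G x \<in> X.Ob" using F G x by (simp_all add: realizes_def)
    show "un C (anchor G x) \<in> \<delta> e" if "e \<in> projections S" "un C (anchor F x) \<in> \<delta> e" for e
      using anchor_iff[OF F x that(1)] anchor_iff[OF G x that(1)] that(2) by simp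
  qed
  then have anc: "anchor F = anchor G"
    using F G by (intro extensionalityI[of _ Y.Ob]) (auto simp add: realizes_def)
  have obj: "obj_map F = obj_map G"
    using F G by (intro extensionalityI[of _ Y.Ob]) (auto simp add: realizes_def)
  have "arr_map F (s, x) = arr_map G (s, x)" if P: "(s, x) \<in> cofun_arrows C D F" for s x
  proof -
    have P': "(s, x) \<in> cofun_arrows C D G" using P anc by simp
    obtain a where a: "a \<in> carrier S" "s \<in> \<delta> a" using X.basis[of X.Arr s] realized(1)[OF F P] by auto
    show ?thesis
      using Y.rep_inj[OF mor_in[OF a(1)] realized(7)[OF F P a] realized(7)[OF G P' a]]
        realized(4)[OF F P] realized(4)[OF G P'] by simp
  qed
  then have pw: "arr_map F p = arr_map G p" if "p \<in> cofun_arrows C D F" for p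
    using that by (cases p) simp
  then have arr: "arr_map F = arr_map G"
    using F G anc by (intro extensionalityI[of _ "cofun_arrows C D F"]) (auto simp add: realizes_def)
  have "act F p = act G p" if "p \<in> cofun_arrows C D F" for p
    using that realized(5)[OF F] realized(5)[OF G] anc arr by (cases p) simp
  then have "act F = act G"
    using F G anc by (intro extensionalityI[of _ "cofun_arrows C D F"]) (auto simp add: realizes_def)
  then show ?thesis using anc arr obj by simp
qed

end

lemma realizes_iff:
  assumes "sgp_morphism S T \<phi>"
  shows "realizes C S \<delta> D \<epsilon> \<phi> F \<longleftrightarrow> is_cofunctor C D F \<and> corr \<phi> F"
  using realizing_cofunctor[OF assms] realizing_corr[OF assms] cofunctor_realizes by blast

end

subsection \<open>Types of morphisms\<close>

context representation_pair
begin

context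
  fixes \<phi> :: "'a \<Rightarrow> 'b" and F :: "('c, 'o, 'd, 'p) cofun"
  assumes \<phi>: "sgp_morphism S T \<phi>" and F: "realizes C S \<delta> D \<epsilon> \<phi> F"
begin

text \<open>With injectivity, each arrow of \<open>\<epsilon> u\<close> comes from a single arrow
  lying in both \<open>\<delta> s\<close> and \<open>\<delta> t\<close>; compactness of
  \<open>\<epsilon> u\<close> then collects finitely many slices inside the intersection into
  \<open>v\<close>. Conversely, an arrow that is the image of two arrows lies in some
  \<open>\<epsilon> u\<close>. An arrow of \<open>\<delta> v\<close> mapped to it has the same
  domain as both, and \<open>\<delta> v\<close> is part of a slice around each, so the two
  coincide.\<close>

lemma weakly_meet_preserving_iff: "weakly_meet_preserving S T \<phi> \<longleftrightarrow> injective_on_arrows C D F"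
proof
  assume inj: "injective_on_arrows C D F"
  show "weakly_meet_preserving S T \<phi>"
    unfolding weakly_meet_preserving_def
  proof (intro ballI impI)
    fix s t u assume c: "s \<in> carrier S" "t \<in> carrier S" "u \<in> carrier T"
      and "le T u (\<phi> s)" "le T u (\<phi> t)"
    then have sub: "\<epsilon> u \<subseteq> \<epsilon> (\<phi> s)" "\<epsilon> u \<subseteq> \<epsilon> (\<phi> t)"
      using Y.le_iff mor_in[OF \<phi>] by simp_all
    let ?B = "{c \<in> carrier S. \<delta> c \<subseteq> \<delta> s \<inter> \<delta> t}"
    have cov: "\<exists>V\<in>(\<lambda>c. \<epsilon> (\<phi> c)) ` ?B. openin (C1 D) V \<and> w \<in> V" if w: "w \<in> \<epsilon> u" for w
    proof -
      obtain s' where s': "s' \<in> \<delta> s" "(s', dm D w) \<in> cofun_arrows C D F" "arr_map F (s', dm D w) = w"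
        using realizing_surj[OF \<phi> F c(1)] sub(1) w by blast
      obtain t' where t': "t' \<in> \<delta> t" "(t', dm D w) \<in> cofun_arrows C D F" "arr_map F (t', dm D w) = w"
        using realizing_surj[OF \<phi> F c(2)] sub(2) w by blast
      have "s' = t'" using inj s' t' unfolding injective_on_arrows_def by metis
      moreover have "openin (C1 C) (\<delta> s \<inter> \<delta> t)"
        using X.slice c by (auto simp add: compact_slice_def is_slice_def)
      ultimately obtain a where a: "a \<in> carrier S" "s' \<in> \<delta> a" "\<delta> a \<subseteq> \<delta> s \<inter> \<delta> t"
        using X.basis[of "\<delta> s \<inter> \<delta> t" s'] s' t' by blast
      then have "w \<in> \<epsilon> (\<phi> a)" using realized(7)[OF \<phi> F s'(2) a(1,2)] s'(3) by simp
      moreover have "openin (C1 D) (\<epsilon> (\<phi> a))"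
        using Y.slice[OF mor_in[OF \<phi> a(1)]] by (simp add: compact_slice_def is_slice_def)
      ultimately show ?thesis using a by blast
    qed
    have K: "compactin (C1 D) (\<epsilon> u)" using Y.slice[OF c(3)] by (simp add: compact_slice_def)
    obtain \<F> where \<F>: "finite \<F>" "\<F> \<subseteq> (\<lambda>c. \<epsilon> (\<phi> c)) ` ?B" "\<epsilon> u \<subseteq> \<Union>\<F>"
      using compactin_finite_cover[OF K cov] .
    obtain B where B: "B \<subseteq> ?B" "finite B" "\<F> = (\<lambda>c. \<epsilon> (\<phi> c)) ` B"
      using finite_subset_image[OF \<F>(1,2)] by blast
    have "compact_open (C1 C) (\<Union>(\<delta> ` B))"
      using B X.slice compact_slice_compact_open by (intro compact_open_Union) blast+
    moreover have "\<Union>(\<delta> ` B) \<subseteq> \<delta> s" using B by blast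
    ultimately obtain v where v: "v \<in> carrier S" "\<delta> v = \<Union>(\<delta> ` B)" using X.restrict[OF c(1)] by blast
    have "\<delta> v \<subseteq> \<delta> s" "\<delta> v \<subseteq> \<delta> t" using v B by auto
    moreover have "\<epsilon> (\<phi> c) \<subseteq> \<epsilon> (\<phi> v)" if "c \<in> B" for c
      using that B v by (intro mor_mono[OF \<phi>]) auto
    then have "\<epsilon> u \<subseteq> \<epsilon> (\<phi> v)" using \<F>(3) B(3) by blast
    ultimately show "\<exists>v\<in>carrier S. le S v s \<and> le S v t \<and> le T u (\<phi> v)"
      using v(1) c X.le_iff Y.le_iff mor_in[OF \<phi>] by blast
  qed
next
  assume w: "weakly_meet_preserving S T \<phi>"
  show "injective_on_arrows C D F"
    unfolding injective_on_arrows_def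
  proof (intro allI impI)
    fix s t x assume s: "(s, x) \<in> cofun_arrows C D F" and t: "(t, x) \<in> cofun_arrows C D F"
      and eq: "arr_map F (s, x) = arr_map F (t, x)"
    note rs = realized[OF \<phi> F s] and rt = realized[OF \<phi> F t]
    obtain a where a: "a \<in> carrier S" "s \<in> \<delta> a" using X.basis[of X.Arr s] rs by auto
    obtain b where b: "b \<in> carrier S" "t \<in> \<delta> b" using X.basis[of X.Arr t] rt by auto
    have "openin (C1 D) (\<epsilon> (\<phi> a) \<inter> \<epsilon> (\<phi> b))"
      using Y.slice mor_in[OF \<phi>] a b by (auto simp add: compact_slice_def is_slice_def)
    then obtain u where u: "u \<in> carrier T" "arr_map F (s, x) \<in> \<epsilon> u" "\<epsilon> u \<subseteq> \<epsilon> (\<phi> a) \<inter> \<epsilon> (\<phi> b)"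
      using Y.basis[of "\<epsilon> (\<phi> a) \<inter> \<epsilon> (\<phi> b)" "arr_map F (s, x)"] rs(7)[OF a] rt(7)[OF b] eq by auto
    then have "le T u (\<phi> a)" "le T u (\<phi> b)" using Y.le_iff mor_in[OF \<phi>] a b by auto
    then obtain v where "v \<in> carrier S" "le S v a" "le S v b" "le T u (\<phi> v)"
      using w a(1) b(1) u(1) unfolding weakly_meet_preserving_def by blast
    then have v: "v \<in> carrier S" "\<delta> v \<subseteq> \<delta> a" "\<delta> v \<subseteq> \<delta> b" "\<epsilon> u \<subseteq> \<epsilon> (\<phi> v)"
      using X.le_iff Y.le_iff mor_in[OF \<phi>] a b u by auto
    have m: "arr_map F (s, x) \<in> \<epsilon> (\<phi> v)" using v(4) u(2) by blast
    obtain r where r: "r \<in> \<delta> v" "(r, x) \<in> cofun_arrows C D F"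
      using realizing_surj[OF \<phi> F v(1) m] rs(4) by metis
    have "dm C r = dm C s" "dm C r = dm C t" using rs(3) rt(3) r(2) by (simp_all add: in_cofun_arrows)
    then show "s = t" using X.rep_inj[OF a(1) _ a(2)] X.rep_inj[OF b(1) _ b(2)] r(1) v(2,3) by blast
  qed
qed

text \<open>Surjectivity says that each arrow of \<open>D\<close> lies in the image of some slice.
  For a single \<open>t\<close> this is a cover of a compact slice by basic pieces below such
  images, so finitely many pieces suffice.\<close>

lemma proper_morphism_iff: "proper_morphism S T \<phi> \<longleftrightarrow> surjective_on_arrows C D F"
proof
  assume p: "proper_morphism S T \<phi>"
  show "surjective_on_arrows C D F"
    unfolding surjective_on_arrows_def
  proof
    fix b assume "b \<in> Y.Arr"
    then obtain t where t: "t \<in> carrier T" "b \<in> \<epsilon> t" using Y.basis[of Y.Arr b] by auto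
    obtain n \<tau> \<sigma> v where n: "\<forall>j\<in>{1..n::nat}. \<tau> j \<in> carrier T \<and> \<sigma> j \<in> carrier S \<and> le T (\<tau> j) (\<phi> (\<sigma> j))"
      and v: "is_join T (\<tau> ` {1..n}) v" "le T t v"
      using p t(1) unfolding proper_morphism_def by blast
    have vn: "v \<in> carrier T \<and> \<epsilon> v = \<Union>(\<epsilon> ` \<tau> ` {1..n})"
      using Y.is_join_iff[of "\<tau> ` {1..n}" v] v(1) n by blast
    then have "\<epsilon> t \<subseteq> \<epsilon> v" using Y.le_iff[OF t(1)] v(2) by simp
    then have "b \<in> \<Union>(\<epsilon> ` \<tau> ` {1..n})" using vn t(2) by auto
    then obtain j where j: "j \<in> {1..n}" "b \<in> \<epsilon> (\<tau> j)" by blast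
    then have nj: "\<tau> j \<in> carrier T" "\<sigma> j \<in> carrier S" "le T (\<tau> j) (\<phi> (\<sigma> j))" using n by simp_all
    then have bj: "b \<in> \<epsilon> (\<phi> (\<sigma> j))" using Y.le_iff[OF nj(1) mor_in[OF \<phi> nj(2)]] j(2) by blast
    obtain s where "(s, dm D b) \<in> cofun_arrows C D F" "arr_map F (s, dm D b) = b"
      using realizing_surj[OF \<phi> F nj(2) bj] .
    then show "\<exists>s. (s, dm D b) \<in> cofun_arrows C D F \<and> arr_map F (s, dm D b) = b"
      by blast
  qed
next
  assume surj: "surjective_on_arrows C D F"
  show "proper_morphism S T \<phi>"
    unfolding proper_morphism_def
  proof
    fix t assume t: "t \<in> carrier T"
    let ?B = "{v \<in> carrier T. \<epsilon> v \<subseteq> \<epsilon> t \<and> (\<exists>a\<in>carrier S. \<epsilon> v \<subseteq> \<epsilon> (\<phi> a))}"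
    have cov: "\<exists>V\<in>\<epsilon> ` ?B. openin (C1 D) V \<and> w \<in> V" if w: "w \<in> \<epsilon> t" for w
    proof -
      have "w \<in> Y.Arr" using w Y.rep_subset[OF t] by blast
      then obtain s where s: "(s, dm D w) \<in> cofun_arrows C D F" "arr_map F (s, dm D w) = w"
        using surj unfolding surjective_on_arrows_def by blast
      obtain a where a: "a \<in> carrier S" "s \<in> \<delta> a" using X.basis[of X.Arr s] realized(1)[OF \<phi> F s(1)] by auto
      have wa: "w \<in> \<epsilon> (\<phi> a)" using realized(7)[OF \<phi> F s(1) a] s(2) by simp
      have "openin (C1 D) (\<epsilon> (\<phi> a) \<inter> \<epsilon> t)"
        using Y.slice mor_in[OF \<phi>] a t by (auto simp add: compact_slice_def is_slice_def)
      then obtain v where v: "v \<in> carrier T" "w \<in> \<epsilon> v" "\<epsilon> v \<subseteq> \<epsilon> (\<phi> a) \<inter> \<epsilon> t"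
        using Y.basis[of "\<epsilon> (\<phi> a) \<inter> \<epsilon> t" w] w wa by blast
      then have "v \<in> ?B" using a(1) by blast
      then show ?thesis using v Y.slice[OF v(1)] by (auto simp add: compact_slice_def is_slice_def)
    qed
    have K: "compactin (C1 D) (\<epsilon> t)" using Y.slice[OF t] by (simp add: compact_slice_def)
    obtain \<F> where \<F>: "finite \<F>" "\<F> \<subseteq> \<epsilon> ` ?B" "\<epsilon> t \<subseteq> \<Union>\<F>"
      using compactin_finite_cover[OF K cov] .
    obtain B where B: "B \<subseteq> ?B" "finite B" "\<F> = \<epsilon> ` B"
      using finite_subset_image[OF \<F>(1,2)] by blast
    \<comment> \<open>The definition asks for \<open>n \<ge> 1\<close>, but the finite subcover may
      be empty. Adding the zero, whose slice is empty, leaves the join unchanged.\<close>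
    have z: "zero_of T \<in> ?B"
      using Y.zero_of Y.projection_carrier X.zero_of(1) X.projection_carrier by auto
    obtain xs where xs: "set xs = insert (zero_of T) B" using finite_list B(2) by (metis finite_insert)
    \<comment> \<open>Positions in a list start at 0, the indices in the definition at 1.\<close>
    define \<tau> where "\<tau> j = xs ! (j - 1)" for j
    have ex: "\<forall>v\<in>?B. \<exists>a. a \<in> carrier S \<and> \<epsilon> v \<subseteq> \<epsilon> (\<phi> a)" by blast
    obtain \<alpha> where \<alpha>: "\<forall>v\<in>?B. \<alpha> v \<in> carrier S \<and> \<epsilon> v \<subseteq> \<epsilon> (\<phi> (\<alpha> v))"
      using bchoice[OF ex] ..
    have "{1..length xs} = Suc ` {..<length xs}" by (simp add: image_Suc_lessThan)
    then have \<tau>: "\<tau> ` {1..length xs} = set xs"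
      by (simp add: image_image \<tau>_def set_conv_nth) (auto simp add: image_iff)
    have sub: "set xs \<subseteq> ?B" unfolding xs insert_subset using B(1) z by (rule conjI[rotated])
    have len: "1 \<le> length xs" using xs by (cases xs) auto
    have "\<tau> j \<in> carrier T \<and> \<alpha> (\<tau> j) \<in> carrier S \<and> le T (\<tau> j) (\<phi> (\<alpha> (\<tau> j)))" if "j \<in> {1..length xs}" for j
    proof -
      have j: "\<tau> j \<in> ?B" using that \<tau> sub by blast
      then show ?thesis using bspec[OF \<alpha> j] Y.le_iff[of "\<tau> j" "\<phi> (\<alpha> (\<tau> j))"] mor_in[OF \<phi>] by simp
    qed
    moreover have "is_join T (\<tau> ` {1..length xs}) t"
    proof -
      have "\<Union>(\<epsilon> ` set xs) = \<epsilon> t" using \<F>(3) B(3) xs sub by auto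
      then show ?thesis using Y.is_join_iff[of "set xs" t] sub t \<tau> by auto
    qed
    moreover have "le T t t" using Y.le_iff t by simp
    ultimately show "\<exists>n\<ge>1. \<exists>(\<tau> :: nat \<Rightarrow> 'b) (\<sigma> :: nat \<Rightarrow> 'a).
        (\<forall>j\<in>{1..n}. \<tau> j \<in> carrier T \<and> \<sigma> j \<in> carrier S \<and> le T (\<tau> j) (\<phi> (\<sigma> j))) \<and>
        (\<exists>v. is_join T (\<tau> ` {1..n}) v \<and> le T t v)"
      using len by (intro exI[of _ "length xs"] conjI exI[of _ \<tau>] exI[of _ "\<lambda>j. \<alpha> (\<tau> j)"]) auto
  qed
qed

lemma morphism_of_type_iff: "morphism_of_type i S T \<phi> \<longleftrightarrow> cofunctor_of_type i C D F"
  using realizing_cofunctor[OF \<phi> F] \<phi> weakly_meet_preserving_iff proper_morphism_iff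
  by (simp add: morphism_of_type_def cofunctor_of_type_def)

end

end

subsection \<open>Identities and composites\<close>

lemma (in representation) representation_pair_refl: "representation_pair C S \<delta> C S \<delta>"
  by unfold_locales

lemma (in representation) id_morphism:
  "sgp_morphism S S (restrict (\<lambda>x. x) (carrier S))"
proof -
  have pc: "projections S \<subseteq> carrier S" using projection_carrier by blast
  have "\<exists>p\<in>projections S. le S q p" if "q \<in> projections S" for q
    using that le_iff projection_carrier by blast
  then show ?thesis
    using pc zero_of join_projections projection_mult
    by (auto simp add: sgp_morphism_def gba_morphism_def mult_closed star_closed meet_projections subset_iff)
qed

lemma (in representation) id_realizes:
  "realizes C S \<delta> C \<delta> (restrict (\<lambda>x. x) (carrier S)) (id_cofun C)"
proof -
  have P: "pullback_set C (C0 C) (restrict (\<lambda>x. x) Ob) = pullback_set C (C0 C) (\<lambda>x. x)"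
    by (auto simp add: pullback_set_def)
  show ?thesis
    unfolding realizes_def id_cofun_def Let_def by (auto simp add: P) (auto simp add: pullback_set_def)
qed

lemma (in representation_pair) sgp_morphism_le:
  assumes "sgp_morphism S T \<phi>" "s \<in> carrier S" "t \<in> carrier S" "le S s t"
  shows "le T (\<phi> s) (\<phi> t)"
  using assms mor_mono[OF assms(1-3)] X.le_iff[OF assms(2,3)]
    Y.le_iff[OF mor_in[OF assms(1,2)] mor_in[OF assms(1,3)]] by simp

section \<open>Composites of morphisms and of cofunctors\<close>

context
  fixes C :: "('c, 'o) top_cat" and S :: "('a, 'z) restr_sgp_scheme" and \<delta> :: "'a \<Rightarrow> 'c set"
    and D :: "('d, 'p) top_cat" and T :: "('b, 'y) restr_sgp_scheme" and \<epsilon> :: "'b \<Rightarrow> 'd set"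
    and E :: "('e, 'q) top_cat" and U :: "('u, 'w) restr_sgp_scheme" and \<zeta> :: "'u \<Rightarrow> 'e set"
    and \<phi> :: "'a \<Rightarrow> 'b" and \<psi> :: "'b \<Rightarrow> 'u"
    and F :: "('c, 'o, 'd, 'p) cofun" and G :: "('d, 'p, 'e, 'q) cofun"
  assumes R: "representation C S \<delta>" "representation D T \<epsilon>" "representation E U \<zeta>"
    and m: "sgp_morphism S T \<phi>" "sgp_morphism T U \<psi>"
begin

interpretation A: representation_pair C S \<delta> D T \<epsilon>
  by (intro representation_pair.intro R)

interpretation B: representation_pair D T \<epsilon> E U \<zeta>
  by (intro representation_pair.intro R)

lemma comp_morphism: "sgp_morphism S U (compose (carrier S) \<psi> \<phi>)"
proof -
  have in1: "\<And>s. s \<in> carrier S \<Longrightarrow> \<phi> s \<in> carrier T" and in2: "\<And>s. s \<in> carrier T \<Longrightarrow> \<psi> s \<in> carrier U"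
    using A.mor_in[OF m(1)] B.mor_in[OF m(2)] by auto
  have p1: "\<And>s. s \<in> projections S \<Longrightarrow> \<phi> s \<in> projections T" and p2: "\<And>s. s \<in> projections T \<Longrightarrow> \<psi> s \<in> projections U"
    using A.mor_proj[OF m(1)] B.mor_proj[OF m(2)] by auto
  have pc: "\<And>e. e \<in> projections S \<Longrightarrow> e \<in> carrier S" "\<And>e. e \<in> projections T \<Longrightarrow> e \<in> carrier T"
    "\<And>e. e \<in> projections U \<Longrightarrow> e \<in> carrier U"
    using A.X.projection_carrier A.Y.projection_carrier B.Y.projection_carrier by auto
  have "\<exists>p\<in>projections S. le U q (compose (carrier S) \<psi> \<phi> p)" if q: "q \<in> projections U" for q
  proof -
    obtain p' where p': "p' \<in> projections T" "le U q (\<psi> p')"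
      using m(2) q unfolding sgp_morphism_def by blast
    obtain p where p: "p \<in> projections S" "le T p' (\<phi> p)"
      using m(1) p'(1) unfolding sgp_morphism_def by blast
    have "le U (\<psi> p') (\<psi> (\<phi> p))" using B.sgp_morphism_le[OF m(2)] p p' pc in1 by simp
    have c: "q \<in> carrier U" "\<psi> p' \<in> carrier U" "\<psi> (\<phi> p) \<in> carrier U"
      using pc q p(1) p'(1) in1 in2 by auto
    have "le U q (\<psi> (\<phi> p))"
      using \<open>le U (\<psi> p') (\<psi> (\<phi> p))\<close> p'(2)
      unfolding B.Y.le_iff[OF c(1,2)] B.Y.le_iff[OF c(2,3)] B.Y.le_iff[OF c(1,3)] by simp
    then show ?thesis using p pc by (auto simp add: compose_eq)
  qed
  moreover have "compose (carrier S) \<psi> \<phi> (join_on (projections S) (le S) e f) =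
      join_on (projections U) (le U) (compose (carrier S) \<psi> \<phi> e) (compose (carrier S) \<psi> \<phi> f)"
    if "e \<in> projections S" "f \<in> projections S" for e f
    using that A.X.join_projections[OF that] m p1 pc
    by (simp add: compose_eq sgp_morphism_def gba_morphism_def)
  moreover have "compose (carrier S) \<psi> \<phi> (meet_on (projections S) (le S) e f) =
      meet_on (projections U) (le U) (compose (carrier S) \<psi> \<phi> e) (compose (carrier S) \<psi> \<phi> f)"
    if "e \<in> projections S" "f \<in> projections S" for e f
  proof -
    have "meet_on (projections S) (le S) e f \<in> carrier S"
      using A.X.meet_projections[OF that] A.X.projection_mult(1)[OF that] pc by simp
    then show ?thesis
      using that m p1 pc by (simp add: compose_eq sgp_morphism_def gba_morphism_def)
  qed
  moreover have "compose (carrier S) \<psi> \<phi> (zero_of S) = zero_of U"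
    using A.X.zero_of(1) pc m by (simp add: compose_eq sgp_morphism_def gba_morphism_def)
  ultimately have "gba_morphism (projections S) (le S) (zero_of S) (projections U) (le U) (zero_of U)
      (compose (carrier S) \<psi> \<phi>) \<and> (\<forall>q\<in>projections U. \<exists>p\<in>projections S. le U q (compose (carrier S) \<psi> \<phi> p))"
    using p1 p2 pc by (simp add: gba_morphism_def compose_eq)
  moreover have "compose (carrier S) \<psi> \<phi> \<in> carrier S \<rightarrow>\<^sub>E carrier U"
    using in1 in2 by (auto simp add: compose_def)
  moreover have "compose (carrier S) \<psi> \<phi> (mult S x y) = mult U (compose (carrier S) \<psi> \<phi> x) (compose (carrier S) \<psi> \<phi> y)"
    if "x \<in> carrier S" "y \<in> carrier S" for x y
    using that m A.X.mult_closed[OF that] in1 by (simp add: compose_eq sgp_morphism_def)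
  moreover have "compose (carrier S) \<psi> \<phi> (star S x) = star U (compose (carrier S) \<psi> \<phi> x)"
    if "x \<in> carrier S" for x
    using that m A.X.star_closed[OF that] in1 by (simp add: compose_eq sgp_morphism_def)
  ultimately show ?thesis unfolding sgp_morphism_def by blast
qed

context
  assumes F: "realizes C S \<delta> D \<epsilon> \<phi> F" and G: "realizes D T \<epsilon> E \<zeta> \<psi> G"
begin

lemma comp_arrows:
  assumes "(s, x) \<in> cofun_arrows C E (comp_cofun C E G F)"
  shows "(s, anchor G x) \<in> cofun_arrows C D F" "(arr_map F (s, anchor G x), x) \<in> cofun_arrows D E G"
    "arr_map (comp_cofun C E G F) (s, x) = arr_map G (arr_map F (s, anchor G x), x)"
    "act (comp_cofun C E G F) (s, x) = act G (arr_map F (s, anchor G x), x)"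
proof -
  have s: "s \<in> A.X.Arr" "x \<in> B.Y.Ob" "dm C s = anchor F (anchor G x)"
    using assms by (auto simp add: comp_cofun_def Let_def pullback_set_def)
  then show 1: "(s, anchor G x) \<in> cofun_arrows C D F"
    using G by (simp add: A.in_cofun_arrows realizes_def)
  show "(arr_map F (s, anchor G x), x) \<in> cofun_arrows D E G"
    using A.realized[OF m(1) F 1] s by (simp add: B.in_cofun_arrows)
  show "arr_map (comp_cofun C E G F) (s, x) = arr_map G (arr_map F (s, anchor G x), x)"
    "act (comp_cofun C E G F) (s, x) = act G (arr_map F (s, anchor G x), x)"
    using assms by (simp_all add: comp_cofun_def Let_def)
qed

text \<open>Only domains, ranges and membership in slices have to be compared. Continuity,
  properness and the compactness of images of the composite then come from
  \<open>realizing_cofunctor\<close>.\<close>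

lemma comp_realizes: "realizes C S \<delta> E \<zeta> (compose (carrier S) \<psi> \<phi>) (comp_cofun C E G F)"
proof -
  let ?H = "comp_cofun C E G F"
  have "dm E (arr_map ?H (s, x)) = x \<and> act ?H (s, x) = rg E (arr_map ?H (s, x)) \<and>
      (\<forall>a\<in>carrier S. s \<in> \<delta> a \<longrightarrow> arr_map ?H (s, x) \<in> \<zeta> (compose (carrier S) \<psi> \<phi> a))"
    if P: "(s, x) \<in> cofun_arrows C E ?H" for s x
  proof -
    note c = comp_arrows[OF P]
    show ?thesis
      using A.realized[OF m(1) F c(1)] B.realized[OF m(2) G c(2)] c(3,4) A.mor_in[OF m(1)]
      by (simp add: compose_eq)
  qed
  moreover have "anchor ?H x \<in> topspace (C0 C) \<and> obj_map ?H x = x" if "x \<in> B.Y.Ob" for x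
    using that F G by (simp add: comp_cofun_def Let_def realizes_def)
  ultimately show ?thesis
    unfolding realizes_def by (auto simp add: comp_cofun_def Let_def)
qed

lemma comp_type:
  assumes "cofunctor_of_type i C D F" "cofunctor_of_type i D E G"
  shows "cofunctor_of_type i C E (comp_cofun C E G F)"
proof -
  interpret AB: representation_pair C S \<delta> E U \<zeta> by (intro representation_pair.intro R)
  let ?H = "comp_cofun C E G F"
  have "injective_on_arrows C E ?H" if "injective_on_arrows C D F" "injective_on_arrows D E G"
    unfolding injective_on_arrows_def
  proof (intro allI impI)
    fix s t x assume s: "(s, x) \<in> cofun_arrows C E ?H" and t: "(t, x) \<in> cofun_arrows C E ?H"
      and eq: "arr_map ?H (s, x) = arr_map ?H (t, x)"
    note s = comp_arrows[OF s] and t = comp_arrows[OF t]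
    have "arr_map F (s, anchor G x) = arr_map F (t, anchor G x)"
      using that(2) s t eq unfolding injective_on_arrows_def by metis
    then show "s = t" using that(1) s t unfolding injective_on_arrows_def by metis
  qed
  moreover have "surjective_on_arrows C E ?H" if sF: "surjective_on_arrows C D F" and sG: "surjective_on_arrows D E G"
    unfolding surjective_on_arrows_def
  proof
    fix t assume t: "t \<in> B.Y.Arr"
    then obtain v where v: "(v, dm E t) \<in> cofun_arrows D E G" "arr_map G (v, dm E t) = t"
      using sG unfolding surjective_on_arrows_def by blast
    then have v': "v \<in> A.Y.Arr" "dm D v = anchor G (dm E t)" by (simp_all add: B.in_cofun_arrows)
    then obtain s where s: "(s, dm D v) \<in> cofun_arrows C D F" "arr_map F (s, dm D v) = v"
      using sF unfolding surjective_on_arrows_def by blast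
    have P: "(s, dm E t) \<in> cofun_arrows C E ?H"
      using s v v' B.Y.dm_in[OF t] by (simp add: pullback_set_def comp_cofun_def Let_def)
    then show "\<exists>s. (s, dm E t) \<in> cofun_arrows C E ?H \<and> arr_map ?H (s, dm E t) = t"
      using comp_arrows(3)[OF P] s(2) v v' by auto
  qed
  ultimately show ?thesis
    using assms AB.realizing_cofunctor[OF comp_morphism comp_realizes]
    unfolding cofunctor_of_type_def by blast
qed

end

end

lemma (in representation) id_type: "cofunctor_of_type i C C (id_cofun C)"
proof -
  interpret P: representation_pair C S \<delta> C S \<delta> by (rule representation_pair_refl)
  have "injective_on_arrows C C (id_cofun C)" "surjective_on_arrows C C (id_cofun C)"
    using dm_in by (auto simp add: injective_on_arrows_def surjective_on_arrows_def id_cofun_def Let_def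
        pullback_set_def)
  then show ?thesis
    using P.realizing_cofunctor[OF id_morphism id_realizes] by (simp add: cofunctor_of_type_def)
qed

text \<open>\<open>kind C\<close> is the family of slices that make up the semigroup of
  \<open>C\<close>: compact slices in three of the equivalences, compact bislices in the fourth. The
  condition on images in \<open>Q\<close> lets \<open>cofun_image\<close> land among the represented
  slices of \<open>D\<close>.\<close>

theorem equivalence_criterion:
  fixes \<A> :: "('a, 'z) restr_sgp_scheme set" and \<B> :: "('c, 'o) top_cat set"
    and kind :: "('c, 'o) top_cat \<Rightarrow> 'c set set"
  assumes L: "\<And>S. S \<in> \<A> \<Longrightarrow> \<exists>C\<in>\<B>. \<exists>\<delta>. representation C S \<delta> \<and> \<delta> ` carrier S = kind C"
    and R: "\<And>C. C \<in> \<B> \<Longrightarrow> \<exists>S\<in>\<A>. \<exists>\<delta>. representation C S \<delta> \<and> \<delta> ` carrier S = kind C"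
    and Q: "\<And>C D F. C \<in> \<B> \<Longrightarrow> D \<in> \<B> \<Longrightarrow>
      Q C D F \<longleftrightarrow> cofunctor_of_type i C D F \<and> (\<forall>A\<in>kind C. cofun_image C D F A \<in> kind D)"
  shows "equivalent_categories (sgp_cat i \<A>) (cofun_cat Q \<B>)"
proof -
  define \<T> where "\<T> = {(S, C, \<delta>). S \<in> \<A> \<and> C \<in> \<B> \<and> representation C S \<delta> \<and> \<delta> ` carrier S = kind C}"
  define Rel where "Rel = (\<lambda>(S :: ('a, 'z) restr_sgp_scheme, C :: ('c, 'o) top_cat, \<delta> :: 'a \<Rightarrow> 'c set)
      (T :: ('a, 'z) restr_sgp_scheme, D :: ('c, 'o) top_cat, \<epsilon> :: 'a \<Rightarrow> 'c set) (\<phi> :: 'a \<Rightarrow> 'a) F.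
      \<forall>s\<in>carrier S. \<epsilon> (\<phi> s) = cofun_image C D F (\<delta> s))"
  have R1: "representation C S \<delta>" if "(S, C, \<delta>) \<in> \<T>" for S C \<delta> using that by (simp add: \<T>_def)
  have pair: "representation_pair C S \<delta> D T \<epsilon>" if "(S, C, \<delta>) \<in> \<T>" "(T, D, \<epsilon>) \<in> \<T>" for S C \<delta> T D \<epsilon>
    using that R1 by (intro representation_pair.intro)
  \<comment> \<open>A cofunctor that realizes a morphism respects \<open>kind\<close>, because its
    images are the slices \<open>\<epsilon> (\<phi> a)\<close>.\<close>
  have Q1: "Q C D F \<longleftrightarrow> cofunctor_of_type i C D F" if t: "(S, C, \<delta>) \<in> \<T>" "(T, D, \<epsilon>) \<in> \<T>"
    and m: "sgp_morphism S T \<phi>" and r: "realizes C S \<delta> D \<epsilon> \<phi> F" for S C \<delta> T D \<epsilon> \<phi> F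
  proof -
    interpret representation_pair C S \<delta> D T \<epsilon> by (rule pair[OF t])
    have "cofun_image C D F A \<in> kind D" if A: "A \<in> kind C" for A
    proof -
      have "A \<in> \<delta> ` carrier S" using A t(1) by (simp add: \<T>_def)
      then obtain a where "a \<in> carrier S" "A = \<delta> a" by blast
      then have "\<phi> a \<in> carrier T" "\<epsilon> (\<phi> a) = cofun_image C D F A"
        using realizing_corr[OF m r] mor_in[OF m] by (auto simp add: corr_def)
      then show ?thesis using t(2) by (auto simp add: \<T>_def)
    qed
    then show ?thesis using Q t by (auto simp add: \<T>_def)
  qed
  \<comment> \<open>Once \<open>F\<close> realizes \<open>\<phi>\<close>, the type of
    \<open>\<phi>\<close> and the type of \<open>F\<close> are interchangeable, so either side may
    carry it.\<close>
  have main: "morphism_of_type i S T \<phi> \<and> Rel (S, C, \<delta>) (T, D, \<epsilon>) \<phi> F \<longleftrightarrow>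
      sgp_morphism S T \<phi> \<and> realizes C S \<delta> D \<epsilon> \<phi> F \<and> Q C D F"
    if t: "(S, C, \<delta>) \<in> \<T>" "(T, D, \<epsilon>) \<in> \<T>" and F: "is_cofunctor C D F" for S C \<delta> T D \<epsilon> \<phi> F
  proof -
    interpret representation_pair C S \<delta> D T \<epsilon> by (rule pair[OF t])
    have "Rel (S, C, \<delta>) (T, D, \<epsilon>) \<phi> F \<longleftrightarrow> corr \<phi> F" by (simp add: Rel_def corr_def)
    then show ?thesis
      using realizes_iff F morphism_of_type_iff Q1[OF t] by (metis morphism_of_type_def)
  qed
  have hom: "hom (sgp_cat i \<A>) S T = {f. morphism_of_type i S T f}" "objs (sgp_cat i \<A>) = \<A>"
    "ident (sgp_cat i \<A>) S = restrict (\<lambda>x. x) (carrier S)"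
    "cmp (sgp_cat i \<A>) S T U g f = compose (carrier S) g f" for S T U f g
    by (simp_all add: sgp_cat_def)
  have homB: "hom (cofun_cat Q \<B>) C D = {F. Q C D F}" "objs (cofun_cat Q \<B>) = \<B>"
    "ident (cofun_cat Q \<B>) C = id_cofun C"
    "cmp (cofun_cat Q \<B>) C D E G F = comp_cofun C E G F" for C D E F G
    by (simp_all add: cofun_cat_def)
  have fwd: "\<exists>!F. Q C D F \<and> Rel (S, C, \<delta>) (T, D, \<epsilon>) \<phi> F"
    if t: "(S, C, \<delta>) \<in> \<T>" "(T, D, \<epsilon>) \<in> \<T>" and m: "morphism_of_type i S T \<phi>" for S C \<delta> T D \<epsilon> \<phi>
  proof -
    interpret representation_pair C S \<delta> D T \<epsilon> by (rule pair[OF t])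
    have m': "sgp_morphism S T \<phi>" using m by (simp add: morphism_of_type_def)
    have "is_cofunctor C D F" if "Q C D F" for F
      using that Q t by (auto simp add: \<T>_def cofunctor_of_type_def)
    then have "Q C D F \<and> Rel (S, C, \<delta>) (T, D, \<epsilon>) \<phi> F \<longleftrightarrow> realizes C S \<delta> D \<epsilon> \<phi> F" for F
      using main[OF t, of F \<phi>] m m' realizing_cofunctor[OF m'] Q1[OF t m'] morphism_of_type_iff[OF m'] by blast
    then show ?thesis using realizing_exists[OF m'] realizes_unique[OF m'] by metis
  qed
  have bwd: "\<exists>!\<phi>. morphism_of_type i S T \<phi> \<and> Rel (S, C, \<delta>) (T, D, \<epsilon>) \<phi> F"
    if t: "(S, C, \<delta>) \<in> \<T>" "(T, D, \<epsilon>) \<in> \<T>" and q: "Q C D F" for S C \<delta> T D \<epsilon> F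
  proof -
    interpret representation_pair C S \<delta> D T \<epsilon> by (rule pair[OF t])
    have F: "is_cofunctor C D F" and img: "\<And>A. A \<in> kind C \<Longrightarrow> cofun_image C D F A \<in> kind D"
      using q Q t by (auto simp add: \<T>_def cofunctor_of_type_def)
    have "cofun_image C D F (\<delta> s) \<in> \<epsilon> ` carrier T" if "s \<in> carrier S" for s
      using img[of "\<delta> s"] that t by (auto simp add: \<T>_def)
    then obtain \<phi> where \<phi>: "sgp_morphism S T \<phi>" "corr \<phi> F"
      using morphism_of_cofunctor[OF F] by blast
    have "morphism_of_type i S T \<phi> \<and> Rel (S, C, \<delta>) (T, D, \<epsilon>) \<phi> F"
      using main[OF t F] \<phi> realizes_iff F q by blast
    moreover have "\<phi> = \<psi>" if "morphism_of_type i S T \<psi> \<and> Rel (S, C, \<delta>) (T, D, \<epsilon>) \<psi> F" for \<psi>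
    proof (rule corr_unique)
      show "corr \<phi> F" by (rule \<phi>(2))
      show "corr \<psi> F" using that by (simp add: Rel_def corr_def)
      show "\<phi> \<in> carrier S \<rightarrow>\<^sub>E carrier T" "\<psi> \<in> carrier S \<rightarrow>\<^sub>E carrier T"
        using \<phi>(1) that by (simp_all add: sgp_morphism_def morphism_of_type_def)
    qed
    ultimately show ?thesis by blast
  qed
  have idn: "Q C C (id_cofun C) \<and> morphism_of_type i S S (restrict (\<lambda>x. x) (carrier S)) \<and>
      Rel (S, C, \<delta>) (S, C, \<delta>) (restrict (\<lambda>x. x) (carrier S)) (id_cofun C)"
    if t: "(S, C, \<delta>) \<in> \<T>" for S C \<delta>
  proof -
    interpret representation C S \<delta> by (rule R1[OF t])
    have "is_cofunctor C C (id_cofun C)" using id_type[of i] by (simp add: cofunctor_of_type_def)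
    then show ?thesis
      using main[OF t t, of "id_cofun C"] id_type[of i] id_morphism id_realizes Q1[OF t t id_morphism id_realizes] by blast
  qed
  have comp: "Q C E (comp_cofun C E G F) \<and> morphism_of_type i S U (compose (carrier S) \<psi> \<phi>) \<and>
      Rel (S, C, \<delta>) (U, E, \<zeta>) (compose (carrier S) \<psi> \<phi>) (comp_cofun C E G F)"
    if t: "(S, C, \<delta>) \<in> \<T>" "(T, D, \<epsilon>) \<in> \<T>" "(U, E, \<zeta>) \<in> \<T>" and
      m: "morphism_of_type i S T \<phi>" "morphism_of_type i T U \<psi>" and q: "Q C D F" "Q D E G" and
      r: "Rel (S, C, \<delta>) (T, D, \<epsilon>) \<phi> F" "Rel (T, D, \<epsilon>) (U, E, \<zeta>) \<psi> G" for S C \<delta> T D \<epsilon> U E \<zeta> \<phi> \<psi> F G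
  proof -
    have ty: "cofunctor_of_type i C D F" "cofunctor_of_type i D E G"
      using q Q t by (auto simp add: \<T>_def)
    then have cof: "is_cofunctor C D F" "is_cofunctor D E G" by (simp_all add: cofunctor_of_type_def)
    have m': "sgp_morphism S T \<phi>" "sgp_morphism T U \<psi>"
      and re: "realizes C S \<delta> D \<epsilon> \<phi> F" "realizes D T \<epsilon> E \<zeta> \<psi> G"
      using main[OF t(1,2) cof(1)] main[OF t(2,3) cof(2)] m r q by blast+
    note reps = R1[OF t(1)] R1[OF t(2)] R1[OF t(3)]
    note cm = comp_morphism[OF reps m'] and cr = comp_realizes[OF reps m' re]
      and ct = comp_type[OF reps m' re ty]
    have "is_cofunctor C E (comp_cofun C E G F)" using ct by (simp add: cofunctor_of_type_def)
    then show ?thesis using main[OF t(1,3)] cm cr ct Q1[OF t(1,3) cm cr] by blast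
  qed
  have exT: "\<exists>C \<delta>. (S, C, \<delta>) \<in> \<T>" if "S \<in> \<A>" for S using L[OF that] that by (auto simp add: \<T>_def)
  have exT': "\<exists>S \<delta>. (S, C, \<delta>) \<in> \<T>" if "C \<in> \<B>" for C using R[OF that] that by (auto simp add: \<T>_def)
  have idA: "morphism_of_type i S S (restrict (\<lambda>x. x) (carrier S))" if "S \<in> \<A>" for S
    using exT[OF that] idn by blast
  \<comment> \<open>That the types are closed under composition is read off from cofunctors, where
    they mean injectivity and surjectivity on arrows.\<close>
  have compA: "morphism_of_type i S U (compose (carrier S) g f)"
    if o: "S \<in> \<A>" "T \<in> \<A>" "U \<in> \<A>" and f: "morphism_of_type i S T f" "morphism_of_type i T U g" for S T U f g
  proof -
    obtain C \<delta> D \<epsilon> E \<zeta> where t: "(S, C, \<delta>) \<in> \<T>" "(T, D, \<epsilon>) \<in> \<T>" "(U, E, \<zeta>) \<in> \<T>"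
      using exT o by meson
    show ?thesis using fwd[OF t(1,2) f(1)] fwd[OF t(2,3) f(2)] comp[OF t f] by blast
  qed
  have mem: "f \<in> carrier S \<rightarrow>\<^sub>E carrier T" if "morphism_of_type i S T f" for S T :: "('a, 'z) restr_sgp_scheme" and f
    using that by (simp add: morphism_of_type_def sgp_morphism_def)
  have unitA: "compose (carrier S) f (restrict (\<lambda>x. x) (carrier S)) = f \<and>
      compose (carrier S) (restrict (\<lambda>x. x) (carrier T)) f = f"
    if "morphism_of_type i S T f" for S T :: "('a, 'z) restr_sgp_scheme" and f
    using mem[OF that] by (auto simp add: fun_eq_iff compose_def PiE_iff extensional_def)
  have catA: "is_category (sgp_cat i \<A>)"
    unfolding is_category_def hom
  proof (intro conjI ballI)
    show "compose (carrier W) (compose (carrier X) h g) f = compose (carrier W) h (compose (carrier W) g f)"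
      if "f \<in> {f. morphism_of_type i W X f}" for W X Y Z :: "('a, 'z) restr_sgp_scheme" and f g h
      using mem[of W X f] that by (auto simp add: compose_def fun_eq_iff PiE_iff)
    show "compose (carrier X) g f \<in> {f. morphism_of_type i X Z f}"
      if "X \<in> \<A>" "Y \<in> \<A>" "Z \<in> \<A>" "f \<in> {f. morphism_of_type i X Y f}"
        "g \<in> {f. morphism_of_type i Y Z f}" for X Y Z f g
      using compA[OF that(1-3)] that(4,5) by simp
  qed (use idA unitA in simp_all)
  show ?thesis
  proof (rule equivalent_categories_of_correspondence[OF catA, where T = \<T> and a = fst and
        b = "\<lambda>t. fst (snd t)" and Rel = Rel], unfold hom homB)
    show "\<exists>!g. g \<in> {F. Q (fst (snd t)) (fst (snd t')) F} \<and> Rel t t' f g"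
      if "t \<in> \<T>" "t' \<in> \<T>" "f \<in> {f. morphism_of_type i (fst t) (fst t') f}" for t t' f
      using fwd that by (cases t; cases t') simp
    show "\<exists>!f. f \<in> {f. morphism_of_type i (fst t) (fst t') f} \<and> Rel t t' f g"
      if "t \<in> \<T>" "t' \<in> \<T>" "g \<in> {F. Q (fst (snd t)) (fst (snd t')) F}" for t t' g
      using bwd that by (cases t; cases t') simp
    show "id_cofun (fst (snd t)) \<in> {F. Q (fst (snd t)) (fst (snd t)) F} \<and>
        Rel t t (restrict (\<lambda>x. x) (carrier (fst t))) (id_cofun (fst (snd t)))" if "t \<in> \<T>" for t
      using idn that by (cases t) simp
    show "comp_cofun (fst (snd t)) (fst (snd t'')) g' g \<in> {F. Q (fst (snd t)) (fst (snd t'')) F} \<and>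
        Rel t t'' (compose (carrier (fst t)) f' f) (comp_cofun (fst (snd t)) (fst (snd t'')) g' g)"
      if "t \<in> \<T>" "t' \<in> \<T>" "t'' \<in> \<T>" "f \<in> {f. morphism_of_type i (fst t) (fst t') f}"
        "f' \<in> {f. morphism_of_type i (fst t') (fst t'') f}"
        "g \<in> {F. Q (fst (snd t)) (fst (snd t')) F}" "g' \<in> {F. Q (fst (snd t')) (fst (snd t'')) F}"
        "Rel t t' f g" "Rel t' t'' f' g'" for t t' t'' f f' g g'
      using comp that by (cases t; cases t'; cases t'') auto
    show "fst t \<in> \<A>" "fst (snd t) \<in> \<B>" if "t \<in> \<T>" for t using that by (auto simp add: \<T>_def)
    show "\<exists>t\<in>\<T>. fst t = X" if "X \<in> \<A>" for X using exT[OF that] by force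
    show "\<exists>t\<in>\<T>. fst (snd t) = Y" if "Y \<in> \<B>" for Y using exT'[OF that] by force
  qed
qed

section \<open>Range operations and bislices\<close>

text \<open>The comparison with cofunctors concerns product and star alone, so the range operation
  is recorded separately.\<close>

definition range_representation ::
  "('c, 'o) top_cat \<Rightarrow> ('a, 'z) range_sgp_scheme \<Rightarrow> ('a \<Rightarrow> 'c set) \<Rightarrow> bool" where
  "range_representation C S \<delta> \<longleftrightarrow>
    (\<forall>s\<in>carrier S. plus S s \<in> carrier S \<and> \<delta> (plus S s) = un C ` rg C ` \<delta> s)"

lemma (in ample_category) open_map_rgI:
  assumes "\<And>W a. openin (C1 C) W \<Longrightarrow> a \<in> W \<Longrightarrow>
      \<exists>A. openin (C1 C) A \<and> a \<in> A \<and> A \<subseteq> W \<and> openin (C0 C) (rg C ` A)"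
  shows "open_map (C1 C) (C0 C) (rg C)"
  unfolding open_map_def
proof (intro allI impI)
  fix W assume W: "openin (C1 C) W"
  show "openin (C0 C) (rg C ` W)"
  proof (subst openin_subopen, intro ballI)
    fix x assume "x \<in> rg C ` W"
    then obtain a where a: "a \<in> W" "x = rg C a" by blast
    obtain A where "a \<in> A" "A \<subseteq> W" "openin (C0 C) (rg C ` A)" using assms[OF W a(1)] by blast
    then show "\<exists>T. openin (C0 C) T \<and> x \<in> T \<and> T \<subseteq> rg C ` W"
      using a(2) by (intro exI[of _ "rg C ` A"]) auto
  qed
qed

text \<open>On a compact bislice \<open>rg\<close> is injective, continuous and open, hence a
  homeomorphism onto an open set.\<close>

lemma (in ample_category) biampleI:
  assumes basis: "\<And>W a. openin (C1 C) W \<Longrightarrow> a \<in> W \<Longrightarrow> \<exists>A. compact_bislice C A \<and> a \<in> A \<and> A \<subseteq> W"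
    and rg: "open_map (C1 C) (C0 C) (rg C)"
  shows "biample C"
proof -
  have open_bi: "openin (C1 C) A" if "compact_bislice C A" for A
    using that by (simp add: compact_bislice_def is_bislice_def is_slice_def)
  have "local_homeomorphism (C1 C) (C0 C) (rg C)"
    unfolding local_homeomorphism_def
  proof (intro conjI ballI)
    show "rg C \<in> Arr \<rightarrow> Ob" using rg_in by blast
    fix a assume "a \<in> Arr"
    then obtain A where A: "compact_bislice C A" "a \<in> A" using basis[of Arr a] by auto
    have oA: "openin (C1 C) A" using open_bi A by blast
    have oR: "openin (C0 C) (rg C ` A)" using rg oA by (simp add: open_map_def)
    have AO: "A \<subseteq> Arr" "rg C ` A \<subseteq> Ob" using oA oR openin_subset by blast+
    have "homeomorphic_map (subtopology (C1 C) A) (subtopology (C0 C) (rg C ` A)) (rg C)"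
    proof (rule bijective_open_imp_homeomorphic_map)
      show "continuous_map (subtopology (C1 C) A) (subtopology (C0 C) (rg C ` A)) (rg C)"
        using continuous_map_from_subtopology[OF cont_rg]
        by (auto simp add: continuous_map_in_subtopology)
      show "open_map (subtopology (C1 C) A) (subtopology (C0 C) (rg C ` A)) (rg C)"
        unfolding open_map_def
      proof (intro allI impI)
        fix W assume W: "openin (subtopology (C1 C) A) W"
        then have "openin (C1 C) W" "W \<subseteq> A" using oA openin_trans_full openin_imp_subset by blast+
        then have "openin (C0 C) (rg C ` W)" "rg C ` W \<subseteq> rg C ` A" using rg by (auto simp add: open_map_def)
        then show "openin (subtopology (C0 C) (rg C ` A)) (rg C ` W)"
          using oR by (simp add: openin_open_subtopology)
      qed
      show "rg C ` topspace (subtopology (C1 C) A) = topspace (subtopology (C0 C) (rg C ` A))"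
        using AO by auto
      show "inj_on (rg C) (topspace (subtopology (C1 C) A))"
        using A(1) AO by (simp add: compact_bislice_iff inf_absorb2)
    qed
    then show "\<exists>U. openin (C1 C) U \<and> a \<in> U \<and> openin (C0 C) (rg C ` U) \<and>
        homeomorphic_map (subtopology (C1 C) U) (subtopology (C0 C) (rg C ` U)) (rg C)"
      using oA oR A(2) by blast
  qed
  moreover have "openin (C1 C) = arbitrary union_of (compact_bislice C)"
    using openin_topology_base_unique[of "C1 C" "compact_bislice C"] open_bi basis by blast
  ultimately show ?thesis using ample by (simp add: biample_def bietale_category_def ample_def)
qed

lemma biample_ample:
  assumes "biample C"
  shows "ample C"
proof -
  have "openin (C1 C) = arbitrary union_of (compact_bislice C)" using assms by (simp add: biample_def)
  then have "(\<forall>V. compact_bislice C V \<longrightarrow> openin (C1 C) V) \<and>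
      (\<forall>U x. openin (C1 C) U \<and> x \<in> U \<longrightarrow> (\<exists>V. compact_bislice C V \<and> x \<in> V \<and> V \<subseteq> U))"
    using openin_topology_base_unique by metis
  then have "openin (C1 C) = arbitrary union_of (compact_slice C)"
    using openin_topology_base_unique[of "C1 C" "compact_slice C"]
    by (meson compact_bislice_slice compact_slice_def is_slice_def)
  then show ?thesis using assms by (simp add: ample_def biample_def bietale_category_def)
qed

lemma biample_strongly_ample: "biample C \<Longrightarrow> strongly_ample C"
  using biample_ample open_map_local_homeomorphism
  by (auto simp add: strongly_ample_def biample_def bietale_category_def)

lemma biample_basis:
  assumes "biample C" "openin (C1 C) W" "a \<in> W"
  obtains A where "compact_bislice C A" "a \<in> A" "A \<subseteq> W"
proof -
  have "(arbitrary union_of (compact_bislice C)) W" using assms by (simp add: biample_def)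
  then show ?thesis using assms(3) that by (auto simp add: arbitrary_union_of_alt)
qed

text \<open>\<open>s\<^sup>+\<close> is the least projection \<open>p\<close> with \<open>p s = s\<close>, while \<open>r(\<delta> s)\<close> is compact, hence the
  intersection of the compact open sets containing it.\<close>

lemma (in representation) range_representation_of_range_semigroup:
  fixes S' :: "('a, 'y) range_sgp_scheme"
  assumes R: "range_semigroup S'"
    and S: "carrier S' = carrier S" "mult S' = mult S" "star S' = star S"
  shows "range_representation C S' \<delta>"
  unfolding range_representation_def
proof (intro ballI conjI)
  fix s assume "s \<in> carrier S'"
  then have s: "s \<in> carrier S" using S by simp
  have pl: "plus S' s \<in> carrier S" "mult S (plus S' s) s = s" "star S (plus S' s) = plus S' s"
    using R s S by (simp_all add: range_semigroup_def)
  have pe: "plus S' e = e" if "e \<in> projections S" for e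
    using R S that by (auto simp add: range_semigroup_def projections_def)
  show "plus S' s \<in> carrier S'" using pl S by simp
  define p where "p = plus S' s"
  have p: "p \<in> projections S" using pl unfolding p_def projections_def by (metis imageI)
  then have pc: "p \<in> carrier S" using projection_carrier by blast
  define U where "U = dm C ` \<delta> p"
  have \<delta>p: "\<delta> p = un C ` U" using rep_projection[OF p] by (simp add: U_def)
  have U: "compact_open (C0 C) U" using compact_open_dm_rep[OF pc] by (simp add: U_def)
  have UO: "U \<subseteq> Ob" using compact_open_subset U by blast
  have "\<delta> s = \<delta> (mult S p s)" using pl(2) by (simp add: p_def)
  also have "\<dots> = {a \<in> \<delta> s. rg C a \<in> U}"
    using rep_mult[OF pc s] slice_prod_un_left[OF rep_subset[OF s] UO] \<delta>p by simp
  finally have sub: "rg C ` \<delta> s \<subseteq> U" by blast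
  have "U \<subseteq> rg C ` \<delta> s"
  proof (rule ccontr)
    assume "\<not> U \<subseteq> rg C ` \<delta> s"
    then obtain y where y: "y \<in> U" "y \<notin> rg C ` \<delta> s" by blast
    have "compactin (C0 C) (rg C ` \<delta> s)"
      using image_compactin[OF _ cont_rg] slice[OF s] by (simp add: compact_slice_def)
    then have "openin (C0 C) (Ob - rg C ` \<delta> s)"
      using compact_closed by (simp add: closedin_def)
    then obtain W where W: "compact_open (C0 C) W" "y \<in> W" "W \<subseteq> Ob - rg C ` \<delta> s"
      using compact_open_nbhd[of "Ob - rg C ` \<delta> s" y] y UO by blast
    \<comment> \<open>\<open>W\<close> is a compact open neighbourhood of a point of
      \<open>U\<close> that is not a range, chosen to miss all ranges. The projection over the rest
      of \<open>U\<close> therefore still fixes \<open>s\<close>.\<close>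
    obtain e where e: "e \<in> projections S" "\<delta> e = un C ` (U - W)" "dm C ` \<delta> e = U - W"
      using projection_exists[OF compact_open_Diff[OF U W(1)]] .
    have ec: "e \<in> carrier S" using e projection_carrier by blast
    have "\<delta> (mult S e s) = {a \<in> \<delta> s. rg C a \<in> U - W}"
      using rep_mult[OF ec s] slice_prod_un_left[OF rep_subset[OF s], of "U - W"] UO e(2) by auto
    also have "\<dots> = \<delta> s" using sub W(3) by blast
    finally have es: "mult S e s = s" using rep_eqI[OF mult_closed[OF ec s] s] by simp
    \<comment> \<open>Minimality in algebraic form: the law
      \<open>(x y)\<^sup>+ = (x y\<^sup>+)\<^sup>+\<close> turns \<open>e s = s\<close> into
      \<open>p = e p\<close>.\<close>
    have "plus S' (mult S e s) = plus S' (mult S e p)"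
      using R s ec S by (simp add: range_semigroup_def p_def)
    also have "\<dots> = mult S e p" using pe projection_mult(1)[OF e(1) p] by blast
    finally have "p = mult S e p" using es by (simp add: p_def)
    then have "\<delta> p \<subseteq> \<delta> e" using projection_mult(2)[OF e(1) p] by auto
    then have "U \<subseteq> U - W" using e(3) U_def by blast
    then show False using y W by blast
  qed
  then show "\<delta> (plus S' s) = un C ` rg C ` \<delta> s" using sub \<delta>p by (simp add: p_def)
qed

lemma (in representation) rep_eq_iff: "s \<in> carrier S \<Longrightarrow> t \<in> carrier S \<Longrightarrow> s = t \<longleftrightarrow> \<delta> s = \<delta> t"
  using rep_eqI by blast

locale range_rep = representation C S \<delta>
  for C :: "('c, 'o) top_cat" and S :: "('a, 'z) range_sgp_scheme" and \<delta> :: "'a \<Rightarrow> 'c set" +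
  assumes range_rep: "range_representation C S \<delta>"
begin

lemma plus_closed: "s \<in> carrier S \<Longrightarrow> plus S s \<in> carrier S"
  and rep_plus: "s \<in> carrier S \<Longrightarrow> \<delta> (plus S s) = un C ` rg C ` \<delta> s"
  using range_rep by (simp_all add: range_representation_def)

lemma rg_rep_subset: "s \<in> carrier S \<Longrightarrow> rg C ` \<delta> s \<subseteq> Ob"
  using rep_subset rg_in by blast

lemma plus_projection: "s \<in> carrier S \<Longrightarrow> plus S s \<in> projections S"
  by (rule projectionI[OF plus_closed rep_plus rg_rep_subset])

lemma compact_open_rg_rep: "s \<in> carrier S \<Longrightarrow> compact_open (C0 C) (rg C ` \<delta> s)"
  using compact_open_dm_rep[OF plus_closed] rep_plus rg_rep_subset by simp

text \<open>The ranges of a represented slice are the objects of the represented projection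
  \<open>plus S s\<close>, hence a compact open set. An algebraic range operation thus forces
  \<open>rg\<close> to be open.\<close>

lemma open_map_rg: "open_map (C1 C) (C0 C) (rg C)"
proof (rule open_map_rgI)
  fix W a assume "openin (C1 C) W" "a \<in> W"
  then obtain s where "s \<in> carrier S" "a \<in> \<delta> s" "\<delta> s \<subseteq> W" using basis by blast
  then show "\<exists>A. openin (C1 C) A \<and> a \<in> A \<and> A \<subseteq> W \<and> openin (C0 C) (rg C ` A)"
    using slice compact_open_rg_rep by (metis compact_open_def compact_slice_def is_slice_def)
qed

lemma strongly_ample: "strongly_ample C"
  using ample open_map_rg by (simp add: strongly_ample_def)

section \<open>Laws of the range operation on slices\<close>

lemma rep_plus_mult:
  "s \<in> carrier S \<Longrightarrow> t \<in> carrier S \<Longrightarrow> \<delta> (mult S (plus S s) t) = {b \<in> \<delta> t. rg C b \<in> rg C ` \<delta> s}"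
  by (simp add: rep_mult plus_closed rep_plus slice_prod_un_left rep_subset rg_rep_subset)

lemma rep_mult_plus:
  "s \<in> carrier S \<Longrightarrow> t \<in> carrier S \<Longrightarrow> \<delta> (mult S s (plus S t)) = {a \<in> \<delta> s. dm C a \<in> rg C ` \<delta> t}"
  by (simp add: rep_mult plus_closed rep_plus slice_prod_un_right rep_subset rg_rep_subset)

lemma rg_slice_prod:
  assumes "s \<in> carrier S" "t \<in> carrier S"
  shows "rg C ` slice_prod C (\<delta> s) (\<delta> t) = rg C ` {a \<in> \<delta> s. dm C a \<in> rg C ` \<delta> t}"
proof (intro equalityI subsetI)
  fix x assume "x \<in> rg C ` slice_prod C (\<delta> s) (\<delta> t)"
  then obtain a b where ab: "x = rg C (mu C a b)" "a \<in> \<delta> s" "b \<in> \<delta> t" "rg C b = dm C a"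
    by (auto simp add: slice_prod_def)
  then have "a \<in> Arr" "b \<in> Arr" using rep_subset[OF assms(1)] rep_subset[OF assms(2)] by auto
  then have "x = rg C a" using ab(1,4) by simp
  moreover have "dm C a \<in> rg C ` \<delta> t" using ab by (metis image_eqI)
  ultimately show "x \<in> rg C ` {a \<in> \<delta> s. dm C a \<in> rg C ` \<delta> t}" using ab(2) by blast
next
  fix x assume "x \<in> rg C ` {a \<in> \<delta> s. dm C a \<in> rg C ` \<delta> t}"
  then obtain a b where ab: "x = rg C a" "a \<in> \<delta> s" "b \<in> \<delta> t" "rg C b = dm C a" by auto
  then have "mu C a b \<in> slice_prod C (\<delta> s) (\<delta> t)" by (auto simp add: slice_prod_def)
  moreover have "a \<in> Arr" "b \<in> Arr" using ab rep_subset[OF assms(1)] rep_subset[OF assms(2)] by auto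
  then have "x = rg C (mu C a b)" using ab(1,4) by simp
  ultimately show "x \<in> rg C ` slice_prod C (\<delta> s) (\<delta> t)" by blast
qed

lemma range_semigroup: "range_semigroup S"
proof -
  have px: "mult S (plus S x) x = x" if "x \<in> carrier S" for x
    by (rule rep_eqI) (auto simp add: that mult_closed plus_closed rep_plus_mult)
  have pp: "\<delta> (mult S (plus S x) (plus S y)) = un C ` (rg C ` \<delta> x \<inter> rg C ` \<delta> y)"
    if "x \<in> carrier S" "y \<in> carrier S" for x y
    by (simp add: that plus_closed rep_mult rep_plus slice_prod_un_un rg_rep_subset)
  have comm: "mult S (plus S x) (plus S y) = mult S (plus S y) (plus S x)"
    if "x \<in> carrier S" "y \<in> carrier S" for x y
    by (rule rep_eqI) (simp_all add: that mult_closed plus_closed pp Int_commute)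
  have pe: "plus S e = e" if e: "e \<in> projections S" for e
  proof (rule rep_eqI)
    have ec: "e \<in> carrier S" using e projection_carrier by blast
    then show "e \<in> carrier S" "plus S e \<in> carrier S" using plus_closed by auto
    have "rg C ` un C ` U = U" if "U \<subseteq> Ob" for U
      using that rg_un by (auto simp add: image_image subset_iff)
    then have "rg C ` un C ` dm C ` \<delta> e = dm C ` \<delta> e" using dm_rep_subset[OF ec] by blast
    then show "\<delta> (plus S e) = \<delta> e" using rep_plus[OF ec] rep_projection[OF e] by simp
  qed
  have c2: "mult S (plus S y) (plus S x) = plus S (mult S (plus S x) (plus S y))"
    if "x \<in> carrier S" "y \<in> carrier S" for x y
    using pe[OF projection_mult(1)[OF plus_projection[OF that(2)] plus_projection[OF that(1)]]] comm[OF that]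
    by simp
  have c3: "plus S (mult S x y) = plus S (mult S x (plus S y))"
    if "x \<in> carrier S" "y \<in> carrier S" for x y
    by (rule rep_eqI) (simp_all add: that mult_closed plus_closed rep_plus rep_mult_plus rg_slice_prod rep_mult[of x y])
  have c4: "star S (plus S x) = plus S x \<and> plus S (star S x) = star S x" if "x \<in> carrier S" for x
    using projection_star[OF plus_projection[OF that]] pe[of "star S x"] imageI[OF that, of "star S"]
    unfolding projections_def by blast
  show ?thesis
    unfolding range_semigroup_def
    by (intro conjI ballI; (rule restriction_semigroup plus_closed px comm c2 c3 c4[THEN conjunct1] c4[THEN conjunct2]; assumption))
qed

text \<open>For each \<open>e\<close> the equation says that an arrow of \<open>\<delta> s\<close>
  sharing its range with an arrow of \<open>\<delta> s\<close> over \<open>e\<close> lies itself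
  over \<open>e\<close>. Since projections separate objects, two arrows with the same range must
  have the same domain too.\<close>

lemma rg_inj_iff:
  assumes s: "s \<in> carrier S"
  shows "inj_on (rg C) (\<delta> s) \<longleftrightarrow> (\<forall>e\<in>projections S. mult S s e = mult S (plus S (mult S s e)) s)"
proof -
  have eq: "mult S s e = mult S (plus S (mult S s e)) s \<longleftrightarrow>
      {a \<in> \<delta> s. dm C a \<in> dm C ` \<delta> e} = {a \<in> \<delta> s. rg C a \<in> rg C ` {a \<in> \<delta> s. dm C a \<in> dm C ` \<delta> e}}"
    if e: "e \<in> projections S" for e
  proof -
    have ec: "e \<in> carrier S" using e projection_carrier by blast
    have 1: "\<delta> (mult S s e) = {a \<in> \<delta> s. dm C a \<in> dm C ` \<delta> e}"
      using rep_mult_star[OF s ec] projection_star[OF e] by simp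
    note c = mult_closed[OF s ec]
    show ?thesis
      unfolding rep_eq_iff[OF c mult_closed[OF plus_closed[OF c] s]] rep_plus_mult[OF c s] 1 ..
  qed
  show ?thesis
  proof
    assume inj: "inj_on (rg C) (\<delta> s)"
    show "\<forall>e\<in>projections S. mult S s e = mult S (plus S (mult S s e)) s"
    proof
      fix e assume "e \<in> projections S"
      from eq[OF this] show "mult S s e = mult S (plus S (mult S s e)) s"
        using inj unfolding inj_on_def by blast
    qed
  next
    assume *: "\<forall>e\<in>projections S. mult S s e = mult S (plus S (mult S s e)) s"
    show "inj_on (rg C) (\<delta> s)"
    proof (rule inj_onI)
      fix a b assume ab: "a \<in> \<delta> s" "b \<in> \<delta> s" and r: "rg C a = rg C b"
      have O: "dm C a \<in> Ob" "dm C b \<in> Ob" using ab dm_rep_subset[OF s] by blast+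
      have "dm C a = dm C b"
      proof (rule separation_eq[OF O])
        fix U assume U: "compact_open (C0 C) U" "dm C a \<in> U"
        obtain e where e: "e \<in> projections S" "dm C ` \<delta> e = U"
          using projection_exists[OF U(1)] by metis
        have "{a \<in> \<delta> s. dm C a \<in> U} = {a \<in> \<delta> s. rg C a \<in> rg C ` {a \<in> \<delta> s. dm C a \<in> U}}"
          using eq[OF e(1)] * e by simp
        moreover have "rg C b \<in> rg C ` {a \<in> \<delta> s. dm C a \<in> U}"
          using ab(1) U(2) r by (metis (mono_tags, lifting) image_eqI mem_Collect_eq)
        ultimately show "dm C b \<in> U" using ab(2) by blast
      qed
      then show "a = b" using rep_inj[OF s] ab by blast
    qed
  qed
qed

text \<open>One half of the condition is the law \<open>x\<^sup>* y = y (x y)\<^sup>*\<close> at a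
  projection; the other half is injectivity of \<open>rg\<close> by
  \<open>rg_inj_iff\<close>.\<close>

lemma bideterministic_iff:
  assumes s: "s \<in> carrier S"
  shows "bideterministic S s \<longleftrightarrow> compact_bislice C (\<delta> s)"
proof -
  have *: "mult S e s = mult S s (star S (mult S e s))" if e: "e \<in> projections S" for e
  proof -
    have "mult S (star S e) s = mult S s (star S (mult S e s))"
      using restriction_semigroup s projection_carrier[OF e] unfolding restriction_semigroup_def by blast
    then show ?thesis unfolding projection_star[OF e] .
  qed
  have "bideterministic S s \<longleftrightarrow> (\<forall>e\<in>projections S. mult S s e = mult S (plus S (mult S s e)) s)"
    unfolding bideterministic_def
    by (rule ball_cong[OF refl], rule iffI, erule conjunct2, rule conjI[OF *], assumption+)
  then show ?thesis using rg_inj_iff[OF s] slice[OF s] by (simp only: compact_bislice_iff simp_thms)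
qed

text \<open>The law for \<open>x\<close> and \<open>y\<close> depends on \<open>y\<close> only
  through \<open>plus S y\<close>, and these elements are exactly the projections. So the law
  becomes the criterion of \<open>rg_inj_iff\<close> for \<open>x\<close>.\<close>

lemma birestriction_iff:
  "birestriction_semigroup S \<longleftrightarrow> (\<forall>s\<in>carrier S. compact_bislice C (\<delta> s))"
proof -
  have pe: "plus S e = e" if "e \<in> projections S" for e
    using range_semigroup that by (auto simp add: range_semigroup_def projections_def)
  have pp: "plus S (mult S x y) = plus S (mult S x (plus S y))" if "x \<in> carrier S" "y \<in> carrier S" for x y
    using range_semigroup that by (auto simp add: range_semigroup_def)
  have "(\<forall>y\<in>carrier S. mult S x (plus S y) = mult S (plus S (mult S x y)) x) \<longleftrightarrow>
      compact_bislice C (\<delta> x)" if x: "x \<in> carrier S" for x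
  proof -
    have "(\<forall>y\<in>carrier S. mult S x (plus S y) = mult S (plus S (mult S x y)) x) \<longleftrightarrow>
        (\<forall>e\<in>projections S. mult S x e = mult S (plus S (mult S x e)) x)"
      using pe pp[OF x] plus_projection projection_carrier by metis
    then show ?thesis using rg_inj_iff[OF x] slice[OF x] by (simp add: compact_bislice_iff)
  qed
  then show ?thesis using range_semigroup by (simp add: birestriction_semigroup_def)
qed

lemma bicompatible_iff:
  assumes "s \<in> carrier S" "t \<in> carrier S"
    and inj: "inj_on (rg C) (\<delta> s)" "inj_on (rg C) (\<delta> t)"
  shows "mult S (plus S t) s = mult S (plus S s) t \<longleftrightarrow> inj_on (rg C) (\<delta> s \<union> \<delta> t)"
proof -
  have "mult S (plus S t) s = mult S (plus S s) t \<longleftrightarrow>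
      {a \<in> \<delta> s. rg C a \<in> rg C ` \<delta> t} = {a \<in> \<delta> t. rg C a \<in> rg C ` \<delta> s}"
    unfolding rep_eq_iff[OF mult_closed[OF plus_closed[OF assms(2)] assms(1)] mult_closed[OF plus_closed[OF assms(1)] assms(2)]]
      rep_plus_mult[OF assms(1,2)] rep_plus_mult[OF assms(2,1)] ..
  also have "\<dots> \<longleftrightarrow> inj_on (rg C) (\<delta> s \<union> \<delta> t)"
  proof
    assume *: "{a \<in> \<delta> s. rg C a \<in> rg C ` \<delta> t} = {a \<in> \<delta> t. rg C a \<in> rg C ` \<delta> s}"
    have "a = b" if "a \<in> \<delta> s" "b \<in> \<delta> t" "rg C a = rg C b" for a b
    proof -
      have "rg C a \<in> rg C ` \<delta> t" using that(2,3) by auto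
      then have "a \<in> \<delta> t" using * that(1) by blast
      then show ?thesis using inj(2) that by (simp add: inj_on_def)
    qed
    then show "inj_on (rg C) (\<delta> s \<union> \<delta> t)"
      using inj unfolding inj_on_def by (metis (no_types) Un_iff)
  next
    assume "inj_on (rg C) (\<delta> s \<union> \<delta> t)"
    then show "{a \<in> \<delta> s. rg C a \<in> rg C ` \<delta> t} = {a \<in> \<delta> t. rg C a \<in> rg C ` \<delta> s}"
      unfolding inj_on_def by blast
  qed
  finally show ?thesis .
qed

lemma boolean_birestriction:
  assumes K: "\<delta> ` carrier S = Collect (compact_bislice C)"
  shows "boolean_birestriction_semigroup S"
proof -
  have bi: "compact_bislice C (\<delta> s)" if "s \<in> carrier S" for s using K that by blast
  have join: "\<exists>v. is_join S {s, t} v"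
    if st: "s \<in> carrier S" "t \<in> carrier S" "mult S s (star S t) = mult S t (star S s)"
      "mult S (plus S t) s = mult S (plus S s) t" for s t
  proof -
    have "inj_on (dm C) (\<delta> s \<union> \<delta> t)" using compatible_iff[OF st(1,2)] st(3) by (simp add: compatible_def)
    moreover have "inj_on (rg C) (\<delta> s \<union> \<delta> t)"
      using bicompatible_iff[OF st(1,2)] st(4) bi st(1,2) by (simp add: compact_bislice_iff)
    ultimately have "compact_bislice C (\<delta> s \<union> \<delta> t)"
      using compact_slice_Un slice st(1,2) by (simp add: compact_bislice_iff)
    then have "\<delta> s \<union> \<delta> t \<in> \<delta> ` carrier S" using K by blast
    then obtain v where "v \<in> carrier S" "\<delta> v = \<delta> s \<union> \<delta> t" by auto
    then show ?thesis using is_join_iff[of "{s, t}" v] st by auto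
  qed
  have "birestriction_semigroup S" using birestriction_iff bi by blast
  then show ?thesis
    unfolding boolean_birestriction_semigroup_def
    using ex_zero gba join by blast
qed

end

text \<open>Cover \<open>A\<close> by finitely many represented slices and join them one at a time.
  The partial joins stay inside \<open>A\<close>, so joins are required only for pairs inside a
  common slice; such pairs are compatible, on both sides if \<open>A\<close> is a bislice.\<close>

lemma (in representation) slice_in_image:
  assumes A: "compact_slice C A"
    and join: "\<And>s t. s \<in> carrier S \<Longrightarrow> t \<in> carrier S \<Longrightarrow> \<delta> s \<union> \<delta> t \<subseteq> A \<Longrightarrow> \<exists>v. is_join S {s, t} v"
  shows "A \<in> \<delta> ` carrier S"
proof -
  obtain B where B: "finite B" "B \<subseteq> carrier S" "A = \<Union>(\<delta> ` B)"
    using compact_slice_finite_union[OF A] .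
  have "\<exists>v\<in>carrier S. \<delta> v = \<Union>(\<delta> ` B')" if "B' \<subseteq> B" "finite B'" for B'
    using that(2,1)
  proof (induction rule: finite_induct)
    case empty
    then show ?case using zero_of projection_carrier by auto
  next
    case (insert s B')
    then obtain v where v: "v \<in> carrier S" "\<delta> v = \<Union>(\<delta> ` B')" by auto
    have s: "s \<in> carrier S" using insert.prems B(2) by blast
    have sub: "\<delta> s \<union> \<delta> v \<subseteq> A" using v insert.prems B(3) by auto
    obtain w where w: "is_join S {s, v} w" using join[OF s v(1) sub] ..
    have "w \<in> carrier S" "\<delta> w = \<delta> s \<union> \<delta> v" using is_join_iff[of "{s, v}" w] w s v(1) by simp_all
    then show ?case using v by auto
  qed
  then show ?thesis using B(1,3) by (metis imageI order_refl)
qed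

lemma (in representation) boolean_image:
  assumes "boolean_restriction_semigroup S"
  shows "\<delta> ` carrier S = Collect (compact_slice C)"
proof (intro equalityI subsetI)
  fix A assume "A \<in> Collect (compact_slice C)"
  then have A: "compact_slice C A" by simp
  show "A \<in> \<delta> ` carrier S"
  proof (rule slice_in_image[OF A])
    fix s t assume st: "s \<in> carrier S" "t \<in> carrier S" "\<delta> s \<union> \<delta> t \<subseteq> A"
    have "inj_on (dm C) A" using A by (simp add: compact_slice_def is_slice_def)
    then have "compatible S s t" using compatible_iff[OF st(1,2)] st(3) inj_on_subset by blast
    then show "\<exists>v. is_join S {s, t} v"
      using assms st(1,2) unfolding boolean_restriction_semigroup_def by blast
  qed
qed (use slice in blast)

lemma (in range_rep) boolean_birestriction_image:
  assumes B: "boolean_birestriction_semigroup S"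
  shows "\<delta> ` carrier S = Collect (compact_bislice C)" "biample C"
proof -
  have bi: "compact_bislice C (\<delta> s)" if "s \<in> carrier S" for s
    using B birestriction_iff that by (simp add: boolean_birestriction_semigroup_def)
  show "\<delta> ` carrier S = Collect (compact_bislice C)"
  proof (intro equalityI subsetI)
    fix A assume "A \<in> Collect (compact_bislice C)"
    then have A: "compact_slice C A" "inj_on (rg C) A" by (simp_all add: compact_bislice_iff)
    show "A \<in> \<delta> ` carrier S"
    proof (rule slice_in_image[OF A(1)])
      fix s t assume st: "s \<in> carrier S" "t \<in> carrier S" "\<delta> s \<union> \<delta> t \<subseteq> A"
      have "inj_on (dm C) A" using A by (simp add: compact_slice_def is_slice_def)
      then have "compatible S s t" using compatible_iff[OF st(1,2)] st(3) inj_on_subset by blast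
      moreover have "mult S (plus S t) s = mult S (plus S s) t"
        using bicompatible_iff[OF st(1,2)] inj_on_subset[OF A(2)] st(3) by simp
      ultimately show "\<exists>v. is_join S {s, t} v"
        using B st(1,2) unfolding boolean_birestriction_semigroup_def compatible_def by blast
    qed
  qed (use bi in blast)
  show "biample C"
  proof (rule biampleI[OF _ open_map_rg])
    show "\<exists>A. compact_bislice C A \<and> a \<in> A \<and> A \<subseteq> W" if "openin (C1 C) W" "a \<in> W" for W a
      using basis[OF that] bi by blast
  qed
qed

text \<open>Joins are unions, so each arrow of \<open>\<delta> s\<close> lies in a bideterministic
  part, which is a bislice.\<close>

lemma (in range_rep) etale_biample:
  assumes "etale_boolean_range_semigroup S"
  shows "biample C"
proof (rule biampleI[OF _ open_map_rg])
  fix W a assume "openin (C1 C) W" "a \<in> W"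
  then obtain s where s: "s \<in> carrier S" "a \<in> \<delta> s" "\<delta> s \<subseteq> W" using basis by blast
  then obtain B where B: "finite B" "B \<subseteq> {b \<in> carrier S. bideterministic S b}" "is_join S B s"
    using assms unfolding etale_boolean_range_semigroup_def by blast
  have "B \<subseteq> carrier S" using B(2) by blast
  then have "\<delta> s = \<Union>(\<delta> ` B)" using is_join_iff[OF B(1)] B(3) by blast
  then obtain b where "b \<in> B" "a \<in> \<delta> b" "\<delta> b \<subseteq> W" using s by blast
  moreover have "compact_bislice C (\<delta> b)" if "b \<in> B" for b
    using bideterministic_iff B(2) that by blast
  ultimately show "\<exists>A. compact_bislice C A \<and> a \<in> A \<and> A \<subseteq> W" by blast
qed

text \<open>Compact bislices inside \<open>\<delta> s\<close> cover it. They are represented because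
  every compact slice is, and finitely many suffice by compactness.\<close>

lemma (in range_rep) biample_etale:
  assumes bi: "biample C" and K: "\<delta> ` carrier S = Collect (compact_slice C)"
  shows "etale_boolean_range_semigroup S"
proof -
  have "\<exists>B. finite B \<and> B \<subseteq> {b \<in> carrier S. bideterministic S b} \<and> is_join S B s"
    if s: "s \<in> carrier S" for s
  proof -
    let ?B = "{b \<in> carrier S. bideterministic S b \<and> \<delta> b \<subseteq> \<delta> s}"
    have cov: "\<exists>V\<in>\<delta> ` ?B. openin (C1 C) V \<and> a \<in> V" if a: "a \<in> \<delta> s" for a
    proof -
      have os: "openin (C1 C) (\<delta> s)" using slice[OF s] by (simp add: compact_slice_def is_slice_def)
      obtain A where A: "compact_bislice C A" "a \<in> A" "A \<subseteq> \<delta> s" using biample_basis[OF bi os a] .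
      then have "A \<in> \<delta> ` carrier S" using K compact_bislice_slice by blast
      then obtain b where b: "b \<in> carrier S" "A = \<delta> b" by blast
      then have "b \<in> ?B" using bideterministic_iff A by blast
      moreover have "openin (C1 C) A" using A(1) by (simp add: compact_bislice_def is_bislice_def is_slice_def)
      ultimately show ?thesis using b(2) A(2) by blast
    qed
    have c: "compactin (C1 C) (\<delta> s)" using slice[OF s] by (simp add: compact_slice_def)
    obtain \<F> where \<F>: "finite \<F>" "\<F> \<subseteq> \<delta> ` ?B" "\<delta> s \<subseteq> \<Union>\<F>"
      using compactin_finite_cover[OF c cov] .
    obtain B where B: "B \<subseteq> ?B" "finite B" "\<F> = \<delta> ` B"
      using finite_subset_image[OF \<F>(1,2)] by blast
    have BC: "B \<subseteq> carrier S" using B(1) by blast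
    have "\<delta> s = \<Union>(\<delta> ` B)" using B(1,3) \<F>(3) by auto
    then have "is_join S B s" using is_join_iff[OF B(2) BC] s by simp
    then show ?thesis using B(1,2) by blast
  qed
  moreover have "boolean_restriction_semigroup S" using boolean_restriction K by blast
  ultimately show ?thesis
    using range_semigroup by (simp add: etale_boolean_range_semigroup_def boolean_range_semigroup_def)
qed

subsection \<open>Encoding slices\<close>

text \<open>The elements of the semigroup must lie in the prescribed type \<open>'a\<close>, while
  slices are sets of arrows. \<open>enc\<close> names the slices of the family \<open>K\<close>, and
  \<open>inv_into K enc\<close> reads the names.\<close>

lemma (in ample_category) encoded_representation:
  fixes enc :: "'c set \<Rightarrow> 'a" and S :: "('a, 'z) restr_sgp_scheme"
  assumes inj: "inj_on enc K" and K: "\<And>A. A \<in> K \<Longrightarrow> compact_slice C A"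
    and prod: "\<And>A B. A \<in> K \<Longrightarrow> B \<in> K \<Longrightarrow> slice_prod C A B \<in> K"
    and un: "\<And>U. compact_open (C0 C) U \<Longrightarrow> un C ` U \<in> K"
    and basis: "\<And>W a. openin (C1 C) W \<Longrightarrow> a \<in> W \<Longrightarrow> \<exists>A\<in>K. a \<in> A \<and> A \<subseteq> W"
    and S: "carrier S = enc ` K"
      "\<And>A B. A \<in> K \<Longrightarrow> B \<in> K \<Longrightarrow> mult S (enc A) (enc B) = enc (slice_prod C A B)"
      "\<And>A. A \<in> K \<Longrightarrow> star S (enc A) = enc (un C ` dm C ` A)"
  shows "representation C S (inv_into K enc)" "inv_into K enc ` carrier S = K"
proof -
  have dec: "inv_into K enc (enc A) = A" if "A \<in> K" for A using inj that by simp
  have st: "un C ` dm C ` A \<in> K" if "A \<in> K" for A using un compact_open_dm K that by blast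
  show "inv_into K enc ` carrier S = K" using dec S(1) by force
  show "representation C S (inv_into K enc)"
  proof
    show "inj_on (inv_into K enc) (carrier S)" using S(1) by (simp add: inj_on_inv_into)
    show "compact_slice C (inv_into K enc s)" if "s \<in> carrier S" for s
      using that S(1) dec K by auto
    show "mult S s t \<in> carrier S" if "s \<in> carrier S" "t \<in> carrier S" for s t
      using that S prod by auto
    show "star S s \<in> carrier S" if "s \<in> carrier S" for s using that S st by auto
    show "inv_into K enc (mult S s t) = slice_prod C (inv_into K enc s) (inv_into K enc t)"
      if "s \<in> carrier S" "t \<in> carrier S" for s t using that S prod dec by auto
    show "inv_into K enc (star S s) = un C ` dm C ` inv_into K enc s" if "s \<in> carrier S" for s
      using that S st dec by auto
    show "\<exists>e\<in>carrier S. inv_into K enc e = un C ` U" if "compact_open (C0 C) U" for U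
      using un[OF that] S(1) dec by auto
    show "\<exists>s\<in>carrier S. a \<in> inv_into K enc s \<and> inv_into K enc s \<subseteq> W"
      if "openin (C1 C) W" "a \<in> W" for W a
      using basis[OF that] S(1) dec by auto
  qed
qed

definition slice_sgp :: "('c, 'o) top_cat \<Rightarrow> 'c set set \<Rightarrow> ('c set \<Rightarrow> 'a) \<Rightarrow> 'a range_sgp" where
  "slice_sgp C K enc =
    \<lparr>carrier = enc ` K,
     mult = (\<lambda>x y. enc (slice_prod C (inv_into K enc x) (inv_into K enc y))),
     star = (\<lambda>x. enc (un C ` dm C ` inv_into K enc x)),
     plus = (\<lambda>x. enc (un C ` rg C ` inv_into K enc x))\<rparr>"

text \<open>Openness of \<open>rg\<close> makes the ranges of a compact slice compact open, so that
  the range operation stays within \<open>K\<close>.\<close>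

lemma (in ample_category) slice_sgp_range_rep:
  assumes inj: "inj_on enc K" and K: "\<And>A. A \<in> K \<Longrightarrow> compact_slice C A"
    and prod: "\<And>A B. A \<in> K \<Longrightarrow> B \<in> K \<Longrightarrow> slice_prod C A B \<in> K"
    and un: "\<And>U. compact_open (C0 C) U \<Longrightarrow> un C ` U \<in> K"
    and basis: "\<And>W a. openin (C1 C) W \<Longrightarrow> a \<in> W \<Longrightarrow> \<exists>A\<in>K. a \<in> A \<and> A \<subseteq> W"
    and rg: "open_map (C1 C) (C0 C) (rg C)"
  shows "range_rep C (slice_sgp C K enc) (inv_into K enc)"
    "inv_into K enc ` carrier (slice_sgp C K enc) = K"
proof -
  have S: "carrier (slice_sgp C K enc) = enc ` K"
    "\<And>A B. A \<in> K \<Longrightarrow> B \<in> K \<Longrightarrow> mult (slice_sgp C K enc) (enc A) (enc B) = enc (slice_prod C A B)"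
    "\<And>A. A \<in> K \<Longrightarrow> star (slice_sgp C K enc) (enc A) = enc (un C ` dm C ` A)"
    using inj by (simp_all add: slice_sgp_def)
  note R = encoded_representation[OF inj K prod un basis S]
  show "inv_into K enc ` carrier (slice_sgp C K enc) = K" by (rule R(2))
  have pl: "un C ` rg C ` A \<in> K" if "A \<in> K" for A
  proof -
    have A: "compact_slice C A" using K that by blast
    have "compact_open (C0 C) (rg C ` A)"
      using A rg image_compactin[OF _ cont_rg]
      by (auto simp add: compact_open_def compact_slice_def is_slice_def open_map_def)
    then show ?thesis using un by blast
  qed
  have "range_representation C (slice_sgp C K enc) (inv_into K enc)"
    unfolding range_representation_def using inj pl by (auto simp add: slice_sgp_def)
  then show "range_rep C (slice_sgp C K enc) (inv_into K enc)"
    using R(1) by (simp add: range_rep_def range_rep_axioms_def)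
qed

section \<open>Germs\<close>

text \<open>The properties of preBoolean restriction semigroups with local units on which the construction of
  the category of germs rests; they hold both for Boolean restriction semigroups with local units and
  for Boolean birestriction semigroups. The last one says that \<open>e \<mapsto> (e s)\<^sup>*\<close> preserves joins.\<close>

locale germ_semigroup =
  fixes S :: "('a, 'z) restr_sgp_scheme"
  assumes restriction: "restriction_semigroup S"
    and ex_zero: "\<exists>z. is_zero S z"
    and gba: "generalized_boolean_algebra (projections S) (le S) (zero_of S)"
    and local_units: "local_units S"
    and bounded_join: "s \<in> carrier S \<Longrightarrow> t \<in> carrier S \<Longrightarrow> u \<in> carrier S \<Longrightarrow> le S s u \<Longrightarrow> le S t u \<Longrightarrow>
      \<exists>v. is_join S {s, t} v"
    and star_join: "e \<in> projections S \<Longrightarrow> f \<in> projections S \<Longrightarrow> s \<in> carrier S \<Longrightarrow>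
      le S (star S (mult S (join_on (projections S) (le S) e f) s))
        (join_on (projections S) (le S) (star S (mult S e s)) (star S (mult S f s)))"

section \<open>Elementary calculus of restriction semigroups\<close>

locale restriction_sgp =
  fixes S :: "('a, 'z) restr_sgp_scheme"
  assumes restriction: "restriction_semigroup S"
begin

abbreviation prd (infixl "\<cdot>" 70) where "x \<cdot> y \<equiv> mult S x y"
abbreviation P where "P \<equiv> projections S"

lemma m_closed: "x \<in> carrier S \<Longrightarrow> y \<in> carrier S \<Longrightarrow> x \<cdot> y \<in> carrier S"
  using restriction unfolding restriction_semigroup_def by blast

lemma assoc: "x \<in> carrier S \<Longrightarrow> y \<in> carrier S \<Longrightarrow> z \<in> carrier S \<Longrightarrow> x \<cdot> y \<cdot> z = x \<cdot> (y \<cdot> z)"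
  using restriction unfolding restriction_semigroup_def by blast

lemma star_in: "x \<in> carrier S \<Longrightarrow> star S x \<in> P"
  by (simp add: projections_def)

lemma P_carrier: "e \<in> P \<Longrightarrow> e \<in> carrier S"
  using restriction unfolding restriction_semigroup_def projections_def by blast

lemma mult_star: "x \<in> carrier S \<Longrightarrow> x \<cdot> star S x = x"
  using restriction unfolding restriction_semigroup_def by blast

lemma star_mult_left: "x \<in> carrier S \<Longrightarrow> y \<in> carrier S \<Longrightarrow> star S (star S x \<cdot> y) = star S (x \<cdot> y)"
  using restriction unfolding restriction_semigroup_def by metis

lemma star_pass: "x \<in> carrier S \<Longrightarrow> y \<in> carrier S \<Longrightarrow> star S x \<cdot> y = y \<cdot> star S (x \<cdot> y)"
  using restriction unfolding restriction_semigroup_def by blast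

lemma P_comm: "e \<in> P \<Longrightarrow> f \<in> P \<Longrightarrow> e \<cdot> f = f \<cdot> e"
  using restriction unfolding restriction_semigroup_def projections_def by blast

lemma star_P_mult: "e \<in> P \<Longrightarrow> f \<in> P \<Longrightarrow> star S (e \<cdot> f) = e \<cdot> f"
proof -
  assume "e \<in> P" "f \<in> P"
  then obtain x y where "e = star S x" "f = star S y" "x \<in> carrier S" "y \<in> carrier S"
    by (auto simp add: projections_def)
  then show ?thesis using restriction unfolding restriction_semigroup_def by metis
qed

lemma P_mult: "e \<in> P \<Longrightarrow> f \<in> P \<Longrightarrow> e \<cdot> f \<in> P"
  using star_P_mult star_in m_closed P_carrier by metis

lemma P_idem: "e \<in> P \<Longrightarrow> e \<cdot> e = e"
proof -
  assume "e \<in> P"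
  then obtain x where x: "e = star S x" "x \<in> carrier S" by (auto simp add: projections_def)
  have "star S x = star S (x \<cdot> star S x)" using mult_star x by simp
  also have "\<dots> = star S (star S x \<cdot> star S x)"
    using star_mult_left[of x "star S x"] x P_carrier[OF star_in] by simp
  also have "\<dots> = star S x \<cdot> star S x" using star_P_mult star_in x by simp
  finally show ?thesis using x by simp
qed

lemma star_P [simp]: "e \<in> P \<Longrightarrow> star S e = e"
  using star_P_mult[of e e] P_idem by simp

lemma star_mult_P: "x \<in> carrier S \<Longrightarrow> e \<in> P \<Longrightarrow> star S (x \<cdot> e) = star S x \<cdot> e"
  using star_mult_left[of x e] star_P_mult star_in P_carrier by metis

lemma P_pass: "e \<in> P \<Longrightarrow> y \<in> carrier S \<Longrightarrow> e \<cdot> y = y \<cdot> star S (e \<cdot> y)"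
  using star_pass[of e y] P_carrier by simp

lemma P_left_comm: "e \<in> P \<Longrightarrow> f \<in> P \<Longrightarrow> g \<in> P \<Longrightarrow> e \<cdot> (f \<cdot> g) = f \<cdot> (e \<cdot> g)"
  using assoc P_comm P_carrier by metis

lemma P_left_idem: "e \<in> P \<Longrightarrow> f \<in> P \<Longrightarrow> e \<cdot> (e \<cdot> f) = e \<cdot> f"
  using assoc P_idem P_carrier by metis

lemma le_P_iff: "e \<in> P \<Longrightarrow> le S e f \<longleftrightarrow> e = f \<cdot> e"
  by (simp add: le_def)

lemma le_star_mult_right:
  assumes "x \<in> carrier S" "y \<in> carrier S"
  shows "le S (star S (x \<cdot> y)) (star S y)"
proof -
  have "star S (x \<cdot> y) = star S (x \<cdot> (y \<cdot> star S y))" using mult_star assms by simp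
  also have "\<dots> = star S (x \<cdot> y \<cdot> star S y)" using assoc assms P_carrier star_in by simp
  also have "\<dots> = star S (x \<cdot> y) \<cdot> star S y" using star_mult_P assms m_closed star_in by simp
  also have "\<dots> = star S y \<cdot> star S (x \<cdot> y)" using P_comm assms m_closed star_in by simp
  finally show ?thesis using le_P_iff assms m_closed star_in by simp
qed

lemma mult_le1: "e \<in> P \<Longrightarrow> f \<in> P \<Longrightarrow> le S (e \<cdot> f) e"
  using le_P_iff[OF P_mult] P_left_idem by simp

lemma mult_le2: "e \<in> P \<Longrightarrow> f \<in> P \<Longrightarrow> le S (e \<cdot> f) f"
  using mult_le1[of f e] P_comm by simp

lemma le_refl: "s \<in> carrier S \<Longrightarrow> le S s s"
  by (simp add: le_def mult_star)

lemma le_antisym: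
  assumes "s \<in> carrier S" "t \<in> carrier S" "le S s t" "le S t s"
  shows "s = t"
proof -
  have P: "star S s \<in> P" "star S t \<in> P" using assms star_in by simp_all
  have s: "s = t \<cdot> star S s" and t: "t = s \<cdot> star S t" using assms by (simp_all add: le_def)
  have "star S s = star S t \<cdot> star S s" using s star_mult_P[OF assms(2) P(1)] by simp
  also have "\<dots> = star S s \<cdot> star S t" using P_comm P by simp
  also have "\<dots> = star S t" using t star_mult_P[OF assms(1) P(2)] by simp
  finally show "s = t" using s mult_star[OF assms(2)] by simp
qed

lemma join_on_lub:
  assumes "lattice_on P (le S)" "e \<in> P" "f \<in> P"
  shows "is_lub_on P (le S) {e, f} (join_on P (le S) e f)"
proof -
  obtain u where u: "is_lub_on P (le S) {e, f} u" using assms unfolding lattice_on_def by blast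
  have "v = u" if "is_lub_on P (le S) {e, f} v" for v
    using u that le_antisym P_carrier unfolding is_lub_on_def by blast
  then show ?thesis unfolding join_on_def using u by (metis theI)
qed

lemma meet_eq:
  assumes "e \<in> P" "f \<in> P"
  shows "meet_on P (le S) e f = e \<cdot> f"
  unfolding meet_on_def
proof (rule the_equality)
  have glb: "le S v (e \<cdot> f)" if "v \<in> P" "le S v e" "le S v f" for v
    using that assoc[of e f v] P_carrier assms by (simp add: le_P_iff)
  show lub: "is_glb_on P (le S) {e, f} (e \<cdot> f)"
    unfolding is_glb_on_def using glb P_mult mult_le1 mult_le2 assms by auto
  show "w = e \<cdot> f" if "is_glb_on P (le S) {e, f} w" for w
    using that lub le_antisym P_carrier unfolding is_glb_on_def by blast
qed

lemma is_join_unique: "is_join S A v \<Longrightarrow> is_join S A w \<Longrightarrow> v = w"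
  unfolding is_join_def is_lub_on_def by (metis le_antisym)

lemma zero_pass:
  assumes "is_zero S z" "y \<in> carrier S"
  shows "y \<cdot> z = z"
proof -
  have z: "z \<in> P" "z \<cdot> y = z" using assms by (auto simp add: is_zero_def)
  then have "z = y \<cdot> star S z" using P_pass[OF z(1) assms(2)] by simp
  then show ?thesis using z(1) by simp
qed

lemma is_zero_unique: "is_zero S z \<Longrightarrow> is_zero S w \<Longrightarrow> z = w"
  using zero_pass P_carrier unfolding is_zero_def by metis

text \<open>If the domains of \<open>s\<close> and \<open>t\<close> lie below \<open>j\<close>, then
  \<open>v \<cdot> j\<close> is again an upper bound of both. So \<open>v\<close> lies below
  \<open>v \<cdot> j\<close>, which bounds its domain by \<open>j\<close>.\<close>

lemma is_join_star:
  assumes st: "s \<in> carrier S" "t \<in> carrier S" and v: "is_join S {s, t} v" and j: "j \<in> P"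
    and le: "le S (star S s) j" "le S (star S t) j"
  shows "le S (star S v) j"
proof -
  have vc: "v \<in> carrier S" and up: "le S s v" "le S t v"
    and least: "\<And>w. w \<in> carrier S \<Longrightarrow> le S s w \<Longrightarrow> le S t w \<Longrightarrow> le S v w"
    using v by (auto simp add: is_join_def is_lub_on_def)
  have jc: "j \<in> carrier S" using P_carrier j .
  have ub: "le S x (v \<cdot> j)" if x: "x \<in> carrier S" "le S x v" "le S (star S x) j" for x
  proof -
    have xP: "star S x \<in> P" using star_in x(1) .
    have "x = v \<cdot> (j \<cdot> star S x)" using x(2) x(3)[unfolded le_P_iff[OF xP]] by (simp add: le_def)
    then show ?thesis using assoc[OF vc jc P_carrier[OF xP]] by (simp add: le_def)
  qed
  have vP: "star S v \<in> P" using star_in vc .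
  have vj: "v \<cdot> j \<in> carrier S" using m_closed vc jc by simp
  have "le S v (v \<cdot> j)" using least[OF vj] ub st up le by blast
  then have "star S v = star S (v \<cdot> j \<cdot> star S v)" by (simp add: le_def)
  also have "\<dots> = star S v \<cdot> j \<cdot> star S v"
    using star_mult_P[OF vj vP] star_mult_P[OF vc j] by simp
  also have "\<dots> = j \<cdot> star S v"
    using P_comm[OF vP j] P_idem[OF vP] assoc[OF jc] P_carrier[OF vP] by simp
  finally show ?thesis using le_P_iff[OF vP] by simp
qed

end

sublocale germ_semigroup \<subseteq> restriction_sgp
  by (unfold_locales, rule restriction)

section \<open>Joins and differences of projections\<close>

context germ_semigroup
begin

definition z where "z = zero_of S"
definition jn where "jn e f = join_on P (le S) e f"

lemma is_zero_z: "is_zero S z"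
  unfolding z_def zero_of_def by (rule theI') (use ex_zero is_zero_unique in blast)

lemma z_P: "z \<in> P" and z_left: "x \<in> carrier S \<Longrightarrow> z \<cdot> x = z"
  using is_zero_z by (auto simp add: is_zero_def)

lemma z_right: "x \<in> carrier S \<Longrightarrow> x \<cdot> z = z"
  using zero_pass is_zero_z by blast

lemma lattice: "lattice_on P (le S)"
  using gba unfolding generalized_boolean_algebra_def by blast

lemma le_trans_P: "e \<in> P \<Longrightarrow> f \<in> P \<Longrightarrow> g \<in> P \<Longrightarrow> le S e f \<Longrightarrow> le S f g \<Longrightarrow> le S e g"
  using lattice unfolding lattice_on_def by blast

lemma jn_lub: "e \<in> P \<Longrightarrow> f \<in> P \<Longrightarrow> is_lub_on P (le S) {e, f} (jn e f)"
  unfolding jn_def using join_on_lub lattice by blast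

lemma jn_P: "e \<in> P \<Longrightarrow> f \<in> P \<Longrightarrow> jn e f \<in> P"
  and jn_ge1: "e \<in> P \<Longrightarrow> f \<in> P \<Longrightarrow> le S e (jn e f)"
  and jn_ge2: "e \<in> P \<Longrightarrow> f \<in> P \<Longrightarrow> le S f (jn e f)"
  and jn_least: "e \<in> P \<Longrightarrow> f \<in> P \<Longrightarrow> g \<in> P \<Longrightarrow> le S e g \<Longrightarrow> le S f g \<Longrightarrow> le S (jn e f) g"
  using jn_lub unfolding is_lub_on_def by blast+

lemma distrib:
  assumes "e \<in> P" "f \<in> P" "g \<in> P"
  shows "e \<cdot> jn f g = jn (e \<cdot> f) (e \<cdot> g)"
proof -
  have "meet_on P (le S) e (jn f g) = jn (meet_on P (le S) e f) (meet_on P (le S) e g)"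
    using gba assms unfolding generalized_boolean_algebra_def jn_def by blast
  then show ?thesis using meet_eq assms jn_P by simp
qed

text \<open>\<open>g\<close> is the difference of \<open>e\<close> and \<open>f\<close>, obtained as
  the complement of \<open>e \<cdot> f\<close> in the interval from \<open>z\<close> to
  \<open>e\<close>.\<close>

lemma complement:
  assumes "e \<in> P" "f \<in> P"
  obtains g where "g \<in> P" "g \<cdot> f = z" "jn (e \<cdot> f) g = e"
proof -
  have "z \<in> P" "e \<cdot> f \<in> P" "le S z (e \<cdot> f)" "le S (e \<cdot> f) e"
    using z_P P_mult assms mult_le1 le_P_iff z_right P_carrier by auto
  then obtain g where g: "g \<in> P" "le S g e" "meet_on P (le S) (e \<cdot> f) g = z" "jn (e \<cdot> f) g = e"
    using gba assms unfolding generalized_boolean_algebra_def jn_def z_def by blast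
  have "g \<cdot> f = e \<cdot> g \<cdot> f" using g(2) le_P_iff[OF g(1)] by simp
  also have "\<dots> = e \<cdot> f \<cdot> g" using assoc P_comm P_carrier assms g(1) by metis
  also have "\<dots> = z" using g(1,3) meet_eq assms P_mult by simp
  finally show ?thesis using that g by blast
qed

subsection \<open>Prime filters of projections\<close>

definition pf :: "'a set \<Rightarrow> bool" where
  "pf x \<longleftrightarrow> x \<subseteq> P \<and> x \<noteq> {} \<and> z \<notin> x \<and> (\<forall>e\<in>x. \<forall>f\<in>P. le S e f \<longrightarrow> f \<in> x) \<and>
    (\<forall>e\<in>x. \<forall>f\<in>x. e \<cdot> f \<in> x) \<and> (\<forall>e\<in>P. \<forall>f\<in>P. jn e f \<in> x \<longrightarrow> e \<in> x \<or> f \<in> x)"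

lemma pf_P: "pf x \<Longrightarrow> e \<in> x \<Longrightarrow> e \<in> P"
  and pf_carrier: "pf x \<Longrightarrow> e \<in> x \<Longrightarrow> e \<in> carrier S"
  and pf_zero: "pf x \<Longrightarrow> z \<notin> x"
  and pf_up: "pf x \<Longrightarrow> e \<in> x \<Longrightarrow> f \<in> P \<Longrightarrow> le S e f \<Longrightarrow> f \<in> x"
  and pf_mult: "pf x \<Longrightarrow> e \<in> x \<Longrightarrow> f \<in> x \<Longrightarrow> e \<cdot> f \<in> x"
  and pf_prime: "pf x \<Longrightarrow> e \<in> P \<Longrightarrow> f \<in> P \<Longrightarrow> jn e f \<in> x \<Longrightarrow> e \<in> x \<or> f \<in> x"
  using P_carrier unfolding pf_def by blast+

lemma pf_mult_iff:
  assumes "pf x" "e \<in> P" "f \<in> P"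
  shows "e \<cdot> f \<in> x \<longleftrightarrow> e \<in> x \<and> f \<in> x"
  using assms pf_mult pf_up[OF assms(1) _ assms(2) mult_le1[OF assms(2,3)]]
    pf_up[OF assms(1) _ assms(3) mult_le2[OF assms(2,3)]] by blast

lemma pf_nonempty: "pf x \<Longrightarrow> \<exists>e. e \<in> x"
  unfolding pf_def by blast

definition ideal :: "'a set \<Rightarrow> bool" where
  "ideal I \<longleftrightarrow> I \<subseteq> P \<and> z \<in> I \<and> (\<forall>f\<in>I. \<forall>e\<in>P. le S e f \<longrightarrow> e \<in> I) \<and> (\<forall>e\<in>I. \<forall>f\<in>I. jn e f \<in> I)"

text \<open>Stone's separation theorem by Zorn's lemma: a filter maximal among those containing
  \<open>e\<close> and avoiding \<open>I\<close> is prime. It is applied to ideals of projections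
  over which some property holds, to conclude that the property holds over a given
  projection.\<close>

lemma prime_filter_exists:
  assumes I: "ideal I" and e: "e \<in> P" "e \<notin> I"
  obtains x where "pf x" "e \<in> x" "x \<inter> I = {}"
proof -
  define \<A> where "\<A> = {F. F \<subseteq> P \<and> e \<in> F \<and> (\<forall>a\<in>F. \<forall>b\<in>P. le S a b \<longrightarrow> b \<in> F) \<and>
      (\<forall>a\<in>F. \<forall>b\<in>F. a \<cdot> b \<in> F) \<and> F \<inter> I = {}}"
  have Iz: "z \<in> I" and Idown: "\<And>a b. a \<in> P \<Longrightarrow> b \<in> I \<Longrightarrow> le S a b \<Longrightarrow> a \<in> I"
    and Ijn: "\<And>a b. a \<in> I \<Longrightarrow> b \<in> I \<Longrightarrow> jn a b \<in> I"
    using I unfolding ideal_def by blast+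
  have glb: "le S v (a \<cdot> b)" if "a \<in> P" "b \<in> P" "v \<in> P" "le S v a" "le S v b" for a b v
    using that assoc[of a b v] P_carrier by (simp add: le_P_iff)
  define E where "E = {f \<in> P. le S e f}"
  have E: "f \<in> E \<longleftrightarrow> f \<in> P \<and> le S e f" for f by (simp add: E_def)
  have "E \<in> \<A>"
    unfolding \<A>_def mem_Collect_eq
  proof (intro conjI ballI impI)
    show "b \<in> E" if "a \<in> E" "b \<in> P" "le S a b" for a b
      using that le_trans_P[OF e(1), of a b] by (simp add: E)
    show "a \<cdot> b \<in> E" if "a \<in> E" "b \<in> E" for a b
      using that glb[of a b e] P_mult e(1) by (simp add: E)
  qed (use e Idown le_refl[OF P_carrier[OF e(1)]] E in auto)
  moreover have "\<Union>\<C> \<in> \<A>" if C: "\<C> \<noteq> {}" "subset.chain \<A> \<C>" for \<C>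
  proof -
    have sub: "\<C> \<subseteq> \<A>" and tot: "\<And>X Y. X \<in> \<C> \<Longrightarrow> Y \<in> \<C> \<Longrightarrow> X \<subseteq> Y \<or> Y \<subseteq> X"
      using C(2) unfolding subset.chain_def by blast+
    have "a \<cdot> b \<in> \<Union>\<C>" if ab: "a \<in> \<Union>\<C>" "b \<in> \<Union>\<C>" for a b
    proof -
      obtain X Y where XY: "X \<in> \<C>" "Y \<in> \<C>" "a \<in> X" "b \<in> Y" using ab by blast
      then obtain W where "W \<in> \<C>" "a \<in> W" "b \<in> W" using tot by blast
      then show ?thesis using sub unfolding \<A>_def by blast
    qed
    moreover have "b \<in> \<Union>\<C>" if "a \<in> \<Union>\<C>" "b \<in> P" "le S a b" for a b
      using that sub unfolding \<A>_def by blast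
    moreover have "e \<in> \<Union>\<C>" "\<Union>\<C> \<subseteq> P" "\<Union>\<C> \<inter> I = {}" using C(1) sub unfolding \<A>_def by blast+
    ultimately show ?thesis unfolding \<A>_def by blast
  qed
  ultimately obtain x where x: "x \<in> \<A>" and max: "\<And>X. X \<in> \<A> \<Longrightarrow> x \<subseteq> X \<Longrightarrow> X = x"
    using subset_Zorn_nonempty[of \<A>] by blast
  have xP: "x \<subseteq> P" and ex: "e \<in> x" and xup: "\<And>a b. a \<in> x \<Longrightarrow> b \<in> P \<Longrightarrow> le S a b \<Longrightarrow> b \<in> x"
    and xm: "\<And>a b. a \<in> x \<Longrightarrow> b \<in> x \<Longrightarrow> a \<cdot> b \<in> x" and xI: "x \<inter> I = {}"
    using x unfolding \<A>_def by blast+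
  \<comment> \<open>By maximality, the filter generated by \<open>x\<close> and a projection
    \<open>a\<close> outside \<open>x\<close> meets \<open>I\<close>.\<close>
  have hit: "\<exists>f\<in>x. f \<cdot> a \<in> I" if a: "a \<in> P" "a \<notin> x" for a
  proof (rule ccontr)
    assume no: "\<not> ?thesis"
    define X where "X = {b \<in> P. \<exists>f\<in>x. le S (f \<cdot> a) b}"
    have xX: "x \<subseteq> X" using xP a(1) mult_le1 unfolding X_def by blast
    have aX: "a \<in> X" using ex xP a(1) mult_le2 unfolding X_def by blast
    have "X \<in> \<A>"
    proof -
      have "X \<subseteq> P" by (auto simp add: X_def)
      moreover have "e \<in> X" using ex xX by blast
      moreover have "c \<in> X" if b: "b \<in> X" and c: "c \<in> P" "le S b c" for b c
      proof -
        obtain f where f: "f \<in> x" "le S (f \<cdot> a) b" "b \<in> P" using b by (auto simp add: X_def)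
        then have "le S (f \<cdot> a) c" using le_trans_P[OF P_mult] xP a(1) c by blast
        then show ?thesis using f(1) c by (auto simp add: X_def)
      qed
      moreover have "b \<cdot> c \<in> X" if b: "b \<in> X" and c: "c \<in> X" for b c
      proof -
        obtain f where f: "f \<in> x" "le S (f \<cdot> a) b" "b \<in> P" using b by (auto simp add: X_def)
        obtain g where g: "g \<in> x" "le S (g \<cdot> a) c" "c \<in> P" using c by (auto simp add: X_def)
        have P: "f \<in> P" "g \<in> P" "f \<cdot> a \<in> P" "g \<cdot> a \<in> P" "f \<cdot> g \<in> P" "f \<cdot> g \<cdot> a \<in> P"
          using f g xP a(1) P_mult by blast+
        have "f \<cdot> g \<cdot> a = g \<cdot> (f \<cdot> a)" using assoc P_comm P_carrier P a(1) by metis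
        then have "le S (f \<cdot> g \<cdot> a) b"
          using le_trans_P[OF P(6) P(3) f(3) _ f(2)] mult_le2[OF P(2,3)] by simp
        moreover have "f \<cdot> g \<cdot> a = f \<cdot> (g \<cdot> a)" using assoc P_carrier P a(1) by metis
        then have "le S (f \<cdot> g \<cdot> a) c"
          using le_trans_P[OF P(6) P(4) g(3) _ g(2)] mult_le2[OF P(1,4)] by simp
        ultimately have "le S (f \<cdot> g \<cdot> a) (b \<cdot> c)" using glb f(3) g(3) P(6) by blast
        then show ?thesis using xm[OF f(1) g(1)] P_mult f(3) g(3) by (auto simp add: X_def)
      qed
      moreover have "X \<inter> I = {}"
      proof -
        have False if b: "b \<in> X" "b \<in> I" for b
        proof -
          obtain f where f: "f \<in> x" "le S (f \<cdot> a) b" using b(1) by (auto simp add: X_def)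
          then have "f \<cdot> a \<in> I" using Idown[OF P_mult] b(2) xP a(1) by blast
          then show False using no f(1) by blast
        qed
        then show ?thesis by blast
      qed
      ultimately show ?thesis unfolding \<A>_def by blast
    qed
    then show False using max xX aX a(2) by blast
  qed
  have "a \<in> x \<or> b \<in> x" if ab: "a \<in> P" "b \<in> P" "jn a b \<in> x" for a b
  proof (rule ccontr)
    assume "\<not> ?thesis"
    then obtain f g where f: "f \<in> x" "f \<cdot> a \<in> I" and g: "g \<in> x" "g \<cdot> b \<in> I" using hit ab by blast
    have P: "f \<in> P" "g \<in> P" "f \<cdot> g \<in> P" "f \<cdot> a \<in> P" "g \<cdot> b \<in> P" using f g xP ab P_mult by blast+
    have "f \<cdot> g \<cdot> a = g \<cdot> (f \<cdot> a)" using assoc P_comm P_carrier P ab(1) by metis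
    then have "f \<cdot> g \<cdot> a \<in> I" using Idown[OF _ f(2)] mult_le2[OF P(2,4)] P_mult P ab by simp
    moreover have "f \<cdot> g \<cdot> b = f \<cdot> (g \<cdot> b)" using assoc P_carrier P ab(2) by metis
    then have "f \<cdot> g \<cdot> b \<in> I" using Idown[OF _ g(2)] mult_le2[OF P(1,5)] P_mult P ab by simp
    \<comment> \<open>Distributivity puts the meet of \<open>f \<cdot> g\<close> with the join of
      \<open>a\<close> and \<open>b\<close> into \<open>I\<close>, although it also lies in
      \<open>x\<close>.\<close>
    ultimately have "f \<cdot> g \<cdot> jn a b \<in> I" using Ijn distrib[OF P(3) ab(1,2)] by simp
    moreover have "f \<cdot> g \<cdot> jn a b \<in> x" using xm f(1) g(1) ab(3) by blast
    ultimately show False using xI by blast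
  qed
  moreover have "z \<notin> x" using xI Iz by blast
  ultimately have "pf x" unfolding pf_def using xP ex xup xm by blast
  then show ?thesis using that ex xI by blast
qed

subsection \<open>The action on prime filters\<close>

text \<open>\<open>valid s x\<close> says that the germ of \<open>s\<close> at \<open>x\<close> is defined; \<open>rp s x\<close> is its range.\<close>

definition valid :: "'a \<Rightarrow> 'a set \<Rightarrow> bool" where
  "valid s x \<longleftrightarrow> s \<in> carrier S \<and> pf x \<and> star S s \<in> x"

definition rp :: "'a \<Rightarrow> 'a set \<Rightarrow> 'a set" where
  "rp s x = {e \<in> P. star S (e \<cdot> s) \<in> x}"

text \<open>It makes \<open>e \<mapsto> (e s)\<^sup>*\<close> preserve meets and hence order, so
  that preimages of filters under this map are closed under meets and upwards.\<close>

lemma star_em: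
  assumes "e \<in> P" "f \<in> P" "s \<in> carrier S"
  shows "star S (e \<cdot> f \<cdot> s) = star S (e \<cdot> s) \<cdot> star S (f \<cdot> s)"
proof -
  have c: "e \<in> carrier S" "f \<in> carrier S" using assms P_carrier by auto
  have P: "star S (f \<cdot> s) \<in> P" using assms c m_closed star_in by simp
  have "e \<cdot> f \<cdot> s = e \<cdot> (s \<cdot> star S (f \<cdot> s))" using assoc c assms P_pass by simp
  also have "\<dots> = e \<cdot> s \<cdot> star S (f \<cdot> s)" using assoc c assms P_carrier[OF P] by simp
  finally show ?thesis using star_mult_P[OF _ P] m_closed c assms by simp
qed

text \<open>\<open>rp s x\<close> is the preimage of \<open>x\<close> under
  \<open>e \<mapsto> (e s)\<^sup>*\<close>. A local unit of \<open>s\<close> makes it nonempty,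
  \<open>star_em\<close> makes it a filter, and \<open>star_join\<close> makes it prime.\<close>

lemma pf_rp:
  assumes v: "valid s x"
  shows "pf (rp s x)"
proof -
  have s: "s \<in> carrier S" and x: "pf x" and sx: "star S s \<in> x" using v by (simp_all add: valid_def)
  have P: "star S (e \<cdot> s) \<in> P" if "e \<in> P" for e using that s P_carrier m_closed star_in by simp
  obtain e where e: "e \<in> P" "e \<cdot> s = s" using local_units s unfolding local_units_def by blast
  have "e \<in> rp s x" using e sx by (simp add: rp_def)
  then have ne: "rp s x \<noteq> {}" by blast
  have sub: "rp s x \<subseteq> P" by (auto simp add: rp_def)
  have nz: "z \<notin> rp s x" using z_left s pf_zero x z_P by (simp add: rp_def)
  have up: "f \<in> rp s x" if e: "e \<in> rp s x" and f: "f \<in> P" "le S e f" for e f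
  proof -
    have eP: "e \<in> P" and ex: "star S (e \<cdot> s) \<in> x" using e by (simp_all add: rp_def)
    have "star S (e \<cdot> s) = star S (f \<cdot> s) \<cdot> star S (e \<cdot> s)"
      using star_em[OF f(1) eP s] f(2) le_P_iff[OF eP] by simp
    then have "le S (star S (e \<cdot> s)) (star S (f \<cdot> s))" using le_P_iff[OF P[OF eP]] by simp
    then show ?thesis using pf_up[OF x ex P[OF f(1)]] f(1) by (simp add: rp_def)
  qed
  have mu: "e \<cdot> f \<in> rp s x" if "e \<in> rp s x" "f \<in> rp s x" for e f
    using that star_em[OF _ _ s] pf_mult[OF x] P_mult by (simp add: rp_def)
  have prime: "e \<in> rp s x \<or> f \<in> rp s x" if ef: "e \<in> P" "f \<in> P" "jn e f \<in> rp s x" for e f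
  proof -
    have "le S (star S (jn e f \<cdot> s)) (jn (star S (e \<cdot> s)) (star S (f \<cdot> s)))"
      using star_join[OF ef(1,2) s] by (simp add: jn_def)
    moreover have "star S (jn e f \<cdot> s) \<in> x" using ef(3) by (simp add: rp_def)
    ultimately have "jn (star S (e \<cdot> s)) (star S (f \<cdot> s)) \<in> x"
      using pf_up[OF x] jn_P P ef by blast
    then show ?thesis using pf_prime[OF x P P] ef by (auto simp add: rp_def)
  qed
  show ?thesis
    unfolding pf_def by (intro conjI ballI impI; (rule sub ne nz up mu prime; assumption))
qed

lemma rp_mult:
  assumes "s \<in> carrier S" "t \<in> carrier S"
  shows "rp (s \<cdot> t) x = rp s (rp t x)"
proof -
  have "star S (e \<cdot> (s \<cdot> t)) = star S (star S (e \<cdot> s) \<cdot> t)" "star S (e \<cdot> s) \<in> P" if "e \<in> P" for e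
    using that assms assoc[of e s t] star_mult_left[of "e \<cdot> s" t] P_carrier m_closed star_in by simp_all
  then show ?thesis by (auto simp add: rp_def)
qed

lemma valid_mult:
  assumes "valid t x" "valid s (rp t x)"
  shows "valid (s \<cdot> t) x"
proof -
  have "star S (star S s \<cdot> t) \<in> x" using assms(2) by (simp add: valid_def rp_def)
  then show ?thesis using assms star_mult_left m_closed by (simp add: valid_def)
qed

lemma valid_multD:
  assumes s: "s \<in> carrier S" and t: "t \<in> carrier S" and v: "valid (s \<cdot> t) x"
  shows "valid t x" "valid s (rp t x)"
proof -
  have x: "pf x" "star S (s \<cdot> t) \<in> x" using v by (simp_all add: valid_def)
  then show 1: "valid t x"
    using pf_up[OF x star_in[OF t] le_star_mult_right[OF s t]] t by (simp add: valid_def)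
  have "star S s \<in> rp t x" using x s t star_mult_left star_in by (simp add: rp_def)
  then show "valid s (rp t x)" using s pf_rp[OF 1] by (simp add: valid_def)
qed

lemma valid_P: "pf x \<Longrightarrow> e \<in> x \<Longrightarrow> valid e x"
  using pf_P pf_carrier by (simp add: valid_def)

lemma rp_P:
  assumes "pf x" "e \<in> x"
  shows "rp e x = x"
  using assms pf_P[OF assms] pf_mult_iff[OF assms(1) _ pf_P[OF assms]] star_P_mult pf_P
  by (auto simp add: rp_def)

lemma valid_restrict:
  assumes "valid s x" "e \<in> x"
  shows "valid (s \<cdot> e) x"
proof -
  have "pf x" "e \<in> P" using assms pf_P by (auto simp add: valid_def)
  then show ?thesis using assms star_mult_P pf_mult m_closed P_carrier by (simp add: valid_def)
qed

lemma valid_restrictD: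
  assumes "s \<in> carrier S" "e \<in> P" "valid (s \<cdot> e) x"
  shows "valid s x" "e \<in> x"
  using assms star_mult_P[OF assms(1,2)] pf_mult_iff[of x "star S s" e] star_in by (auto simp add: valid_def)

lemma rp_restrict:
  assumes "s \<in> carrier S" "e \<in> x" "pf x"
  shows "rp (s \<cdot> e) x = rp s x"
  using rp_mult[OF assms(1) pf_carrier[OF assms(3,2)]] rp_P[OF assms(3,2)] by simp

definition same_germ :: "'a set \<Rightarrow> 'a \<Rightarrow> 'a \<Rightarrow> bool" where
  "same_germ x s t \<longleftrightarrow> (\<exists>e\<in>x. s \<cdot> e = t \<cdot> e)"

lemma same_germ_sym: "same_germ x s t \<Longrightarrow> same_germ x t s"
  unfolding same_germ_def by metis

lemma same_germ_refl: "pf x \<Longrightarrow> same_germ x s s"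
  using pf_nonempty unfolding same_germ_def by blast

lemma same_germ_trans:
  assumes "pf x" "s \<in> carrier S" "t \<in> carrier S" "u \<in> carrier S" "same_germ x s t" "same_germ x t u"
  shows "same_germ x s u"
proof -
  obtain e f where ef: "e \<in> x" "s \<cdot> e = t \<cdot> e" "f \<in> x" "t \<cdot> f = u \<cdot> f"
    using assms(5,6) unfolding same_germ_def by blast
  have P: "e \<in> P" "f \<in> P" "e \<in> carrier S" "f \<in> carrier S" using ef pf_P pf_carrier assms(1) by blast+
  have "s \<cdot> (e \<cdot> f) = t \<cdot> e \<cdot> f" using assoc[of s e f] ef P assms by simp
  also have "\<dots> = t \<cdot> f \<cdot> e" using assoc[of t e f] assoc[of t f e] P_comm[of e f] P assms by simp
  also have "\<dots> = u \<cdot> (e \<cdot> f)" using assoc[of u f e] ef P_comm[of e f] P assms by simp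
  finally show ?thesis using pf_mult[OF assms(1) ef(1,3)] unfolding same_germ_def by blast
qed

lemma same_germ_restrict:
  assumes "s \<in> carrier S" "pf x" "e \<in> x"
  shows "same_germ x (s \<cdot> e) s"
  using assoc[of s e e] P_idem[of e] pf_P[OF assms(2,3)] P_carrier assms unfolding same_germ_def by auto

lemma same_germ_rp:
  assumes "pf x" "s \<in> carrier S" "t \<in> carrier S" "same_germ x s t"
  shows "rp s x = rp t x"
  using assms rp_restrict unfolding same_germ_def by metis

text \<open>If \<open>s\<close> and \<open>s'\<close> agree on a projection \<open>e\<close> in the
  range of the germ of \<open>t\<close>, then \<open>s \<cdot> t\<close> and
  \<open>s' \<cdot> t\<close> agree on \<open>(e t)\<^sup>*\<close>, because
  \<open>t (e t)\<^sup>* = e t\<close>.\<close>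

lemma same_germ_mult:
  assumes x: "pf x" and c: "s \<in> carrier S" "s' \<in> carrier S" "t \<in> carrier S" "t' \<in> carrier S"
    and s: "same_germ (rp t x) s s'" and t: "same_germ x t t'"
  shows "same_germ x (s \<cdot> t) (s' \<cdot> t')"
proof -
  obtain e where e: "e \<in> P" "star S (e \<cdot> t) \<in> x" "s \<cdot> e = s' \<cdot> e"
    using s unfolding same_germ_def rp_def by blast
  obtain f where f: "f \<in> x" "t \<cdot> f = t' \<cdot> f" using t unfolding same_germ_def by blast
  let ?g = "star S (e \<cdot> t)"
  have ec: "e \<in> carrier S" "?g \<in> carrier S" "f \<in> carrier S" "f \<in> P"
    using e P_carrier pf_carrier[OF x] pf_P[OF x] f by auto
  have "s \<cdot> t \<cdot> ?g = s \<cdot> (t \<cdot> ?g)" using assoc c ec by simp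
  also have "\<dots> = s \<cdot> (e \<cdot> t)" using P_pass[OF e(1) c(3)] by simp
  also have "\<dots> = s' \<cdot> (e \<cdot> t)" using assoc[of s e t] assoc[of s' e t] e(3) c ec by simp
  also have "\<dots> = s' \<cdot> (t \<cdot> ?g)" using P_pass[OF e(1) c(3)] by simp
  also have "\<dots> = s' \<cdot> t \<cdot> ?g" using assoc c ec by simp
  finally have 1: "same_germ x (s \<cdot> t) (s' \<cdot> t)" using e(2) unfolding same_germ_def by blast
  have "s' \<cdot> t \<cdot> f = s' \<cdot> t' \<cdot> f" using assoc[of s' t f] assoc[of s' t' f] f c ec by simp
  then have "same_germ x (s' \<cdot> t) (s' \<cdot> t')" using f(1) unfolding same_germ_def by blast
  then show ?thesis using same_germ_trans[OF x _ _ _ 1] m_closed c by simp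
qed

lemma same_germ_left_P:
  assumes "s \<in> carrier S" "pf x" "e \<in> rp s x"
  shows "same_germ x (e \<cdot> s) s"
proof -
  have e: "e \<in> P" "star S (e \<cdot> s) \<in> x" using assms by (simp_all add: rp_def)
  have "e \<cdot> s \<cdot> star S (e \<cdot> s) = e \<cdot> s" using mult_star m_closed P_carrier e assms by simp
  also have "\<dots> = s \<cdot> star S (e \<cdot> s)" using P_pass e assms by simp
  finally show ?thesis using e(2) unfolding same_germ_def by blast
qed

lemma same_germ_valid:
  assumes "valid s x" "t \<in> carrier S" "same_germ x s t"
  shows "valid t x"
proof -
  have x: "pf x" "s \<in> carrier S" using assms by (simp_all add: valid_def)
  obtain e where e: "e \<in> x" "s \<cdot> e = t \<cdot> e" using assms(3) unfolding same_germ_def by blast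
  have "valid (t \<cdot> e) x" using valid_restrict[OF assms(1) e(1)] e(2) by simp
  then show ?thesis using valid_restrictD(1)[OF assms(2) pf_P[OF x(1) e(1)]] by blast
qed

text \<open>\<open>s \<cdot> jn e f\<close> is the join of \<open>s \<cdot> e\<close> and
  \<open>s \<cdot> f\<close>. That join exists since \<open>s\<close> bounds both; it lies below
  \<open>s \<cdot> jn e f\<close>, and distributivity of projections shows that its domain is as
  large. Hence \<open>s \<cdot> jn e f\<close> depends on the two restrictions alone.\<close>

lemma join_restrict:
  assumes s: "s \<in> carrier S" and t: "t \<in> carrier S" and e: "e \<in> P" and f: "f \<in> P"
    and eq: "s \<cdot> e = t \<cdot> e" "s \<cdot> f = t \<cdot> f"
  shows "s \<cdot> jn e f = t \<cdot> jn e f"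
proof -
  have "is_join S {s \<cdot> e, s \<cdot> f} (s \<cdot> jn e f)" if s: "s \<in> carrier S" for s
  proof -
    have c: "e \<in> carrier S" "f \<in> carrier S" "s \<cdot> e \<in> carrier S" "s \<cdot> f \<in> carrier S"
      using e f s P_carrier m_closed by auto
    have j: "jn e f \<in> P" "jn e f \<in> carrier S" using jn_P e f P_carrier by auto
    have sj: "s \<cdot> jn e f \<in> carrier S" using m_closed s j by simp
    have le_s: "le S (s \<cdot> g) s" if g: "g \<in> P" for g
    proof -
      have "s \<cdot> star S (s \<cdot> g) = s \<cdot> star S s \<cdot> g"
        using star_mult_P[OF s g] assoc[of s "star S s" g] s g star_in P_carrier by simp
      then show ?thesis using mult_star[OF s] by (simp add: le_def)
    qed
    have le_j: "le S (s \<cdot> g) (s \<cdot> jn e f)" if g: "g \<in> P" "le S g (jn e f)" for g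
    proof -
      have gc: "g \<in> carrier S" "star S s \<in> P" "star S s \<in> carrier S" using g P_carrier star_in s by auto
      have "jn e f \<cdot> star S (s \<cdot> g) = star S s \<cdot> (jn e f \<cdot> g)"
        using star_mult_P[OF s g(1)] P_left_comm[OF j(1) gc(2) g(1)] by simp
      also have "\<dots> = star S (s \<cdot> g)" using g(2) le_P_iff[OF g(1)] star_mult_P[OF s g(1)] by simp
      finally have "s \<cdot> jn e f \<cdot> star S (s \<cdot> g) = s \<cdot> star S (s \<cdot> g)"
        using assoc[of s "jn e f" "star S (s \<cdot> g)"] s j star_in[OF m_closed[OF s gc(1)]] P_carrier by simp
      also have "\<dots> = s \<cdot> g" using le_s[OF g(1)] by (simp add: le_def)
      finally show ?thesis by (simp add: le_def)
    qed
    obtain v where v: "is_join S {s \<cdot> e, s \<cdot> f} v"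
      using bounded_join[OF c(3,4) s le_s[OF e] le_s[OF f]] by blast
    have vc: "v \<in> carrier S" and up: "le S (s \<cdot> e) v" "le S (s \<cdot> f) v"
      and vle: "le S v (s \<cdot> jn e f)"
      using v le_j[OF e jn_ge1[OF e f]] le_j[OF f jn_ge2[OF e f]] sj
      by (auto simp add: is_join_def is_lub_on_def)
    have P: "star S s \<in> P" "star S v \<in> P" using star_in s vc by auto
    have star_le: "le S (star S (s \<cdot> g)) (star S v)" if g: "g \<in> P" and le: "le S (s \<cdot> g) v" for g
    proof -
      have gP: "star S (s \<cdot> g) \<in> P" using star_in m_closed s P_carrier[OF g] by simp
      have "star S (s \<cdot> g) = star S (v \<cdot> star S (s \<cdot> g))" using le by (simp add: le_def)
      then show ?thesis using star_mult_P[OF vc gP] le_P_iff[OF gP] by simp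
    qed
    have "le S (jn (star S s \<cdot> e) (star S s \<cdot> f)) (star S v)"
      using jn_least[OF P_mult[OF P(1) e] P_mult[OF P(1) f] P(2)]
        star_le[OF e up(1)] star_le[OF f up(2)] star_mult_P[OF s] e f by simp
    then have "le S (star S (s \<cdot> jn e f)) (star S v)"
      using distrib[OF P(1) e f] star_mult_P[OF s j(1)] by simp
    moreover have jP: "star S (s \<cdot> jn e f) \<in> P" using star_in sj by simp
    ultimately have "star S (s \<cdot> jn e f) = star S v \<cdot> star S (s \<cdot> jn e f)" using le_P_iff[OF jP] by simp
    then have "s \<cdot> jn e f = s \<cdot> jn e f \<cdot> (star S v \<cdot> star S (s \<cdot> jn e f))" using mult_star[OF sj] by simp
    also have "\<dots> = s \<cdot> jn e f \<cdot> star S v"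
      using P_comm[OF P(2) jP] assoc[of "s \<cdot> jn e f" "star S (s \<cdot> jn e f)" "star S v"] sj P_carrier jP P(2)
        mult_star[OF sj] by simp
    also have "\<dots> = v" using vle by (simp add: le_def)
    finally show ?thesis using v by simp
  qed
  from this[OF s] this[OF t] show ?thesis using eq is_join_unique by simp
qed

text \<open>The projections on which \<open>s\<close> and \<open>t\<close> agree form an ideal, by
  \<open>join_restrict\<close>. If \<open>star S s\<close> were not in it, some prime filter
  containing \<open>star S s\<close> would avoid the ideal, against the equality of germs there. The
  same holds for \<open>star S t\<close>, so each element lies below the other.\<close>

lemma eq_of_same_germs:
  assumes s: "s \<in> carrier S" and t: "t \<in> carrier S"
    and st: "\<And>x. valid s x \<Longrightarrow> same_germ x s t" and ts: "\<And>x. valid t x \<Longrightarrow> same_germ x s t"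
  shows "s = t"
proof -
  define I where "I = {e \<in> P. s \<cdot> e = t \<cdot> e}"
  have "e \<in> I" if "f \<in> I" "e \<in> P" "le S e f" for e f
  proof -
    have "s \<cdot> (f \<cdot> e) = t \<cdot> (f \<cdot> e)"
      using that assoc[of s f e] assoc[of t f e] s t P_carrier by (simp add: I_def)
    then show ?thesis using that le_P_iff[OF that(2)] by (simp add: I_def)
  qed
  moreover have "jn e f \<in> I" if "e \<in> I" "f \<in> I" for e f
    using that join_restrict[OF s t] jn_P by (simp add: I_def)
  moreover have "z \<in> I" using z_right s t z_P by (simp add: I_def)
  ultimately have I: "ideal I" unfolding ideal_def by (auto simp add: I_def)
  have in_I: "star S u \<in> I" if u: "u \<in> carrier S" and g: "\<And>x. valid u x \<Longrightarrow> same_germ x s t" for u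
  proof (rule ccontr)
    assume "star S u \<notin> I"
    then obtain x where x: "pf x" "star S u \<in> x" "x \<inter> I = {}"
      using prime_filter_exists[OF I star_in[OF u]] by blast
    then have "same_germ x s t" using g u by (simp add: valid_def)
    then obtain e where "e \<in> x" "s \<cdot> e = t \<cdot> e" unfolding same_germ_def by blast
    then show False using x pf_P by (auto simp add: I_def)
  qed
  have "s \<cdot> star S s = t \<cdot> star S s" "s \<cdot> star S t = t \<cdot> star S t"
    using in_I[OF s st] in_I[OF t ts] by (auto simp add: I_def)
  then have "le S s t" "le S t s" using mult_star s t by (simp_all add: le_def)
  then show ?thesis using le_antisym s t by blast
qed

end

subsection \<open>The category of germs\<close>

text \<open>Germs and prime filters are sets of elements of \<open>S\<close>; \<open>gC\<close> and
  \<open>gO\<close> name them in the prescribed types of arrows and objects.\<close>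

locale germ_encoding = germ_semigroup S
  for S :: "('a, 'z) restr_sgp_scheme" +
  fixes gC :: "'a set \<Rightarrow> 'c" and gO :: "'a set \<Rightarrow> 'o"
  assumes gC: "inj_on gC (Pow (carrier S))" and gO: "inj_on gO (Pow (carrier S))"
begin

definition arr :: "'a \<Rightarrow> 'a set \<Rightarrow> 'c" where
  "arr s x = gC {t \<in> carrier S. valid t x \<and> same_germ x s t}"

definition \<theta> :: "'a \<Rightarrow> 'c set" where
  "\<theta> s = {arr s x | x. valid s x}"

text \<open>The class of a germ determines its base point: for \<open>e \<in> x\<close> it contains
  \<open>s \<cdot> e\<close>, which is valid only at filters containing \<open>e\<close>. So
  \<open>arr\<close> can encode the class without storing \<open>x\<close>.\<close>

lemma arr_eq_iff:
  assumes "valid s x" "valid t y"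
  shows "arr s x = arr t y \<longleftrightarrow> x = y \<and> same_germ x s t"
proof
  let ?g = "\<lambda>s x. {t \<in> carrier S. valid t x \<and> same_germ x s t}"
  have sub: "?g u w \<in> Pow (carrier S)" for u w by auto
  have inv: "x \<subseteq> y" if v: "valid s x" "valid t y" and eq: "?g s x = ?g t y" for s t x y
  proof
    fix e assume e: "e \<in> x"
    have s: "s \<in> carrier S" "pf x" using v by (simp_all add: valid_def)
    have se: "valid (s \<cdot> e) x" "same_germ x s (s \<cdot> e)"
      using valid_restrict[OF v(1) e] same_germ_sym[OF same_germ_restrict[OF s e]] by simp_all
    have "s \<cdot> e \<in> ?g s x" using se by (simp add: valid_def)
    then have "valid (s \<cdot> e) y" using eq by simp
    then show "e \<in> y" using valid_restrictD(2)[OF s(1) pf_P[OF s(2) e]] by blast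
  qed
  assume "arr s x = arr t y"
  then have eq: "?g s x = ?g t y" unfolding arr_def by (rule inj_onD[OF gC _ sub sub])
  have xy: "x = y" using inv[OF assms eq] inv[OF assms(2,1) eq[symmetric]] by (rule subset_antisym)
  have "s \<in> ?g s x" using assms same_germ_refl by (auto simp add: valid_def)
  then have "same_germ y t s" using eq by simp
  then show "x = y \<and> same_germ x s t" using xy same_germ_sym by simp
next
  assume *: "x = y \<and> same_germ x s t"
  have x: "pf x" "s \<in> carrier S" "t \<in> carrier S" using assms by (simp_all add: valid_def)
  have st: "same_germ x s t" and ts: "same_germ x t s" and xy: "x = y" using * same_germ_sym by blast+
  have "{u \<in> carrier S. valid u x \<and> same_germ x s u} = {u \<in> carrier S. valid u x \<and> same_germ x t u}"
    using same_germ_trans[OF x _ st] same_germ_trans[OF x(1,3,2) _ ts]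
      same_germ_trans[OF x(1,3,2) _ ts] same_germ_trans[OF x _ st] by blast
  then show "arr s x = arr t y" unfolding arr_def xy by (rule arg_cong)
qed

lemma gO_eq_iff: "pf x \<Longrightarrow> pf y \<Longrightarrow> gO x = gO y \<longleftrightarrow> x = y"
proof -
  assume "pf x" "pf y"
  then have "x \<in> Pow (carrier S)" "y \<in> Pow (carrier S)" using pf_carrier by auto
  then show ?thesis using inj_on_eq_iff[OF gO] by blast
qed

lemma valid_pf: "valid s x \<Longrightarrow> pf x"
  by (simp add: valid_def)

section \<open>Arrows, objects and structure maps of the category of germs\<close>

definition A1 :: "'c set" where "A1 = {arr s x | s x. valid s x}"
definition O0 :: "'o set" where "O0 = gO ` Collect pf"

text \<open>The structure maps are read off from an arbitrary representative; the lemmas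
  \<open>dmf\<close>, \<open>rgf\<close>, \<open>unf\<close> and \<open>muf\<close> show that its
  choice does not matter.\<close>

definition dmf :: "'c \<Rightarrow> 'o" where
  "dmf a = (SOME w. \<exists>s x. valid s x \<and> a = arr s x \<and> w = gO x)"

definition rgf :: "'c \<Rightarrow> 'o" where
  "rgf a = (SOME w. \<exists>s x. valid s x \<and> a = arr s x \<and> w = gO (rp s x))"

definition unf :: "'o \<Rightarrow> 'c" where
  "unf w = (SOME a. \<exists>e x. pf x \<and> e \<in> x \<and> w = gO x \<and> a = arr e x)"

definition muf :: "'c \<Rightarrow> 'c \<Rightarrow> 'c" where
  "muf a b = (SOME c. \<exists>s t x. valid t x \<and> valid s (rp t x) \<and> a = arr s (rp t x) \<and> b = arr t x \<and>
    c = arr (s \<cdot> t) x)"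

lemma dmf:
  assumes "valid s x"
  shows "dmf (arr s x) = gO x"
  unfolding dmf_def
proof (rule some_equality)
  show "\<exists>t y. valid t y \<and> arr s x = arr t y \<and> gO x = gO y" using assms by blast
  fix w assume "\<exists>t y. valid t y \<and> arr s x = arr t y \<and> w = gO y"
  then obtain t y where "valid t y" "arr s x = arr t y" "w = gO y" by blast
  then show "w = gO x" using arr_eq_iff[OF assms, of t y] by simp
qed

lemma rgf:
  assumes "valid s x"
  shows "rgf (arr s x) = gO (rp s x)"
  unfolding rgf_def
proof (rule some_equality)
  show "\<exists>t y. valid t y \<and> arr s x = arr t y \<and> gO (rp s x) = gO (rp t y)" using assms by blast
  fix w assume "\<exists>t y. valid t y \<and> arr s x = arr t y \<and> w = gO (rp t y)"
  then obtain t y where t: "valid t y" "arr s x = arr t y" "w = gO (rp t y)" by blast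
  have "x = y" "same_germ x s t" using iffD1[OF arr_eq_iff[OF assms t(1)] t(2)] by blast+
  then show "w = gO (rp s x)" using t same_germ_rp[of x s t] assms by (simp add: valid_def)
qed

text \<open>Two projections in \<open>x\<close> agree on their meet, so the unit at \<open>x\<close>
  is the germ of any of them.\<close>

lemma arr_P:
  assumes "pf x" "e \<in> x" "f \<in> x"
  shows "arr e x = arr f x"
proof -
  have "e \<cdot> (e \<cdot> f) = f \<cdot> (e \<cdot> f)"
    using P_left_idem[of e f] P_left_comm[of f e f] P_idem[of f] assms pf_P by simp
  then have "same_germ x e f" using pf_mult assms unfolding same_germ_def by blast
  then show ?thesis using arr_eq_iff[OF valid_P valid_P] assms by simp
qed

lemma unf:
  assumes "pf x" "e \<in> x"
  shows "unf (gO x) = arr e x"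
  unfolding unf_def
proof (rule some_equality)
  show "\<exists>f y. pf y \<and> f \<in> y \<and> gO x = gO y \<and> arr e x = arr f y" using assms by blast
  fix a assume "\<exists>f y. pf y \<and> f \<in> y \<and> gO x = gO y \<and> a = arr f y"
  then obtain f y where f: "pf y" "f \<in> y" "gO x = gO y" "a = arr f y" by blast
  then have "x = y" using iffD1[OF gO_eq_iff[OF assms(1) f(1)] f(3)] by simp
  then show "a = arr e x" using f(2,4) arr_P[OF assms] by simp
qed

lemma muf:
  assumes t: "valid t x" and s: "valid s (rp t x)"
  shows "muf (arr s (rp t x)) (arr t x) = arr (s \<cdot> t) x"
  unfolding muf_def
proof (rule some_equality)
  show "\<exists>s' t' y. valid t' y \<and> valid s' (rp t' y) \<and> arr s (rp t x) = arr s' (rp t' y) \<and>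
      arr t x = arr t' y \<and> arr (s \<cdot> t) x = arr (s' \<cdot> t') y" by (intro exI conjI) (rule t s refl)+
  fix c assume "\<exists>s' t' y. valid t' y \<and> valid s' (rp t' y) \<and> arr s (rp t x) = arr s' (rp t' y) \<and>
      arr t x = arr t' y \<and> c = arr (s' \<cdot> t') y"
  then obtain s' t' y where h: "valid t' y" "valid s' (rp t' y)" "arr s (rp t x) = arr s' (rp t' y)"
    "arr t x = arr t' y" "c = arr (s' \<cdot> t') y" by (elim exE conjE) (rule that; assumption)
  have xy: "x = y" "same_germ x t t'" using iffD1[OF arr_eq_iff[OF t h(1)] h(4)] by blast+
  have ss: "same_germ (rp t x) s s'" using iffD1[OF arr_eq_iff[OF s h(2)] h(3)] by blast
  have c: "pf x" "s \<in> carrier S" "s' \<in> carrier S" "t \<in> carrier S" "t' \<in> carrier S"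
    using t s h by (simp_all add: valid_def)
  have "same_germ x (s \<cdot> t) (s' \<cdot> t')" using same_germ_mult[OF c ss xy(2)] .
  then show "c = arr (s \<cdot> t) x"
    using arr_eq_iff[OF valid_mult[OF t s] valid_mult[OF h(1,2)]] h(5) xy(1) by simp
qed

lemma arr_cases:
  assumes "a \<in> A1"
  obtains s x where "valid s x" "a = arr s x"
  using assms unfolding A1_def by blast

lemma composable_cases:
  assumes "a \<in> A1" "b \<in> A1" "rgf b = dmf a"
  obtains s t x where "valid t x" "valid s (rp t x)" "a = arr s (rp t x)" "b = arr t x"
proof -
  obtain s y where s: "valid s y" "a = arr s y" using arr_cases[OF assms(1)] .
  obtain t x where t: "valid t x" "b = arr t x" using arr_cases[OF assms(2)] .
  have "gO (rp t x) = gO y" using assms(3) dmf rgf s t by simp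
  then have "y = rp t x" using gO_eq_iff[OF pf_rp[OF t(1)] valid_pf[OF s(1)]] by simp
  then show ?thesis using that s t by blast
qed

section \<open>Topologies on prime filters and on germs\<close>

definition X0 :: "'o topology" where
  "X0 = topology (\<lambda>W. W \<subseteq> O0 \<and> (\<forall>x. pf x \<longrightarrow> gO x \<in> W \<longrightarrow>
    (\<exists>e\<in>x. \<forall>y. pf y \<longrightarrow> e \<in> y \<longrightarrow> gO y \<in> W)))"

text \<open>Openness is stated by neighbourhoods: \<open>s\<close> is kept fixed while the base
  point moves among the filters containing some \<open>e\<close>. The sets \<open>\<theta> s\<close>
  form a basis.\<close>

definition X1 :: "'c topology" where
  "X1 = topology (\<lambda>W. W \<subseteq> A1 \<and> (\<forall>s x. valid s x \<longrightarrow> arr s x \<in> W \<longrightarrow>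
    (\<exists>e\<in>x. \<forall>y. valid s y \<longrightarrow> e \<in> y \<longrightarrow> arr s y \<in> W)))"

lemma pf_common:
  assumes "pf x" "e \<in> x" "f \<in> x"
  obtains g where "g \<in> x" "\<And>y. pf y \<Longrightarrow> g \<in> y \<Longrightarrow> e \<in> y \<and> f \<in> y"
  using that[of "e \<cdot> f"] pf_mult[OF assms] pf_mult_iff[OF _ pf_P[OF assms(1,2)] pf_P[OF assms(1,3)]] by blast

lemma openin_X0:
  "openin X0 W \<longleftrightarrow> W \<subseteq> O0 \<and> (\<forall>x. pf x \<longrightarrow> gO x \<in> W \<longrightarrow>
    (\<exists>e\<in>x. \<forall>y. pf y \<longrightarrow> e \<in> y \<longrightarrow> gO y \<in> W))"
proof -
  let ?L = "\<lambda>W. W \<subseteq> O0 \<and> (\<forall>x. pf x \<longrightarrow> gO x \<in> W \<longrightarrow>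
    (\<exists>e\<in>x. \<forall>y. pf y \<longrightarrow> e \<in> y \<longrightarrow> gO y \<in> W))"
  have "istopology ?L"
    unfolding istopology_def
  proof (rule conjI; intro allI impI)
    fix V W assume V: "?L V" and W: "?L W"
    have "\<exists>e\<in>x. \<forall>y. pf y \<longrightarrow> e \<in> y \<longrightarrow> gO y \<in> V \<inter> W" if x: "pf x" "gO x \<in> V \<inter> W" for x
    proof -
      obtain e where e: "e \<in> x" "\<And>y. pf y \<Longrightarrow> e \<in> y \<Longrightarrow> gO y \<in> V" using V x by blast
      obtain f where f: "f \<in> x" "\<And>y. pf y \<Longrightarrow> f \<in> y \<Longrightarrow> gO y \<in> W" using W x by blast
      obtain g where "g \<in> x" "\<And>y. pf y \<Longrightarrow> g \<in> y \<Longrightarrow> e \<in> y \<and> f \<in> y" using pf_common[OF x(1) e(1) f(1)] by blast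
      then show ?thesis using e(2) f(2) by blast
    qed
    then show "?L (V \<inter> W)" using V by blast
  next
    fix \<K> assume \<K>: "\<forall>K\<in>\<K>. ?L K"
    have "\<exists>e\<in>x. \<forall>y. pf y \<longrightarrow> e \<in> y \<longrightarrow> gO y \<in> \<Union>\<K>" if x: "pf x" "gO x \<in> \<Union>\<K>" for x
    proof -
      obtain K where K: "K \<in> \<K>" "gO x \<in> K" using x by blast
      obtain e where "e \<in> x" "\<And>y. pf y \<Longrightarrow> e \<in> y \<Longrightarrow> gO y \<in> K" using \<K> K x(1) by blast
      then show ?thesis using K(1) by blast
    qed
    moreover have "\<Union>\<K> \<subseteq> O0" using \<K> by blast
    ultimately show "?L (\<Union>\<K>)" by blast
  qed
  then show ?thesis unfolding X0_def by (simp add: topology_inverse')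
qed

lemma openin_X1:
  "openin X1 W \<longleftrightarrow> W \<subseteq> A1 \<and> (\<forall>s x. valid s x \<longrightarrow> arr s x \<in> W \<longrightarrow>
    (\<exists>e\<in>x. \<forall>y. valid s y \<longrightarrow> e \<in> y \<longrightarrow> arr s y \<in> W))"
proof -
  let ?L = "\<lambda>W. W \<subseteq> A1 \<and> (\<forall>s x. valid s x \<longrightarrow> arr s x \<in> W \<longrightarrow>
    (\<exists>e\<in>x. \<forall>y. valid s y \<longrightarrow> e \<in> y \<longrightarrow> arr s y \<in> W))"
  have "istopology ?L"
    unfolding istopology_def
  proof (rule conjI; intro allI impI)
    fix V W assume V: "?L V" and W: "?L W"
    have "\<exists>e\<in>x. \<forall>y. valid s y \<longrightarrow> e \<in> y \<longrightarrow> arr s y \<in> V \<inter> W" if x: "valid s x" "arr s x \<in> V \<inter> W" for s x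
    proof -
      have p: "pf y" if "valid s y" for y using that by (simp add: valid_def)
      obtain e where e: "e \<in> x" "\<And>y. valid s y \<Longrightarrow> e \<in> y \<Longrightarrow> arr s y \<in> V" using V x by blast
      obtain f where f: "f \<in> x" "\<And>y. valid s y \<Longrightarrow> f \<in> y \<Longrightarrow> arr s y \<in> W" using W x by blast
      obtain g where "g \<in> x" "\<And>y. pf y \<Longrightarrow> g \<in> y \<Longrightarrow> e \<in> y \<and> f \<in> y"
        using pf_common[OF p[OF x(1)] e(1) f(1)] by blast
      then show ?thesis using e(2) f(2) p by blast
    qed
    then show "?L (V \<inter> W)" using V by blast
  next
    fix \<K> assume \<K>: "\<forall>K\<in>\<K>. ?L K"
    have "\<exists>e\<in>x. \<forall>y. valid s y \<longrightarrow> e \<in> y \<longrightarrow> arr s y \<in> \<Union>\<K>" if x: "valid s x" "arr s x \<in> \<Union>\<K>" for s x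
    proof -
      obtain K where K: "K \<in> \<K>" "arr s x \<in> K" using x by blast
      obtain e where "e \<in> x" "\<And>y. valid s y \<Longrightarrow> e \<in> y \<Longrightarrow> arr s y \<in> K" using \<K> K x(1) by blast
      then show ?thesis using K(1) by blast
    qed
    moreover have "\<Union>\<K> \<subseteq> A1" using \<K> by blast
    ultimately show "?L (\<Union>\<K>)" by blast
  qed
  then show ?thesis unfolding X1_def by (simp add: topology_inverse')
qed

lemma topspace_X0 [simp]: "topspace X0 = O0"
proof -
  have "openin X0 O0" unfolding openin_X0 using pf_nonempty by (auto simp add: O0_def)
  then show ?thesis using openin_X0[of "topspace X0"] openin_subset by blast
qed

lemma topspace_X1 [simp]: "topspace X1 = A1"
proof -
  have "openin X1 A1" unfolding openin_X1 by (auto simp add: A1_def valid_def)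
  then show ?thesis using openin_X1[of "topspace X1"] openin_subset by blast
qed

lemma \<theta>_iff: "valid s x \<Longrightarrow> t \<in> carrier S \<Longrightarrow> arr s x \<in> \<theta> t \<longleftrightarrow> same_germ x s t"
proof
  assume v: "valid s x" and t: "t \<in> carrier S"
  show "same_germ x s t" if "arr s x \<in> \<theta> t"
  proof -
    obtain y where y: "valid t y" "arr s x = arr t y" using \<open>arr s x \<in> \<theta> t\<close> unfolding \<theta>_def by blast
    then show ?thesis using iffD1[OF arr_eq_iff[OF v y(1)] y(2)] by blast
  qed
  show "arr s x \<in> \<theta> t" if g: "same_germ x s t"
  proof -
    have "valid t x" using same_germ_valid[OF v t g] .
    moreover have "arr s x = arr t x" using arr_eq_iff[OF v \<open>valid t x\<close>] g by simp
    ultimately show ?thesis unfolding \<theta>_def by blast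
  qed
qed

lemma \<theta>_self: "valid s x \<Longrightarrow> arr s x \<in> \<theta> s"
  unfolding \<theta>_def by blast

lemma \<theta>_A1: "\<theta> s \<subseteq> A1"
  unfolding \<theta>_def A1_def by blast

lemma arr_restrict:
  assumes "valid s x" "e \<in> x"
  shows "arr (s \<cdot> e) x = arr s x"
  using arr_eq_iff[OF valid_restrict[OF assms] assms(1)] same_germ_restrict[of s x e] assms
  by (simp add: valid_def)

lemma \<theta>_restrict:
  assumes "s \<in> carrier S" "e \<in> P"
  shows "\<theta> (s \<cdot> e) = {arr s x | x. valid s x \<and> e \<in> x}"
  unfolding \<theta>_def using valid_restrict valid_restrictD[OF assms] arr_restrict by metis

lemma open_\<theta>:
  assumes s: "s \<in> carrier S"
  shows "openin X1 (\<theta> s)"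
  unfolding openin_X1
proof (intro conjI allI impI)
  show "\<theta> s \<subseteq> A1" by (rule \<theta>_A1)
  fix t x assume t: "valid t x" "arr t x \<in> \<theta> s"
  then obtain e where e: "e \<in> x" "t \<cdot> e = s \<cdot> e"
    using \<theta>_iff[OF t(1) s] unfolding same_germ_def by blast
  have "arr t y \<in> \<theta> s" if "valid t y" "e \<in> y" for y
    using \<theta>_iff[OF that(1) s] e(2) that(2) unfolding same_germ_def by blast
  then show "\<exists>e\<in>x. \<forall>y. valid t y \<longrightarrow> e \<in> y \<longrightarrow> arr t y \<in> \<theta> s" using e(1) by blast
qed

text \<open>The projections over which the germs of \<open>s\<close> have a finite subcover form an
  ideal. If it missed \<open>star S s\<close>, a prime filter \<open>x\<close> containing
  \<open>star S s\<close> would avoid it; yet the open set that contains \<open>arr s x\<close>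
  covers, by itself, all germs of \<open>s\<close> over some \<open>e \<in> x\<close>.\<close>

lemma compact_\<theta>:
  assumes s: "s \<in> carrier S"
  shows "compactin X1 (\<theta> s)"
  unfolding compactin_def
proof (intro conjI allI impI)
  show "\<theta> s \<subseteq> topspace X1" using \<theta>_A1 by simp
  fix \<U> assume \<U>: "Ball \<U> (openin X1) \<and> \<theta> s \<subseteq> \<Union>\<U>"
  define I where "I = {f \<in> P. \<exists>\<F>. finite \<F> \<and> \<F> \<subseteq> \<U> \<and> (\<forall>y. valid s y \<longrightarrow> f \<in> y \<longrightarrow> arr s y \<in> \<Union>\<F>)}"
  have down: "e \<in> I" if f: "f \<in> I" and e: "e \<in> P" "le S e f" for e f
  proof -
    obtain \<F> where \<F>: "finite \<F>" "\<F> \<subseteq> \<U>" "\<And>y. valid s y \<Longrightarrow> f \<in> y \<Longrightarrow> arr s y \<in> \<Union>\<F>"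
      and fP: "f \<in> P" using f by (auto simp add: I_def)
    have "arr s y \<in> \<Union>\<F>" if "valid s y" "e \<in> y" for y
      using \<F>(3)[OF that(1)] pf_up[of y e f] that e(2) fP by (simp add: valid_def)
    then show ?thesis using \<F>(1,2) e(1) unfolding I_def by blast
  qed
  have join: "jn e f \<in> I" if e: "e \<in> I" and f: "f \<in> I" for e f
  proof -
    obtain \<F> where \<F>: "finite \<F>" "\<F> \<subseteq> \<U>" "\<And>y. valid s y \<Longrightarrow> e \<in> y \<Longrightarrow> arr s y \<in> \<Union>\<F>"
      and eP: "e \<in> P" using e by (auto simp add: I_def)
    obtain \<G> where \<G>: "finite \<G>" "\<G> \<subseteq> \<U>" "\<And>y. valid s y \<Longrightarrow> f \<in> y \<Longrightarrow> arr s y \<in> \<Union>\<G>"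
      and fP: "f \<in> P" using f by (auto simp add: I_def)
    have "arr s y \<in> \<Union>(\<F> \<union> \<G>)" if y: "valid s y" "jn e f \<in> y" for y
    proof -
      have "e \<in> y \<or> f \<in> y" using pf_prime[OF _ eP fP y(2)] y(1) by (simp add: valid_def)
      then show ?thesis using \<F>(3)[OF y(1)] \<G>(3)[OF y(1)] by auto
    qed
    moreover have "finite (\<F> \<union> \<G>)" "\<F> \<union> \<G> \<subseteq> \<U>" using \<F> \<G> by auto
    ultimately show ?thesis using jn_P[OF eP fP] unfolding I_def by blast
  qed
  have "z \<in> I" using z_P pf_zero unfolding I_def valid_def by (intro CollectI conjI exI[of _ "{}"]) auto
  then have I: "ideal I" unfolding ideal_def using down join by (auto simp add: I_def)
  have "star S s \<in> I"
  proof (rule ccontr)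
    assume "star S s \<notin> I"
    then obtain x where x: "pf x" "star S s \<in> x" "x \<inter> I = {}"
      using prime_filter_exists[OF I star_in[OF s]] by blast
    then have v: "valid s x" using s by (simp add: valid_def)
    have "arr s x \<in> \<Union>\<U>" using \<U> \<theta>_self[OF v] by blast
    then obtain U where U: "U \<in> \<U>" "arr s x \<in> U" ..
    have "openin X1 U" using \<U> U(1) by blast
    then obtain e where e: "e \<in> x" "\<And>y. valid s y \<Longrightarrow> e \<in> y \<Longrightarrow> arr s y \<in> U"
      using v U(2) unfolding openin_X1 by blast
    have "e \<in> I" using pf_P[OF x(1) e(1)] e(2) U(1)
      unfolding I_def by (intro CollectI conjI exI[of _ "{U}"]) auto
    then show False using x(3) e(1) by blast
  qed
  then obtain \<F> where \<F>: "finite \<F>" "\<F> \<subseteq> \<U>" "\<And>y. valid s y \<Longrightarrow> star S s \<in> y \<Longrightarrow> arr s y \<in> \<Union>\<F>"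
    unfolding I_def by blast
  have "\<theta> s \<subseteq> \<Union>\<F>"
  proof
    fix a assume "a \<in> \<theta> s"
    then obtain y where "a = arr s y" "valid s y" unfolding \<theta>_def by blast
    then show "a \<in> \<Union>\<F>" using \<F>(3)[of y] by (simp add: valid_def)
  qed
  then show "\<exists>\<F>. finite \<F> \<and> \<F> \<subseteq> \<U> \<and> \<theta> s \<subseteq> \<Union>\<F>" using \<F>(1,2) by blast
qed

definition germ_cat :: "('c, 'o) top_cat" where
  "germ_cat = \<lparr>C1 = X1, C0 = X0, un = unf, dm = dmf, rg = rgf, mu = muf\<rparr>"

lemma germ_cat_simps [simp]:
  "C1 germ_cat = X1" "C0 germ_cat = X0" "un germ_cat = unf" "dm germ_cat = dmf" "rg germ_cat = rgf"
  "mu germ_cat = muf"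
  by (simp_all add: germ_cat_def)

lemma dmf_in: "a \<in> A1 \<Longrightarrow> dmf a \<in> O0"
  by (auto simp add: A1_def O0_def dmf valid_def)

lemma rgf_in: "a \<in> A1 \<Longrightarrow> rgf a \<in> O0"
  using pf_rp by (auto simp add: A1_def O0_def rgf)

lemma unf_in: "w \<in> O0 \<Longrightarrow> unf w \<in> A1"
proof -
  assume "w \<in> O0"
  then obtain x where x: "pf x" "w = gO x" by (auto simp add: O0_def)
  obtain e where e: "e \<in> x" using pf_nonempty[OF x(1)] by blast
  show ?thesis using unf[OF x(1) e] valid_P[OF x(1) e] x(2) unfolding A1_def by auto
qed

lemma continuous_unf: "continuous_map X0 X1 unf"
  unfolding continuous_map_def
proof (intro conjI allI impI)
  show "unf \<in> topspace X0 \<rightarrow> topspace X1" using unf_in by simp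
  fix W assume W: "openin X1 W"
  show "openin X0 {w \<in> topspace X0. unf w \<in> W}"
    unfolding openin_X0
  proof (intro conjI allI impI)
    fix x assume x: "pf x" "gO x \<in> {w \<in> topspace X0. unf w \<in> W}"
    obtain e where e: "e \<in> x" using pf_nonempty[OF x(1)] by blast
    have "arr e x \<in> W" using unf[OF x(1) e] x(2) by simp
    then obtain f where f: "f \<in> x" "\<And>y. valid e y \<Longrightarrow> f \<in> y \<Longrightarrow> arr e y \<in> W"
      using W valid_P[OF x(1) e] unfolding openin_X1 by blast
    obtain g where g: "g \<in> x" "\<And>y. pf y \<Longrightarrow> g \<in> y \<Longrightarrow> e \<in> y \<and> f \<in> y" using pf_common[OF x(1) e f(1)] by blast
    have "gO y \<in> {w \<in> topspace X0. unf w \<in> W}" if y: "pf y" "g \<in> y" for y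
      using f(2)[of y] g(2)[OF y] valid_P[of y e] unf[of y e] y(1) by (simp add: O0_def)
    then show "\<exists>e\<in>x. \<forall>y. pf y \<longrightarrow> e \<in> y \<longrightarrow> gO y \<in> {w \<in> topspace X0. unf w \<in> W}" using g(1) by blast
  qed auto
qed

lemma continuous_dmf: "continuous_map X1 X0 dmf"
  unfolding continuous_map_def
proof (intro conjI allI impI)
  show "dmf \<in> topspace X1 \<rightarrow> topspace X0" using dmf_in by simp
  fix W assume W: "openin X0 W"
  show "openin X1 {a \<in> topspace X1. dmf a \<in> W}"
    unfolding openin_X1
  proof (intro conjI allI impI)
    fix s x assume s: "valid s x" "arr s x \<in> {a \<in> topspace X1. dmf a \<in> W}"
    then have "pf x" "gO x \<in> W" using dmf[OF s(1)] by (simp_all add: valid_def)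
    then obtain e where e: "e \<in> x" "\<And>y. pf y \<Longrightarrow> e \<in> y \<Longrightarrow> gO y \<in> W" using W unfolding openin_X0 by blast
    have "arr s y \<in> {a \<in> topspace X1. dmf a \<in> W}" if y: "valid s y" "e \<in> y" for y
    proof -
      have "gO y \<in> W" using e(2) y by (simp add: valid_def)
      moreover have "arr s y \<in> A1" using y(1) unfolding A1_def by blast
      ultimately show ?thesis using dmf[OF y(1)] by simp
    qed
    then show "\<exists>e\<in>x. \<forall>y. valid s y \<longrightarrow> e \<in> y \<longrightarrow> arr s y \<in> {a \<in> topspace X1. dmf a \<in> W}" using e(1) by blast
  qed auto
qed

lemma continuous_rgf: "continuous_map X1 X0 rgf"
  unfolding continuous_map_def
proof (intro conjI allI impI)
  show "rgf \<in> topspace X1 \<rightarrow> topspace X0" using rgf_in by simp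
  fix W assume W: "openin X0 W"
  show "openin X1 {a \<in> topspace X1. rgf a \<in> W}"
    unfolding openin_X1
  proof (intro conjI allI impI)
    fix s x assume s: "valid s x" "arr s x \<in> {a \<in> topspace X1. rgf a \<in> W}"
    then have "gO (rp s x) \<in> W" using rgf[OF s(1)] by simp
    then obtain e where e: "e \<in> rp s x" "\<And>y. pf y \<Longrightarrow> e \<in> y \<Longrightarrow> gO y \<in> W"
      using W pf_rp[OF s(1)] unfolding openin_X0 by blast
    \<comment> \<open>The range of the germ at \<open>y\<close> contains \<open>e\<close> exactly
      when \<open>(e s)\<^sup>*\<close> belongs to \<open>y\<close>, so this projection gives the
      neighbourhood.\<close>
    have "arr s y \<in> {a \<in> topspace X1. rgf a \<in> W}" if y: "valid s y" "star S (e \<cdot> s) \<in> y" for y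
    proof -
      have "e \<in> rp s y" using e(1) y(2) by (simp add: rp_def)
      then have "gO (rp s y) \<in> W" using e(2) pf_rp[OF y(1)] by simp
      moreover have "arr s y \<in> A1" using y(1) unfolding A1_def by blast
      ultimately show ?thesis using rgf[OF y(1)] by simp
    qed
    moreover have "star S (e \<cdot> s) \<in> x" using e(1) by (simp add: rp_def)
    ultimately show "\<exists>e\<in>x. \<forall>y. valid s y \<longrightarrow> e \<in> y \<longrightarrow> arr s y \<in> {a \<in> topspace X1. rgf a \<in> W}" by blast
  qed auto
qed

lemma composable_germ_cat:
  "(a, b) \<in> composable germ_cat \<longleftrightarrow> a \<in> A1 \<and> b \<in> A1 \<and> rgf b = dmf a"
  by (simp add: composable_def)

lemma continuous_muf:
  "continuous_map (subtopology (prod_topology X1 X1) (composable germ_cat)) X1 (\<lambda>(x, y). muf x y)"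
  unfolding continuous_map_def
proof (intro conjI allI impI)
  let ?X = "subtopology (prod_topology X1 X1) (composable germ_cat)"
  have top: "topspace ?X = composable germ_cat" by (auto simp add: composable_germ_cat)
  show "(\<lambda>(x, y). muf x y) \<in> topspace ?X \<rightarrow> topspace X1"
  proof
    fix p assume "p \<in> topspace ?X"
    then obtain a b where p: "p = (a, b)" "a \<in> A1" "b \<in> A1" "rgf b = dmf a"
      unfolding top by (cases p) (simp add: composable_germ_cat)
    obtain s t x where st: "valid t x" "valid s (rp t x)" "a = arr s (rp t x)" "b = arr t x"
      using composable_cases[OF p(2-4)] .
    then show "(case p of (x, y) \<Rightarrow> muf x y) \<in> topspace X1"
      using muf[OF st(1,2)] valid_mult[OF st(1,2)] p(1) unfolding topspace_X1 A1_def by auto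
  qed
  fix W assume W: "openin X1 W"
  show "openin ?X {p \<in> topspace ?X. (case p of (x, y) \<Rightarrow> muf x y) \<in> W}"
  proof (subst openin_subopen, intro ballI)
    fix p assume p: "p \<in> {p \<in> topspace ?X. (case p of (x, y) \<Rightarrow> muf x y) \<in> W}"
    then obtain a b where ab: "p = (a, b)" "a \<in> A1" "b \<in> A1" "rgf b = dmf a" "muf a b \<in> W"
      unfolding top by (cases p) (simp add: composable_germ_cat)
    obtain s t x where st: "valid t x" "valid s (rp t x)" "a = arr s (rp t x)" "b = arr t x"
      using composable_cases[OF ab(2-4)] .
    have c: "s \<in> carrier S" "t \<in> carrier S" "pf x" using st by (simp_all add: valid_def)
    have "arr (s \<cdot> t) x \<in> W" using ab(5) muf[OF st(1,2)] st by simp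
    then obtain e where e: "e \<in> x" "\<And>y. valid (s \<cdot> t) y \<Longrightarrow> e \<in> y \<Longrightarrow> arr (s \<cdot> t) y \<in> W"
      using W valid_mult[OF st(1,2)] unfolding openin_X1 by blast
    have eP: "e \<in> P" "e \<in> carrier S" using e(1) pf_P pf_carrier c(3) by blast+
    \<comment> \<open>Restricting \<open>t\<close> to \<open>e\<close> pins the base point of the
      second factor; the base point of the first is then determined as the range of the
      second.\<close>
    let ?N = "(\<theta> s \<times> \<theta> (t \<cdot> e)) \<inter> composable germ_cat"
    have "openin (prod_topology X1 X1) (\<theta> s \<times> \<theta> (t \<cdot> e))"
      using open_\<theta> c(1) m_closed[OF c(2) eP(2)] by (simp add: openin_prod_Times_iff)
    then have "openin ?X ?N" unfolding openin_subtopology by blast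
    moreover have "p \<in> ?N"
      using ab st \<theta>_self[OF st(2)] \<theta>_restrict[OF c(2) eP(1)] st(1) e(1) by (auto simp add: composable_germ_cat)
    moreover have "?N \<subseteq> {p \<in> topspace ?X. (case p of (x, y) \<Rightarrow> muf x y) \<in> W}"
    proof
      fix q assume q: "q \<in> ?N"
      then obtain u y where u: "q = (arr s u, arr t y)" "valid s u" "valid t y" "e \<in> y"
        "rgf (arr t y) = dmf (arr s u)"
        using \<theta>_restrict[OF c(2) eP(1)] by (auto simp add: composable_germ_cat \<theta>_def[of s])
      have "gO (rp t y) = gO u" using u(5) rgf[OF u(3)] dmf[OF u(2)] by simp
      then have "rp t y = u" using gO_eq_iff[OF pf_rp[OF u(3)] valid_pf[OF u(2)]] by simp
      then have "muf (arr s u) (arr t y) = arr (s \<cdot> t) y" "valid (s \<cdot> t) y"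
        using muf[OF u(3)] valid_mult[OF u(3)] u(2) by auto
      then have "muf (arr s u) (arr t y) \<in> W" using e(2) u(4) by simp
      then show "q \<in> {p \<in> topspace ?X. (case p of (x, y) \<Rightarrow> muf x y) \<in> W}" using q u(1) unfolding top by auto
    qed
    ultimately show "\<exists>N. openin ?X N \<and> p \<in> N \<and> N \<subseteq> {p \<in> topspace ?X. (case p of (x, y) \<Rightarrow> muf x y) \<in> W}"
      by blast
  qed
qed

lemma topological_germ_cat: "topological_category germ_cat"
proof -
  have un: "dmf (unf w) = w \<and> rgf (unf w) = w" if "w \<in> O0" for w
  proof -
    obtain x where x: "pf x" "w = gO x" using \<open>w \<in> O0\<close> by (auto simp add: O0_def)
    obtain e where e: "e \<in> x" using pf_nonempty[OF x(1)] by blast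
    note v = valid_P[OF x(1) e]
    show ?thesis using unf[OF x(1) e] dmf[OF v] rgf[OF v] rp_P[OF x(1) e] x(2) by simp
  qed
  have mul: "dmf (muf a b) = dmf b \<and> rgf (muf a b) = rgf a"
    if ab: "a \<in> A1" "b \<in> A1" "rgf b = dmf a" for a b
  proof -
    obtain s t x where st: "valid t x" "valid s (rp t x)" "a = arr s (rp t x)" "b = arr t x"
      using composable_cases[OF ab] .
    have "rp (s \<cdot> t) x = rp s (rp t x)" using rp_mult st by (simp add: valid_def)
    then show ?thesis
      using muf[OF st(1,2)] dmf[OF valid_mult[OF st(1,2)]] rgf[OF valid_mult[OF st(1,2)]] dmf[OF st(1)]
        rgf[OF st(2)] st(3,4) by simp
  qed
  have unit: "muf a (unf (dmf a)) = a \<and> muf (unf (rgf a)) a = a" if a: "a \<in> A1" for a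
  proof -
    obtain s x where s: "valid s x" "a = arr s x" using arr_cases[OF a] .
    have sc: "s \<in> carrier S" and x: "pf x" and ex: "star S s \<in> x" using s by (simp_all add: valid_def)
    note e = valid_P[OF x ex]
    have r: "rp (star S s) x = x" using rp_P[OF x ex] .
    have "muf (arr s x) (arr (star S s) x) = arr (s \<cdot> star S s) x"
      using muf[OF e, of s] r s(1) by simp
    then have 1: "muf a (unf (dmf a)) = a"
      using unf[OF x ex] dmf[OF s(1)] mult_star[OF sc] s(2) by simp
    note pr = pf_rp[OF s(1)]
    obtain f where f: "f \<in> rp s x" using pf_nonempty[OF pr] by blast
    note vf = valid_P[OF pr f]
    have "muf (unf (rgf a)) a = arr (f \<cdot> s) x"
      using unf[OF pr f] rgf[OF s(1)] muf[OF s(1) vf] s(2) by simp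
    also have "\<dots> = a"
      using arr_eq_iff[OF valid_mult[OF s(1) vf] s(1)] same_germ_left_P[OF sc x f] s(2) by simp
    finally show ?thesis using 1 by simp
  qed
  have assoc3: "muf (muf a b) c = muf a (muf b c)"
    if abc: "a \<in> A1" "b \<in> A1" "c \<in> A1" "rgf b = dmf a" "rgf c = dmf b" for a b c
  proof -
    obtain t u x where tu: "valid u x" "valid t (rp u x)" "b = arr t (rp u x)" "c = arr u x"
      using composable_cases[OF abc(2,3,5)] .
    obtain s y where sy: "valid s y" "a = arr s y" using arr_cases[OF abc(1)] .
    have "gO (rp t (rp u x)) = gO y" using abc(4) rgf[OF tu(2)] dmf[OF sy(1)] tu(3) sy(2) by simp
    then have y: "y = rp t (rp u x)"
      using gO_eq_iff[OF pf_rp[OF tu(2)] valid_pf[OF sy(1)]] by simp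
    have car: "s \<in> carrier S" "t \<in> carrier S" "u \<in> carrier S" using tu sy by (simp_all add: valid_def)
    have vs: "valid s (rp t (rp u x))" using sy(1) y by simp
    have yu: "rp (t \<cdot> u) x = rp t (rp u x)" using rp_mult car by simp
    have "muf a b = arr (s \<cdot> t) (rp u x)" using muf[OF tu(2) vs] sy(2) tu(3) y by simp
    then have "muf (muf a b) c = arr (s \<cdot> t \<cdot> u) x"
      using muf[OF tu(1) valid_mult[OF tu(2) vs]] tu(4) by simp
    moreover have "muf b c = arr (t \<cdot> u) x" using muf[OF tu(1,2)] tu(3,4) by simp
    then have "muf a (muf b c) = arr (s \<cdot> (t \<cdot> u)) x"
      using muf[OF valid_mult[OF tu(1,2)], of s] yu vs sy(2) y by simp
    ultimately show ?thesis using assoc car by simp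
  qed
  show ?thesis
    unfolding topological_category_def
    using continuous_unf continuous_dmf continuous_rgf continuous_muf un mul unit assoc3
    by (auto simp add: composable_germ_cat)
qed

section \<open>Basic compact open sets of filters, and ampleness\<close>

definition DD :: "'a \<Rightarrow> 'o set" where
  "DD e = {gO x | x. pf x \<and> e \<in> x}"

lemma dmf_\<theta>: "s \<in> carrier S \<Longrightarrow> dmf ` \<theta> s = DD (star S s)"
proof (intro equalityI subsetI)
  show "w \<in> DD (star S s)" if "s \<in> carrier S" "w \<in> dmf ` \<theta> s" for w
    using that dmf by (auto simp add: \<theta>_def DD_def valid_def)
  show "w \<in> dmf ` \<theta> s" if s: "s \<in> carrier S" and w: "w \<in> DD (star S s)" for w
  proof -
    obtain x where x: "w = gO x" "pf x" "star S s \<in> x" using w unfolding DD_def by blast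
    then have v: "valid s x" using s by (simp add: valid_def)
    show ?thesis using \<theta>_self[OF v] dmf[OF v] x(1) by (metis image_eqI)
  qed
qed

lemma DD_iff: "pf x \<Longrightarrow> gO x \<in> DD e \<longleftrightarrow> e \<in> x"
  unfolding DD_def using gO_eq_iff by auto

lemma open_DD: "openin X0 (DD e)"
  unfolding openin_X0
proof (intro conjI allI impI)
  show "DD e \<subseteq> O0" by (auto simp add: DD_def O0_def)
  show "\<exists>f\<in>x. \<forall>y. pf y \<longrightarrow> f \<in> y \<longrightarrow> gO y \<in> DD e" if "pf x" "gO x \<in> DD e" for x
    using that DD_iff by blast
qed

lemma compact_DD: "e \<in> P \<Longrightarrow> compactin X0 (DD e)"
  using image_compactin[OF compact_\<theta> continuous_dmf] dmf_\<theta> P_carrier by fastforce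

lemma open_map_dmf: "open_map X1 X0 dmf"
  unfolding open_map_def
proof (intro allI impI)
  fix W assume W: "openin X1 W"
  show "openin X0 (dmf ` W)"
    unfolding openin_X0
  proof (intro conjI allI impI)
    show "dmf ` W \<subseteq> O0" using openin_subset[OF W] dmf_in by auto
    fix x assume x: "pf x" "gO x \<in> dmf ` W"
    then obtain a where a: "a \<in> W" "gO x = dmf a" by blast
    then have "a \<in> A1" using openin_subset[OF W] by auto
    then obtain s y where s: "valid s y" "a = arr s y" using arr_cases by blast
    then have "y = x" using a(2) dmf[OF s(1)] gO_eq_iff[OF x(1)] by (simp add: valid_def)
    then have v: "valid s x" "arr s x \<in> W" using s a by auto
    then obtain e where e: "e \<in> x" "\<And>y. valid s y \<Longrightarrow> e \<in> y \<Longrightarrow> arr s y \<in> W"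
      using W unfolding openin_X1 by blast
    have sx: "star S s \<in> x" "s \<in> carrier S" using v by (simp_all add: valid_def)
    obtain g where g: "g \<in> x" "\<And>y. pf y \<Longrightarrow> g \<in> y \<Longrightarrow> e \<in> y \<and> star S s \<in> y"
      using pf_common[OF x(1) e(1) sx(1)] by blast
    have "gO y \<in> dmf ` W" if y: "pf y" "g \<in> y" for y
    proof -
      have vy: "valid s y" using g(2)[OF y] y(1) sx(2) by (simp add: valid_def)
      then have "arr s y \<in> W" using e(2) g(2)[OF y] by blast
      then show ?thesis using dmf[OF vy] by (metis image_eqI)
    qed
    then show "\<exists>e\<in>x. \<forall>y. pf y \<longrightarrow> e \<in> y \<longrightarrow> gO y \<in> dmf ` W" using g(1) by blast
  qed
qed

lemma inj_dmf_\<theta>: "inj_on dmf (\<theta> s)"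
proof (rule inj_onI)
  fix a b assume "a \<in> \<theta> s" "b \<in> \<theta> s" and eq: "dmf a = dmf b"
  then obtain x y where xy: "a = arr s x" "valid s x" "b = arr s y" "valid s y" unfolding \<theta>_def by blast
  then have "gO x = gO y" using eq dmf by simp
  then show "a = b" using gO_eq_iff[of x y] xy by (simp add: valid_def)
qed

lemma compact_slice_\<theta>: "s \<in> carrier S \<Longrightarrow> compact_slice germ_cat (\<theta> s)"
  by (simp add: compact_slice_def is_slice_def open_\<theta> compact_\<theta> inj_dmf_\<theta>)

lemma \<theta>_basis:
  assumes W: "openin X1 W" and a: "a \<in> W"
  shows "\<exists>s\<in>carrier S. a \<in> \<theta> s \<and> \<theta> s \<subseteq> W"
proof -
  have "a \<in> A1" using W a openin_subset by fastforce
  then obtain s x where s: "valid s x" "a = arr s x" using arr_cases by blast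
  then obtain e where e: "e \<in> x" "\<And>y. valid s y \<Longrightarrow> e \<in> y \<Longrightarrow> arr s y \<in> W"
    using W a unfolding openin_X1 by blast
  have c: "s \<in> carrier S" "e \<in> P" "e \<in> carrier S" using s e(1) pf_P P_carrier by (auto simp add: valid_def)
  have "a \<in> \<theta> (s \<cdot> e)" "\<theta> (s \<cdot> e) \<subseteq> W"
    using \<theta>_restrict[OF c(1,2)] s e by auto
  then show ?thesis using m_closed[OF c(1,3)] by blast
qed

lemma Hausdorff_X0: "Hausdorff_space X0"
proof -
  have sep: "\<exists>U V. openin X0 U \<and> openin X0 V \<and> gO x \<in> U \<and> gO y \<in> V \<and> disjnt U V"
    if xy: "pf x" "pf y" "e \<in> x" "e \<notin> y" for x y e
  proof -
    obtain f where f: "f \<in> y" using pf_nonempty[OF xy(2)] by blast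
    have P: "e \<in> P" "f \<in> P" using pf_P xy f by blast+
    \<comment> \<open>\<open>g\<close> is the part of \<open>f\<close> outside \<open>e\<close>.
      Since \<open>f\<close> but not \<open>e\<close> belongs to \<open>y\<close>, primeness puts
      \<open>g\<close> into \<open>y\<close>, and no prime filter contains both \<open>e\<close> and
      \<open>g\<close>.\<close>
    obtain g where g: "g \<in> P" "g \<cdot> e = z" "jn (f \<cdot> e) g = f" using complement[OF P(2,1)] .
    have "f \<cdot> e \<notin> y" using pf_mult_iff[OF xy(2) P(2,1)] xy(4) by blast
    then have gy: "g \<in> y" using pf_prime[OF xy(2) P_mult[OF P(2,1)] g(1)] g(3) f by simp
    have "disjnt (DD e) (DD g)"
    proof -
      have False if w: "w \<in> DD e" "w \<in> DD g" for w
      proof -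
        obtain v where v: "w = gO v" "pf v" "e \<in> v" using w(1) unfolding DD_def by blast
        then have "g \<in> v" using w(2) DD_iff by blast
        then have "z \<in> v" using pf_mult[OF v(2) _ v(3)] g(2) by metis
        then show False using pf_zero[OF v(2)] by blast
      qed
      then show ?thesis by (auto simp add: disjnt_iff)
    qed
    then show ?thesis
      using open_DD[of e] open_DD[of g] DD_iff[OF xy(1)] DD_iff[OF xy(2)] xy(3) gy by blast
  qed
  show ?thesis
    unfolding Hausdorff_space_def
  proof (intro allI impI)
    fix v w assume vw: "v \<in> topspace X0 \<and> w \<in> topspace X0 \<and> v \<noteq> w"
    then obtain x y where xy: "pf x" "v = gO x" "pf y" "w = gO y" by (auto simp add: O0_def)
    then have "x \<noteq> y" using vw by blast
    then consider e where "e \<in> x" "e \<notin> y" | e where "e \<in> y" "e \<notin> x" by blast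
    then show "\<exists>U V. openin X0 U \<and> openin X0 V \<and> v \<in> U \<and> w \<in> V \<and> disjnt U V"
    proof cases
      case 1
      show ?thesis using sep[OF xy(1,3) 1] unfolding xy(2,4) .
    next
      case 2
      obtain U V where "openin X0 U" "openin X0 V" "gO y \<in> U" "gO x \<in> V" "disjnt U V"
        using sep[OF xy(3,1) 2] by blast
      then show ?thesis unfolding xy(2,4) using disjnt_sym by blast
    qed
  qed
qed

lemma ample_germ_cat: "ample germ_cat"
proof -
  have "\<exists>U K. openin X0 U \<and> compactin X0 K \<and> w \<in> U \<and> U \<subseteq> K" if w: "w \<in> topspace X0" for w
  proof -
    obtain x where x: "pf x" "w = gO x" using w by (auto simp add: O0_def)
    obtain e where e: "e \<in> x" using pf_nonempty[OF x(1)] by blast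
    then show ?thesis using open_DD compact_DD pf_P[OF x(1) e] DD_iff[OF x(1)] x(2) by blast
  qed
  then have lc: "locally_compact_space X0" by (simp add: locally_compact_space_def)
  have "local_homeomorphism X1 X0 dmf"
    unfolding local_homeomorphism_def
  proof (intro conjI ballI)
    show "dmf \<in> topspace X1 \<rightarrow> topspace X0" using dmf_in by simp
    fix a assume "a \<in> topspace X1"
    then obtain s x where s: "valid s x" "a = arr s x" using arr_cases by auto
    then have c: "s \<in> carrier S" by (simp add: valid_def)
    have o: "openin X0 (dmf ` \<theta> s)" using open_map_dmf open_\<theta>[OF c] by (simp add: open_map_def)
    have "homeomorphic_map (subtopology X1 (\<theta> s)) (subtopology X0 (dmf ` \<theta> s)) dmf"
    proof (rule bijective_open_imp_homeomorphic_map)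
      show "continuous_map (subtopology X1 (\<theta> s)) (subtopology X0 (dmf ` \<theta> s)) dmf"
        using continuous_map_from_subtopology[OF continuous_dmf]
        by (auto simp add: continuous_map_in_subtopology)
      show "open_map (subtopology X1 (\<theta> s)) (subtopology X0 (dmf ` \<theta> s)) dmf"
        unfolding open_map_def
      proof (intro allI impI)
        fix W assume "openin (subtopology X1 (\<theta> s)) W"
        then have "openin X1 W" "W \<subseteq> \<theta> s" using open_\<theta>[OF c] by (simp_all add: openin_open_subtopology)
        then show "openin (subtopology X0 (dmf ` \<theta> s)) (dmf ` W)"
          using o open_map_dmf by (auto simp add: openin_open_subtopology open_map_def)
      qed
      show "dmf ` topspace (subtopology X1 (\<theta> s)) = topspace (subtopology X0 (dmf ` \<theta> s))"
        using \<theta>_A1[of s] openin_subset[OF o] by (simp add: inf_absorb2)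
      show "inj_on dmf (topspace (subtopology X1 (\<theta> s)))"
        using inj_dmf_\<theta>[of s] by (rule inj_on_subset) simp
    qed
    then show "\<exists>U. openin X1 U \<and> a \<in> U \<and> openin X0 (dmf ` U) \<and>
        homeomorphic_map (subtopology X1 U) (subtopology X0 (dmf ` U)) dmf"
      using o open_\<theta>[OF c] \<theta>_self[OF s(1)] s(2) by blast
  qed
  then have "etale_category germ_cat"
    using topological_germ_cat lc Hausdorff_X0 by (simp add: etale_category_def)
  moreover have "openin X1 = arbitrary union_of (compact_slice germ_cat)"
    unfolding openin_topology_base_unique
  proof (intro conjI allI impI)
    show "openin X1 V" if "compact_slice germ_cat V" for V
      using that by (simp add: compact_slice_def is_slice_def)
    show "\<exists>V. compact_slice germ_cat V \<and> a \<in> V \<and> V \<subseteq> W" if "openin X1 W \<and> a \<in> W" for W a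
      using \<theta>_basis[of W a] compact_slice_\<theta> that by blast
  qed
  ultimately show ?thesis by (simp add: ample_def)
qed

lemma DD_join: "e \<in> P \<Longrightarrow> f \<in> P \<Longrightarrow> DD (jn e f) = DD e \<union> DD f"
  unfolding DD_def using pf_prime pf_up[OF _ _ jn_P jn_ge1] pf_up[OF _ _ jn_P jn_ge2] by blast

text \<open>By compactness the set is a finite union of sets \<open>DD e\<close>, and such a union
  is again of this form because prime filters turn joins into unions.\<close>

lemma compact_open_DD:
  assumes U: "openin X0 U" "compactin X0 U"
  shows "\<exists>e\<in>P. U = DD e"
proof -
  have cov: "\<exists>V\<in>DD ` {e \<in> P. DD e \<subseteq> U}. openin X0 V \<and> w \<in> V" if w: "w \<in> U" for w
  proof -
    have "w \<in> O0" using w openin_subset[OF U(1)] by auto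
    then obtain x where x: "pf x" "w = gO x" by (auto simp add: O0_def)
    then obtain e where e: "e \<in> x" "\<And>y. pf y \<Longrightarrow> e \<in> y \<Longrightarrow> gO y \<in> U"
      using U(1) w unfolding openin_X0 by blast
    then have "DD e \<subseteq> U" unfolding DD_def by blast
    then show ?thesis using e(1) pf_P[OF x(1)] open_DD DD_iff[OF x(1)] x(2) by blast
  qed
  obtain \<F> where \<F>: "finite \<F>" "\<F> \<subseteq> DD ` {e \<in> P. DD e \<subseteq> U}" "U \<subseteq> \<Union>\<F>"
    using compactin_finite_cover[OF U(2) cov] .
  have "\<exists>e\<in>P. DD e = \<Union>\<F>" using \<F>(1,2)
  proof (induction rule: finite_induct)
    case empty
    have "DD z = {}" unfolding DD_def using pf_zero by blast
    then show ?case using z_P by auto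
  next
    case (insert V \<F>)
    then obtain e f where "e \<in> P" "DD e = V" "f \<in> P" "DD f = \<Union>\<F>" by auto
    then show ?case using DD_join jn_P by (metis Union_insert)
  qed
  moreover have "\<Union>\<F> = U" using \<F>(2,3) by blast
  ultimately show ?thesis by metis
qed

lemma unf_DD: "e \<in> P \<Longrightarrow> unf ` DD e = \<theta> e"
proof -
  assume e: "e \<in> P"
  have v: "valid e x \<longleftrightarrow> pf x \<and> e \<in> x" for x using e P_carrier by (auto simp add: valid_def)
  show ?thesis unfolding DD_def \<theta>_def v using unf by (auto simp add: image_iff) metis+
qed

lemma \<theta>_mult:
  assumes s: "s \<in> carrier S" and t: "t \<in> carrier S"
  shows "\<theta> (s \<cdot> t) = slice_prod germ_cat (\<theta> s) (\<theta> t)"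
proof (intro equalityI subsetI)
  fix a assume "a \<in> \<theta> (s \<cdot> t)"
  then obtain x where x: "a = arr (s \<cdot> t) x" "valid (s \<cdot> t) x" unfolding \<theta>_def by blast
  note v = valid_multD[OF s t x(2)]
  have "a = muf (arr s (rp t x)) (arr t x)" using muf[OF v] x by simp
  moreover have "rgf (arr t x) = dmf (arr s (rp t x))" using rgf[OF v(1)] dmf[OF v(2)] by simp
  ultimately show "a \<in> slice_prod germ_cat (\<theta> s) (\<theta> t)"
    unfolding slice_prod_def germ_cat_simps using \<theta>_self[OF v(1)] \<theta>_self[OF v(2)] by blast
next
  fix a assume "a \<in> slice_prod germ_cat (\<theta> s) (\<theta> t)"
  then obtain y x where xy: "a = muf (arr s y) (arr t x)" "valid s y" "valid t x" "rgf (arr t x) = dmf (arr s y)"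
    unfolding slice_prod_def germ_cat_simps \<theta>_def by blast
  have "gO (rp t x) = gO y" using xy(4) rgf[OF xy(3)] dmf[OF xy(2)] by simp
  then have "rp t x = y" using gO_eq_iff[OF pf_rp[OF xy(3)] valid_pf[OF xy(2)]] by simp
  then have "a = arr (s \<cdot> t) x" "valid (s \<cdot> t) x" using muf[OF xy(3)] valid_mult[OF xy(3)] xy by auto
  then show "a \<in> \<theta> (s \<cdot> t)" unfolding \<theta>_def by blast
qed

lemma germ_representation: "representation germ_cat S \<theta>"
proof unfold_locales
  show "ample germ_cat" by (rule ample_germ_cat)
  show "inj_on \<theta> (carrier S)"
  proof (rule inj_onI)
    fix s t assume s: "s \<in> carrier S" and t: "t \<in> carrier S" and eq: "\<theta> s = \<theta> t"
    show "s = t"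
    proof (rule eq_of_same_germs[OF s t])
      show "same_germ x s t" if "valid s x" for x
        using \<theta>_self[OF that] \<theta>_iff[OF that t] eq by simp
      show "same_germ x s t" if "valid t x" for x
        using \<theta>_self[OF that] \<theta>_iff[OF that s] eq same_germ_sym by simp
    qed
  qed
  show "compact_slice germ_cat (\<theta> s)" if "s \<in> carrier S" for s using compact_slice_\<theta>[OF that] .
  show "s \<cdot> t \<in> carrier S" if "s \<in> carrier S" "t \<in> carrier S" for s t using m_closed[OF that] .
  show "star S s \<in> carrier S" if "s \<in> carrier S" for s using P_carrier[OF star_in[OF that]] .
  show "\<theta> (s \<cdot> t) = slice_prod germ_cat (\<theta> s) (\<theta> t)" if "s \<in> carrier S" "t \<in> carrier S" for s t
    using \<theta>_mult[OF that] .
  show "\<theta> (star S s) = un germ_cat ` dm germ_cat ` \<theta> s" if "s \<in> carrier S" for s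
    using unf_DD[OF star_in[OF that]] dmf_\<theta>[OF that] by simp
  show "\<exists>e\<in>carrier S. \<theta> e = un germ_cat ` U" if "compact_open (C0 germ_cat) U" for U
  proof -
    obtain e where e: "e \<in> P" "U = DD e" using compact_open_DD[of U] \<open>compact_open (C0 germ_cat) U\<close>
      by (auto simp add: compact_open_def)
    then show ?thesis using unf_DD[OF e(1)] P_carrier[OF e(1)] by auto
  qed
  show "\<exists>s\<in>carrier S. a \<in> \<theta> s \<and> \<theta> s \<subseteq> W" if "openin (C1 germ_cat) W" "a \<in> W" for W a
    using \<theta>_basis that by simp
qed

end

lemma (in germ_semigroup) representation_exists:
  assumes "Pow (carrier S) \<lesssim> (UNIV :: 'c set)" "Pow (carrier S) \<lesssim> (UNIV :: 'o set)"
  shows "\<exists>(C :: ('c, 'o) top_cat) \<delta>. representation C S \<delta>"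
proof -
  obtain gC :: "'a set \<Rightarrow> 'c" where gC: "inj_on gC (Pow (carrier S))"
    using assms(1) by (auto simp add: lepoll_def)
  obtain gO :: "'a set \<Rightarrow> 'o" where gO: "inj_on gO (Pow (carrier S))"
    using assms(2) by (auto simp add: lepoll_def)
  interpret germ_encoding S gC gO by unfold_locales (rule gC gO)+
  show ?thesis using germ_representation by blast
qed

subsection \<open>Boolean restriction and birestriction semigroups\<close>

text \<open>Elements below a common bound are compatible, so joins of compatible pairs give the
  bounded ones. For the last property, the join of two projections in \<open>S\<close> is itself a
  projection; right multiplication therefore preserves the join taken among projections, and
  \<open>is_join_star\<close> bounds the domain.\<close>

lemma germ_semigroup_boolean:
  assumes B: "boolean_restriction_semigroup S" and L: "local_units S"
  shows "germ_semigroup S"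
proof -
  have R: "restriction_semigroup S" and Z: "\<exists>z. is_zero S z"
    and G: "generalized_boolean_algebra (projections S) (le S) (zero_of S)"
    and J: "\<And>s t. s \<in> carrier S \<Longrightarrow> t \<in> carrier S \<Longrightarrow> compatible S s t \<Longrightarrow> \<exists>v. is_join S {s, t} v"
    and M: "\<And>s t u v. s \<in> carrier S \<Longrightarrow> t \<in> carrier S \<Longrightarrow> u \<in> carrier S \<Longrightarrow> is_join S {s, t} v \<Longrightarrow>
      is_join S {mult S s u, mult S t u} (mult S v u)"
    using B unfolding boolean_restriction_semigroup_def by blast+
  interpret restriction_sgp S by unfold_locales (rule R)
  have lat: "lattice_on P (le S)" using G unfolding generalized_boolean_algebra_def by blast
  note lub = join_on_lub[OF lat]
  have bounded: "\<exists>v. is_join S {s, t} v"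
    if c: "s \<in> carrier S" "t \<in> carrier S" "u \<in> carrier S" and l: "le S s u" "le S t u" for s t u
  proof -
    have P: "star S s \<in> P" "star S t \<in> P" "star S s \<in> carrier S" "star S t \<in> carrier S"
      using c star_in P_carrier by auto
    have "s \<cdot> star S t = u \<cdot> star S s \<cdot> star S t" using l(1) by (simp add: le_def)
    also have "\<dots> = u \<cdot> star S t \<cdot> star S s" using assoc[of u] P_comm[OF P(1,2)] c P by simp
    also have "\<dots> = t \<cdot> star S s" using l(2) by (simp add: le_def)
    finally show ?thesis using J c by (simp add: compatible_def)
  qed
  have star_join: "le S (star S (join_on P (le S) e f \<cdot> s)) (join_on P (le S) (star S (e \<cdot> s)) (star S (f \<cdot> s)))"
    if ef: "e \<in> P" "f \<in> P" and s: "s \<in> carrier S" for e f s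
  proof -
    have c: "e \<in> carrier S" "f \<in> carrier S" using ef P_carrier by auto
    have "compatible S e f" using P_comm ef by (simp add: compatible_def)
    then obtain v where v: "is_join S {e, f} v" using J c by blast
    then have vc: "v \<in> carrier S" and up: "le S e v" "le S f v"
      and least: "\<And>w. w \<in> carrier S \<Longrightarrow> le S e w \<Longrightarrow> le S f w \<Longrightarrow> le S v w"
      by (auto simp add: is_join_def is_lub_on_def)
    have vP: "star S v \<in> P" using star_in vc .
    have "le S g (star S v)" if g: "g \<in> P" "le S g v" for g
    proof -
      have "g = v \<cdot> g" using le_P_iff g by blast
      then have "star S g = star S v \<cdot> g" using star_mult_P[OF vc g(1)] by simp
      then show ?thesis using le_P_iff g(1) by simp
    qed
    \<comment> \<open>\<open>star S v\<close> is an upper bound of \<open>e\<close> and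
      \<open>f\<close>, which forces their join \<open>v\<close> to be a projection.\<close>
    then have "le S v (star S v)" using least[OF P_carrier[OF vP]] up ef by blast
    then have "v = star S v" using P_idem[OF vP] by (simp add: le_def)
    then have vP': "v \<in> P" using vP by simp
    have "v = join_on P (le S) e f"
      using lub[OF ef] vP' vc up least P_carrier le_antisym unfolding is_lub_on_def by (metis insertI1 insert_iff singletonD)
    then have J: "is_join S {e \<cdot> s, f \<cdot> s} (join_on P (le S) e f \<cdot> s)" using M[OF c s v] by simp
    have P: "star S (e \<cdot> s) \<in> P" "star S (f \<cdot> s) \<in> P" using star_in m_closed c s by auto
    show ?thesis
      using is_join_star[OF m_closed[OF c(1) s] m_closed[OF c(2) s] J] lub[OF P] unfolding is_lub_on_def by blast
  qed
  show ?thesis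
    by (unfold_locales; (rule R Z G L bounded star_join; assumption))
qed

lemma range_local_units:
  assumes "range_semigroup S"
  shows "local_units S"
proof -
  have "plus S s \<in> projections S \<and> mult S (plus S s) s = s" if "s \<in> carrier S" for s
    using assms that unfolding range_semigroup_def projections_def by (metis image_eqI)
  then show ?thesis unfolding local_units_def by blast
qed

text \<open>The range operation takes the place of distributivity over joins. Let \<open>g\<close>
  be the join of \<open>e\<close> and \<open>f\<close>, \<open>j\<close> the join of
  \<open>(e s)\<^sup>*\<close> and \<open>(f s)\<^sup>*\<close>, and \<open>w = s j\<close>. The
  range of \<open>w\<close> contains those of \<open>e s\<close> and \<open>f s\<close>, hence the
  part of the range of \<open>s\<close> below \<open>g\<close>. Therefore
  \<open>g s = g w = g s j\<close>, which bounds the domain of \<open>g s\<close> by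
  \<open>j\<close>.\<close>

lemma germ_semigroup_birestriction:
  assumes B: "boolean_birestriction_semigroup S"
  shows "germ_semigroup S"
proof -
  have BR: "birestriction_semigroup S" and Z: "\<exists>z. is_zero S z"
    and G: "generalized_boolean_algebra (projections S) (le S) (zero_of S)"
    and J: "\<And>s t. s \<in> carrier S \<Longrightarrow> t \<in> carrier S \<Longrightarrow> mult S s (star S t) = mult S t (star S s) \<Longrightarrow>
      mult S (plus S t) s = mult S (plus S s) t \<Longrightarrow> \<exists>v. is_join S {s, t} v"
    using B unfolding boolean_birestriction_semigroup_def by blast+
  have RG: "range_semigroup S"
    and br: "\<And>x y. x \<in> carrier S \<Longrightarrow> y \<in> carrier S \<Longrightarrow> mult S x (plus S y) = mult S (plus S (mult S x y)) x"
    using BR unfolding birestriction_semigroup_def by blast+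
  have R: "restriction_semigroup S" using RG unfolding range_semigroup_def by blast
  have L: "local_units S" using range_local_units[OF RG] .
  interpret restriction_sgp S by unfold_locales (rule R)
  have pl: "plus S x \<in> carrier S" "plus S x \<cdot> x = x" "star S (plus S x) = plus S x" if "x \<in> carrier S" for x
    using RG that unfolding range_semigroup_def by blast+
  have plP: "plus S x \<in> P" if "x \<in> carrier S" for x using star_in[OF pl(1)[OF that]] pl(3)[OF that] by simp
  have pe: "plus S e = e" if "e \<in> P" for e
    using that RG unfolding range_semigroup_def projections_def by blast
  have pm: "plus S (x \<cdot> y) = plus S (x \<cdot> plus S y)" if "x \<in> carrier S" "y \<in> carrier S" for x y
    using RG that unfolding range_semigroup_def by blast
  have brP: "x \<cdot> e = plus S (x \<cdot> e) \<cdot> x" if "x \<in> carrier S" "e \<in> P" for x e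
    using br[OF that(1) P_carrier[OF that(2)]] pe[OF that(2)] by simp
  have plus_em: "plus S (e \<cdot> x) = e \<cdot> plus S x" if "e \<in> P" "x \<in> carrier S" for e x
    using pm[OF P_carrier[OF that(1)] that(2)] pe P_mult[OF that(1) plP[OF that(2)]] by simp
  have lat: "lattice_on P (le S)" using G unfolding generalized_boolean_algebra_def by blast
  have bounded: "\<exists>v. is_join S {s, t} v"
    if c: "s \<in> carrier S" "t \<in> carrier S" "u \<in> carrier S" and l: "le S s u" "le S t u" for s t u
  proof -
    have P: "star S s \<in> P" "star S t \<in> P" "star S s \<in> carrier S" "star S t \<in> carrier S"
      using c star_in P_carrier by auto
    have s: "s = u \<cdot> star S s" and t: "t = u \<cdot> star S t" using l by (simp_all add: le_def)
    have swap: "u \<cdot> star S s \<cdot> star S t = u \<cdot> star S t \<cdot> star S s"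
      using assoc[of u] P_comm[OF P(1,2)] c P by simp
    have 1: "s \<cdot> star S t = t \<cdot> star S s" using swap s t by simp
    \<comment> \<open>Below \<open>u\<close>, multiplying by a range on the left restricts the
      domain, since \<open>y\<^sup>+ u = u y\<^sup>*\<close>. Both compatibility conditions thus
      reduce to the commuting of projections.\<close>
    have half: "plus S y \<cdot> x = u \<cdot> star S y \<cdot> star S x"
      if x: "x = u \<cdot> star S x" "star S x \<in> P" and y: "y = u \<cdot> star S y" "star S y \<in> P" for x y
    proof -
      have yc: "y \<in> carrier S" using y m_closed[OF c(3) P_carrier[OF y(2)]] by simp
      have "plus S y \<cdot> u = u \<cdot> star S y" using brP[OF c(3) y(2)] y(1) by simp
      then show ?thesis
        using assoc[OF pl(1)[OF yc] c(3) P_carrier[OF x(2)]] x(1) by simp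
    qed
    have "plus S t \<cdot> s = plus S s \<cdot> t" using half[OF s P(1) t P(2)] half[OF t P(2) s P(1)] swap by simp
    then show ?thesis using J[OF c(1,2) 1] by blast
  qed
  note lub = join_on_lub[OF lat]
  have star_join: "le S (star S (join_on P (le S) e f \<cdot> s)) (join_on P (le S) (star S (e \<cdot> s)) (star S (f \<cdot> s)))"
    if ef: "e \<in> P" "f \<in> P" and s: "s \<in> carrier S" for e f s
  proof -
    define g where "g = join_on P (le S) e f"
    define j where "j = join_on P (le S) (star S (e \<cdot> s)) (star S (f \<cdot> s))"
    define w where "w = s \<cdot> j"
    have c: "e \<in> carrier S" "f \<in> carrier S" using ef P_carrier by auto
    have es: "star S (e \<cdot> s) \<in> P" "star S (f \<cdot> s) \<in> P" using star_in m_closed c s by auto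
    have gP: "g \<in> P" and jP: "j \<in> P" and jle: "le S (star S (e \<cdot> s)) j" "le S (star S (f \<cdot> s)) j"
      using lub[OF ef] lub[OF es] unfolding is_lub_on_def g_def j_def by blast+
    have gc: "g \<in> carrier S" and jc: "j \<in> carrier S" using gP jP P_carrier by auto
    have wc: "w \<in> carrier S" using m_closed s jc by (simp add: w_def)
    have spP: "plus S s \<in> P" and wpP: "plus S w \<in> P" using plP s wc by auto
    \<comment> \<open>\<open>a \<cdot> s\<close> is a restriction of \<open>w\<close>, so its range,
      which is \<open>a \<cdot> plus S s\<close>, lies in that of \<open>w\<close>.\<close>
    have below: "le S (a \<cdot> plus S s) (plus S w)" if a: "a \<in> P" "le S (star S (a \<cdot> s)) j" for a
    proof -
      have aP: "star S (a \<cdot> s) \<in> P" using star_in m_closed P_carrier a(1) s by simp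
      have "a \<cdot> s = s \<cdot> (j \<cdot> star S (a \<cdot> s))"
        using P_pass[OF a(1) s] a(2) le_P_iff[OF aP] by simp
      also have "\<dots> = w \<cdot> star S (a \<cdot> s)" using assoc[OF s jc P_carrier[OF aP]] by (simp add: w_def)
      finally have aw: "a \<cdot> s = plus S w \<cdot> (a \<cdot> s)"
        using pl(2)[OF wc] assoc[OF pl(1)[OF wc] wc P_carrier[OF aP]] by simp
      have "a \<cdot> plus S s = plus S (a \<cdot> s)" using plus_em[OF a(1) s] by simp
      also have "\<dots> = plus S (plus S w \<cdot> (a \<cdot> s))" using aw by simp
      also have "\<dots> = plus S w \<cdot> plus S (a \<cdot> s)"
        using plus_em[OF wpP m_closed[OF P_carrier[OF a(1)] s]] .
      also have "\<dots> = plus S w \<cdot> (a \<cdot> plus S s)" using plus_em[OF a(1) s] by simp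
      finally show ?thesis using le_P_iff[OF P_mult[OF a(1) spP]] by blast
    qed
    have P2: "plus S s \<cdot> e \<in> P" "plus S s \<cdot> f \<in> P" using P_mult spP ef by auto
    have "plus S s \<cdot> g = join_on P (le S) (plus S s \<cdot> e) (plus S s \<cdot> f)"
      using G spP ef meet_eq gP unfolding generalized_boolean_algebra_def g_def by metis
    moreover have "le S (plus S s \<cdot> e) (plus S w)" "le S (plus S s \<cdot> f) (plus S w)"
      using below[OF ef(1) jle(1)] below[OF ef(2) jle(2)] P_comm spP ef by simp_all
    ultimately have "le S (plus S s \<cdot> g) (plus S w)"
      using lub[OF P2] wpP unfolding is_lub_on_def by simp
    then have pg: "plus S s \<cdot> g = plus S w \<cdot> (plus S s \<cdot> g)" using le_P_iff[OF P_mult[OF spP gP]] by simp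
    have "g \<cdot> s = g \<cdot> (plus S s \<cdot> s)" using pl(2)[OF s] by simp
    also have "\<dots> = plus S s \<cdot> g \<cdot> s" using assoc[OF gc pl(1)[OF s] s] P_comm[OF gP spP] by simp
    also have "\<dots> = plus S w \<cdot> (plus S s \<cdot> g) \<cdot> s" using pg by simp
    also have "\<dots> = g \<cdot> plus S w \<cdot> (plus S s \<cdot> s)"
    proof -
      have "plus S w \<cdot> (plus S s \<cdot> g) = g \<cdot> plus S w \<cdot> plus S s"
        using P_comm[OF spP gP] P_left_comm[OF wpP gP spP] assoc[OF gc P_carrier[OF wpP] P_carrier[OF spP]] by simp
      then show ?thesis
        using assoc[OF m_closed[OF gc P_carrier[OF wpP]] P_carrier[OF spP] s] by simp
    qed
    also have "\<dots> = g \<cdot> (plus S w \<cdot> s)" using pl(2)[OF s] assoc[OF gc P_carrier[OF wpP] s] by simp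
    \<comment> \<open>The birestriction law applied to \<open>s\<close> and \<open>j\<close> reads
      \<open>w\<^sup>+ s = s j = w\<close>.\<close>
    also have "\<dots> = g \<cdot> w" using brP[OF s jP] by (simp add: w_def)
    finally have gs: "g \<cdot> s = g \<cdot> s \<cdot> j" using assoc[OF gc s jc] by (simp add: w_def)
    have "star S (g \<cdot> s) = star S (g \<cdot> s) \<cdot> j" using gs star_mult_P[OF m_closed[OF gc s] jP] by simp
    moreover have "star S (g \<cdot> s) \<in> P" using star_in m_closed gc s by simp
    ultimately show ?thesis
      using le_P_iff P_comm jP unfolding g_def[symmetric] j_def[symmetric] by metis
  qed
  show ?thesis
    by (unfold_locales; (rule R Z G L bounded star_join; assumption))
qed

section \<open>The four equivalences\<close>

text \<open>Lists of a fixed length are coded by iterated pairing. The length enters the final code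
  separately, because the bare coding \<open>c\<close> need not be injective across lengths.\<close>

lemma lists_lepoll_infinite:
  assumes "infinite A"
  shows "lists A \<lesssim> A"
proof -
  obtain p where p: "bij_betw p (A \<times> A) A"
    using card_of_Times_same_infinite[OF assms] card_of_ordIso by blast
  then have pA: "\<And>x y. x \<in> A \<Longrightarrow> y \<in> A \<Longrightarrow> p (x, y) \<in> A"
    and pi: "\<And>x y x' y'. x \<in> A \<Longrightarrow> y \<in> A \<Longrightarrow> x' \<in> A \<Longrightarrow> y' \<in> A \<Longrightarrow> p (x, y) = p (x', y') \<Longrightarrow> x = x' \<and> y = y'"
    by (auto simp add: bij_betw_def inj_on_def)
  obtain q :: "nat \<Rightarrow> 'a" where q: "inj q" "range q \<subseteq> A"
    using infinite_countable_subset[OF assms] by blast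
  \<comment> \<open>\<open>q 0\<close> is an arbitrary end marker in \<open>A\<close>; later
    \<open>q (length xs)\<close> records the length.\<close>
  define c where "c xs = foldr (\<lambda>x y. p (x, y)) xs (q 0)" for xs
  have cA: "c xs \<in> A" if "xs \<in> lists A" for xs
    using that q(2) pA by (induction xs) (auto simp add: c_def)
  have ci: "xs = ys" if "xs \<in> lists A" "ys \<in> lists A" "length xs = length ys" "c xs = c ys" for xs ys
    using that(3,1,2,4)
  proof (induction rule: list_induct2)
    case (Cons x xs y ys)
    then have "p (x, c xs) = p (y, c ys)" by (simp add: c_def)
    then show ?case using Cons pi[of x "c xs" y "c ys"] cA by simp
  qed simp
  have "inj_on (\<lambda>xs. p (q (length xs), c xs)) (lists A)"
  proof (rule inj_onI)
    fix xs ys assume xy: "xs \<in> lists A" "ys \<in> lists A" "p (q (length xs), c xs) = p (q (length ys), c ys)"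
    then have "q (length xs) = q (length ys) \<and> c xs = c ys" using pi cA q(2) by (meson rangeI subsetD)
    then show "xs = ys" using ci xy(1,2) q(1) by (simp add: inj_eq)
  qed
  moreover have "(\<lambda>xs. p (q (length xs), c xs)) ` lists A \<subseteq> A" using pA cA q(2) by blast
  ultimately show ?thesis unfolding lepoll_def by blast
qed

text \<open>Smallness passes only along injections, so the finite subsets have to be counted. For
  infinite \<open>X\<close> they inject into \<open>X\<close> by way of lists; for finite
  \<open>X\<close> they inject into the infinite type, with a finite image.\<close>

lemma finite_subsets_small:
  fixes small :: "'a set \<Rightarrow> bool"
  assumes sm: "smallness small TYPE('c) TYPE('o)" and X: "small X"
  shows "\<exists>Y. small Y \<and> {B. finite B \<and> B \<subseteq> X} \<lesssim> Y"
proof (cases "finite X")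
  case True
  then have "finite {B. finite B \<and> B \<subseteq> X}" by simp
  then have "{B. finite B \<and> B \<subseteq> X} \<lesssim> (UNIV :: 'a set)"
    using sm finite_lepoll_infinite by (auto simp add: smallness_def)
  then obtain f :: "'a set \<Rightarrow> 'a" where f: "inj_on f {B. finite B \<and> B \<subseteq> X}" by (auto simp add: lepoll_def)
  have "small (f ` {B. finite B \<and> B \<subseteq> X})" using sm True by (simp add: smallness_def)
  then show ?thesis using f unfolding lepoll_def by blast
next
  case False
  have "{B. finite B \<and> B \<subseteq> X} = set ` lists X" by (rule Collect_finite_subset_eq_lists)
  then have "{B. finite B \<and> B \<subseteq> X} \<lesssim> X"
    using lepoll_trans[OF image_lepoll lists_lepoll_infinite[OF False]] by metis
  then show ?thesis using X by blast
qed

text \<open>Even the compact slices outside the image of \<open>\<delta>\<close> are finite unions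
  of represented ones, so there are at most as many as finite subsets of the carrier.\<close>

lemma (in representation) small_categoryI:
  assumes sm: "smallness small TYPE('x) TYPE('y)" and S: "small (carrier S)"
  shows "small_category small C"
proof -
  let ?B = "{B. finite B \<and> B \<subseteq> carrier S}"
  obtain Y where Y: "small Y" "?B \<lesssim> Y" using finite_subsets_small[OF sm S] by blast
  have "{A. compact_slice C A} \<subseteq> (\<lambda>B. \<Union>(\<delta> ` B)) ` ?B"
  proof
    fix A assume "A \<in> {A. compact_slice C A}"
    then have A: "compact_slice C A" by simp
    obtain B where B: "finite B" "B \<subseteq> carrier S" "A = \<Union>(\<delta> ` B)"
      using compact_slice_finite_union[OF A] .
    then have "B \<in> ?B" by blast
    then show "A \<in> (\<lambda>B. \<Union>(\<delta> ` B)) ` ?B" using B(3) by blast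
  qed
  then have "{A. compact_slice C A} \<lesssim> ?B" by (meson image_lepoll lepoll_trans subset_imp_lepoll)
  then show ?thesis using Y lepoll_trans unfolding small_category_def by blast
qed

lemma (in ample_category) slice_basis:
  "openin (C1 C) W \<Longrightarrow> a \<in> W \<Longrightarrow> \<exists>A. compact_slice C A \<and> a \<in> A \<and> A \<subseteq> W"
  using slice_nbhd by metis

lemma bislice_basis:
  "biample C \<Longrightarrow> openin (C1 C) W \<Longrightarrow> a \<in> W \<Longrightarrow> \<exists>A. compact_bislice C A \<and> a \<in> A \<and> A \<subseteq> W"
  using biample_basis by metis

text \<open>Represents \<open>C\<close> by all its compact slices, unencoded and of any size, so
  that results about pairs of representations apply to bare categories.\<close>

lemma ample_representation_exists:
  assumes C: "ample C"
  obtains S :: "'c set restr_sgp" and \<delta> where "representation (C :: ('c, 'o) top_cat) S \<delta>"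
proof -
  interpret ample_category C by unfold_locales (rule C)
  let ?K = "Collect (compact_slice C)"
  let ?S = "\<lparr>carrier = (\<lambda>A. A) ` ?K, mult = slice_prod C, star = \<lambda>A. un C ` dm C ` A\<rparr>"
  have "representation C ?S (inv_into ?K (\<lambda>A. A))"
    by (rule encoded_representation)
      (use compact_slice_prod compact_slice_un slice_basis in \<open>auto simp add: inj_on_def\<close>)
  then show ?thesis using that by blast
qed

lemma compact_slice_cofun_image:
  assumes C: "ample C" and D: "ample D" and F: "is_cofunctor C D F" and A: "compact_slice C A"
  shows "compact_slice D (cofun_image C D F A)"
proof -
  obtain S :: "'a set restr_sgp" and \<delta> where "representation C S \<delta>" using ample_representation_exists[OF C] .
  moreover obtain T :: "'c set restr_sgp" and \<epsilon> where "representation D T \<epsilon>"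
    using ample_representation_exists[OF D] .
  ultimately interpret representation_pair C S \<delta> D T \<epsilon> by (intro representation_pair.intro)
  show ?thesis using compact_slice_cofun_image[OF F A] .
qed

text \<open>The range of \<open>arr_map F (s, x)\<close> is \<open>act F (s, x)\<close>, whose
  anchor is \<open>rg C s\<close>. Arrows with equal ranges in the image of a bislice therefore come
  from one \<open>s\<close> and can differ only in the point acted upon. Conversely, the image of a
  bislice around \<open>s\<close> contains the arrows of \<open>s\<close> at all these points, and
  injectivity of \<open>rg\<close> on it separates them.\<close>

lemma injective_action_iff:
  assumes C: "biample C" and D: "biample D" and F: "is_cofunctor C D F"
  shows "injective_action C D F \<longleftrightarrow>
    (\<forall>A. compact_bislice C A \<longrightarrow> compact_bislice D (cofun_image C D F A))"
proof -
  have aC: "ample C" and aD: "ample D" using biample_ample C D by auto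
  obtain S :: "'a set restr_sgp" and \<delta> where "representation C S \<delta>" using ample_representation_exists[OF aC] .
  moreover obtain T :: "'c set restr_sgp" and \<epsilon> where "representation D T \<epsilon>"
    using ample_representation_exists[OF aD] .
  ultimately interpret representation_pair C S \<delta> D T \<epsilon> by (intro representation_pair.intro)
  note facts = arr_map_facts[OF F]
  show ?thesis
  proof
    assume inj: "injective_action C D F"
    show "\<forall>A. compact_bislice C A \<longrightarrow> compact_bislice D (cofun_image C D F A)"
    proof (intro allI impI)
      fix A assume A: "compact_bislice C A"
      have "inj_on (rg D) (cofun_image C D F A)"
      proof (rule inj_onI)
        fix b c assume "b \<in> cofun_image C D F A" "c \<in> cofun_image C D F A" and eq: "rg D b = rg D c"
        then obtain s x t y where st: "b = arr_map F (s, x)" "s \<in> A" "(s, x) \<in> cofun_arrows C D F"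
          "c = arr_map F (t, y)" "t \<in> A" "(t, y) \<in> cofun_arrows C D F"
          by (auto simp add: cofun_image_def)
        have act: "act F (s, x) = act F (t, y)" using eq st facts(3) by metis
        then have "rg C s = rg C t" using facts(5)[OF st(3)] facts(5)[OF st(6)] by simp
        then have "s = t" using A st(2,5) by (simp add: compact_bislice_iff inj_on_def)
        then have "x = y" using inj act st(3,6) unfolding injective_action_def by blast
        then show "b = c" using st \<open>s = t\<close> by simp
      qed
      then show "compact_bislice D (cofun_image C D F A)"
        using compact_slice_cofun_image[OF F compact_bislice_slice[OF A]] by (simp add: compact_bislice_iff)
    qed
  next
    assume bi: "\<forall>A. compact_bislice C A \<longrightarrow> compact_bislice D (cofun_image C D F A)"
    show "injective_action C D F"
      unfolding injective_action_def
    proof (intro allI impI)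
      fix s x y assume s: "(s, x) \<in> cofun_arrows C D F" "(s, y) \<in> cofun_arrows C D F"
        and eq: "act F (s, x) = act F (s, y)"
      have "s \<in> topspace (C1 C)" using s(1) by (simp add: in_cofun_arrows)
      then obtain A where A: "compact_bislice C A" "s \<in> A"
        using bislice_basis[OF C openin_topspace, of s] by blast
      have i: "inj_on (rg D) (cofun_image C D F A)" using bi A(1) by (simp add: compact_bislice_iff)
      have e: "rg D (arr_map F (s, x)) = rg D (arr_map F (s, y))"
        using facts(3)[OF s(1)] facts(3)[OF s(2)] eq by simp
      have ar: "arr_map F (s, x) = arr_map F (s, y)"
        by (rule inj_onD[OF i e cofun_imageI[OF F A(2) s(1)] cofun_imageI[OF F A(2) s(2)]])
      show "x = y" using facts(2)[OF s(1)] unfolding ar facts(2)[OF s(2)] by (rule sym)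
    qed
  qed
qed

text \<open>One coding serves every family of compact slices, so it encodes the bislices as
  well.\<close>

lemma slice_encoding:
  fixes small :: "'a set \<Rightarrow> bool"
  assumes sm: "smallness small TYPE('x) TYPE('y)" and C: "small_category small C"
  obtains enc where "\<And>K. K \<subseteq> Collect (compact_slice C) \<Longrightarrow> inj_on enc K \<and> small (enc ` K)"
proof -
  obtain X enc where X: "small X" "inj_on enc {A. compact_slice C A}" "enc ` {A. compact_slice C A} \<subseteq> X"
    using C unfolding small_category_def lepoll_def by blast
  have "inj_on enc K \<and> small (enc ` K)" if K: "K \<subseteq> Collect (compact_slice C)" for K
  proof -
    have "enc ` K \<lesssim> X" using K X(3) by (intro subset_imp_lepoll) blast
    then have "small (enc ` K)" using sm X(1) unfolding smallness_def by blast
    then show ?thesis using inj_on_subset[OF X(2) K] by blast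
  qed
  then show ?thesis using that by blast
qed

section \<open>Passing between range semigroups and categories within the given types\<close>

lemma strongly_ample_range_rep:
  fixes small :: "'a set \<Rightarrow> bool"
  assumes sm: "smallness small TYPE('x) TYPE('y)" and C: "strongly_ample C" "small_category small C"
  shows "\<exists>(S :: 'a range_sgp) \<delta>. range_rep C S \<delta> \<and> \<delta> ` carrier S = Collect (compact_slice C) \<and> small (carrier S)"
proof -
  interpret ample_category C using C by unfold_locales (simp add: strongly_ample_def)
  let ?K = "Collect (compact_slice C)"
  obtain enc where enc: "\<And>K. K \<subseteq> Collect (compact_slice C) \<Longrightarrow> inj_on enc K \<and> small (enc ` K)"
    using slice_encoding[OF sm C(2)] by blast
  have "range_rep C (slice_sgp C ?K enc) (inv_into ?K enc)"
    "inv_into ?K enc ` carrier (slice_sgp C ?K enc) = ?K"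
    by (rule slice_sgp_range_rep; use enc C(1) compact_slice_prod compact_slice_un slice_basis in
      \<open>auto simp add: strongly_ample_def\<close>)+
  moreover have "small (carrier (slice_sgp C ?K enc))" using enc[of ?K] by (simp add: slice_sgp_def)
  ultimately show ?thesis by blast
qed

lemma biample_range_rep:
  fixes small :: "'a set \<Rightarrow> bool"
  assumes sm: "smallness small TYPE('x) TYPE('y)" and C: "biample C" "small_category small C"
  shows "\<exists>(S :: 'a range_sgp) \<delta>. range_rep C S \<delta> \<and> \<delta> ` carrier S = Collect (compact_bislice C) \<and> small (carrier S)"
proof -
  have sC: "strongly_ample C" using biample_strongly_ample C(1) .
  interpret ample_category C using sC by unfold_locales (simp add: strongly_ample_def)
  let ?K = "Collect (compact_bislice C)"
  obtain enc where enc: "\<And>K. K \<subseteq> Collect (compact_slice C) \<Longrightarrow> inj_on enc K \<and> small (enc ` K)"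
    using slice_encoding[OF sm C(2)] by blast
  have K: "?K \<subseteq> Collect (compact_slice C)" using compact_bislice_slice by blast
  have "range_rep C (slice_sgp C ?K enc) (inv_into ?K enc)"
    by (rule slice_sgp_range_rep(1); use enc[OF K] sC compact_bislice_prod compact_bislice_un
      bislice_basis[OF C(1)] compact_bislice_slice in \<open>auto simp add: strongly_ample_def\<close>)
  moreover have "inv_into ?K enc ` carrier (slice_sgp C ?K enc) = ?K"
    using enc[OF K] by (auto simp add: slice_sgp_def image_image)
  moreover have "small (carrier (slice_sgp C ?K enc))" using enc[OF K] by (simp add: slice_sgp_def)
  ultimately show ?thesis by blast
qed

lemma range_rep_exists:
  fixes small :: "'a set \<Rightarrow> bool" and S :: "('a, 'z) range_sgp_scheme"
  assumes sm: "smallness small TYPE('c) TYPE('o)" and S: "small (carrier S)"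
    and G: "germ_semigroup S" and R: "range_semigroup S"
  shows "\<exists>(C :: ('c, 'o) top_cat) \<delta>. range_rep C S \<delta> \<and> small_category small C"
proof -
  have "Pow (carrier S) \<lesssim> (UNIV :: 'c set)" "Pow (carrier S) \<lesssim> (UNIV :: 'o set)"
    using sm S by (simp_all add: smallness_def)
  then obtain C :: "('c, 'o) top_cat" and \<delta> where rep: "representation C S \<delta>"
    using germ_semigroup.representation_exists[OF G] by blast
  interpret representation C S \<delta> by (rule rep)
  have "range_representation C S \<delta>"
    by (rule range_representation_of_range_semigroup[OF R]) simp_all
  then have "range_rep C S \<delta>" using rep by (simp add: range_rep_def range_rep_axioms_def)
  then show ?thesis using small_categoryI[OF sm S] by blast
qed

theorem theorem2:
  fixes small :: "'a set \<Rightarrow> bool" and i :: nat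
  assumes "smallness small TYPE('c) TYPE('o)"
    and "i \<in> {1, 2, 3, 4}"
  shows
    "equivalent_categories
       (sgp_cat i {S :: 'a restr_sgp. boolean_restriction_semigroup S \<and> local_units S \<and>
          small (carrier S)})
       (cofun_cat (cofunctor_of_type i)
          {C :: ('c, 'o) top_cat. ample C \<and> small_category small C}) \<and>
     equivalent_categories
       (sgp_cat i {S :: 'a range_sgp. boolean_range_semigroup S \<and> small (carrier S)})
       (cofun_cat (cofunctor_of_type i)
          {C :: ('c, 'o) top_cat. strongly_ample C \<and> small_category small C}) \<and>
     equivalent_categories
       (sgp_cat i {S :: 'a range_sgp. etale_boolean_range_semigroup S \<and> small (carrier S)})
       (cofun_cat (cofunctor_of_type i)
          {C :: ('c, 'o) top_cat. biample C \<and> small_category small C}) \<and>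
     equivalent_categories
       (sgp_cat i {S :: 'a range_sgp. boolean_birestriction_semigroup S \<and> small (carrier S)})
       (cofun_cat (\<lambda>C D F. cofunctor_of_type i C D F \<and> injective_action C D F)
          {C :: ('c, 'o) top_cat. biample C \<and> small_category small C})"
proof -
  note sm = assms(1)
  let ?slices = "\<lambda>C :: ('c, 'o) top_cat. Collect (compact_slice C)"
  let ?bislices = "\<lambda>C :: ('c, 'o) top_cat. Collect (compact_bislice C)"
  \<comment> \<open>Cofunctors send compact slices to compact slices, which is stated here in the
    form that \<open>equivalence_criterion\<close> expects.\<close>
  have Q: "cofunctor_of_type i C D F \<longleftrightarrow>
      cofunctor_of_type i C D F \<and> (\<forall>A\<in>?slices C. cofun_image C D F A \<in> ?slices D)"
    if "ample C" "ample D" for C D :: "('c, 'o) top_cat" and F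
    using compact_slice_cofun_image[OF that] by (auto simp add: cofunctor_of_type_def)
  \<comment> \<open>For bislices, preservation of the family is injectivity of the action.\<close>
  have Q': "cofunctor_of_type i C D F \<and> injective_action C D F \<longleftrightarrow>
      cofunctor_of_type i C D F \<and> (\<forall>A\<in>?bislices C. cofun_image C D F A \<in> ?bislices D)"
    if "biample C" "biample D" for C D :: "('c, 'o) top_cat" and F
    using injective_action_iff[OF that] by (auto simp add: cofunctor_of_type_def)
  have sa: "ample C" if "strongly_ample C" for C :: "('c, 'o) top_cat"
    using that by (simp add: strongly_ample_def)
  \<comment> \<open>Shared by the second and the third equivalence; in the third,
    \<open>etale_biample\<close> then shows that this same category is biample.\<close>
  have boolean_range: "\<exists>(C :: ('c, 'o) top_cat) \<delta>. range_rep C S \<delta> \<and> small_category small C \<and>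
      \<delta> ` carrier S = ?slices C"
    if S: "boolean_range_semigroup S" "small (carrier S)" for S :: "'a range_sgp"
  proof -
    have B: "boolean_restriction_semigroup S" and R: "range_semigroup S"
      using S(1) by (simp_all add: boolean_range_semigroup_def)
    obtain C :: "('c, 'o) top_cat" and \<delta> where C: "range_rep C S \<delta>" "small_category small C"
      using range_rep_exists[OF sm S(2) germ_semigroup_boolean[OF B range_local_units[OF R]] R] by blast
    then interpret range_rep C S \<delta> by simp
    show ?thesis using C boolean_image[OF B] by blast
  qed
  have 1: "equivalent_categories
       (sgp_cat i {S :: 'a restr_sgp. boolean_restriction_semigroup S \<and> local_units S \<and>
          small (carrier S)})
       (cofun_cat (cofunctor_of_type i)
          {C :: ('c, 'o) top_cat. ample C \<and> small_category small C})"
  proof (rule equivalence_criterion[where kind = ?slices])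
    fix S :: "'a restr_sgp"
    assume "S \<in> {S. boolean_restriction_semigroup S \<and> local_units S \<and> small (carrier S)}"
    then have S: "boolean_restriction_semigroup S" "local_units S" "small (carrier S)" by simp_all
    have "Pow (carrier S) \<lesssim> (UNIV :: 'c set)" "Pow (carrier S) \<lesssim> (UNIV :: 'o set)"
      using sm S(3) by (simp_all add: smallness_def)
    then obtain C :: "('c, 'o) top_cat" and \<delta> where rep: "representation C S \<delta>"
      using germ_semigroup.representation_exists[OF germ_semigroup_boolean[OF S(1,2)]] by blast
    interpret representation C S \<delta> by (rule rep)
    show "\<exists>C\<in>{C :: ('c, 'o) top_cat. ample C \<and> small_category small C}.
        \<exists>\<delta>. representation C S \<delta> \<and> \<delta> ` carrier S = ?slices C"
      using rep ample small_categoryI[OF sm S(3)] boolean_image[OF S(1)] by blast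
  next
    fix C :: "('c, 'o) top_cat" assume "C \<in> {C. ample C \<and> small_category small C}"
    then have C: "ample C" "small_category small C" by simp_all
    interpret C: ample_category C by unfold_locales (rule C(1))
    obtain enc where "\<And>K. K \<subseteq> Collect (compact_slice C) \<Longrightarrow> inj_on enc K \<and> small (enc ` K)"
      using slice_encoding[OF sm C(2)] by blast
    then have enc: "inj_on enc (?slices C)" "small (enc ` ?slices C)" by blast+
    define S :: "'a restr_sgp" where "S = \<lparr>carrier = enc ` ?slices C,
      mult = \<lambda>x y. enc (slice_prod C (inv_into (?slices C) enc x) (inv_into (?slices C) enc y)),
      star = \<lambda>x. enc (un C ` dm C ` inv_into (?slices C) enc x)\<rparr>"
    have S: "carrier S = enc ` ?slices C"
      "\<And>A B. A \<in> ?slices C \<Longrightarrow> B \<in> ?slices C \<Longrightarrow> mult S (enc A) (enc B) = enc (slice_prod C A B)"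
      "\<And>A. A \<in> ?slices C \<Longrightarrow> star S (enc A) = enc (un C ` dm C ` A)"
      using enc(1) by (simp_all add: S_def)
    have rep: "representation C S (inv_into (?slices C) enc)"
      "inv_into (?slices C) enc ` carrier S = ?slices C"
      by (rule C.encoded_representation[OF enc(1)];
        use S C.compact_slice_prod C.compact_slice_un C.slice_basis in auto)+
    interpret representation C S "inv_into (?slices C) enc" by (rule rep(1))
    have "boolean_restriction_semigroup S" using boolean_restriction rep(2) by blast
    then have "S \<in> {S. boolean_restriction_semigroup S \<and> local_units S \<and> small (carrier S)}"
      using local_units enc(2) S(1) by simp
    then show "\<exists>S\<in>{S :: 'a restr_sgp. boolean_restriction_semigroup S \<and> local_units S \<and> small (carrier S)}.
        \<exists>\<delta>. representation C S \<delta> \<and> \<delta> ` carrier S = ?slices C"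
      using rep by blast
  qed (use Q in auto)
  have 2: "equivalent_categories
       (sgp_cat i {S :: 'a range_sgp. boolean_range_semigroup S \<and> small (carrier S)})
       (cofun_cat (cofunctor_of_type i)
          {C :: ('c, 'o) top_cat. strongly_ample C \<and> small_category small C})"
  proof (rule equivalence_criterion[where kind = ?slices])
    fix S :: "'a range_sgp"
    assume "S \<in> {S. boolean_range_semigroup S \<and> small (carrier S)}"
    then have "boolean_range_semigroup S" "small (carrier S)" by simp_all
    from boolean_range[OF this] obtain C :: "('c, 'o) top_cat" and \<delta> where
      C: "range_rep C S \<delta>" "small_category small C" "\<delta> ` carrier S = ?slices C" by blast
    then interpret range_rep C S \<delta> by simp
    show "\<exists>C\<in>{C :: ('c, 'o) top_cat. strongly_ample C \<and> small_category small C}.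
        \<exists>\<delta>. representation C S \<delta> \<and> \<delta> ` carrier S = ?slices C"
      using C strongly_ample representation_axioms by blast
  next
    fix C :: "('c, 'o) top_cat" assume "C \<in> {C. strongly_ample C \<and> small_category small C}"
    then have C: "strongly_ample C" "small_category small C" by simp_all
    obtain S :: "'a range_sgp" and \<delta> where S: "range_rep C S \<delta>" "\<delta> ` carrier S = ?slices C"
      "small (carrier S)" using strongly_ample_range_rep[OF sm C] by blast
    then interpret range_rep C S \<delta> by simp
    have "boolean_range_semigroup S"
      using boolean_restriction S(2) range_semigroup by (auto simp add: boolean_range_semigroup_def)
    then show "\<exists>S\<in>{S :: 'a range_sgp. boolean_range_semigroup S \<and> small (carrier S)}.
        \<exists>\<delta>. representation C S \<delta> \<and> \<delta> ` carrier S = ?slices C"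
      using S representation_axioms by blast
  qed (use Q sa in auto)
  have 3: "equivalent_categories
       (sgp_cat i {S :: 'a range_sgp. etale_boolean_range_semigroup S \<and> small (carrier S)})
       (cofun_cat (cofunctor_of_type i)
          {C :: ('c, 'o) top_cat. biample C \<and> small_category small C})"
  proof (rule equivalence_criterion[where kind = ?slices])
    fix S :: "'a range_sgp"
    assume "S \<in> {S. etale_boolean_range_semigroup S \<and> small (carrier S)}"
    then have S: "etale_boolean_range_semigroup S" "small (carrier S)" by simp_all
    have "boolean_range_semigroup S" using S(1) by (simp add: etale_boolean_range_semigroup_def)
    from boolean_range[OF this S(2)] obtain C :: "('c, 'o) top_cat" and \<delta> where
      C: "range_rep C S \<delta>" "small_category small C" "\<delta> ` carrier S = ?slices C" by blast
    then interpret range_rep C S \<delta> by simp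
    show "\<exists>C\<in>{C :: ('c, 'o) top_cat. biample C \<and> small_category small C}.
        \<exists>\<delta>. representation C S \<delta> \<and> \<delta> ` carrier S = ?slices C"
      using C etale_biample[OF S(1)] representation_axioms by blast
  next
    fix C :: "('c, 'o) top_cat" assume "C \<in> {C. biample C \<and> small_category small C}"
    then have C: "biample C" "small_category small C" by simp_all
    obtain S :: "'a range_sgp" and \<delta> where S: "range_rep C S \<delta>" "\<delta> ` carrier S = ?slices C"
      "small (carrier S)" using strongly_ample_range_rep[OF sm biample_strongly_ample[OF C(1)] C(2)] by blast
    then interpret range_rep C S \<delta> by simp
    show "\<exists>S\<in>{S :: 'a range_sgp. etale_boolean_range_semigroup S \<and> small (carrier S)}.
        \<exists>\<delta>. representation C S \<delta> \<and> \<delta> ` carrier S = ?slices C"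
      using S representation_axioms biample_etale[OF C(1) S(2)] by blast
  qed (use Q biample_ample in auto)
  have 4: "equivalent_categories
       (sgp_cat i {S :: 'a range_sgp. boolean_birestriction_semigroup S \<and> small (carrier S)})
       (cofun_cat (\<lambda>C D F. cofunctor_of_type i C D F \<and> injective_action C D F)
          {C :: ('c, 'o) top_cat. biample C \<and> small_category small C})"
  proof (rule equivalence_criterion[where kind = ?bislices])
    fix S :: "'a range_sgp"
    assume "S \<in> {S. boolean_birestriction_semigroup S \<and> small (carrier S)}"
    then have S: "boolean_birestriction_semigroup S" "small (carrier S)" by simp_all
    then have R: "range_semigroup S"
      by (simp add: boolean_birestriction_semigroup_def birestriction_semigroup_def)
    obtain C :: "('c, 'o) top_cat" and \<delta> where C: "range_rep C S \<delta>" "small_category small C"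
      using range_rep_exists[OF sm S(2) germ_semigroup_birestriction[OF S(1)] R] by blast
    then interpret range_rep C S \<delta> by simp
    show "\<exists>C\<in>{C :: ('c, 'o) top_cat. biample C \<and> small_category small C}.
        \<exists>\<delta>. representation C S \<delta> \<and> \<delta> ` carrier S = ?bislices C"
      using C boolean_birestriction_image[OF S(1)] representation_axioms by blast
  next
    fix C :: "('c, 'o) top_cat" assume "C \<in> {C. biample C \<and> small_category small C}"
    then have C: "biample C" "small_category small C" by simp_all
    obtain S :: "'a range_sgp" and \<delta> where S: "range_rep C S \<delta>" "\<delta> ` carrier S = ?bislices C"
      "small (carrier S)" using biample_range_rep[OF sm C] by blast
    then interpret range_rep C S \<delta> by simp
    show "\<exists>S\<in>{S :: 'a range_sgp. boolean_birestriction_semigroup S \<and> small (carrier S)}.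
        \<exists>\<delta>. representation C S \<delta> \<and> \<delta> ` carrier S = ?bislices C"
      using S representation_axioms boolean_birestriction[OF S(2)] by blast
  qed (use Q' in auto)
  show ?thesis using 1 2 3 4 by blast
qed

end
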